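(* Let $\Omega\subset\mathbb{C}$ be a nonempty connected subset, let $a_1,a_2,a_3\in\mathbb{C}$ be pairwise distinct, and let $Q(z)=\prod_{k=1}^{3}(z-a_k)^{m_k}$ with $m_k\in\{1,2\}$. Let $a,b:\Omega\to\mathbb{C}\setminus\{a_1,a_2,a_3\}$ be continuous functions with $a(t)\neq b(t)$ for every $t\in\Omega$. For $t\in\Omega$ put $$P_t(z)=(z-a(t))(z-b(t))\,Q(z),\qquad \varpi(P_t,z)=-P_t(z)\,dz^2 .$$ For $t\in\Omega$ let $\mathcal{J}_{a(t),b(t)}$ be the set of all Jordan arcs in $\mathbb{C}\setminus\{a_1,a_2,a_3\}$ joining $a(t)$ and $b(t)$. Suppose that there is a map $t\mapsto\phi_t\in\mathcal{J}_{a(t),b(t)}$, $t\in\Omega$, continuous with respect to the Hausdorff metric, such that $\phi_t(0)=a(t)$ and $\phi_t(1)=b(t)$ for all $t\in\Omega$, and such that, for some choice of the branch of $\sqrt{P_t(z)}$, $$\Re\int_{\phi_t}\sqrt{P_t(z)}\,dz=0\qquad\text{for all } t\in\Omega .$$ Then the set of all $t\in\Omega$ such that the quadratic differential $\varpi(P_t,z)$ has a short trajectory connecting $a(t)$ and $b(t)$ is a closed subset of $\Omega$.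
   Context: A rational quadratic differential on the Riemann sphere $\overline{\mathbb{C}}$ is a form $\varpi=\varphi(z)\,dz^2$ with $\varphi$ a rational function, transforming under a conformal change of variables $z=z(\zeta)$ as $\widetilde\varphi(\zeta)\,d\zeta^2=\varphi(z(\zeta))(dz/d\zeta)^2d\zeta^2$. Its critical points are its zeros and poles; a critical point is finite if it is a zero or a simple pole, and infinite otherwise; all other points are regular. The (horizontal) trajectories of $\varpi$ are the curves given by $\Im\int^{z}\sqrt{\varphi(s)}\,ds=\text{const}$, equivalently $\varphi(z)\,dz^2>0$ along the curve. (So for $\varphi=-P_t$ they are the level curves $\Re\int^z\sqrt{P_t(s)}\,ds=\text{const}$.) A critical trajectory is a trajectory passing through a critical point. A short trajectory (finite critical trajectory) is a critical trajectory connecting two finite critical points of $\varpi$; it is called unbroken if it does not pass through any finite critical points other than its two endpoints, and broken otherwise. Short trajectories, without further qualification, may be broken or unbroken. *)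

theory Defs
  imports "HOL-Complex_Analysis.Complex_Analysis"
begin

section \<open>Quadratic differentials\<close>

text \<open>
  A rational quadratic differential \<open>\<phi>(z) dz\<^sup>2\<close> is represented by its coefficient \<open>\<phi>\<close> in the
  affine coordinate.  Curves are paths in the plane, so \<open>\<infinity>\<close> is never on a curve.  This loses
  nothing for short trajectories when \<open>\<phi>\<close> is a nonzero polynomial: then \<open>\<phi>(z) dz\<^sup>2\<close> has a pole
  of order \<open>degree \<phi> + 4\<close> at \<open>\<infinity>\<close>, which is thus an infinite critical point.
\<close>

definition qd_zero :: "(complex \<Rightarrow> complex) \<Rightarrow> complex \<Rightarrow> bool" where
  "qd_zero \<phi> z \<longleftrightarrow> \<phi> analytic_on {z} \<and> \<phi> z = 0"

definition finite_critical_point :: "(complex \<Rightarrow> complex) \<Rightarrow> complex \<Rightarrow> bool" where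
  "finite_critical_point \<phi> z \<longleftrightarrow> qd_zero \<phi> z \<or> is_pole \<phi> z \<and> zorder \<phi> z = -1"

definition infinite_critical_point :: "(complex \<Rightarrow> complex) \<Rightarrow> complex \<Rightarrow> bool" where
  "infinite_critical_point \<phi> z \<longleftrightarrow> is_pole \<phi> z \<and> zorder \<phi> z \<noteq> -1"

definition regular_point :: "(complex \<Rightarrow> complex) \<Rightarrow> complex \<Rightarrow> bool" where
  "regular_point \<phi> z \<longleftrightarrow> \<not> finite_critical_point \<phi> z \<and> \<not> infinite_critical_point \<phi> z"

text \<open>
  Horizontality \<open>\<phi>(z) dz\<^sup>2 > 0\<close> is imposed at the regular points only: the curve may run into and
  through finite critical points, where it leaves along any of the horizontal directions.  As the
  curve does not cross itself and critical points are isolated, it meets them at finitely many times.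
\<close>

definition horizontal_curve :: "(complex \<Rightarrow> complex) \<Rightarrow> (real \<Rightarrow> complex) \<Rightarrow> bool" where
  "horizontal_curve \<phi> \<gamma> \<longleftrightarrow> simple_path \<gamma>
     \<and> (\<forall>z \<in> path_image \<gamma>. \<not> infinite_critical_point \<phi> z)
     \<and> (\<forall>s \<in> {0<..<1}. regular_point \<phi> (\<gamma> s) \<longrightarrow>
          (\<exists>v x. (\<gamma> has_vector_derivative v) (at s) \<and> x > 0 \<and> \<phi> (\<gamma> s) * v\<^sup>2 = complex_of_real x))"

text \<open>Broken and unbroken short trajectories are both included.\<close>

definition short_trajectory :: "(complex \<Rightarrow> complex) \<Rightarrow> (real \<Rightarrow> complex) \<Rightarrow> bool" where
  "short_trajectory \<phi> \<gamma> \<longleftrightarrow> horizontal_curve \<phi> \<gamma>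
     \<and> finite_critical_point \<phi> (pathstart \<gamma>) \<and> finite_critical_point \<phi> (pathfinish \<gamma>)"

definition has_short_trajectory :: "(complex \<Rightarrow> complex) \<Rightarrow> complex \<Rightarrow> complex \<Rightarrow> bool" where
  "has_short_trajectory \<phi> p q \<longleftrightarrow>
     (\<exists>\<gamma>. short_trajectory \<phi> \<gamma> \<and> pathstart \<gamma> = p \<and> pathfinish \<gamma> = q)"


section \<open>Jordan arcs and the Hausdorff metric\<close>

definition jordan_arcs_avoiding :: "complex set \<Rightarrow> complex \<Rightarrow> complex \<Rightarrow> (real \<Rightarrow> complex) set" where
  "jordan_arcs_avoiding A p q =
     {\<gamma>. arc \<gamma> \<and> path_image \<gamma> \<inter> A = {} \<and> pathstart \<gamma> = p \<and> pathfinish \<gamma> = q}"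

text \<open>Only meaningful for nonempty bounded sets; a metric on nonempty compact sets.\<close>

definition hausdorff_dist :: "'a::metric_space set \<Rightarrow> 'a set \<Rightarrow> real" where
  "hausdorff_dist S T = max (SUP x\<in>S. infdist x T) (SUP y\<in>T. infdist y S)"

definition hausdorff_continuous_on :: "'a::topological_space set \<Rightarrow> ('a \<Rightarrow> 'b::metric_space set) \<Rightarrow> bool" where
  "hausdorff_continuous_on \<Omega> K \<longleftrightarrow>
     (\<forall>t\<in>\<Omega>. ((\<lambda>u. hausdorff_dist (K u) (K t)) \<longlongrightarrow> 0) (at t within \<Omega>))"


section \<open>Integrals of square root branches along arcs\<close>

definition sqrt_branch_on :: "complex set \<Rightarrow> (complex \<Rightarrow> complex) \<Rightarrow> (complex \<Rightarrow> complex) \<Rightarrow> bool" where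
  "sqrt_branch_on S f r \<longleftrightarrow> continuous_on S r \<and> (\<forall>z\<in>S. (r z)\<^sup>2 = f z)"

text \<open>
  A Jordan arc need not be rectifiable, so the integral is taken by means of local holomorphic
  primitives continued along the path, with a continuous limit at the two ends (where a square root
  may be branched).  For piecewise continuously differentiable arcs this is the usual contour
  integral, see lemma \<open>has_arc_integral_sqrt_iff\<close> below.
\<close>

definition has_arc_integral :: "(complex \<Rightarrow> complex) \<Rightarrow> complex \<Rightarrow> (real \<Rightarrow> complex) \<Rightarrow> bool"
    (infixr \<open>has'_arc'_integral\<close> 50) where
  "(f has_arc_integral I) \<gamma> \<longleftrightarrow>
     (\<exists>F. continuous_on {0..1} F \<and> F 1 - F 0 = I \<and>
          (\<forall>s\<in>{0<..<1}. \<exists>U G. open U \<and> \<gamma> s \<in> U \<and> G holomorphic_on U \<and>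
             (\<forall>\<^sub>F u in nhds s. F u = G (\<gamma> u) \<and> f (\<gamma> u) = deriv G (\<gamma> u))))"

lemma has_arc_integral_imp_has_contour_integral:
  assumes "valid_path \<gamma>" and "(f has_arc_integral I) \<gamma>"
  shows "(f has_contour_integral I) \<gamma>"
proof -
  obtain F where F: "continuous_on {0..1} F" "F 1 - F 0 = I"
    and loc: "\<And>s. s \<in> {0<..<1} \<Longrightarrow> \<exists>U G. open U \<and> \<gamma> s \<in> U \<and> G holomorphic_on U \<and>
             (\<forall>\<^sub>F u in nhds s. F u = G (\<gamma> u) \<and> f (\<gamma> u) = deriv G (\<gamma> u))"
    using assms(2) unfolding has_arc_integral_def by blast
  obtain K where K: "finite K" "\<And>s. s \<in> {0..1} - K \<Longrightarrow> \<gamma> differentiable at s"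
    using assms(1) unfolding valid_path_def piecewise_C1_differentiable_on_def
      C1_differentiable_on_eq by blast
  have der: "(F has_vector_derivative f (\<gamma> s) * vector_derivative \<gamma> (at s)) (at s)"
    if s: "s \<in> {0<..<1} - K" for s
  proof -
    obtain U G where UG: "open U" "\<gamma> s \<in> U" "G holomorphic_on U"
      and ev: "\<forall>\<^sub>F u in nhds s. F u = G (\<gamma> u) \<and> f (\<gamma> u) = deriv G (\<gamma> u)"
      using loc[of s] s by blast
    have "(\<gamma> has_vector_derivative vector_derivative \<gamma> (at s)) (at s)"
      using K(2)[of s] s by (simp add: vector_derivative_works[symmetric])
    moreover have "(G has_field_derivative deriv G (\<gamma> s)) (at (\<gamma> s))"
      using UG holomorphic_derivI by blast
    ultimately have "((G \<circ> \<gamma>) has_vector_derivative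
        vector_derivative \<gamma> (at s) * deriv G (\<gamma> s)) (at s)"
      by (rule field_vector_diff_chain_at)
    moreover obtain N where "open N" "s \<in> N" "\<And>u. u \<in> N \<Longrightarrow> (G \<circ> \<gamma>) u = F u"
      using ev unfolding eventually_nhds by auto
    ultimately have "(F has_vector_derivative vector_derivative \<gamma> (at s) * deriv G (\<gamma> s)) (at s)"
      by (rule has_vector_derivative_transform_within_open)
    moreover have "f (\<gamma> s) = deriv G (\<gamma> s)"
      using eventually_nhds_x_imp_x[OF ev] by simp
    ultimately show ?thesis by (simp add: mult.commute)
  qed
  have "((\<lambda>s. f (\<gamma> s) * vector_derivative \<gamma> (at s)) has_integral (F 1 - F 0)) {0..1}"
    by (rule fundamental_theorem_of_calculus_interior_strong[OF K(1)]) (use der F(1) in auto)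
  then show ?thesis
    by (simp add: has_contour_integral F(2))
qed

lemma has_arc_integral_sqrt_iff:
  assumes \<gamma>: "valid_path \<gamma>" and P: "P holomorphic_on UNIV"
    and nz: "\<And>s. s \<in> {0<..<1} \<Longrightarrow> P (\<gamma> s) \<noteq> 0"
    and r: "sqrt_branch_on (path_image \<gamma>) P r"
  shows "(r has_arc_integral I) \<gamma> \<longleftrightarrow> (r has_contour_integral I) \<gamma>"
proof
  assume "(r has_arc_integral I) \<gamma>"
  with \<gamma> show "(r has_contour_integral I) \<gamma>" by (rule has_arc_integral_imp_has_contour_integral)
next
  assume "(r has_contour_integral I) \<gamma>"
  define h where "h = (\<lambda>s. r (\<gamma> s) * vector_derivative \<gamma> (at s))"
  have hI: "(h has_integral I) {0..1}"
    using \<open>(r has_contour_integral I) \<gamma>\<close> by (simp add: has_contour_integral h_def)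
  define F where "F = (\<lambda>x. integral {0..x} h)"
  obtain K where K: "finite K" "\<And>s. s \<in> {0..1} - K \<Longrightarrow> \<gamma> differentiable at s"
    using \<gamma> unfolding valid_path_def piecewise_C1_differentiable_on_def
      C1_differentiable_on_eq by blast
  have cont: "continuous_on {0..1} \<gamma>"
    using \<gamma> valid_path_imp_path path_def by blast
  have contr: "continuous_on {0..1} (\<lambda>s. r (\<gamma> s))"
    using r cont unfolding sqrt_branch_on_def path_image_def
    by (metis continuous_on_compose2 order_refl)
  have rsq: "(r (\<gamma> s))\<^sup>2 = P (\<gamma> s)" if "s \<in> {0..1}" for s
    using r that unfolding sqrt_branch_on_def path_image_def by auto
  show "(r has_arc_integral I) \<gamma>"
    unfolding has_arc_integral_def
  proof (intro exI[of _ F] conjI ballI)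
    show "continuous_on {0..1} F"
      unfolding F_def by (rule indefinite_integral_continuous_1) (use hI in blast)
    show "F 1 - F 0 = I" using hI by (simp add: F_def integral_unique)
    fix s :: real assume s: "s \<in> {0<..<1}"
    have contP: "continuous_on UNIV P" using P holomorphic_on_imp_continuous_on by blast
    have "open {z. P z \<noteq> 0}"
      using open_Collect_neq[OF contP continuous_on_const, of 0] by simp
    then obtain e where e: "e > 0" "ball (\<gamma> s) e \<subseteq> {z. P z \<noteq> 0}"
      using nz[OF s] openE by blast
    let ?B = "ball (\<gamma> s) e"
    have "P holomorphic_on ?B" using P holomorphic_on_subset by blast
    moreover have "simply_connected ?B" by (simp add: convex_imp_simply_connected)
    ultimately obtain g0 where g0: "g0 holomorphic_on ?B" "\<And>z. z \<in> ?B \<Longrightarrow> P z = (g0 z)\<^sup>2"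
      using e(2) simply_connected_eq_holomorphic_sqrt[of ?B] open_ball by blast
    have "(g0 (\<gamma> s))\<^sup>2 = (r (\<gamma> s))\<^sup>2" using g0(2) e(1) rsq[of s] s by auto
    then have "g0 (\<gamma> s) = r (\<gamma> s) \<or> - g0 (\<gamma> s) = r (\<gamma> s)"
      by (metis minus_minus power2_eq_iff)
    moreover have "(\<lambda>z. - g0 z) holomorphic_on ?B" using g0(1) by (intro holomorphic_intros)
    ultimately obtain g where g: "g holomorphic_on ?B" "\<And>z. z \<in> ?B \<Longrightarrow> P z = (g z)\<^sup>2"
      "g (\<gamma> s) = r (\<gamma> s)"
      using g0 by (metis power2_minus)
    obtain G0 where G0: "\<And>z. z \<in> ?B \<Longrightarrow> (G0 has_field_derivative g z) (at z)"
      using holomorphic_convex_primitive'[of ?B g] g(1) at_within_open[OF _ open_ball] 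
      by (metis convex_ball open_ball)
    have rnz: "r (\<gamma> s) \<noteq> 0" using rsq[of s] nz[OF s] s by fastforce
    have cs: "isCont \<gamma> s" using cont s continuous_on_interior[of "{0..1}" \<gamma> s] by simp
    have crs: "isCont (\<lambda>s. r (\<gamma> s)) s"
      using contr s continuous_on_interior[of "{0..1}" "\<lambda>s. r (\<gamma> s)" s] by simp
    have "isCont g (\<gamma> s)"
      using g(1) e(1) by (meson centre_in_ball continuous_on_eq_continuous_at 
          holomorphic_on_imp_continuous_on open_ball)
    then have cgs: "isCont (\<lambda>s. g (\<gamma> s)) s" using cs isCont_o2 by blast
    have "isCont (\<lambda>u. r (\<gamma> u) + g (\<gamma> u)) s" using crs cgs by (rule continuous_add)
    moreover have "r (\<gamma> s) + g (\<gamma> s) \<noteq> 0" using g(3) rnz by simp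
    ultimately obtain d1 where d1: "d1 > 0" "\<And>u. dist s u < d1 \<Longrightarrow> r (\<gamma> u) + g (\<gamma> u) \<noteq> 0"
      using continuous_at_avoid[of s "\<lambda>u. r (\<gamma> u) + g (\<gamma> u)" 0] by blast
    obtain d2 where d2: "d2 > 0" "\<And>u. dist u s < d2 \<Longrightarrow> \<gamma> u \<in> ?B"
      using cs e(1) unfolding continuous_at_eps_delta 
      by (metis dist_commute dist_norm mem_ball real_norm_def)
    define d where "d = min (min d1 d2) (min s (1 - s)) / 2"
    have d: "d > 0" "d < d1" "d < d2" "d < s" "d < 1 - s" "s - d > 0" "s + d < 1"
      using d1(1) d2(1) s unfolding d_def by (auto simp: min_def field_simps)
    have near: "\<gamma> u \<in> ?B" "r (\<gamma> u) = g (\<gamma> u)" "u \<in> {0<..<1}" if u: "u \<in> {s-d..s+d}" for u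
    proof -
      have du: "dist s u \<le> d" using u by (auto simp: dist_real_def)
      show B: "\<gamma> u \<in> ?B" using d2(2)[of u] du d(3) by (simp add: dist_commute)
      show u01: "u \<in> {0<..<1}" using u d by auto
      have "(r (\<gamma> u))\<^sup>2 = (g (\<gamma> u))\<^sup>2" using rsq[of u] g(2)[OF B] u01 by simp
      moreover have "r (\<gamma> u) + g (\<gamma> u) \<noteq> 0" using d1(2)[of u] du d(2) by simp
      ultimately show "r (\<gamma> u) = g (\<gamma> u)"
        by (metis add.left_inverse power2_eq_iff)
    qed
    define G where "G = (\<lambda>z. G0 z + (F (s - d) - G0 (\<gamma> (s - d))))"
    have Gd: "(G has_field_derivative g z) (at z)" if "z \<in> ?B" for z
      unfolding G_def by (rule derivative_eq_intros G0[OF that] refl | simp)+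
    have FG: "F u = G (\<gamma> u)" if u: "u \<in> {s-d..s+d}" for u
    proof -
      have "(h has_integral ((G \<circ> \<gamma>) u - (G \<circ> \<gamma>) (s - d))) {s-d..u}"
      proof (rule fundamental_theorem_of_calculus_interior_strong[OF K(1)])
        show "s - d \<le> u" using u by simp
        fix x assume x: "x \<in> {s-d<..<u} - K"
        then have x': "x \<in> {s-d..s+d}" using u by auto
        have "(\<gamma> has_vector_derivative vector_derivative \<gamma> (at x)) (at x)"
          using K(2)[of x] x near(3)[OF x'] by (simp add: vector_derivative_works[symmetric])
        from field_vector_diff_chain_at[OF this Gd[OF near(1)[OF x']]]
        show "(G \<circ> \<gamma> has_vector_derivative h x) (at x)"
          using near(2)[OF x'] by (simp add: h_def mult.commute)
      next
        have "continuous_on ?B G"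
          using Gd by (meson DERIV_isCont continuous_at_imp_continuous_on)
        moreover have "continuous_on {s-d..u} \<gamma>"
          using cont by (rule continuous_on_subset) (use d u in auto)
        moreover have "\<gamma> ` {s-d..u} \<subseteq> ?B" using near(1) u by auto
        ultimately show "continuous_on {s-d..u} (G \<circ> \<gamma>)"
          by (meson continuous_on_compose continuous_on_subset)
      qed
      then have "integral {s-d..u} h = G (\<gamma> u) - G (\<gamma> (s - d))"
        by (simp add: integral_unique)
      moreover have "h integrable_on {0..u}"
        using hI near(3)[OF u] by (intro integrable_on_subinterval[of h "{0..1}" 0 u]) auto
      then have "integral {0..s-d} h + integral {s-d..u} h = integral {0..u} h"
        using d u by (intro Henstock_Kurzweil_Integration.integral_combine) auto
      ultimately have "F u = F (s - d) + (G (\<gamma> u) - G (\<gamma> (s - d)))"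
        by (simp add: F_def)
      then show ?thesis by (simp add: G_def)
    qed
    show "\<exists>U G. open U \<and> \<gamma> s \<in> U \<and> G holomorphic_on U \<and>
             (\<forall>\<^sub>F u in nhds s. F u = G (\<gamma> u) \<and> r (\<gamma> u) = deriv G (\<gamma> u))"
    proof (intro exI[of _ ?B] exI[of _ G] conjI)
      show "G holomorphic_on ?B"
        using Gd holomorphic_on_open open_ball by blast
      have "\<forall>\<^sub>F u in nhds s. u \<in> {s-d<..<s+d}"
        by (rule eventually_nhds_in_open) (use d in auto)
      then show "\<forall>\<^sub>F u in nhds s. F u = G (\<gamma> u) \<and> r (\<gamma> u) = deriv G (\<gamma> u)"
      proof eventually_elim
        case (elim u)
        then have u: "u \<in> {s-d..s+d}" by simp
        show ?case using FG[OF u] near(2)[OF u] DERIV_imp_deriv[OF Gd[OF near(1)[OF u]]] by simp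
      qed
    qed (use e in auto)
  qed
qed

end

theory Submission
  imports Defs
begin

text \<open>
  Cut a short trajectory at the zeros it meets.  The pieces are edges: horizontal arcs from zero to
  zero with regular interior, here parametrised at unit speed for \<open>\<bar>P\<bar>\<^sup>1\<^sup>/\<^sup>2 \<bar>dz\<bar>\<close>.  If \<open>t\<^sub>m \<rightarrow> t\<close>, edges
  of \<open>P\<^sub>m\<close> subconverge to chains of edges of the limit \<open>P\<close>, provided their lengths and moduli of
  continuity are bounded uniformly.  There are finitely many graphs on the indices of the roots, so
  one of them is the edge graph for infinitely many \<open>m\<close>; in the limit it yields a chain of edges from
  \<open>a t\<close> to \<open>b t\<close>.  Two edges which share a regular point have the same image, hence such a chain
  contains a Jordan arc.

  The uniform bounds come from the fact that a trajectory of a polynomial differential meets a disc away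
  from the zeros at most once.  Otherwise a piece of it closed up by a vertical segment \<open>\<sigma>\<close> bounds a
  domain \<open>D\<close>.  Take a Riemann map \<open>k\<close> of \<open>D\<close> onto the unit disc with \<open>k z0 = 0\<close>, and write
  \<open>P = g\<^sup>2 b\<close> on \<open>D\<close> with \<open>b\<close> a product of Blaschke factors in \<open>k\<close>.  Then \<open>f1 = g / k\<close> and
  \<open>f2 = g k b\<close> satisfy \<open>f1 f2 = P\<close> and \<open>\<bar>f1\<bar> = \<bar>f2\<bar>\<close> on the boundary, so \<open>f1 dz + cnj (f2 dz)\<close> vanishes
  along the trajectory and the integral over \<open>\<sigma>\<close> alone accounts for the residue of \<open>f1\<close> at \<open>z0\<close>.  For
  \<open>z0\<close> in a flow box next to \<open>\<sigma>\<close> this residue is at least half the length of \<open>\<sigma>\<close>, which is too much.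
\<close>

section \<open>Flow boxes and leaves\<close>

text \<open>What has to be excluded is that trajectories grow longer and longer, or accumulate on
  themselves, as the roots move; so every bound may depend only on the number of roots and on a disc
  containing them. The contradiction behind the phrase "too much" is \<open>4 < 2 * pi\<close>: for
  a transversal of natural length \<open>2 * R0\<close> the residue accounts for at least
  \<open>2 * pi * R0\<close>, while on the transversal both differentials have natural modulus near
  1 and together give about \<open>4 * R0\<close>. This takes the place of the count of angles and
  zeros in Teichmueller's lemma. Zeros of \<open>P\<close> inside \<open>D\<close> cost nothing,
  because Blaschke factors have modulus 1 on the boundary. Boundary values of the Riemann map are
  avoided: the loop is pushed slightly into \<open>D\<close>, along a parallel of the trajectory in
  its analytic continuation, where the cancellation holds up to a small error. In the limit roots
  may merge, so they are tracked by their index in a list, and an edge whose ends merge is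
  dropped.\<close>

definition root_poly :: "complex list \<Rightarrow> complex \<Rightarrow> complex" where
  "root_poly rs z = (\<Prod>r\<leftarrow>rs. z - r)"

lemma root_poly_Nil [simp]: "root_poly [] z = 1"
  and root_poly_Cons [simp]: "root_poly (r # rs) z = (z - r) * root_poly rs z"
  by (simp_all add: root_poly_def)

lemma root_poly_eq_0_iff: "root_poly rs z = 0 \<longleftrightarrow> z \<in> set rs"
  by (induction rs) auto

lemma root_poly_holomorphic [holomorphic_intros]: "root_poly rs holomorphic_on S"
proof (induction rs)
  case Nil
  have "root_poly [] = (\<lambda>z. 1)" by auto
  then show ?case by simp
next
  case (Cons r rs)
  have "root_poly (r # rs) = (\<lambda>z. (z - r) * root_poly rs z)" by auto
  with Cons show ?case by (auto intro!: holomorphic_intros)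
qed

lemma norm_root_poly_ge:
  assumes "0 \<le> d" "\<And>r. r \<in> set rs \<Longrightarrow> d \<le> norm (z - r)"
  shows "d ^ length rs \<le> norm (root_poly rs z)"
  using assms by (induction rs) (auto simp: norm_mult intro!: mult_mono)

lemma norm_root_poly_le:
  assumes "\<And>r. r \<in> set rs \<Longrightarrow> norm (z - r) \<le> d"
  shows "norm (root_poly rs z) \<le> d ^ length rs"
  using assms
proof (induction rs)
  case (Cons r rs)
  then have "0 \<le> d" using norm_ge_zero[of "z - r"] by (meson list.set_intros(1) order_trans)
  with Cons show ?case by (auto simp: norm_mult intro!: mult_mono)
qed auto

text \<open>Each factor of the quotient is \<open>1 + u\<close> with \<open>|u| \<le> k\<close>, and
  the errors multiply out to at most \<open>(1 + k) ^ n - 1\<close>.\<close>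

lemma root_poly_ratio:
  assumes "0 < d" "\<And>r. r \<in> set rs \<Longrightarrow> d \<le> norm (z0 - r)" "norm (z - z0) \<le> k * d"
  shows "norm (root_poly rs z / root_poly rs z0 - 1) \<le> (1 + k) ^ length rs - 1"
  using assms(2)
proof (induction rs)
  case (Cons r rs)
  have "0 \<le> k" using assms(1,3) norm_ge_zero[of "z - z0"] 
    by (meson order_trans zero_le_mult_iff not_le)
  define u where "u = (z - z0) / (z0 - r)"
  define A where "A = root_poly rs z / root_poly rs z0 - 1"
  have d: "d \<le> norm (z0 - r)" using Cons by auto
  then have nz: "z0 \<noteq> r" using assms(1) by auto
  have "norm u \<le> k * d / d"
    unfolding u_def norm_divide using d assms \<open>0 \<le> k\<close> by (intro frac_le) auto
  then have u: "norm u \<le> k" using assms(1) by simp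
  have A: "norm A \<le> (1 + k) ^ length rs - 1" unfolding A_def using Cons by auto
  have "root_poly (r # rs) z / root_poly (r # rs) z0 = (1 + u) * (1 + A)"
    using nz by (simp add: u_def A_def field_simps)
  then have "root_poly (r # rs) z / root_poly (r # rs) z0 - 1 = u + A + u * A"
    by (simp add: algebra_simps)
  also have "norm \<dots> \<le> norm u + norm A + norm u * norm A"
    by (metis norm_triangle_mono norm_mult norm_triangle_ineq order_refl)
  also have "\<dots> \<le> k + ((1 + k) ^ length rs - 1) + k * ((1 + k) ^ length rs - 1)"
    using u A \<open>0 \<le> k\<close> by (intro add_mono mult_mono) auto
  also have "\<dots> = (1 + k) ^ length (r # rs) - 1" by (simp add: algebra_simps)
  finally show ?case .
qed auto

text \<open>The relative radius on which \<open>root_poly\<close> varies little: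
  \<open>(1 + 1 / (3 * (n + 1))) ^ n \<le> exp (1/3) \<le> 3/2\<close> keeps the quotient of two
  values within \<open>1/2\<close> of 1.\<close>

definition box_const :: "nat \<Rightarrow> real" where "box_const n = 1 / (3 * (real n + 1))"

lemma box_const_pos: "0 < box_const n" and box_const_le: "box_const n \<le> 1/3"
  by (auto simp: box_const_def field_simps)

lemma box_const_power: "(1 + box_const n) ^ n \<le> 3 / 2"
proof -
  have "(1 + box_const n) ^ n \<le> exp (box_const n) ^ n"
    using box_const_pos[of n] by (intro power_mono) auto
  also have "\<dots> = exp (real n * box_const n)" by (simp add: exp_of_nat_mult)
  also have "\<dots> \<le> exp (1/3)" by (simp add: box_const_def field_simps)
  also have "\<dots> \<le> 3/2" using exp_bound[of "1/3"] by (simp add: power2_eq_square)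
  finally show ?thesis .
qed

text \<open>\<open>\<beta>\<close> inverts a local branch of \<open>\<integral> \<surd>(-P) dz\<close>: it maps horizontal lines to horizontal trajectories.\<close>

definition flow_box :: "complex list \<Rightarrow> real \<Rightarrow> (complex \<Rightarrow> complex) \<Rightarrow> bool" where
  "flow_box rs \<rho> \<beta> \<longleftrightarrow> 0 < \<rho> \<and> \<beta> holomorphic_on ball 0 \<rho> \<and> inj_on \<beta> (ball 0 \<rho>)
     \<and> (\<forall>w\<in>ball 0 \<rho>. - root_poly rs (\<beta> w) * (deriv \<beta> w)\<^sup>2 = 1)"

text \<open>On \<open>B\<close> the square root \<open>f\<close> of \<open>-P\<close> stays within
  \<open>M / 2\<close> of its value \<open>f0\<close> at the centre, so its primitive differs from
  the linear map \<open>f0 * z\<close> by a map with Lipschitz constant \<open>M / 2\<close>. This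
  makes the primitive injective, and \<open>\<beta>\<close> is its inverse. The explicit radii make
  boxes of different differentials comparable; the last clause gives points close to
  \<open>z0\<close> a proportionally small box coordinate.\<close>

lemma flow_box_exists:
  assumes d: "0 < d" "\<And>r. r \<in> set rs \<Longrightarrow> d \<le> norm (z0 - r)"
  defines "k \<equiv> box_const (length rs)" and "M \<equiv> sqrt (norm (root_poly rs z0))"
  obtains \<beta> where "flow_box rs (k * d * M / 12) \<beta>" "\<beta> 0 = z0"
    "\<And>z. norm (z - z0) \<le> k * d / 36 \<Longrightarrow>
       \<exists>w. norm w \<le> 3 / 2 * M * norm (z - z0) \<and> w \<in> ball 0 (k * d * M / 12) \<and> \<beta> w = z"
proof -
  let ?P = "root_poly rs" and ?\<rho> = "k * d * M / 12"
  define B where "B = ball z0 (k * d)"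
  have k: "0 < k" "k \<le> 1/3" unfolding k_def using box_const_pos box_const_le by auto
  have kd: "k * d < d" "0 < k * d" using k d(1) by auto
  have ratio: "norm (?P z / ?P z0 - 1) \<le> 1/2" if "z \<in> B" for z
    using root_poly_ratio[OF d, where z = z and k = k and rs = rs] box_const_power[of "length rs"] that
    unfolding B_def k_def by (auto simp: dist_norm norm_minus_commute less_imp_le)
  have nzP: "?P z \<noteq> 0" if "z \<in> B" for z
  proof
    assume "?P z = 0"
    then have "norm (?P z / ?P z0 - 1) = 1" by simp
    with ratio[OF that] show False by simp
  qed
  have z0B: "z0 \<in> B" using kd by (simp add: B_def)
  have "(\<lambda>z. - ?P z) holomorphic_on B" by (intro holomorphic_intros)
  moreover have "simply_connected B" "open B" unfolding B_def by (simp_all add: convex_imp_simply_connected)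
  moreover have "\<forall>z\<in>B. - ?P z \<noteq> 0" using nzP by simp
  ultimately obtain f where f: "f holomorphic_on B" "\<And>z. z \<in> B \<Longrightarrow> - ?P z = (f z)\<^sup>2"
    using simply_connected_eq_holomorphic_sqrt[of B] by blast
  define f0 where "f0 = f z0"
  have f0: "f0 \<noteq> 0" "f0\<^sup>2 = - ?P z0" using f(2)[OF z0B] nzP[OF z0B] by (auto simp: f0_def)
  have M: "norm f0 = M" 
    unfolding M_def using f0(2) by (metis norm_ge_zero norm_minus_cancel norm_power real_sqrt_unique)
  have M0: "0 < M" using M f0 by auto
  have close: "norm (f z - f0) \<le> M / 2" if z: "z \<in> B" for z
  proof -
    define u where "u = (\<lambda>z. f z / f0)"
    have u2: "(u z)\<^sup>2 = ?P z / ?P z0" if "z \<in> B" for z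
      using f(2)[OF that] f0 by (simp add: u_def power_divide flip: f(2)[OF that])
    \<comment> \<open>The bound on \<open>u^2 - 1\<close> controls \<open>u\<close> only up to sign.
      Since \<open>Re u\<close> cannot vanish, connectedness of \<open>B\<close> fixes the sign from
      \<open>u z0 = 1\<close>; then \<open>|u + 1| \<ge> 1\<close> bounds \<open>u - 1\<close> by
      \<open>u^2 - 1\<close>.\<close>
    have Ru: "Re (u z) \<noteq> 0" if "z \<in> B" for z
    proof
      assume "Re (u z) = 0"
      then have "Re ((u z)\<^sup>2 - 1) \<le> -1" by (simp add: power2_eq_square)
      then have "1 \<le> norm ((u z)\<^sup>2 - 1)" 
        using abs_Re_le_cmod[of "(u z)\<^sup>2 - 1"] by linarith
      with ratio[OF that] u2[OF that] show False by simp
    qed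
    have "connected ((\<lambda>z. Re (u z)) ` B)"
      unfolding u_def B_def 
      by (intro connected_continuous_image continuous_intros holomorphic_on_imp_continuous_on)
         (use f(1) f0 in \<open>auto simp: B_def\<close>)
    moreover have "Re (u z0) = 1" using f0 by (simp add: u_def f0_def)
    ultimately have "0 < Re (u z)"
      using Ru z z0B unfolding connected_iff_interval
      by (metis (no_types, lifting) imageE image_eqI less_eq_real_def not_less zero_le_one)
    then have "1 \<le> norm (u z + 1)" using abs_Re_le_cmod[of "u z + 1"] by simp
    moreover have "(u z - 1) * (u z + 1) = (u z)\<^sup>2 - 1" by (simp add: power2_eq_square algebra_simps)
    then have "norm (u z - 1) * norm (u z + 1) \<le> 1/2"
      using ratio[OF z] u2[OF z] by (metis norm_mult)
    ultimately have "norm (u z - 1) \<le> 1/2" 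
      by (smt (verit, best) mult_le_cancel_left1 norm_ge_zero)
    moreover have "f z - f0 = f0 * (u z - 1)" using f0 by (simp add: u_def algebra_simps)
    ultimately show ?thesis using M M0 by (simp add: norm_mult)
  qed
  obtain \<Phi>0 where \<Phi>0: "\<And>z. z \<in> B \<Longrightarrow> (\<Phi>0 has_field_derivative f z) (at z within B)"
    using holomorphic_convex_primitive'[of B f] f(1) unfolding B_def by auto
  define \<Phi> where "\<Phi> = (\<lambda>z. \<Phi>0 z - \<Phi>0 z0)"
  have \<Phi>: "(\<Phi> has_field_derivative f z) (at z)" if "z \<in> B" for z
  proof -
    have "(\<Phi>0 has_field_derivative f z) (at z)"
      using \<Phi>0[OF that] at_within_open[OF that] by (simp add: B_def)
    then show ?thesis unfolding \<Phi>_def by (auto intro!: derivative_eq_intros)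
  qed
  have \<Phi>0': "\<Phi> z0 = 0" by (simp add: \<Phi>_def)
  have bil: "norm ((\<Phi> z - f0 * z) - (\<Phi> z' - f0 * z')) \<le> M / 2 * norm (z - z')" if "z \<in> B" "z' \<in> B" for z z'
  proof (rule field_differentiable_bound[where S = B and f' = "\<lambda>z. f z - f0"])
    show "((\<lambda>a. \<Phi> a - f0 * a) has_field_derivative f z - f0) (at z within B)" if "z \<in> B" for z
      by (rule has_field_derivative_at_within) (auto intro!: derivative_eq_intros \<Phi> that)
  qed (use that close in \<open>auto simp: B_def\<close>)
  have low: "M / 2 * norm (z - z') \<le> norm (\<Phi> z - \<Phi> z')"
    and upp: "norm (\<Phi> z - \<Phi> z') \<le> 3 / 2 * M * norm (z - z')" if "z \<in> B" "z' \<in> B" for z z'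
  proof -
    have eq: "norm (f0 * (z - z')) = M * norm (z - z')" by (simp add: norm_mult M)
    have e: "(\<Phi> z - f0 * z) - (\<Phi> z' - f0 * z') = (\<Phi> z - \<Phi> z') - f0 * (z - z')" by (simp add: algebra_simps)
    have "norm ((\<Phi> z - \<Phi> z') - f0 * (z - z')) \<le> M / 2 * norm (z - z')" using bil[OF that] e by simp
    then show "M / 2 * norm (z - z') \<le> norm (\<Phi> z - \<Phi> z')"
      "norm (\<Phi> z - \<Phi> z') \<le> 3 / 2 * M * norm (z - z')"
      using norm_triangle_ineq2[of "f0 * (z - z')" "\<Phi> z - \<Phi> z'"] 
        norm_triangle_ineq2[of "\<Phi> z - \<Phi> z'" "f0 * (z - z')"] eq
      by (auto simp: norm_minus_commute)
  qed
  have inj: "inj_on \<Phi> B"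
  proof (rule inj_onI)
    fix x y assume "x \<in> B" "y \<in> B" "\<Phi> x = \<Phi> y"
    with low[of x y] M0 show "x = y" by (simp add: mult_le_0_iff)
  qed
  have hol: "\<Phi> holomorphic_on B" using \<Phi> \<open>open B\<close> holomorphic_on_open by blast
  have der: "deriv \<Phi> z = f z" if "z \<in> B" for z using \<Phi>[OF that] by (rule DERIV_imp_deriv)
  obtain \<beta> where \<beta>: "\<beta> holomorphic_on \<Phi> ` B" "\<And>z. z \<in> B \<Longrightarrow> deriv \<Phi> z * deriv \<beta> (\<Phi> z) = 1"
      "\<And>z. z \<in> B \<Longrightarrow> \<beta> (\<Phi> z) = z"
    using holomorphic_has_inverse[OF hol \<open>open B\<close> inj] by metis
  have cb: "cball z0 (k * d / 2) \<subseteq> B" using kd by (auto simp: B_def)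
  \<comment> \<open>Bloch's lemma applies because \<open>|f| \<le> 3/2 * M\<close> is below
    \<open>2 * M\<close>. The 12 in the box radius comes from \<open>sqrt 2 \<le> 17/12\<close>,
    which gives \<open>(3 - 2 * sqrt 2) / 2 \<ge> 1/12\<close>.\<close>
  have "ball (\<Phi> z0) ((3 - 2 * sqrt 2) * (k * d / 2) * norm (deriv \<Phi> z0)) \<subseteq> \<Phi> ` ball z0 (k * d / 2)"
  proof (rule Bloch_lemma)
    show "\<Phi> holomorphic_on cball z0 (k * d / 2)" using hol cb holomorphic_on_subset by blast
    show "norm (deriv \<Phi> z) \<le> 2 * norm (deriv \<Phi> z0)" if "z \<in> ball z0 (k * d / 2)" for z
    proof -
      have zB: "z \<in> B" using that cb by auto
      have "norm (f z) \<le> M + M / 2" using close[OF zB] M 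
        by (metis add.commute add_mono norm_triangle_sub order_refl order_trans)
      then show ?thesis using der[OF zB] der[OF z0B] M M0 by (simp add: f0_def)
    qed
  qed (use kd in auto)
  moreover have "?\<rho> \<le> (3 - 2 * sqrt 2) * (k * d / 2) * norm (deriv \<Phi> z0)"
  proof -
    have "sqrt 2 \<le> 17/12" by (rule real_le_lsqrt) (auto simp: power2_eq_square)
    then have "1/12 \<le> (3 - 2 * sqrt 2) / 2" by simp
    then have "1/12 * (k * d * M) \<le> (3 - 2 * sqrt 2) / 2 * (k * d * M)"
      using kd M0 by (intro mult_right_mono) auto
    then show ?thesis using der[OF z0B] M by (simp add: f0_def)
  qed
  ultimately have "ball 0 ?\<rho> \<subseteq> \<Phi> ` ball z0 (k * d / 2)"
    using subset_ball order_trans unfolding \<Phi>0' by blast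
  moreover have "ball z0 (k * d / 2) \<subseteq> B" using cb ball_subset_cball by blast
  ultimately have sub: "ball 0 ?\<rho> \<subseteq> \<Phi> ` B" by blast
  have fb: "flow_box rs ?\<rho> \<beta>"
    unfolding flow_box_def
  proof (intro conjI ballI)
    show "\<beta> holomorphic_on ball 0 ?\<rho>" using \<beta>(1) sub holomorphic_on_subset by blast
    show "inj_on \<beta> (ball 0 ?\<rho>)"
      by (rule inj_on_subset[OF _ sub]) (auto simp: inj_on_def \<beta>(3))
    fix w :: complex assume "w \<in> ball 0 ?\<rho>"
    then obtain z where z: "z \<in> B" "w = \<Phi> z" using sub by auto
    have "(f z * deriv \<beta> w)\<^sup>2 = 1" using \<beta>(2)[OF z(1)] der[OF z(1)] z(2) by simp
    then show "- root_poly rs (\<beta> w) * (deriv \<beta> w)\<^sup>2 = 1"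
      using f(2)[OF z(1)] \<beta>(3)[OF z(1)] z(2) by (simp add: power_mult_distrib)
  qed (use kd M0 k(1) d(1) in auto)
  moreover have "\<beta> 0 = z0" using \<beta>(3)[OF z0B] \<Phi>0' by simp
  moreover have "\<exists>w. norm w \<le> 3 / 2 * M * norm (z - z0) \<and> w \<in> ball 0 ?\<rho> \<and> \<beta> w = z"
    if z: "norm (z - z0) \<le> k * d / 36" for z
  proof (intro exI conjI)
    have zB: "z \<in> B" using z kd by (auto simp: B_def dist_norm norm_minus_commute)
    show b: "norm (\<Phi> z) \<le> 3 / 2 * M * norm (z - z0)" using upp[OF zB z0B] \<Phi>0' by simp
    also have "\<dots> \<le> 3 / 2 * M * (k * d / 36)" using z M0 by (intro mult_left_mono) auto
    also have "\<dots> < ?\<rho>" using kd M0 k(1) d(1) by (simp add: field_simps)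
    finally show "\<Phi> z \<in> ball 0 ?\<rho>" by simp
    show "\<beta> (\<Phi> z) = z" by (rule \<beta>(3)[OF zB])
  qed
  ultimately show ?thesis using that by blast
qed

lemma flow_boxD:
  assumes "flow_box rs \<rho> \<beta>"
  shows "0 < \<rho>" "\<beta> holomorphic_on ball 0 \<rho>" "inj_on \<beta> (ball 0 \<rho>)"
    "w \<in> ball 0 \<rho> \<Longrightarrow> - root_poly rs (\<beta> w) * (deriv \<beta> w)\<^sup>2 = 1"
    "w \<in> ball 0 \<rho> \<Longrightarrow> root_poly rs (\<beta> w) \<noteq> 0"
    "w \<in> ball 0 \<rho> \<Longrightarrow> (\<beta> has_field_derivative deriv \<beta> w) (at w)"
    "open (\<beta> ` ball 0 \<rho>)"
proof -
  show fb: "0 < \<rho>" "\<beta> holomorphic_on ball 0 \<rho>" "inj_on \<beta> (ball 0 \<rho>)"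
    "w \<in> ball 0 \<rho> \<Longrightarrow> - root_poly rs (\<beta> w) * (deriv \<beta> w)\<^sup>2 = 1"
    using assms unfolding flow_box_def by auto
  then show "w \<in> ball 0 \<rho> \<Longrightarrow> root_poly rs (\<beta> w) \<noteq> 0"
    by (metis mult_zero_left neg_0_equal_iff_equal zero_neq_one)
  show "w \<in> ball 0 \<rho> \<Longrightarrow> (\<beta> has_field_derivative deriv \<beta> w) (at w)"
    using fb(2) holomorphic_derivI open_ball by blast
  show "open (\<beta> ` ball 0 \<rho>)"
    using fb open_mapping_thm3 by blast
qed

text \<open>\<open>\<Phi>\<close> is the natural parameter of the differential: it carries
  \<open>-P dz^2\<close> to \<open>dw^2\<close>, so trajectories become horizontal lines and natural
  lengths become Euclidean.\<close>

lemma flow_box_coordinate: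
  assumes "flow_box rs \<rho> \<beta>"
  obtains \<Phi> where "\<And>w. w \<in> ball 0 \<rho> \<Longrightarrow> \<Phi> (\<beta> w) = w" "\<And>z. z \<in> \<beta> ` ball 0 \<rho> \<Longrightarrow> \<beta> (\<Phi> z) = z"
    "\<Phi> holomorphic_on \<beta> ` ball 0 \<rho>"
    "\<And>z. z \<in> \<beta> ` ball 0 \<rho> \<Longrightarrow> (\<Phi> has_field_derivative deriv \<Phi> z) (at z)"
    "\<And>z. z \<in> \<beta> ` ball 0 \<rho> \<Longrightarrow> (deriv \<Phi> z)\<^sup>2 = - root_poly rs z"
proof -
  note fb = flow_boxD[OF assms]
  obtain \<Phi> where \<Phi>: "\<Phi> holomorphic_on \<beta> ` ball 0 \<rho>" 
    "\<And>w. w \<in> ball 0 \<rho> \<Longrightarrow> deriv \<beta> w * deriv \<Phi> (\<beta> w) = 1" "\<And>w. w \<in> ball 0 \<rho> \<Longrightarrow> \<Phi> (\<beta> w) = w"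
    using holomorphic_has_inverse[OF fb(2) open_ball fb(3)] by metis
  have "(deriv \<Phi> z)\<^sup>2 = - root_poly rs z" if z: "z \<in> \<beta> ` ball 0 \<rho>" for z
  proof -
    obtain w where w: "w \<in> ball 0 \<rho>" "z = \<beta> w" using z by blast
    have "(deriv \<beta> w)\<^sup>2 * (deriv \<Phi> z)\<^sup>2 = 1" using \<Phi>(2)[OF w(1)] w(2)
      by (metis power_mult_distrib power_one)
    then have "- root_poly rs z * (deriv \<beta> w)\<^sup>2 * (deriv \<Phi> z)\<^sup>2 = - root_poly rs z"
      by simp
    moreover have "- root_poly rs z * (deriv \<beta> w)\<^sup>2 = 1" using fb(4)[OF w(1)] w(2) by simp
    ultimately have "1 * (deriv \<Phi> z)\<^sup>2 = - root_poly rs z" by (simp only:)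
    then show ?thesis by simp
  qed
  with \<Phi> fb(7) show ?thesis
    by (intro that[of \<Phi>]) (auto intro: holomorphic_derivI)
qed

text \<open>The last clause says that \<open>u\<close> is proper into the regular points: a leaf is a maximal trajectory.\<close>

definition leaf :: "complex list \<Rightarrow> real set \<Rightarrow> (real \<Rightarrow> complex) \<Rightarrow> bool" where
  "leaf rs I u \<longleftrightarrow> open I \<and> connected I \<and> I \<noteq> {} \<and> inj_on u I
     \<and> (\<forall>x\<in>I. \<exists>v. (u has_vector_derivative v) (at x) \<and> - root_poly rs (u x) * v\<^sup>2 = 1)
     \<and> (\<forall>K. compact K \<and> (\<forall>z\<in>K. root_poly rs z \<noteq> 0) \<longrightarrow> compact {x\<in>I. u x \<in> K})"

lemma leafD:
  assumes "leaf rs I u"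
  shows "open I" "connected I" "inj_on u I"
    "x \<in> I \<Longrightarrow> \<exists>v. (u has_vector_derivative v) (at x) \<and> - root_poly rs (u x) * v\<^sup>2 = 1"
    "compact K \<Longrightarrow> (\<And>z. z \<in> K \<Longrightarrow> root_poly rs z \<noteq> 0) \<Longrightarrow> compact {x\<in>I. u x \<in> K}"
    "x \<in> I \<Longrightarrow> root_poly rs (u x) \<noteq> 0" "x \<in> I \<Longrightarrow> isCont u x"
proof -
  show *: "open I" "connected I" "inj_on u I"
    "x \<in> I \<Longrightarrow> \<exists>v. (u has_vector_derivative v) (at x) \<and> - root_poly rs (u x) * v\<^sup>2 = 1"
    "compact K \<Longrightarrow> (\<And>z. z \<in> K \<Longrightarrow> root_poly rs z \<noteq> 0) \<Longrightarrow> compact {x\<in>I. u x \<in> K}"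
    using assms unfolding leaf_def by auto
  show "x \<in> I \<Longrightarrow> root_poly rs (u x) \<noteq> 0" using *(4) by fastforce
  show "x \<in> I \<Longrightarrow> isCont u x" using *(4) has_vector_derivative_continuous by blast
qed

text \<open>Reversal turns the later of two crossings into the earlier one; it normalises the order
  of their heights.\<close>

lemma leaf_reverse:
  assumes "leaf rs I u" shows "leaf rs (uminus ` I) (\<lambda>x. u (- x))"
  unfolding leaf_def
proof (intro conjI ballI allI impI)
  note l = leafD[OF assms]
  show "open (uminus ` I)" using l(1) by (rule open_negations)
  show "connected (uminus ` I)"
    by (rule connected_continuous_image[OF _ l(2)]) (intro continuous_intros)
  show "uminus ` I \<noteq> {}" using assms by (simp add: leaf_def)
  show "inj_on (\<lambda>x. u (- x)) (uminus ` I)" using l(3) by (auto simp: inj_on_def)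
next
  note l = leafD[OF assms]
  fix x assume "x \<in> uminus ` I"
  then have "- x \<in> I" by auto
  then obtain v where v: "(u has_vector_derivative v) (at (- x))" "- root_poly rs (u (- x)) * v\<^sup>2 = 1"
    using l(4) by blast
  have "(uminus has_vector_derivative (-1::real)) (at x)"
    by (auto intro!: derivative_eq_intros simp: has_real_derivative_iff_has_vector_derivative[symmetric])
  from vector_diff_chain_at[OF this, of u v] v(1)
  have "((\<lambda>x. u (- x)) has_vector_derivative - v) (at x)" by (simp add: o_def)
  with v(2) show "\<exists>v. ((\<lambda>x. u (- x)) has_vector_derivative v) (at x) \<and> - root_poly rs (u (- x)) * v\<^sup>2 = 1"
    by (intro exI[of _ "- v"]) simp
next
  fix K :: "complex set" assume K: "compact K \<and> (\<forall>z\<in>K. root_poly rs z \<noteq> 0)"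
  have "{x \<in> uminus ` I. u (- x) \<in> K} = uminus ` {x \<in> I. u x \<in> K}" by auto
  then show "compact {x \<in> uminus ` I. u (- x) \<in> K}"
    using leafD(5)[OF assms] K compact_negations by metis
qed

text \<open>The half turn is the symmetry of \<open>dw^2\<close>; it exchanges the two sides of the
  transversal \<open>Re w = 0\<close>.\<close>

lemma flow_box_rotate:
  assumes "flow_box rs \<rho> \<beta>" shows "flow_box rs \<rho> (\<lambda>w. \<beta> (- w))"
  unfolding flow_box_def
proof (intro conjI ballI)
  note fb = flow_boxD[OF assms]
  show "0 < \<rho>" by (rule fb)
  have der: "((\<lambda>w. \<beta> (- w)) has_field_derivative - deriv \<beta> (- w)) (at w)" if "w \<in> ball 0 \<rho>" for w
  proof -
    have "- w \<in> ball 0 \<rho>" using that by simp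
    from fb(6)[OF this] have "((\<lambda>w. \<beta> (- w)) has_field_derivative deriv \<beta> (- w) * - 1) (at w)"
      by (rule DERIV_chain2) (auto intro!: derivative_eq_intros)
    then show ?thesis by simp
  qed
  show "(\<lambda>w. \<beta> (- w)) holomorphic_on ball 0 \<rho>"
    unfolding holomorphic_on_open[OF open_ball] using der by blast
  show "inj_on (\<lambda>w. \<beta> (- w)) (ball 0 \<rho>)"
  proof (rule inj_onI)
    fix x y :: complex assume "x \<in> ball 0 \<rho>" "y \<in> ball 0 \<rho>" "\<beta> (- x) = \<beta> (- y)"
    then have "- x = - y" using inj_onD[OF fb(3), of "- x" "- y"] by simp
    then show "x = y" by simp
  qed
  fix w :: complex assume w: "w \<in> ball 0 \<rho>"
  have "- w \<in> ball 0 \<rho>" using w by simp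
  from fb(4)[OF this] show "- root_poly rs (\<beta> (- w)) * (deriv (\<lambda>w. \<beta> (- w)) w)\<^sup>2 = 1"
    unfolding DERIV_imp_deriv[OF der[OF w]] by simp
qed

lemma flow_box_mono:
  assumes "flow_box rs \<rho> \<beta>" "0 < \<rho>'" "\<rho>' \<le> \<rho>" shows "flow_box rs \<rho>' \<beta>"
proof -
  have "ball 0 \<rho>' \<subseteq> ball (0::complex) \<rho>" using assms by auto
  then show ?thesis
    using assms unfolding flow_box_def by (auto intro: holomorphic_on_subset inj_on_subset)
qed

text \<open>Darboux's theorem. Trajectories are only assumed differentiable, so \<open>f'\<close>
  may be discontinuous. If \<open>f'\<close> went from positive to negative, \<open>f\<close> would
  have an interior maximum, which is a zero of \<open>f'\<close>.\<close>

lemma nonzero_derivative_sign: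
  fixes f :: "real \<Rightarrow> real"
  assumes "\<And>x. a < x \<Longrightarrow> x < b \<Longrightarrow> (f has_real_derivative f' x) (at x) \<and> f' x \<noteq> 0"
  shows "(\<forall>x. a < x \<and> x < b \<longrightarrow> 0 < f' x) \<or> (\<forall>x. a < x \<and> x < b \<longrightarrow> f' x < 0)"
proof -
  have no: False if xy: "a < x" "x < y" "y < b" and "0 < g' x" "g' y < 0"
    and g: "\<And>x. a < x \<Longrightarrow> x < b \<Longrightarrow> (g has_real_derivative g' x) (at x) \<and> g' x \<noteq> 0"
  for g g' :: "real \<Rightarrow> real" and x y
  proof -
    have "continuous_on {x..y} g"
    proof (intro continuous_at_imp_continuous_on ballI)
      fix t assume "t \<in> {x..y}"
      then show "isCont g t" using g[of t] xy by (auto dest: DERIV_isCont)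
    qed
    then obtain z where z: "z \<in> {x..y}" "\<And>t. t \<in> {x..y} \<Longrightarrow> g t \<le> g z"
      using continuous_attains_sup[of "{x..y}" g] xy by auto
    have gx: "(g has_real_derivative g' x) (at x)" and gy: "(g has_real_derivative g' y) (at y)"
      using g[of x] g[of y] xy by linarith+
    obtain d where d: "d > 0" "\<forall>h>0. h < d \<longrightarrow> g x < g (x + h)"
      using DERIV_pos_inc_right[OF gx \<open>0 < g' x\<close>] by blast
    obtain e where e: "e > 0" "\<forall>h>0. h < e \<longrightarrow> g y < g (y - h)"
      using DERIV_neg_dec_left[OF gy \<open>g' y < 0\<close>] by blast
    define h where "h = min (min d e) (y - x) / 2"
    have h: "0 < h" "h < d" "h < e" "h < y - x" using d(1) e(1) xy(2) by (auto simp: h_def min_def)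
    have "g x < g (x + h)" "g y < g (y - h)" using d(2) e(2) h by auto
    moreover have "g (x + h) \<le> g z" "g (y - h) \<le> g z" using h by (auto intro!: z(2))
    ultimately have "z \<noteq> x" "z \<noteq> y" by auto
    then have zz: "x < z" "z < y" using z(1) by auto
    have gz: "(g has_real_derivative g' z) (at z)" "g' z \<noteq> 0" using g[of z] zz xy by linarith+
    have "g' z = 0"
    proof (rule DERIV_local_max[OF gz(1), of "min (z - x) (y - z)"])
      show "\<forall>t. \<bar>z - t\<bar> < min (z - x) (y - z) \<longrightarrow> g t \<le> g z"
      proof (intro allI impI z(2))
        fix t assume "\<bar>z - t\<bar> < min (z - x) (y - z)"
        then show "t \<in> {x..y}" by (simp add: abs_less_iff)
      qed
    qed (use zz in simp)
    with gz(2) show False by simp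
  qed
  show ?thesis
  proof (rule ccontr)
    assume "\<not> ?thesis"
    then obtain x y where xy: "a < x" "x < b" "f' x < 0" "a < y" "y < b" "0 < f' y"
      using assms by (metis linorder_neqE_linordered_idom)
    then have "x \<noteq> y" by auto
    then consider "x < y" | "y < x" by linarith
    then show False
    proof cases
      case 1
      show False
        by (rule no[of x y "\<lambda>x. - f' x" "\<lambda>x. - f x"]) (use xy 1 assms in \<open>auto intro!: derivative_eq_intros\<close>)
    next
      case 2
      then show False using no[of y x f' f] xy assms by auto
    qed
  qed
qed

text \<open>The velocity is \<open>1\<close> or \<open>-1\<close> at each time and by Darboux's
  theorem cannot switch, so \<open>g\<close> minus a linear function has derivative zero.\<close>

lemma unit_speed_affine:
  fixes g :: "real \<Rightarrow> complex"
  assumes "a < b" and g: "\<And>x. a < x \<Longrightarrow> x < b \<Longrightarrow> \<exists>v. (g has_vector_derivative v) (at x) \<and> v\<^sup>2 = 1"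
  obtains s :: real where "s \<in> {1, -1}" "\<And>x y. a < x \<Longrightarrow> x < b \<Longrightarrow> a < y \<Longrightarrow> y < b \<Longrightarrow> g x - g y = of_real (s * (x - y))"
proof -
  obtain v where v: "\<And>x. a < x \<Longrightarrow> x < b \<Longrightarrow> (g has_vector_derivative v x) (at x) \<and> (v x)\<^sup>2 = 1"
    using g by metis
  have v1: "v x = 1 \<or> v x = -1" if "a < x" "x < b" for x using v[OF that] by (simp add: power2_eq_1_iff)
  have R: "((\<lambda>x. Re (g x)) has_real_derivative Re (v x)) (at x) \<and> Re (v x) \<noteq> 0" if "a < x" "x < b" for x
    using bounded_linear.has_vector_derivative[OF bounded_linear_Re, of g "v x" "at x"] v[OF that] v1[OF that]
    by (auto simp: has_real_derivative_iff_has_vector_derivative)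
  obtain s :: real where s: "s \<in> {1, -1}" "\<And>x. a < x \<Longrightarrow> x < b \<Longrightarrow> v x = of_real s"
  proof -
    have "(\<forall>x. a < x \<and> x < b \<longrightarrow> 0 < Re (v x)) \<or> (\<forall>x. a < x \<and> x < b \<longrightarrow> Re (v x) < 0)"
      by (rule nonzero_derivative_sign[where f = "\<lambda>x. Re (g x)"]) (use R in auto)
    then show ?thesis
    proof
      assume pos: "\<forall>x. a < x \<and> x < b \<longrightarrow> 0 < Re (v x)"
      have "v x = of_real 1" if "a < x" "x < b" for x using v1[OF that] pos[rule_format, of x] that by auto
      then show ?thesis by (intro that[of 1]) simp_all
    next
      assume neg: "\<forall>x. a < x \<and> x < b \<longrightarrow> Re (v x) < 0"
      have "v x = of_real (-1)" if "a < x" "x < b" for x using v1[OF that] neg[rule_format, of x] that by auto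
      then show ?thesis by (intro that[of "-1"]) simp_all
    qed
  qed
  have "g x - g y = of_real (s * (x - y))" if xy: "a < x" "x < b" "a < y" "y < b" for x y
  proof -
    have "((\<lambda>x. g x - of_real (s * x)) has_vector_derivative 0) (at t within {a<..<b})" if "t \<in> {a<..<b}" for t
    proof (rule has_vector_derivative_at_within)
      have "((\<lambda>x. complex_of_real (s * x)) has_vector_derivative of_real s) (at t)"
        by (auto intro!: derivative_eq_intros has_vector_derivative_of_real)
      moreover have "(g has_vector_derivative of_real s) (at t)" using v[of t] s(2)[of t] that by auto
      ultimately show "((\<lambda>x. g x - of_real (s * x)) has_vector_derivative 0) (at t)"
        using has_vector_derivative_diff[of g "of_real s" "at t"] by fastforce
    qed
    then obtain c where "\<And>x. x \<in> {a<..<b} \<Longrightarrow> g x - of_real (s * x) = c"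
      using has_vector_derivative_zero_constant[of "{a<..<b}" "\<lambda>x. g x - of_real (s * x)"] by auto
    then have "g x - of_real (s * x) = g y - of_real (s * y)" using xy by simp
    then show ?thesis by (simp add: algebra_simps)
  qed
  then show ?thesis by (rule that[OF s(1)])
qed

text \<open>In the natural parameter the condition \<open>-P * v^2 = 1\<close> says that the
  velocity has square 1, so the leaf is a horizontal translation up to its direction
  \<open>s\<close>.\<close>

lemma leaf_flow_local:
  assumes L: "leaf rs I u" and B: "flow_box rs \<rho> \<beta>" and x1: "x1 \<in> I" "u x1 = \<beta> w1" "w1 \<in> ball 0 \<rho>"
  obtains s e :: real where "s \<in> {1, -1}" "0 < e"
    "\<And>\<tau>. \<bar>\<tau>\<bar> < e \<Longrightarrow> x1 + s * \<tau> \<in> I \<and> w1 + of_real \<tau> \<in> ball 0 \<rho> \<and> u (x1 + s * \<tau>) = \<beta> (w1 + of_real \<tau>)"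
proof -
  note l = leafD[OF L] and fb = flow_boxD[OF B]
  obtain \<Phi> where \<Phi>: "\<And>w. w \<in> ball 0 \<rho> \<Longrightarrow> \<Phi> (\<beta> w) = w" "\<And>z. z \<in> \<beta> ` ball 0 \<rho> \<Longrightarrow> \<beta> (\<Phi> z) = z"
    "\<And>z. z \<in> \<beta> ` ball 0 \<rho> \<Longrightarrow> (\<Phi> has_field_derivative deriv \<Phi> z) (at z)"
    "\<And>z. z \<in> \<beta> ` ball 0 \<rho> \<Longrightarrow> (deriv \<Phi> z)\<^sup>2 = - root_poly rs z"
    using flow_box_coordinate[OF B] by metis
  have "continuous_on I u" using l(7) continuous_at_imp_continuous_on by blast
  then have "open (I \<inter> u -` (\<beta> ` ball 0 \<rho>))" by (rule continuous_open_preimage[OF _ l(1) fb(7)])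
  moreover have "x1 \<in> I \<inter> u -` (\<beta> ` ball 0 \<rho>)" using x1 by auto
  ultimately obtain d where d: "d > 0" "ball x1 d \<subseteq> I \<inter> u -` (\<beta> ` ball 0 \<rho>)" using openE by blast
  have dd: "x \<in> I" "u x \<in> \<beta> ` ball 0 \<rho>" if "x1 - d < x" "x < x1 + d" for x
    using d(2) that by (auto simp: subset_eq dist_real_def abs_if)
  have sp: "\<exists>v. ((\<Phi> \<circ> u) has_vector_derivative v) (at x) \<and> v\<^sup>2 = 1" if x: "x1 - d < x" "x < x1 + d" for x
  proof -
    obtain v where v: "(u has_vector_derivative v) (at x)" "- root_poly rs (u x) * v\<^sup>2 = 1"
      using l(4) dd(1)[OF x] by blast
    have "((\<Phi> \<circ> u) has_vector_derivative v * deriv \<Phi> (u x)) (at x)"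
      by (rule field_vector_diff_chain_at[OF v(1) \<Phi>(3)[OF dd(2)[OF x]]])
    moreover have "(v * deriv \<Phi> (u x))\<^sup>2 = 1"
      using v(2) \<Phi>(4)[OF dd(2)[OF x]] by (simp add: power_mult_distrib mult.commute)
    ultimately show ?thesis by blast
  qed
  have lt: "x1 - d < x1 + d" using d(1) by simp
  obtain s :: real where s: "s \<in> {1, -1}" 
    "\<And>x y. x1 - d < x \<Longrightarrow> x < x1 + d \<Longrightarrow> x1 - d < y \<Longrightarrow> y < x1 + d \<Longrightarrow> (\<Phi> \<circ> u) x - (\<Phi> \<circ> u) y = of_real (s * (x - y))"
    by (rule unit_speed_affine[OF lt sp]) blast+
  have fin: "x1 + s * \<tau> \<in> I \<and> w1 + of_real \<tau> \<in> ball 0 \<rho> \<and> u (x1 + s * \<tau>) = \<beta> (w1 + of_real \<tau>)" if "\<bar>\<tau>\<bar> < d" for \<tau>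
  proof -
    let ?x = "x1 + s * \<tau>"
    have x: "x1 - d < ?x" "?x < x1 + d" using s(1) that by auto
    have "(\<Phi> \<circ> u) ?x - (\<Phi> \<circ> u) x1 = of_real (s * (?x - x1))" using s(2)[OF x, of x1] d(1) by auto
    moreover have "s * (?x - x1) = \<tau>" using s(1) by auto
    ultimately have "(\<Phi> \<circ> u) ?x - (\<Phi> \<circ> u) x1 = of_real \<tau>" by (simp only:)
    then have e: "\<Phi> (u ?x) = w1 + of_real \<tau>" using \<Phi>(1)[OF x1(3)] x1(2) by (simp add: diff_eq_eq)
    obtain w where w: "w \<in> ball 0 \<rho>" "u ?x = \<beta> w" using dd(2)[OF x] by (rule imageE)
    then have "w = w1 + of_real \<tau>" using e \<Phi>(1) by simp
    then show ?thesis using w dd(1)[OF x] by blast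
  qed
  show ?thesis by (rule that[OF s(1) d(1) fin])
qed

text \<open>Properness keeps the leaf from ending inside the box, so it runs along the whole chord.\<close>

lemma leaf_flow:
  assumes L: "leaf rs I u" and B: "flow_box rs \<rho> \<beta>" and x1: "x1 \<in> I" "u x1 = \<beta> w1" "w1 \<in> ball 0 \<rho>"
  obtains s :: real where "s \<in> {1, -1}"
    "\<And>\<tau>. w1 + of_real \<tau> \<in> ball 0 \<rho> \<Longrightarrow> x1 + s * \<tau> \<in> I \<and> u (x1 + s * \<tau>) = \<beta> (w1 + of_real \<tau>)"
proof -
  note l = leafD[OF L] and fb = flow_boxD[OF B]
  obtain s e0 :: real where s: "s \<in> {1, -1}" and e0: "0 < e0"
    "\<And>\<tau>. \<bar>\<tau>\<bar> < e0 \<Longrightarrow> x1 + s * \<tau> \<in> I \<and> w1 + of_real \<tau> \<in> ball 0 \<rho> \<and> u (x1 + s * \<tau>) = \<beta> (w1 + of_real \<tau>)"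
    by (rule leaf_flow_local[OF L B x1]) (rule that; assumption)
  define T where "T = {\<tau>::real. w1 + of_real \<tau> \<in> ball 0 \<rho>}"
  define Q where "Q \<tau> \<longleftrightarrow> x1 + s * \<tau> \<in> I \<and> u (x1 + s * \<tau>) = \<beta> (w1 + of_real \<tau>)" for \<tau>
  \<comment> \<open>Requiring \<open>Q\<close> on a whole neighbourhood makes \<open>S\<close> open
    at once; closedness in the chord \<open>T\<close> is where properness enters.\<close>
  define S where "S = {\<tau>. \<exists>e>0. \<forall>\<tau>'. \<bar>\<tau>' - \<tau>\<bar> < e \<longrightarrow> \<tau>' \<in> T \<and> Q \<tau>'}"
  have SQ: "\<tau> \<in> T" "Q \<tau>" if "\<tau> \<in> S" for \<tau>
    using that unfolding S_def by force+
  have S0: "0 \<in> S" unfolding S_def T_def Q_def using e0 by auto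
  have "open S"
    unfolding open_dist
  proof
    fix \<tau> assume "\<tau> \<in> S"
    then obtain e where e: "e > 0" "\<And>\<tau>'. \<bar>\<tau>' - \<tau>\<bar> < e \<Longrightarrow> \<tau>' \<in> T \<and> Q \<tau>'" unfolding S_def by blast
    have "y \<in> S" if y: "dist y \<tau> < e / 2" for y
    proof -
      have "\<bar>\<tau>' - \<tau>\<bar> < e" if "\<bar>\<tau>' - y\<bar> < e / 2" for \<tau>'
        using that y unfolding dist_real_def by linarith
      then show ?thesis unfolding S_def mem_Collect_eq
        by (intro exI[of _ "e/2"]) (use e in auto)
    qed
    then show "\<exists>e>0. \<forall>y. dist y \<tau> < e \<longrightarrow> y \<in> S" using e(1) by (intro exI[of _ "e/2"]) auto
  qed
  have "convex T"
  proof (rule convexI)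
    fix x y p q :: real assume *: "x \<in> T" "y \<in> T" "0 \<le> p" "0 \<le> q" "p + q = 1"
    have "w1 + of_real (p *\<^sub>R x + q *\<^sub>R y) = of_real (p + q) * w1 + of_real p * of_real x + of_real q * of_real y"
      unfolding *(5) by simp
    also have "\<dots> = p *\<^sub>R (w1 + of_real x) + q *\<^sub>R (w1 + of_real y)"
      by (simp add: scaleR_conv_of_real algebra_simps)
    also have "\<dots> \<in> ball 0 \<rho>" using * by (intro convexD[OF convex_ball]) (auto simp: T_def)
    finally show "p *\<^sub>R x + q *\<^sub>R y \<in> T" by (simp add: T_def)
  qed
  then have conT: "connected T" by (rule convex_connected)
  have "closedin (top_of_set T) S"
    unfolding closedin_limpt
  proof (intro conjI allI impI)
    show "S \<subseteq> T" using SQ by blast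
    fix \<tau> assume "\<tau> islimpt S \<and> \<tau> \<in> T"
    then obtain f where f: "\<And>n. f n \<in> S - {\<tau>}" "f \<longlonglongrightarrow> \<tau>" and tT: "\<tau> \<in> T"
      unfolding islimpt_sequential by blast
    let ?w = "w1 + complex_of_real \<tau>" and ?x = "x1 + s * \<tau>"
    have wB: "?w \<in> ball 0 \<rho>" using tT by (simp add: T_def)
    then obtain r where r: "r > 0" "cball ?w r \<subseteq> ball 0 \<rho>" using open_contains_cball open_ball by metis
    have fw: "(\<lambda>n. w1 + complex_of_real (f n)) \<longlonglongrightarrow> ?w" using f(2) by (intro tendsto_intros)
    have fx: "(\<lambda>n. x1 + s * f n) \<longlonglongrightarrow> ?x" using f(2) by (intro tendsto_intros)
    \<comment> \<open>\<open>K\<close> is a compact set of regular points, so the parameters with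
      values in \<open>K\<close> form a compact set; as a limit of such parameters \<open>?x\<close>
      still belongs to \<open>I\<close>.\<close>
    define K where "K = \<beta> ` cball ?w r"
    have cont\<beta>: "continuous_on (ball 0 \<rho>) \<beta>" using fb(2) holomorphic_on_imp_continuous_on by blast
    have "compact K" unfolding K_def
      by (rule compact_continuous_image[OF continuous_on_subset[OF cont\<beta> r(2)]]) simp
    then have cC: "compact {x\<in>I. u x \<in> K}"
      using l(5) r(2) fb(5) unfolding K_def by blast
    have "\<forall>\<^sub>F n in sequentially. w1 + complex_of_real (f n) \<in> ball ?w r"
      using fw r(1) by (simp add: tendsto_iff dist_commute)
    then have "\<forall>\<^sub>F n in sequentially. x1 + s * f n \<in> {x\<in>I. u x \<in> K}"
    proof eventually_elim
      case (elim n)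
      have "Q (f n)" using f(1)[of n] SQ(2) by simp
      moreover have "\<beta> (w1 + complex_of_real (f n)) \<in> K"
        unfolding K_def using elim by (intro imageI) auto
      ultimately show ?case unfolding Q_def by simp
    qed
    then have "?x \<in> {x\<in>I. u x \<in> K}"
      by (rule Lim_in_closed_set[OF compact_imp_closed[OF cC] _ sequentially_bot fx])
    then have xI: "?x \<in> I" by blast
    have "(\<lambda>n. u (x1 + s * f n)) \<longlonglongrightarrow> u ?x" using l(7)[OF xI] fx isCont_tendsto_compose by blast
    moreover have "isCont \<beta> ?w" using fb(6)[OF wB] DERIV_isCont by blast
    then have "(\<lambda>n. \<beta> (w1 + complex_of_real (f n))) \<longlonglongrightarrow> \<beta> ?w" using fw isCont_tendsto_compose by blast
    moreover have "u (x1 + s * f n) = \<beta> (w1 + complex_of_real (f n))" for n using f(1) SQ(2) Q_def by blast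
    ultimately have ux: "u ?x = \<beta> ?w" using LIMSEQ_unique by simp
    obtain s' e :: real where s': "s' \<in> {1,-1}" "0 < e" and
      e: "\<And>\<sigma>. \<bar>\<sigma>\<bar> < e \<Longrightarrow> ?x + s' * \<sigma> \<in> I \<and> ?w + of_real \<sigma> \<in> ball 0 \<rho> \<and> u (?x + s' * \<sigma>) = \<beta> (?w + of_real \<sigma>)"
      by (rule leaf_flow_local[OF L B xI ux wB]) (rule that; assumption)
    obtain n where n: "\<bar>f n - \<tau>\<bar> < e"
      using f(2) s'(2) unfolding LIMSEQ_def dist_real_def by blast
    have Qn: "Q (f n)" using f(1)[of n] SQ(2) by simp
    have "?w + of_real (f n - \<tau>) = w1 + of_real (f n)" by simp
    then have ueq: "u (?x + s' * (f n - \<tau>)) = u (x1 + s * f n)"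
      using e[OF n] Qn unfolding Q_def by metis
    \<comment> \<open>The leaf runs through \<open>?x\<close> in some direction \<open>s'\<close>;
      injectivity of \<open>u\<close>, tested at one \<open>f n \<noteq> \<tau>\<close>, shows that
      it is the old direction \<open>s\<close>.\<close>
    have "?x + s' * (f n - \<tau>) = x1 + s * f n"
      by (rule inj_onD[OF l(3) ueq]) (use e[OF n] Qn in \<open>auto simp: Q_def\<close>)
    then have "(s' - s) * (f n - \<tau>) = 0" by (simp add: algebra_simps)
    then have "s' = s" using f(1)[of n] by auto
    show "\<tau> \<in> S"
      unfolding S_def mem_Collect_eq
    proof (intro exI[of _ e] conjI allI impI)
      fix \<tau>' assume "\<bar>\<tau>' - \<tau>\<bar> < e"
      from e[OF this] have *: "?x + s' * (\<tau>' - \<tau>) \<in> I" "?w + of_real (\<tau>' - \<tau>) \<in> ball 0 \<rho>"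
        "u (?x + s' * (\<tau>' - \<tau>)) = \<beta> (?w + of_real (\<tau>' - \<tau>))" by auto
      have **: "?x + s' * (\<tau>' - \<tau>) = x1 + s * \<tau>'" "?w + of_real (\<tau>' - \<tau>) = w1 + of_real \<tau>'"
        unfolding \<open>s' = s\<close> by (simp_all add: algebra_simps)
      from * show "\<tau>' \<in> T" "Q \<tau>'" unfolding ** T_def Q_def by auto
    qed (rule s')
  qed
  moreover have "openin (top_of_set T) S" using \<open>open S\<close> SQ(1) by (auto simp: openin_open intro!: exI[of _ S])
  ultimately have "S = {} \<or> S = T" using connected_clopen[THEN iffD1, OF conT] by simp
  with S0 have ST: "S = T" by auto
  show ?thesis
  proof (rule that[OF s])
    fix \<tau> assume "w1 + complex_of_real \<tau> \<in> ball 0 \<rho>"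
    then have "\<tau> \<in> S" unfolding ST T_def by simp
    from SQ(2)[OF this] show "x1 + s * \<tau> \<in> I \<and> u (x1 + s * \<tau>) = \<beta> (w1 + of_real \<tau>)" unfolding Q_def .
  qed
qed

section \<open>A leaf crosses a short transversal at most once\<close>

text \<open>Identity theorem: the real points of \<open>S\<close> accumulate at
  \<open>x\<close>.\<close>

lemma agree_on_reals:
  assumes "open S" "convex S" "f holomorphic_on S" "g holomorphic_on S" "of_real x \<in> S"
    and eq: "\<And>t::real. of_real t \<in> S \<Longrightarrow> f (of_real t) = g (of_real t)" and "w \<in> S"
  shows "f w = g w"
proof -
  obtain r where r: "r > 0" "ball (complex_of_real x) r \<subseteq> S" using assms openE by blast
  have "complex_of_real x islimpt {z\<in>S. \<exists>t::real. z = of_real t}"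
    unfolding islimpt_approachable
  proof (intro allI impI)
    fix e :: real assume "e > 0"
    define h where "h = min e r / 2"
    have h: "0 < h" "h < e" "h < r" using \<open>e > 0\<close> r(1) by (auto simp: h_def min_def)
    have "complex_of_real (x + h) \<in> S" using r(2) h by (auto simp: subset_eq dist_norm norm_of_real)
    then show "\<exists>x'\<in>{z \<in> S. \<exists>t::real. z = of_real t}. x' \<noteq> of_real x \<and> dist x' (of_real x) < e"
      using h by (intro bexI[of _ "of_real (x + h)"] CollectI conjI exI[of _ "x + h"]) (auto simp: dist_norm norm_of_real)
  qed
  then have "(\<lambda>w. f w - g w) w = 0"
  proof (rule analytic_continuation[where f = "\<lambda>w. f w - g w" and S = S, rotated 5])
    show "(\<lambda>w. f w - g w) holomorphic_on S" using assms by (intro holomorphic_intros)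
  qed (use assms convex_connected in auto)
  then show ?thesis by simp
qed

text \<open>A leaf is real analytic: in a flow box around \<open>u x\<close> it is
  \<open>\<beta>\<close> along the real axis, which extends to complex times. Compactness of
  \<open>{X..X'}\<close> gives one radius for all boxes, and overlapping extensions agree because
  they agree at real times. The extension supplies curves parallel to the leaf.\<close>

lemma leaf_strip:
  assumes L: "leaf rs I u" and XX: "X \<le> X'" "{X..X'} \<subseteq> I"
  defines "N \<equiv> \<lambda>\<epsilon>. {w. \<exists>x\<in>{X..X'}. norm (w - of_real x) < \<epsilon>}"
  obtains \<epsilon> E where "0 < \<epsilon>" "E holomorphic_on N \<epsilon>" "open (N \<epsilon>)"
    "\<And>t::real. of_real t \<in> N \<epsilon> \<Longrightarrow> t \<in> I \<and> E (of_real t) = u t"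
    "\<And>w. w \<in> N \<epsilon> \<Longrightarrow> - root_poly rs (E w) * (deriv E w)\<^sup>2 = 1"
proof -
  note l = leafD[OF L]
  have contu: "continuous_on I u" using l(7) continuous_at_imp_continuous_on by blast
  have "compact (u ` {X..X'})" 
    by (rule compact_continuous_image[OF continuous_on_subset[OF contu XX(2)]]) simp
  moreover have "u ` {X..X'} \<inter> set rs = {}" using l(6) XX(2) by (auto simp: root_poly_eq_0_iff)
  ultimately obtain d where d: "d > 0" "\<And>z r. z \<in> u ` {X..X'} \<Longrightarrow> r \<in> set rs \<Longrightarrow> d \<le> dist z r"
    using separate_compact_closed[of "u ` {X..X'}" "set rs"] by (metis finite_imp_closed finite_set)
  \<comment> \<open>A lower bound for all box radii along the piece, where
    \<open>|P| \<ge> d ^ length rs\<close>.\<close>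
  define \<epsilon> where "\<epsilon> = box_const (length rs) * d * sqrt (d ^ length rs) / 12"
  have \<epsilon>: "0 < \<epsilon>" using d(1) box_const_pos[of "length rs"] by (simp add: \<epsilon>_def)
  have "\<exists>e. e holomorphic_on ball (of_real x) \<epsilon>
      \<and> (\<forall>w\<in>ball (of_real x) \<epsilon>. - root_poly rs (e w) * (deriv e w)\<^sup>2 = 1)
      \<and> (\<forall>t. complex_of_real t \<in> ball (of_real x) \<epsilon> \<longrightarrow> t \<in> I \<and> e (of_real t) = u t)"
    if x: "x \<in> {X..X'}" for x
  proof -
    have dx: "d \<le> norm (u x - r)" if "r \<in> set rs" for r using d(2)[of "u x" r] x that by (simp add: dist_norm)
    obtain \<beta> where b0: "flow_box rs (box_const (length rs) * d * sqrt (norm (root_poly rs (u x))) / 12) \<beta>" "\<beta> 0 = u x"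
      using flow_box_exists[OF d(1), of rs "u x"] dx by metis
    have "d ^ length rs \<le> norm (root_poly rs (u x))" using norm_root_poly_ge[of d rs "u x"] d(1) dx by auto
    then have "\<epsilon> \<le> box_const (length rs) * d * sqrt (norm (root_poly rs (u x))) / 12"
      unfolding \<epsilon>_def using d(1) box_const_pos[of "length rs"]
      by (intro divide_right_mono mult_left_mono real_sqrt_le_mono) auto
    then have fb: "flow_box rs \<epsilon> \<beta>" using flow_box_mono[OF b0(1) \<epsilon>] by blast
    note fbD = flow_boxD[OF fb]
    have xI: "x \<in> I" using x XX by blast
    obtain s :: real where s: "s \<in> {1, -1}"
      "\<And>\<tau>. 0 + of_real \<tau> \<in> ball (0::complex) \<epsilon> \<Longrightarrow> x + s * \<tau> \<in> I \<and> u (x + s * \<tau>) = \<beta> (0 + of_real \<tau>)"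
      by (rule leaf_flow[OF L fb xI, of 0]) (use b0(2) \<epsilon> that in auto)
    have ss: "s * s = 1" "norm s = 1" using s(1) by auto
    define e where "e = (\<lambda>w. \<beta> (of_real s * (w - of_real x)))"
    have B: "of_real s * (w - of_real x) \<in> ball 0 \<epsilon>" if "w \<in> ball (of_real x) \<epsilon>" for w :: complex
      using that ss(2) by (simp add: norm_mult dist_norm norm_minus_commute)
    have der: "(e has_field_derivative deriv \<beta> (of_real s * (w - of_real x)) * of_real s) (at w)"
      if w: "w \<in> ball (of_real x) \<epsilon>" for w
      unfolding e_def
      by (rule DERIV_chain2[where f = \<beta> and g = "\<lambda>w. of_real s * (w - of_real x)" and x = w, OF fbD(6)[OF B[OF w]]])
         (auto intro!: derivative_eq_intros)
    show ?thesis
    proof (intro exI[of _ e] conjI ballI allI impI)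
      show "e holomorphic_on ball (of_real x) \<epsilon>"
        unfolding holomorphic_on_open[OF open_ball] using der by blast
      fix w :: complex assume w: "w \<in> ball (of_real x) \<epsilon>"
      have "(complex_of_real s)\<^sup>2 = 1" using ss(1) by (metis of_real_1 of_real_mult power2_eq_square)
      then show "- root_poly rs (e w) * (deriv e w)\<^sup>2 = 1"
        unfolding DERIV_imp_deriv[OF der[OF w]] using fbD(4)[OF B[OF w]] by (simp add: e_def power_mult_distrib)
    next
      fix t :: real assume "complex_of_real t \<in> ball (of_real x) \<epsilon>"
      then have "\<bar>s * (t - x)\<bar> < \<epsilon>" using ss(2) 
        by (simp add: abs_mult dist_norm norm_minus_commute flip: of_real_diff)
      then have "x + s * (s * (t - x)) \<in> I \<and> u (x + s * (s * (t - x))) = \<beta> (0 + of_real (s * (t - x)))"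
        by (intro s(2)) (simp del: of_real_mult of_real_diff)
      moreover have "x + s * (s * (t - x)) = t" using ss(1) by (simp flip: mult.assoc)
      ultimately show "t \<in> I" "e (of_real t) = u t" by (simp_all add: e_def)
    qed
  qed
  then obtain e where e: "\<And>x. x \<in> {X..X'} \<Longrightarrow> e x holomorphic_on ball (of_real x) \<epsilon>"
      "\<And>x w. x \<in> {X..X'} \<Longrightarrow> w \<in> ball (of_real x) \<epsilon> \<Longrightarrow> - root_poly rs (e x w) * (deriv (e x) w)\<^sup>2 = 1"
      "\<And>x t. x \<in> {X..X'} \<Longrightarrow> complex_of_real t \<in> ball (of_real x) \<epsilon> \<Longrightarrow> t \<in> I \<and> e x (of_real t) = u t"
    by metis
  have agree: "e x w = e x' w" if *: "x \<in> {X..X'}" "x' \<in> {X..X'}" and w: "w \<in> ball (of_real x) \<epsilon>" "w \<in> ball (of_real x') \<epsilon>" for x x' w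
  proof (rule agree_on_reals[where f = "e x" and g = "e x'" and w = w and x = "(x + x') / 2" and S = "ball (of_real x) \<epsilon> \<inter> ball (of_real x') \<epsilon>"])
    \<comment> \<open>The midpoint of the two centres is a real point of both discs, and the
      intersection of the discs is convex, as the identity theorem requires.\<close>
    have "dist (complex_of_real x) (of_real x') < 2 * \<epsilon>"
      using w dist_triangle_less_add[of "of_real x" w \<epsilon> "of_real x'" \<epsilon>] by (simp add: dist_commute)
    then have "\<bar>x - x'\<bar> < 2 * \<epsilon>" by (simp add: dist_norm flip: of_real_diff)
    then have lt: "\<bar>x' - x\<bar> / 2 < \<epsilon>" "\<bar>x - x'\<bar> / 2 < \<epsilon>" by (simp_all add: abs_minus_commute)
    have eq: "x - (x + x') / 2 = (x - x') / 2" "x' - (x + x') / 2 = (x' - x) / 2"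
      by (simp_all add: field_simps)
    have "\<bar>x - (x + x') / 2\<bar> < \<epsilon>" "\<bar>x' - (x + x') / 2\<bar> < \<epsilon>" 
      unfolding eq using lt by (simp_all only: abs_divide abs_numeral)
    then show "complex_of_real ((x + x') / 2) \<in> ball (of_real x) \<epsilon> \<inter> ball (of_real x') \<epsilon>"
      by (simp add: dist_norm del: of_real_divide of_real_add flip: of_real_diff)
    show "e x holomorphic_on ball (of_real x) \<epsilon> \<inter> ball (of_real x') \<epsilon>"
      using e(1)[OF *(1)] by (rule holomorphic_on_subset) auto
    show "e x' holomorphic_on ball (of_real x) \<epsilon> \<inter> ball (of_real x') \<epsilon>"
      using e(1)[OF *(2)] by (rule holomorphic_on_subset) auto
    show "e x (of_real t) = e x' (of_real t)" if "complex_of_real t \<in> ball (of_real x) \<epsilon> \<inter> ball (of_real x') \<epsilon>" for t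
      using e(3)[OF *(1), of t] e(3)[OF *(2), of t] that by simp
  qed (use w in \<open>auto intro: convex_Int\<close>)
  have NU: "N \<epsilon> = (\<Union>x\<in>{X..X'}. ball (of_real x) \<epsilon>)"
    by (auto simp: N_def dist_norm norm_minus_commute)
  \<comment> \<open>\<open>c w\<close> is the point of \<open>{X..X'}\<close> nearest to
    \<open>w\<close>, so the disc around it contains \<open>w\<close> whenever one of the discs
    does.\<close>
  define c where "c w = max X (min X' (Re w))" for w
  have c: "c w \<in> {X..X'}" for w using XX(1) by (auto simp: c_def)
  have cB: "w \<in> ball (of_real (c w)) \<epsilon>" if "w \<in> N \<epsilon>" for w
  proof -
    obtain x where x: "x \<in> {X..X'}" "norm (w - of_real x) < \<epsilon>" using \<open>w \<in> N \<epsilon>\<close> by (auto simp: N_def)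
    have "\<bar>Re w - c w\<bar> \<le> \<bar>Re w - x\<bar>" using x(1) by (auto simp: c_def max_def min_def)
    then have "norm (w - of_real (c w)) \<le> norm (w - of_real x)"
      by (auto simp: cmod_def intro!: real_sqrt_le_mono abs_le_square_iff[THEN iffD1])
    with x(2) show ?thesis by (simp add: dist_norm norm_minus_commute)
  qed
  define E where "E w = e (c w) w" for w
  have Ee: "E w = e x w" if "x \<in> {X..X'}" "w \<in> ball (of_real x) \<epsilon>" for x w
  proof -
    have "w \<in> N \<epsilon>" using that NU by blast
    then show ?thesis unfolding E_def using agree[OF c that(1) cB that(2)] by blast
  qed
  have der: "(E has_field_derivative deriv (e (c w)) w) (at w)" if "w \<in> N \<epsilon>" for w
  proof (rule has_field_derivative_transform_within_open[OF _ open_ball cB[OF that]])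
    show "(e (c w) has_field_derivative deriv (e (c w)) w) (at w)"
      using e(1)[OF c] cB[OF that] holomorphic_derivI open_ball by blast
  qed (use Ee[OF c] in simp)
  have oN: "open (N \<epsilon>)" unfolding NU by blast
  show ?thesis
  proof (rule that[of \<epsilon> E, OF \<epsilon> _ oN])
    show "E holomorphic_on N \<epsilon>" unfolding holomorphic_on_open[OF oN] using der by blast
    show "t \<in> I \<and> E (of_real t) = u t" if "of_real t \<in> N \<epsilon>" for t :: real
      using e(3)[OF c cB[OF that]] by (simp add: E_def)
    show "- root_poly rs (E w) * (deriv E w)\<^sup>2 = 1" if "w \<in> N \<epsilon>" for w
      using e(2)[OF c cB[OF that]] DERIV_imp_deriv[OF der[OF that]] by (simp add: E_def)
  qed
qed

text \<open>The image of \<open>cball 0 c\<close> under \<open>h'\<close> is compact, hence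
  contained in a smaller concentric disc, and it contains every \<open>\<zeta>\<close> with
  \<open>|h \<zeta>| \<le> c\<close>.\<close>

lemma disc_automorphism_boundary:
  fixes h h' :: "complex \<Rightarrow> complex"
  assumes "continuous_on (ball 0 1) h'" "h' ` ball 0 1 \<subseteq> ball 0 1"
    "\<And>\<zeta>. \<zeta> \<in> ball 0 1 \<Longrightarrow> h' (h \<zeta>) = \<zeta>" "c < 1"
  obtains c' where "0 \<le> c'" "c' < 1" "\<And>\<zeta>. \<zeta> \<in> ball 0 1 \<Longrightarrow> c' < norm \<zeta> \<Longrightarrow> c < norm (h \<zeta>)"
proof (cases "c < 0")
  case True
  then show ?thesis using that[of 0] norm_ge_zero by (smt (verit, best))
next
  case False
  have sub: "cball 0 c \<subseteq> ball (0::complex) 1" using assms(4) by auto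
  have "compact (h' ` cball 0 c)"
    by (rule compact_continuous_image[OF continuous_on_subset[OF assms(1) sub]]) simp
  moreover have "h' ` cball 0 c \<noteq> {}" using False by simp
  ultimately obtain z where z: "z \<in> h' ` cball 0 c" "\<And>w. w \<in> h' ` cball 0 c \<Longrightarrow> norm w \<le> norm z"
    using continuous_attains_sup[of "h' ` cball 0 c" norm] continuous_on_norm_id by blast
  have "norm z < 1" using z(1) sub assms(2) by (force simp: subset_eq)
  moreover have "c < norm (h \<zeta>)" if \<zeta>: "\<zeta> \<in> ball 0 1" "norm z < norm \<zeta>" for \<zeta>
  proof (rule ccontr)
    assume "\<not> c < norm (h \<zeta>)"
    then have "h \<zeta> \<in> cball 0 c" by simp
    then have "\<zeta> \<in> h' ` cball 0 c" using assms(3)[OF \<zeta>(1)] by force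
    from z(2)[OF this] \<zeta>(2) show False by simp
  qed
  ultimately show ?thesis using that[of "norm z"] by simp
qed

text \<open>The zeros of \<open>P o \<psi>\<close> are split off one at a time. A root
  \<open>\<psi> a\<close> contributes the Moebius factor vanishing at \<open>a\<close>, whose
  modulus tends to 1 at the unit circle; the cofactor has no zero because \<open>\<psi>\<close> is
  injective. Roots outside the image go into \<open>g\<close> unchanged. So \<open>b\<close> is a
  finite Blaschke product, and the zero-free \<open>g\<close> will have a square root.\<close>

lemma root_poly_blaschke:
  assumes \<psi>: "\<psi> holomorphic_on ball 0 1" "inj_on \<psi> (ball 0 1)"
  shows "\<exists>g b. g holomorphic_on ball 0 1 \<and> b holomorphic_on ball 0 1
    \<and> (\<forall>\<zeta>\<in>ball 0 1. g \<zeta> \<noteq> 0 \<and> norm (b \<zeta>) \<le> 1 \<and> root_poly rs (\<psi> \<zeta>) = g \<zeta> * b \<zeta>)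
    \<and> (\<forall>c<1. \<exists>c'<1. \<forall>\<zeta>\<in>ball 0 1. c' < norm \<zeta> \<longrightarrow> c < norm (b \<zeta>))"
proof (induction rs)
  case Nil
  show ?case by (intro exI[of _ "\<lambda>_. 1"]) (auto intro!: exI[of _ 0])
next
  case (Cons r rs)
  then obtain g b where g: "g holomorphic_on ball 0 1" and b: "b holomorphic_on ball 0 1"
    and gb: "\<And>\<zeta>. \<zeta> \<in> ball 0 1 \<Longrightarrow> g \<zeta> \<noteq> 0 \<and> norm (b \<zeta>) \<le> 1 \<and> root_poly rs (\<psi> \<zeta>) = g \<zeta> * b \<zeta>"
    and lim: "\<And>c. c < 1 \<Longrightarrow> \<exists>c'<1. \<forall>\<zeta>\<in>ball 0 1. c' < norm \<zeta> \<longrightarrow> c < norm (b \<zeta>)" by blast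
  show ?case
  proof (cases "r \<in> \<psi> ` ball 0 1")
    case False
    show ?thesis
    proof (rule exI[of _ "\<lambda>\<zeta>. (\<psi> \<zeta> - r) * g \<zeta>"], rule exI[of _ b], intro conjI ballI)
      show "(\<lambda>\<zeta>. (\<psi> \<zeta> - r) * g \<zeta>) holomorphic_on ball 0 1" using \<psi>(1) g by (intro holomorphic_intros)
      fix \<zeta> :: complex assume z: "\<zeta> \<in> ball 0 1"
      then have "\<psi> \<zeta> \<noteq> r" using False by blast
      then show "(\<psi> \<zeta> - r) * g \<zeta> \<noteq> 0" "norm (b \<zeta>) \<le> 1" "root_poly (r # rs) (\<psi> \<zeta>) = (\<psi> \<zeta> - r) * g \<zeta> * b \<zeta>"
        using gb[OF z] by auto
    qed (use b lim in auto)
  next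
    case True
    then obtain a where a: "a \<in> ball 0 1" "r = \<psi> a" by blast
    \<comment> \<open>The difference quotient of \<open>\<psi>\<close> at \<open>a\<close>; the
      value \<open>deriv \<psi> a\<close> removes the singularity and is nonzero by
      injectivity.\<close>
    define q where "q = (\<lambda>\<zeta>. if \<zeta> = a then deriv \<psi> a else (\<psi> \<zeta> - \<psi> a) / (\<zeta> - a))"
    define M where "M = Moebius_function 0 a"
    have q: "q holomorphic_on ball 0 1" unfolding q_def by (rule pole_lemma[OF \<psi>(1)]) (use a in \<open>simp add: interior_open\<close>)
    have nz: "1 - cnj a * \<zeta> \<noteq> 0" if "\<zeta> \<in> ball 0 1" for \<zeta>
    proof
      assume "1 - cnj a * \<zeta> = 0"
      then have "norm a * norm \<zeta> = 1" by (metis complex_mod_cnj eq_iff_diff_eq_0 norm_mult norm_one)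
      moreover have "norm a * norm \<zeta> < 1 * 1" using a that by (intro mult_strict_mono') auto
      ultimately show False by simp
    qed
    have qM: "\<psi> \<zeta> - r = q \<zeta> * (1 - cnj a * \<zeta>) * M \<zeta>" if "\<zeta> \<in> ball 0 1" for \<zeta>
      using nz[OF that] a(2) by (simp add: q_def M_def Moebius_function_simple)
    have qnz: "q \<zeta> \<noteq> 0" if z: "\<zeta> \<in> ball 0 1" for \<zeta>
    proof (cases "\<zeta> = a")
      case True
      then show ?thesis using holomorphic_injective_imp_regular[OF \<psi>(1) open_ball \<psi>(2) a(1)] by (simp add: q_def)
    next
      case False
      then have "\<psi> \<zeta> \<noteq> \<psi> a" using inj_onD[OF \<psi>(2) _ z a(1)] by blast
      then show ?thesis using False by (simp add: q_def)
    qed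
    have M: "M holomorphic_on ball 0 1" unfolding M_def using Moebius_function_holomorphic a by simp
    have M1: "norm (M \<zeta>) < 1" if "\<zeta> \<in> ball 0 1" for \<zeta>
      unfolding M_def using Moebius_function_norm_lt_1 a that by simp
    define M' where "M' = Moebius_function 0 (- a)"
    have M'1: "M' ` ball 0 1 \<subseteq> ball 0 1" unfolding M'_def using Moebius_function_norm_lt_1[of "-a"] a by auto
    have M'M: "M' (M \<zeta>) = \<zeta>" if "\<zeta> \<in> ball 0 1" for \<zeta>
      unfolding M'_def M_def using Moebius_function_compose[of "-a" a \<zeta>] a that by simp
    have M': "continuous_on (ball 0 1) M'" unfolding M'_def 
      by (intro holomorphic_on_imp_continuous_on Moebius_function_holomorphic) (use a in simp)
    show ?thesis
    proof (rule exI[of _ "\<lambda>\<zeta>. q \<zeta> * (1 - cnj a * \<zeta>) * g \<zeta>"], rule exI[of _ "\<lambda>\<zeta>. M \<zeta> * b \<zeta>"], intro conjI ballI allI impI)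
      show "(\<lambda>\<zeta>. q \<zeta> * (1 - cnj a * \<zeta>) * g \<zeta>) holomorphic_on ball 0 1" using q g by (intro holomorphic_intros)
      show "(\<lambda>\<zeta>. M \<zeta> * b \<zeta>) holomorphic_on ball 0 1" using M b by (intro holomorphic_intros)
      fix \<zeta> :: complex assume z: "\<zeta> \<in> ball 0 1"
      show "q \<zeta> * (1 - cnj a * \<zeta>) * g \<zeta> \<noteq> 0" using nz[OF z] qnz[OF z] gb[OF z] by simp
      show "norm (M \<zeta> * b \<zeta>) \<le> 1" using M1[OF z] gb[OF z] by (simp add: norm_mult mult_le_one)
      show "root_poly (r # rs) (\<psi> \<zeta>) = q \<zeta> * (1 - cnj a * \<zeta>) * g \<zeta> * (M \<zeta> * b \<zeta>)"
        using qM[OF z] gb[OF z] by simp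
    next
      fix c :: real assume "c < 1"
      \<comment> \<open>With both factors above \<open>c1\<close> in modulus the product exceeds
        \<open>c1 * c1 \<ge> c\<close>; the maximum with 0 admits negative \<open>c\<close>.\<close>
      define c1 where "c1 = sqrt (max c 0)"
      have c1: "0 \<le> c1" "c1 < 1" "c \<le> c1 * c1" using \<open>c < 1\<close> by (auto simp: c1_def)
      obtain d where d: "d < 1" "\<And>\<zeta>. \<zeta> \<in> ball 0 1 \<Longrightarrow> d < norm \<zeta> \<Longrightarrow> c1 < norm (b \<zeta>)" using lim[OF c1(2)] by blast
      obtain e where e: "e < 1" "\<And>\<zeta>. \<zeta> \<in> ball 0 1 \<Longrightarrow> e < norm \<zeta> \<Longrightarrow> c1 < norm (M \<zeta>)"
        using disc_automorphism_boundary[OF M' M'1, of M c1] M'M c1(2) by metis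
      show "\<exists>c'<1. \<forall>\<zeta>\<in>ball 0 1. c' < norm \<zeta> \<longrightarrow> c < norm (M \<zeta> * b \<zeta>)"
      proof (intro exI[of _ "max d e"] conjI ballI impI)
        fix \<zeta> :: complex assume "\<zeta> \<in> ball 0 1" "max d e < norm \<zeta>"
        then have "c1 * c1 < norm (M \<zeta>) * norm (b \<zeta>)" using c1(1) d(2) e(2) by (intro mult_strict_mono') auto
        with c1(3) show "c < norm (M \<zeta> * b \<zeta>)" by (simp add: norm_mult)
      qed (use d e in auto)
    qed
  qed
qed

text \<open>
  On a leaf bounding \<open>D\<close> the differentials \<open>f1 dz\<close> and \<open>cnj (f2 dz)\<close> nearly cancel, because
  \<open>f1 f2 = P\<close> and \<open>f1\<close>, \<open>f2\<close> have asymptotically equal modulus.  The residue \<open>A\<close> of \<open>f1\<close> is at least the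
  conformal radius of \<open>D\<close> in the metric \<open>\<bar>P\<bar>\<^sup>1\<^sup>/\<^sup>2 \<bar>dz\<bar>\<close>.
\<close>

lemma boundary_conjugate_pair:
  assumes D: "open D" "simply_connected D" "D \<noteq> UNIV" "z0 \<in> D"
  obtains f1 f2 :: "complex \<Rightarrow> complex" and A :: real where
    "f1 holomorphic_on D - {z0}" "f2 holomorphic_on D"
    "\<And>z. z \<in> D - {z0} \<Longrightarrow> f1 z * f2 z = root_poly rs z"
    "\<And>c. c < 1 \<Longrightarrow> \<exists>K. compact K \<and> K \<subseteq> D \<and> z0 \<in> K \<and> (\<forall>z\<in>D - K. c * norm (f1 z) \<le> norm (f2 z) \<and> norm (f2 z) \<le> norm (f1 z))"
    "\<And>\<gamma>. valid_path \<gamma> \<Longrightarrow> pathfinish \<gamma> = pathstart \<gamma> \<Longrightarrow> path_image \<gamma> \<subseteq> D - {z0} \<Longrightarrow>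
       norm (contour_integral \<gamma> f1) = 2 * pi * norm (winding_number \<gamma> z0) * A \<and> contour_integral \<gamma> f2 = 0"
    "\<And>h w0 R. h holomorphic_on ball w0 R \<Longrightarrow> h ` ball w0 R \<subseteq> D \<Longrightarrow> h w0 = z0 \<Longrightarrow> 0 < R \<Longrightarrow>
       sqrt (norm (root_poly rs z0)) * norm (deriv h w0) * R \<le> A"
proof -
  have "D \<noteq> {}" using D(4) by blast
  obtain f g where fg: "f holomorphic_on D" "g holomorphic_on ball 0 1"
      "\<And>z. z \<in> D \<Longrightarrow> f z \<in> ball 0 1 \<and> g (f z) = z"
      "\<And>z. z \<in> ball 0 1 \<Longrightarrow> g z \<in> D \<and> f (g z) = z"
    using Riemann_mapping_theorem[of D] D \<open>D \<noteq> {}\<close> by metis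
  define a where "a = f z0"
  have a: "norm a < 1" using fg(3)[OF D(4)] by (simp add: a_def)
  \<comment> \<open>\<open>k\<close> is the Riemann map followed by the disc automorphism that moves
    the image of \<open>z0\<close> to 0, and \<open>\<psi>\<close> is its inverse.\<close>
  define k where "k = (\<lambda>z. Moebius_function 0 a (f z))"
  define \<psi> where "\<psi> = (\<lambda>\<zeta>. g (Moebius_function 0 (- a) \<zeta>))"
  have k: "k holomorphic_on D" unfolding k_def
    by (rule holomorphic_on_compose_gen[of f D "Moebius_function 0 a" "ball 0 1", unfolded o_def, OF fg(1)])
       (use a fg(3) in \<open>auto intro!: Moebius_function_holomorphic\<close>)
  have \<psi>: "\<psi> holomorphic_on ball 0 1" unfolding \<psi>_def
    by (rule holomorphic_on_compose_gen[of "Moebius_function 0 (-a)" "ball 0 1" g "ball 0 1", unfolded o_def])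
       (use a fg(2) Moebius_function_norm_lt_1[of "-a"] in \<open>auto intro!: Moebius_function_holomorphic\<close>)
  have k1: "norm (k z) < 1" if "z \<in> D" for z unfolding k_def using Moebius_function_norm_lt_1 a fg(3)[OF that] by simp
  have \<psi>k: "\<psi> (k z) = z" if "z \<in> D" for z
    unfolding k_def \<psi>_def using fg(3)[OF that] a Moebius_function_compose[of "-a" a "f z"] by simp
  have k\<psi>: "\<psi> \<zeta> \<in> D" "k (\<psi> \<zeta>) = \<zeta>" if "\<zeta> \<in> ball 0 1" for \<zeta>
  proof -
    have "Moebius_function 0 (- a) \<zeta> \<in> ball 0 1" using Moebius_function_norm_lt_1[of "-a" \<zeta> 0] a that by simp
    with fg(4)[OF this] show "\<psi> \<zeta> \<in> D" "k (\<psi> \<zeta>) = \<zeta>"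
      unfolding k_def \<psi>_def using a that Moebius_function_compose[of a "-a" \<zeta>] by auto
  qed
  have k0: "k z0 = 0" by (simp add: k_def a_def Moebius_function_eq_zero)
  have inj\<psi>: "inj_on \<psi> (ball 0 1)" using k\<psi>(2) by (metis inj_onI)
  have injk: "inj_on k D" using \<psi>k by (metis inj_onI)
  have dk: "deriv k z0 \<noteq> 0" using holomorphic_injective_imp_regular[OF k D(1) injk D(4)] .
  obtain G b where G: "G holomorphic_on ball 0 1" and b: "b holomorphic_on ball 0 1"
    and Gb: "\<And>\<zeta>. \<zeta> \<in> ball 0 1 \<Longrightarrow> G \<zeta> \<noteq> 0 \<and> norm (b \<zeta>) \<le> 1 \<and> root_poly rs (\<psi> \<zeta>) = G \<zeta> * b \<zeta>"
    and lim: "\<And>c. c < 1 \<Longrightarrow> \<exists>c'<1. \<forall>\<zeta>\<in>ball 0 1. c' < norm \<zeta> \<longrightarrow> c < norm (b \<zeta>)"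
    using root_poly_blaschke[OF \<psi> inj\<psi>, of rs] by metis
  have "simply_connected (ball (0::complex) 1)" by (simp add: convex_imp_simply_connected)
  then obtain \<gamma> where \<gamma>: "\<gamma> holomorphic_on ball 0 1" "\<And>\<zeta>. \<zeta> \<in> ball 0 1 \<Longrightarrow> G \<zeta> = (\<gamma> \<zeta>)\<^sup>2"
    using simply_connected_eq_holomorphic_sqrt[of "ball 0 1"] G Gb by (metis open_ball)
  \<comment> \<open>\<open>G = \<gamma>^2\<close> turns the product of the two functions into
    \<open>G * b\<close> at \<open>k z\<close>, that is \<open>P z\<close>. The quotient
    \<open>f2 / f1 = k^2 * b\<close> tends to 1 in modulus at the boundary.\<close>
  define f1 where "f1 = (\<lambda>z. \<gamma> (k z) / k z)"
  define f2 where "f2 = (\<lambda>z. \<gamma> (k z) * k z * b (k z))"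
  have kD: "k z \<in> ball 0 1" if "z \<in> D" for z using k1[OF that] by simp
  have knz: "k z \<noteq> 0" if "z \<in> D - {z0}" for z
    using \<psi>k[OF D(4)] \<psi>k[of z] k0 that by force
  have \<gamma>k: "(\<lambda>z. \<gamma> (k z)) holomorphic_on D"
    by (rule holomorphic_on_compose_gen[of k D \<gamma> "ball 0 1", unfolded o_def, OF k \<gamma>(1)]) (use kD in auto)
  have bk: "(\<lambda>z. b (k z)) holomorphic_on D"
    by (rule holomorphic_on_compose_gen[of k D b "ball 0 1", unfolded o_def, OF k b]) (use kD in auto)
  have h1: "f1 holomorphic_on D - {z0}" unfolding f1_def
    by (intro holomorphic_intros) (use \<gamma>k k knz in \<open>auto intro: holomorphic_on_subset\<close>)
  have h2: "f2 holomorphic_on D" unfolding f2_def by (intro holomorphic_intros \<gamma>k k bk)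
  have prod: "f1 z * f2 z = root_poly rs z" if z: "z \<in> D - {z0}" for z
    using knz[OF z] Gb[of "k z"] \<gamma>(2)[of "k z"] \<psi>k[of z] kD[of z] z
    by (simp add: f1_def f2_def power2_eq_square)
  have ratio: "norm (f2 z) = norm (f1 z) * ((norm (k z))\<^sup>2 * norm (b (k z)))" if z: "z \<in> D - {z0}" for z
    using knz[OF z] by (simp add: f1_def f2_def norm_mult norm_divide power2_eq_square)
  have cpt: "\<exists>K. compact K \<and> K \<subseteq> D \<and> z0 \<in> K \<and> (\<forall>z\<in>D - K. c * norm (f1 z) \<le> norm (f2 z) \<and> norm (f2 z) \<le> norm (f1 z))"
    if "c < 1" for c
  proof -
    \<comment> \<open>A fourth root, because the quotient of the moduli is
      \<open>|k|^2 * |b|\<close> and both factors are kept above \<open>c1^2\<close>.\<close>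
    define c1 where "c1 = sqrt (sqrt (max c 0))"
    have c1: "0 \<le> c1" "c1 < 1" "c \<le> c1^2 * c1^2" using that by (auto simp: c1_def)
    obtain d where d: "d < 1" "\<And>\<zeta>. \<zeta> \<in> ball 0 1 \<Longrightarrow> d < norm \<zeta> \<Longrightarrow> c1^2 < norm (b \<zeta>)" 
      using lim[of "c1^2"] c1 by (metis power_less_one_iff zero_less_numeral pos2)
    define e where "e = max d c1"
    have e: "e < 1" "c1 \<le> e" "0 \<le> e" using d c1 by (auto simp: e_def)
    have "continuous_on (ball 0 1) \<psi>" using \<psi> holomorphic_on_imp_continuous_on by blast
    then have "compact (\<psi> ` cball 0 e)"
      by (rule compact_continuous_image[OF continuous_on_subset]) (use e in auto)
    moreover have "\<psi> ` cball 0 e \<subseteq> D" using k\<psi>(1) e by auto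
    moreover have z0K: "z0 \<in> \<psi> ` cball 0 e" using \<psi>k[OF D(4)] k0 e(3) by (intro image_eqI[of _ _ 0]) auto
    moreover have "c * norm (f1 z) \<le> norm (f2 z) \<and> norm (f2 z) \<le> norm (f1 z)" if z: "z \<in> D - \<psi> ` cball 0 e" for z
    proof -
      have zD: "z \<in> D" "z \<in> D - {z0}" using z z0K by auto
      have "e < norm (k z)" 
      proof (rule ccontr)
        assume "\<not> ?thesis"
        then have "z \<in> \<psi> ` cball 0 e" using \<psi>k[OF zD(1)] by (intro image_eqI[of _ _ "k z"]) auto
        with z show False by blast
      qed
      then have "c1^2 < norm (b (k z))" "c1^2 \<le> (norm (k z))^2"
        using d(2)[OF kD[OF zD(1)]] e c1 by (auto simp: e_def intro!: power_mono)
      then have "c1^2 * c1^2 \<le> (norm (k z))^2 * norm (b (k z))" by (intro mult_mono) auto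
      with c1(3) have l: "c \<le> (norm (k z))^2 * norm (b (k z))" by linarith
      have u: "(norm (k z))^2 * norm (b (k z)) \<le> 1"
        using k1[OF zD(1)] Gb[OF kD[OF zD(1)]] by (intro mult_le_one power_le_one) auto
      show ?thesis unfolding ratio[OF zD(2)]
        using mult_left_mono[OF l norm_ge_zero[of "f1 z"]] mult_left_mono[OF u norm_ge_zero[of "f1 z"]]
        by (simp add: mult.commute)
    qed
    ultimately show ?thesis by blast
  qed
  define A where "A = norm (\<gamma> 0) / norm (deriv k z0)"
  have res: "residue f1 z0 = \<gamma> 0 / deriv k z0"
  proof -
    have "residue (\<lambda>w. \<gamma> (k w) / k w) z0 = \<gamma> (k z0) / deriv k z0"
    proof (rule residue_simple_pole_deriv[where s = D])
      show "(k has_field_derivative deriv k z0) (at z0)" using k D holomorphic_derivI by blast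
      have "\<gamma> 0 \<noteq> 0" using Gb[of 0] \<gamma>(2)[of 0] by auto
      then show "\<gamma> (k z0) \<noteq> 0" by (simp add: k0)
    qed (use D k \<gamma>k k0 dk simply_connected_imp_connected in auto)
    then show ?thesis by (simp add: f1_def k0)
  qed
  have int: "norm (contour_integral p f1) = 2 * pi * norm (winding_number p z0) * A \<and> contour_integral p f2 = 0"
    if p: "valid_path p" "pathfinish p = pathstart p" "path_image p \<subseteq> D - {z0}" for p
  proof
    have pD: "path_image p \<subseteq> D" using p(3) by blast
    have "contour_integral p f1 = 2 * pi * \<i> * (\<Sum>q\<in>{z0}. winding_number p q * residue f1 q)"
    proof (rule Residue_theorem[OF D(1)])
      show "connected D" using D(2) simply_connected_imp_connected by blast
      show "\<forall>z. z \<notin> D \<longrightarrow> winding_number p z = 0"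
        using simply_connected_imp_winding_number_zero[OF D(2) valid_path_imp_path[OF p(1)] pD p(2)] by blast
    qed (use h1 p in auto)
    then show "norm (contour_integral p f1) = 2 * pi * norm (winding_number p z0) * A"
      by (simp add: res A_def norm_mult norm_divide)
    show "contour_integral p f2 = 0"
      using Cauchy_theorem_simply_connected[OF D(1,2) h2 p(1) pD p(2)] contour_integral_unique by blast
  qed
  have rad: "sqrt (norm (root_poly rs z0)) * norm (deriv h w0) * R \<le> A"
    if h: "h holomorphic_on ball w0 R" "h ` ball w0 R \<subseteq> D" "h w0 = z0" "0 < R" for h w0 R
  proof -
    \<comment> \<open>The Schwarz lemma for \<open>\<phi>\<close> gives
      \<open>|deriv k z0| * |deriv h w0| * R \<le> 1\<close>. Together with
      \<open>|P z0| = |\<gamma> 0|^2 * |b 0| \<le> |\<gamma> 0|^2\<close> this bounds the residue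
      from below.\<close>
    define \<phi> where "\<phi> = (\<lambda>\<zeta>. k (h (w0 + of_real R * \<zeta>)))"
    have B: "w0 + of_real R * \<zeta> \<in> ball w0 R" if "\<zeta> \<in> ball 0 1" for \<zeta> :: complex
      using that h(4) by (simp add: dist_norm norm_mult)
    have hd: "(h has_field_derivative deriv h w0) (at (w0 + of_real R * 0))"
      using holomorphic_derivI[OF h(1) open_ball, of w0] h(4) by simp
    have lin: "((\<lambda>\<zeta>. w0 + of_real R * \<zeta>) has_field_derivative of_real R) (at 0)"
      by (auto intro!: derivative_eq_intros)
    have kd: "(k has_field_derivative deriv k z0) (at (h (w0 + of_real R * 0)))"
      using holomorphic_derivI[OF k D(1) D(4)] h(3) by simp
    have "(\<phi> has_field_derivative deriv k z0 * (deriv h w0 * of_real R)) (at 0)"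
      unfolding \<phi>_def
      by (rule DERIV_chain2[where f = k and g = "\<lambda>\<zeta>. h (w0 + of_real R * \<zeta>)", OF kd])
         (rule DERIV_chain2[where f = h and g = "\<lambda>\<zeta>. w0 + of_real R * \<zeta>", OF hd lin])
    then have d\<phi>: "deriv \<phi> 0 = deriv k z0 * (deriv h w0 * of_real R)" by (rule DERIV_imp_deriv)
    have "(\<lambda>\<zeta>. h (w0 + of_real R * \<zeta>)) holomorphic_on ball 0 1"
      by (rule holomorphic_on_compose_gen[of "\<lambda>\<zeta>. w0 + of_real R * \<zeta>" _ h "ball w0 R", unfolded o_def])
         (use B h(1) in \<open>auto intro!: holomorphic_intros\<close>)
    then have "\<phi> holomorphic_on ball 0 1" unfolding \<phi>_def
      by (rule holomorphic_on_compose_gen[of _ _ k D, unfolded o_def]) (use B h(2) k in auto)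
    moreover have "\<phi> 0 = 0" using h(3) k0 by (simp add: \<phi>_def)
    moreover have "norm (\<phi> \<zeta>) < 1" if "norm \<zeta> < 1" for \<zeta>
      unfolding \<phi>_def using B[of \<zeta>] that h(2) by (intro k1) auto
    ultimately have "norm (deriv \<phi> 0) \<le> 1" using Schwarz_Lemma(2)[of \<phi> 0] by simp
    then have "norm (deriv h w0) * R \<le> 1 / norm (deriv k z0)"
      unfolding d\<phi> using h(4) dk by (simp add: norm_mult field_simps)
    moreover have "norm (root_poly rs z0) \<le> (norm (\<gamma> 0))\<^sup>2"
    proof -
      have "root_poly rs z0 = (\<gamma> 0)\<^sup>2 * b 0" "norm (b 0) \<le> 1"
        using Gb[of 0] \<gamma>(2)[of 0] \<psi>k[OF D(4)] k0 by auto
      then show ?thesis by (simp add: norm_mult norm_power mult_left_le)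
    qed
    then have "sqrt (norm (root_poly rs z0)) \<le> norm (\<gamma> 0)" by (simp add: real_le_lsqrt)
    ultimately have "sqrt (norm (root_poly rs z0)) * (norm (deriv h w0) * R) \<le> norm (\<gamma> 0) * (1 / norm (deriv k z0))"
      using h(4) by (intro mult_mono) auto
    then show ?thesis by (simp add: A_def mult.assoc)
  qed
  show ?thesis by (rule that[OF h1 h2 prod cpt int rad])
qed

text \<open>Failure for arbitrarily small parameters is turned into a null sequence of
  counterexamples, so that disjointness for small \<open>\<epsilon>\<close> can be proved by passing
  to limits.\<close>

lemma small_parameter:
  assumes "\<And>f::nat\<Rightarrow>real. f \<longlonglongrightarrow> 0 \<Longrightarrow> (\<And>n. 0 < f n) \<Longrightarrow> (\<And>n. Q (f n)) \<Longrightarrow> False"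
  shows "\<exists>d>0. \<forall>\<epsilon>. 0 < \<epsilon> \<and> \<epsilon> < d \<longrightarrow> \<not> Q \<epsilon>"
proof (rule ccontr)
  assume no: "\<not> ?thesis"
  have "\<exists>\<epsilon>. 0 < \<epsilon> \<and> \<epsilon> < inverse (real (Suc n)) \<and> Q \<epsilon>" for n
  proof -
    have "0 < inverse (real (Suc n))" by simp
    with no show ?thesis by blast
  qed
  then obtain f where f: "\<And>n. 0 < f n" "\<And>n. f n < inverse (real (Suc n))" "\<And>n. Q (f n)" by metis
  have "f \<longlonglongrightarrow> 0"
    by (rule real_tendsto_sandwich[OF _ _ tendsto_const LIMSEQ_inverse_real_of_nat])
       (use f(1,2) in \<open>auto intro!: always_eventually less_imp_le\<close>)
  with f show False using assms by blast
qed

lemma bounded_pair_subseq: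
  fixes f g :: "nat \<Rightarrow> real"
  assumes "\<And>n. a \<le> f n \<and> f n \<le> b" "\<And>n. c \<le> g n \<and> g n \<le> d"
  obtains r l k where "strict_mono r" "(\<lambda>n. f (r n)) \<longlonglongrightarrow> l" "(\<lambda>n. g (r n)) \<longlonglongrightarrow> k"
proof -
  have "compact ({a..b} \<times> {c..d})" by (intro compact_Times compact_Icc)
  moreover have "\<forall>n. (f n, g n) \<in> {a..b} \<times> {c..d}" using assms by auto
  ultimately obtain l r where lr: "strict_mono (r::nat\<Rightarrow>nat)" "((\<lambda>n. (f n, g n)) \<circ> r) \<longlonglongrightarrow> l"
    unfolding compact_def by meson
  from tendsto_fst[OF lr(2)] tendsto_snd[OF lr(2)] show ?thesis
    by (intro that[OF lr(1)]) (simp_all add: o_def)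
qed

text \<open>From \<open>p * q = -1\<close> follows
  \<open>cnj p * (p + cnj q) = |p|^2 - 1 = |p| * (|p| - |q|)\<close>, so the sum has modulus exactly
  \<open>|p| - |q|\<close>: nearly equal moduli mean cancellation. It is applied with
  \<open>f1\<close> and \<open>f2\<close> multiplied by the derivative of a natural
  parametrisation.\<close>

lemma norm_add_cnj_pair:
  fixes p q :: complex
  assumes "p * q = -1" "c * norm p \<le> norm q" "norm q \<le> norm p" "1/4 \<le> c" "c \<le> 1"
  shows "norm (p + cnj q) \<le> 2 * (1 - c)" "norm p \<le> inverse (sqrt c)" "norm q \<le> 1"
proof -
  have pq: "norm p * norm q = 1" using assms(1) by (metis norm_minus_cancel norm_mult norm_one)
  have p0: "0 < norm p" using pq by auto
  have "c * (norm p)\<^sup>2 \<le> 1" 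
    using mult_left_mono[OF assms(2), of "norm p"] pq by (simp add: power2_eq_square mult.left_commute)
  then have "(norm p)\<^sup>2 \<le> inverse c" using assms(4) by (simp add: field_simps)
  then show i: "norm p \<le> inverse (sqrt c)" 
    by (metis real_le_rsqrt real_sqrt_inverse)
  have "1/2 \<le> sqrt c" using assms(4) by (intro real_le_rsqrt) (simp add: power2_eq_square)
  then have "inverse (sqrt c) \<le> 2" by (metis inverse_eq_divide inverse_le_iff_le inverse_inverse_eq zero_less_divide_1_iff zero_less_numeral inverse_numeral_1 divide_inverse mult_1 le_imp_inverse_le)
  with i have p2: "norm p \<le> 2" by linarith
  have "norm q * norm q \<le> norm p * norm q" using assms(3) by (simp add: mult_right_mono)
  then have "(norm q)\<^sup>2 \<le> 1" using pq by (simp add: power2_eq_square)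
  then show "norm q \<le> 1" by (simp add: power_le_one_iff)
  have "cnj p * cnj q = -1"
    using arg_cong[OF assms(1), of cnj] by simp
  then have "cnj p * (p + cnj q) = of_real ((norm p)\<^sup>2) - 1"
    unfolding complex_norm_square by (simp add: algebra_simps)
  then have "cnj p * (p + cnj q) = complex_of_real ((norm p)\<^sup>2 - 1)" by simp
  then have "norm p * norm (p + cnj q) = \<bar>(norm p)\<^sup>2 - 1\<bar>"
    by (metis complex_mod_cnj norm_mult norm_of_real)
  also have "(norm p)\<^sup>2 - 1 = norm p * (norm p - norm q)" using pq by (simp add: power2_eq_square algebra_simps)
  also have "\<bar>\<dots>\<bar> = norm p * (norm p - norm q)" using assms(3) by simp
  finally have "norm (p + cnj q) = norm p - norm q" using p0 by simp
  also have "\<dots> \<le> (1 - c) * norm p" using assms(2) by (simp add: algebra_simps)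
  also have "\<dots> \<le> (1 - c) * 2" using p2 assms(5) by (intro mult_left_mono) auto
  finally show "norm (p + cnj q) \<le> 2 * (1 - c)" by simp
qed

text \<open>On a horizontal segment \<open>dw\<close> is real, so conjugation passes through the
  integral.\<close>

lemma contour_integral_linepath_cnj:
  assumes "continuous_on (closed_segment a b) f" "continuous_on (closed_segment a b) g"
    and B: "\<And>w. w \<in> closed_segment a b \<Longrightarrow> norm (f w + cnj (g w)) \<le> C" "0 \<le> C" and "b - a \<in> \<real>"
  shows "norm (contour_integral (linepath a b) f + cnj (contour_integral (linepath a b) g)) \<le> C * norm (b - a)"
proof -
  have i: "f contour_integrable_on linepath a b" "g contour_integrable_on linepath a b"
    using assms contour_integrable_continuous_linepath by auto
  have "((\<lambda>t. g (linepath a b t) * (b - a)) has_integral contour_integral (linepath a b) g) {0..1}"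
    using has_contour_integral_integral[OF i(2)] by (simp add: has_contour_integral_linepath)
  then have "(cnj \<circ> (\<lambda>t. g (linepath a b t) * (b - a)) has_integral cnj (contour_integral (linepath a b) g)) {0..1}"
    unfolding has_integral_cnj .
  then have "((\<lambda>t. cnj (g (linepath a b t)) * (b - a)) has_integral cnj (contour_integral (linepath a b) g)) {0..1}"
    using Reals_cnj_iff[of "b - a"] assms(5) by (simp add: o_def)
  then have "((\<lambda>w. cnj (g w)) has_contour_integral cnj (contour_integral (linepath a b) g)) (linepath a b)"
    by (simp add: has_contour_integral_linepath)
  from has_contour_integral_add[OF has_contour_integral_integral[OF i(1)] this]
  have "((\<lambda>w. f w + cnj (g w)) has_contour_integral (contour_integral (linepath a b) f + cnj (contour_integral (linepath a b) g))) (linepath a b)" .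
  from has_contour_integral_bound_linepath[OF this B(2)] B(1) show ?thesis by blast
qed

text \<open>The leaf from \<open>X\<close> to \<open>X'\<close> and the transversal between the
  heights \<open>y\<close> and \<open>y'\<close> form a loop. Assumption \<open>R\<close> places the
  square to the right of the transversal inside it; the inscribed disc of that square has half the
  transversal as its radius \<open>R0\<close> and yields \<open>a0 \<ge> R0\<close> for the residue.
  The contributions of the leaf cancel, so \<open>2 * pi * a0\<close> would have to come from the
  transversal, which provides only about \<open>4 * R0\<close>.\<close>

lemma no_return_core:
  assumes L: "leaf rs I u" and B: "flow_box rs \<rho> \<beta>"
    and X: "X < X'" "{X..X'} \<subseteq> I" and y: "y < y'" "\<bar>y\<bar> \<le> \<rho> / 4" "\<bar>y'\<bar> \<le> \<rho> / 4"
    and uX: "u X = \<beta> (Complex 0 y)" "u X' = \<beta> (Complex 0 y')"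
    and nc: "\<And>x v. X < x \<Longrightarrow> x < X' \<Longrightarrow> y \<le> v \<Longrightarrow> v \<le> y' \<Longrightarrow> u x \<noteq> \<beta> (Complex 0 v)"
    and R: "\<beta> ` {w. 0 < Re w \<and> Re w < y' - y \<and> y < Im w \<and> Im w < y'}
       \<subseteq> inside (u ` {X..X'} \<union> \<beta> ` {w. Re w = 0 \<and> y \<le> Im w \<and> Im w \<le> y'})"
  shows False
proof -
  note l = leafD[OF L] and fb = flow_boxD[OF B]

  \<comment> \<open>Analytic strip along the leaf, matched with the flow box at the two
    corners\<close>
  define N where "N \<epsilon> = {w::complex. \<exists>x\<in>{X..X'}. norm (w - of_real x) < \<epsilon>}" for \<epsilon>
  obtain \<epsilon>0 E where \<epsilon>0: "0 < \<epsilon>0" and E: "E holomorphic_on N \<epsilon>0" "open (N \<epsilon>0)"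
    "\<And>t::real. of_real t \<in> N \<epsilon>0 \<Longrightarrow> t \<in> I \<and> E (of_real t) = u t"
    "\<And>w. w \<in> N \<epsilon>0 \<Longrightarrow> - root_poly rs (E w) * (deriv E w)\<^sup>2 = 1"
    by (rule leaf_strip[OF L less_imp_le[OF X(1)] X(2), folded N_def]) (rule that; assumption)
  define NN where "NN = N \<epsilon>0"
  note E = E[folded NN_def]
  have Ereal: "E (of_real t) = u t" "of_real t \<in> NN" if "X \<le> t" "t \<le> X'" for t
  proof -
    show "of_real t \<in> NN" unfolding NN_def N_def using that \<epsilon>0 by (auto intro!: bexI[of _ t])
    from E(3)[OF this] show "E (of_real t) = u t" by blast
  qed
  have inj\<beta>: "w = w'" if "\<beta> w = \<beta> w'" "w \<in> ball 0 \<rho>" "w' \<in> ball 0 \<rho>" for w w'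
    using inj_onD[OF fb(3)] that by blast
  have cyB: "Complex 0 v \<in> ball 0 \<rho>" if "\<bar>v\<bar> \<le> \<rho> / 4" for v
    using that fb(1) by (simp add: cmod_def)
  have y0: "Complex 0 y \<in> ball 0 \<rho>" "Complex 0 y' \<in> ball 0 \<rho>" using cyB y by auto
  have XI: "X \<in> I" "X' \<in> I" using X by auto
  \<comment> \<open>\<open>s1\<close> and \<open>s2\<close> are 1 if the leaf runs to the right
    through the box at that crossing and -1 if it runs to the left; all four combinations are
    treated together.\<close>
  obtain s1 :: real where s1: "s1 \<in> {1, -1}"
    "\<And>\<tau>. Complex 0 y + of_real \<tau> \<in> ball 0 \<rho> \<Longrightarrow> X + s1 * \<tau> \<in> I \<and> u (X + s1 * \<tau>) = \<beta> (Complex 0 y + of_real \<tau>)"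
    by (rule leaf_flow[OF L B XI(1) uX(1) y0(1)]) (rule that; assumption)
  obtain s2 :: real where s2: "s2 \<in> {1, -1}"
    "\<And>\<tau>. Complex 0 y' + of_real \<tau> \<in> ball 0 \<rho> \<Longrightarrow> X' + s2 * \<tau> \<in> I \<and> u (X' + s2 * \<tau>) = \<beta> (Complex 0 y' + of_real \<tau>)"
    by (rule leaf_flow[OF L B XI(2) uX(2) y0(2)]) (rule that; assumption)
  define \<epsilon>1 where "\<epsilon>1 = min \<epsilon>0 (\<rho> / 2)"
  have \<epsilon>1: "0 < \<epsilon>1" "\<epsilon>1 \<le> \<epsilon>0" "\<epsilon>1 \<le> \<rho> / 2" using \<epsilon>0 fb(1) by (auto simp: \<epsilon>1_def)
  \<comment> \<open>Near an end \<open>E\<close> and \<open>\<beta>\<close> continue the same real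
    curve, so they differ by an affine change of the natural parameter, given by the direction
    \<open>s\<close> and the height \<open>v\<close>.\<close>
  have corner: "E w = \<beta> (of_real s * (w - of_real Z) + Complex 0 v)"
    if s: "s \<in> {1, -1}" and Z: "Z \<in> {X..X'}" and v: "\<bar>v\<bar> \<le> \<rho> / 4" and w: "norm (w - of_real Z) < \<epsilon>1"
      and flow: "\<And>\<tau>. Complex 0 v + of_real \<tau> \<in> ball 0 \<rho> \<Longrightarrow> Z + s * \<tau> \<in> I \<and> u (Z + s * \<tau>) = \<beta> (Complex 0 v + of_real \<tau>)"
    for s Z v w
  proof (rule agree_on_reals[where f = E and g = "\<lambda>w. \<beta> (of_real s * (w - of_real Z) + Complex 0 v)" 
        and S = "ball (of_real Z) \<epsilon>1" and x = Z and w = w])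
    have inB: "of_real s * (w - of_real Z) + Complex 0 v \<in> ball 0 \<rho>" if "w \<in> ball (of_real Z) \<epsilon>1" for w
    proof -
      have "norm (of_real s * (w - of_real Z)) < \<epsilon>1"
        using that s by (auto simp: norm_mult dist_norm norm_minus_commute)
      moreover have "norm (Complex 0 v) \<le> \<rho> / 4" using v by (simp add: cmod_def)
      ultimately have "norm (of_real s * (w - of_real Z) + Complex 0 v) < \<rho>"
        using norm_triangle_ineq[of "of_real s * (w - of_real Z)" "Complex 0 v"] \<epsilon>1(3) fb(1) by linarith
      then show ?thesis by simp
    qed
    have sub: "ball (of_real Z) \<epsilon>1 \<subseteq> NN" 
      unfolding NN_def N_def using Z \<epsilon>1(2) by (auto simp: dist_norm norm_minus_commute intro!: bexI[of _ Z])
    show "E holomorphic_on ball (of_real Z) \<epsilon>1" using E(1) sub holomorphic_on_subset by blast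
    show "(\<lambda>w. \<beta> (of_real s * (w - of_real Z) + Complex 0 v)) holomorphic_on ball (of_real Z) \<epsilon>1"
      by (rule holomorphic_on_compose_gen[of "\<lambda>w. of_real s * (w - of_real Z) + Complex 0 v" _ \<beta> "ball 0 \<rho>", unfolded o_def, OF _ fb(2)])
         (use inB in \<open>auto intro!: holomorphic_intros simp del: mem_ball\<close>)
    fix t :: real assume t: "complex_of_real t \<in> ball (of_real Z) \<epsilon>1"
    have e: "of_real s * (of_real t - of_real Z) + Complex 0 v = Complex 0 v + of_real (s * (t - Z))" by simp
    have "u (Z + s * (s * (t - Z))) = \<beta> (Complex 0 v + of_real (s * (t - Z)))"
      using flow[of "s * (t - Z)"] inB[OF t] e by simp
    moreover have "Z + s * (s * (t - Z)) = t" using s by auto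
    moreover have "E (of_real t) = u t" using E(3) sub t by blast
    ultimately show "E (of_real t) = \<beta> (of_real s * (of_real t - of_real Z) + Complex 0 v)" by (simp only: e)
  qed (use w \<epsilon>1 in \<open>auto simp: dist_norm norm_minus_commute\<close>)
  have c1: "E (Complex a b) = \<beta> (Complex (s1 * (a - X)) (s1 * b + y))" "Complex (s1 * (a - X)) (s1 * b + y) \<in> ball 0 \<rho>"
    if "norm (Complex a b - of_real X) < \<epsilon>1" for a b
  proof -
    have e: "of_real s1 * (Complex a b - of_real X) + Complex 0 y = Complex (s1 * (a - X)) (s1 * b + y)"
      by (simp add: complex_eq_iff)
    show "E (Complex a b) = \<beta> (Complex (s1 * (a - X)) (s1 * b + y))"
      unfolding e[symmetric] by (rule corner[OF s1(1) _ y(2) that s1(2)]) (use X in auto)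
    have "norm (Complex (s1 * (a - X)) (s1 * b + y)) \<le> norm (of_real s1 * (Complex a b - of_real X)) + norm (Complex 0 y)"
      unfolding e[symmetric] by (rule norm_triangle_ineq)
    also have "\<dots> < \<rho> / 2 + \<rho> / 4 + \<rho> / 4"
      using that s1(1) y(2) \<epsilon>1(3) fb(1) by (auto simp: norm_mult cmod_def[of "Complex 0 y"])
    finally show "Complex (s1 * (a - X)) (s1 * b + y) \<in> ball 0 \<rho>" by simp
  qed
  have c2: "E (Complex a b) = \<beta> (Complex (s2 * (a - X')) (s2 * b + y'))" "Complex (s2 * (a - X')) (s2 * b + y') \<in> ball 0 \<rho>"
    if "norm (Complex a b - of_real X') < \<epsilon>1" for a b
  proof -
    have e: "of_real s2 * (Complex a b - of_real X') + Complex 0 y' = Complex (s2 * (a - X')) (s2 * b + y')"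
      by (simp add: complex_eq_iff)
    show "E (Complex a b) = \<beta> (Complex (s2 * (a - X')) (s2 * b + y'))"
      unfolding e[symmetric] by (rule corner[OF s2(1) _ y(3) that s2(2)]) (use X in auto)
    have "norm (Complex (s2 * (a - X')) (s2 * b + y')) \<le> norm (of_real s2 * (Complex a b - of_real X')) + norm (Complex 0 y')"
      unfolding e[symmetric] by (rule norm_triangle_ineq)
    also have "\<dots> < \<rho> / 2 + \<rho> / 4 + \<rho> / 4"
      using that s2(1) y(3) \<epsilon>1(3) fb(1) by (auto simp: norm_mult cmod_def[of "Complex 0 y'"])
    finally show "Complex (s2 * (a - X')) (s2 * b + y') \<in> ball 0 \<rho>" by simp
  qed

  \<comment> \<open>Displaced copies of the leaf and of the transversal\<close>
  define S1 where "S1 \<epsilon> = {w. Im w = \<epsilon> \<and> X + s1 * \<epsilon> \<le> Re w \<and> Re w \<le> X' + s2 * \<epsilon>}" for \<epsilon>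
  define S2 where "S2 \<epsilon> = {w. Re w = \<epsilon> \<and> y + s1 * \<epsilon> \<le> Im w \<and> Im w \<le> y' + s2 * \<epsilon>}" for \<epsilon>
  \<comment> \<open>Small enough for the displaced curves to stay in the strip and in the box; the
    bound \<open>(y' - y) / 16\<close> lets the displaced transversal be at most an eighth longer
    than the original.\<close>
  define \<epsilon>2 where "\<epsilon>2 = min (min 1 (\<epsilon>0 / 4)) (min (min (\<rho> / 8) ((X' - X) / 4)) ((y' - y) / 16))"
  have \<epsilon>2: "0 < \<epsilon>2" "\<epsilon>2 \<le> 1" "\<epsilon>2 \<le> \<epsilon>0 / 4" "\<epsilon>2 \<le> \<rho> / 8" "\<epsilon>2 \<le> (X' - X) / 4" "\<epsilon>2 \<le> (y' - y) / 16"
  proof -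
    show "0 < \<epsilon>2" unfolding \<epsilon>2_def using \<epsilon>0 fb(1) X(1) y(1) by simp
  qed (simp_all only: \<epsilon>2_def min_le_iff_disj order_refl simp_thms)
  have S1N: "S1 \<epsilon> \<subseteq> NN" if "0 \<le> \<epsilon>" "\<epsilon> < \<epsilon>2" for \<epsilon>
  proof
    fix w assume w: "w \<in> S1 \<epsilon>"
    define t where "t = max X (min X' (Re w))"
    have "\<bar>Re w - t\<bar> \<le> \<epsilon>" using w that s1(1) s2(1) X(1) by (auto simp: S1_def t_def)
    then have "norm (w - of_real t) \<le> \<epsilon> + \<epsilon>"
      using cmod_le[of "w - of_real t"] w that by (simp add: S1_def)
    also have "\<dots> < \<epsilon>0" using that \<epsilon>2(3) \<epsilon>0 by linarith
    finally show "w \<in> NN" unfolding NN_def N_def using X(1) by (auto intro!: bexI[of _ t] simp: t_def)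
  qed
  have S2B: "S2 \<epsilon> \<subseteq> ball 0 \<rho>" if "0 \<le> \<epsilon>" "\<epsilon> < \<epsilon>2" for \<epsilon>
  proof
    fix w assume w: "w \<in> S2 \<epsilon>"
    have "\<bar>Im w\<bar> \<le> \<rho> / 4 + \<epsilon>" using w that s1(1) s2(1) y by (auto simp: S2_def)
    then have "norm w \<le> \<epsilon> + (\<rho> / 4 + \<epsilon>)" using cmod_le[of w] w that by (simp add: S2_def)
    also have "\<dots> < \<rho>" using that \<epsilon>2(4) fb(1) by linarith
    finally show "w \<in> ball 0 \<rho>" by simp
  qed
  define J0 where "J0 = u ` {X..X'} \<union> \<beta> ` S2 0"
  define D where "D = inside J0"
  have RD: "\<beta> ` {w. 0 < Re w \<and> Re w < y' - y \<and> y < Im w \<and> Im w < y'} \<subseteq> D"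
    using R by (simp add: D_def J0_def S2_def)
  have ES1: "E ` S1 0 = u ` {X..X'}"
  proof
    show "E ` S1 0 \<subseteq> u ` {X..X'}"
    proof
      fix z assume "z \<in> E ` S1 0"
      then obtain w where w: "w \<in> S1 0" "z = E w" by blast
      then have "w = of_real (Re w)" by (simp add: S1_def complex_eq_iff)
      with w show "z \<in> u ` {X..X'}" using Ereal(1)[of "Re w"] by (auto simp: S1_def)
    qed
    show "u ` {X..X'} \<subseteq> E ` S1 0"
    proof
      fix z assume "z \<in> u ` {X..X'}"
      then obtain t where t: "X \<le> t" "t \<le> X'" "z = u t" by auto
      then show "z \<in> E ` S1 0" using Ereal(1)[of t] by (intro image_eqI[of _ _ "of_real t"]) (auto simp: S1_def)
    qed
  qed
  \<comment> \<open>The loop is simple: leaf and transversal share only the two corners.\<close>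
  have ends: "(t = X \<and> v = y) \<or> (t = X' \<and> v = y')"
    if h: "X \<le> t" "t \<le> X'" "y \<le> v" "v \<le> y'" "u t = \<beta> (Complex 0 v)" for t v
  proof -
    have v: "Complex 0 v \<in> ball 0 \<rho>" using h y by (intro cyB) auto
    consider "t = X" | "t = X'" | "X < t" "t < X'" using h(1,2) by (metis less_eq_real_def)
    then show ?thesis
    proof cases
      case 1
      then have "\<beta> (Complex 0 v) = \<beta> (Complex 0 y)" using uX(1) h(5) by metis
      from inj\<beta>[OF this v y0(1)] 1 show ?thesis by simp
    next
      case 2
      then have "\<beta> (Complex 0 v) = \<beta> (Complex 0 y')" using uX(2) h(5) by metis
      from inj\<beta>[OF this v y0(2)] 2 show ?thesis by simp
    next
      case 3
      from nc[OF this h(3,4)] h(5) show ?thesis by blast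
    qed
  qed
  have contE: "isCont E w" if "w \<in> NN" for w
    using holomorphic_derivI[OF E(1,2) that] DERIV_isCont by blast
  have cont\<beta>: "isCont \<beta> w" if "w \<in> ball 0 \<rho>" for w using fb(6)[OF that] DERIV_isCont by blast
  have contu: "isCont u t" if "X \<le> t" "t \<le> X'" for t using l(7) X(2) that by auto

  \<comment> \<open>The displaced curves avoid the loop\<close>
  define Q1 where "Q1 \<epsilon> \<longleftrightarrow> (\<epsilon> < \<epsilon>2 \<and> (\<exists>t t'. X + s1 * \<epsilon> \<le> t \<and> t \<le> X' + s2 * \<epsilon> \<and> X \<le> t' \<and> t' \<le> X' \<and> E (Complex t \<epsilon>) = u t'))" for \<epsilon>
  have EE: "\<exists>d>0. \<forall>\<epsilon>. 0 < \<epsilon> \<and> \<epsilon> < d \<longrightarrow> \<not> Q1 \<epsilon>"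
  proof (rule small_parameter)
    fix f :: "nat \<Rightarrow> real"
    assume f: "f \<longlonglongrightarrow> 0" "\<And>n. 0 < f n"
      "\<And>n. Q1 (f n)"
    then obtain T T' where T: "\<And>n. f n < \<epsilon>2" "\<And>n. X + s1 * f n \<le> T n" "\<And>n. T n \<le> X' + s2 * f n" "\<And>n. X \<le> T' n" "\<And>n. T' n \<le> X'"
      "\<And>n. E (Complex (T n) (f n)) = u (T' n)" unfolding Q1_def by metis
    have bd: "X - \<epsilon>2 \<le> T n \<and> T n \<le> X' + \<epsilon>2" for n
      using T(1)[of n] T(2)[of n] T(3)[of n] f(2)[of n] s1(1) s2(1) by auto
    obtain r t t' where r: "strict_mono r" "(\<lambda>n. T (r n)) \<longlonglongrightarrow> t" "(\<lambda>n. T' (r n)) \<longlonglongrightarrow> t'"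
      using bounded_pair_subseq[of "X - \<epsilon>2" T "X' + \<epsilon>2" X T' X'] bd T(4,5) by metis
    have fr: "(\<lambda>n. f (r n)) \<longlonglongrightarrow> 0" using LIMSEQ_subseq_LIMSEQ[OF f(1) r(1)] by (simp add: o_def)
    have "(\<lambda>n. X + s1 * f (r n)) \<longlonglongrightarrow> X + s1 * 0" "(\<lambda>n. X' + s2 * f (r n)) \<longlonglongrightarrow> X' + s2 * 0" by (intro tendsto_intros fr)+
    then have t: "X \<le> t" "t \<le> X'" using LIMSEQ_le[OF _ r(2), of _ "X + s1 * 0"] LIMSEQ_le[OF r(2), of _ "X' + s2 * 0"] T(2,3) by auto
    have t': "X \<le> t'" "t' \<le> X'" using LIMSEQ_le_const[OF r(3)] LIMSEQ_le_const2[OF r(3)] T(4,5) by auto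
    have W: "(\<lambda>n. Complex (T (r n)) (f (r n))) \<longlonglongrightarrow> of_real t"
      using tendsto_Complex[OF r(2) fr] by (simp add: complex_of_real_def)
    have l1: "(\<lambda>n. u (T' (r n))) \<longlonglongrightarrow> u t"
      using isCont_tendsto_compose[OF contE[OF Ereal(2)[OF t]] W] by (simp only: T(6) Ereal(1)[OF t])
    have l2: "(\<lambda>n. u (T' (r n))) \<longlonglongrightarrow> u t'" by (rule isCont_tendsto_compose[OF contu[OF t'] r(3)])
    have tI: "t \<in> I" "t' \<in> I" using X(2) t t' by auto
    \<comment> \<open>Both points tend to the same point of the leaf, where \<open>E\<close> is
      locally injective, so a displaced time cannot have the same image as a real one.\<close>
    have tt: "t = t'" by (rule inj_onD[OF l(3) LIMSEQ_unique[OF l1 l2] tI])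
    have "deriv E (of_real t) \<noteq> 0" using E(4)[OF Ereal(2)[OF t]] by auto
    then obtain e where e: "e > 0" "inj_on E (ball (of_real t) e)"
      using has_complex_derivative_locally_injective[OF E(1) Ereal(2)[OF t] E(2)] by metis
    have W': "(\<lambda>n. complex_of_real (T' (r n))) \<longlonglongrightarrow> of_real t" using r(3) tt by (intro tendsto_of_real) simp
    have "\<forall>\<^sub>F n in sequentially. Complex (T (r n)) (f (r n)) \<in> ball (of_real t) e \<and> complex_of_real (T' (r n)) \<in> ball (of_real t) e"
      using eventually_conj[OF topological_tendstoD[OF W open_ball, of "of_real t" e] topological_tendstoD[OF W' open_ball, of "of_real t" e]] e(1) by auto
    then obtain n where n: "Complex (T (r n)) (f (r n)) \<in> ball (of_real t) e" "complex_of_real (T' (r n)) \<in> ball (of_real t) e"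
      unfolding eventually_sequentially by blast
    have "E (Complex (T (r n)) (f (r n))) = E (of_real (T' (r n)))" using T(6) Ereal(1) T(4,5) by simp
    from inj_onD[OF e(2) this n] have "f (r n) = 0" by (simp add: complex_eq_iff)
    then show False using f(2)[of "r n"] by simp
  qed
  define Q2 where "Q2 \<epsilon> \<longleftrightarrow> (\<epsilon> < \<epsilon>2 \<and> (\<exists>t v. X + s1 * \<epsilon> \<le> t \<and> t \<le> X' + s2 * \<epsilon> \<and> y \<le> v \<and> v \<le> y' \<and> E (Complex t \<epsilon>) = \<beta> (Complex 0 v)))" for \<epsilon>
  have EB: "\<exists>d>0. \<forall>\<epsilon>. 0 < \<epsilon> \<and> \<epsilon> < d \<longrightarrow> \<not> Q2 \<epsilon>"
  proof (rule small_parameter)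
    fix f :: "nat \<Rightarrow> real"
    assume f: "f \<longlonglongrightarrow> 0" "\<And>n. 0 < f n"
      "\<And>n. Q2 (f n)"
    then obtain T V where T: "\<And>n. f n < \<epsilon>2" "\<And>n. X + s1 * f n \<le> T n" "\<And>n. T n \<le> X' + s2 * f n" "\<And>n. y \<le> V n" "\<And>n. V n \<le> y'"
      "\<And>n. E (Complex (T n) (f n)) = \<beta> (Complex 0 (V n))" unfolding Q2_def by metis
    have bd: "X - \<epsilon>2 \<le> T n \<and> T n \<le> X' + \<epsilon>2" for n
      using T(1)[of n] T(2)[of n] T(3)[of n] f(2)[of n] s1(1) s2(1) by auto
    obtain r t v where r: "strict_mono r" "(\<lambda>n. T (r n)) \<longlonglongrightarrow> t" "(\<lambda>n. V (r n)) \<longlonglongrightarrow> v"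
      using bounded_pair_subseq[of "X - \<epsilon>2" T "X' + \<epsilon>2" y V y'] bd T(4,5) by metis
    have fr: "(\<lambda>n. f (r n)) \<longlonglongrightarrow> 0" using LIMSEQ_subseq_LIMSEQ[OF f(1) r(1)] by (simp add: o_def)
    have "(\<lambda>n. X + s1 * f (r n)) \<longlonglongrightarrow> X + s1 * 0" "(\<lambda>n. X' + s2 * f (r n)) \<longlonglongrightarrow> X' + s2 * 0" by (intro tendsto_intros fr)+
    then have t: "X \<le> t" "t \<le> X'" using LIMSEQ_le[OF _ r(2), of _ "X + s1 * 0"] LIMSEQ_le[OF r(2), of _ "X' + s2 * 0"] T(2,3) by auto
    have v: "y \<le> v" "v \<le> y'" using LIMSEQ_le_const[OF r(3)] LIMSEQ_le_const2[OF r(3)] T(4,5) by auto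
    have VB: "Complex 0 z \<in> ball 0 \<rho>" if "y \<le> z" "z \<le> y'" for z using that y by (intro cyB) auto
    have W: "(\<lambda>n. Complex (T (r n)) (f (r n))) \<longlonglongrightarrow> of_real t"
      using tendsto_Complex[OF r(2) fr] by (simp add: complex_of_real_def)
    have l1: "(\<lambda>n. \<beta> (Complex 0 (V (r n)))) \<longlonglongrightarrow> u t"
      using isCont_tendsto_compose[OF contE[OF Ereal(2)[OF t]] W] by (simp only: T(6) Ereal(1)[OF t])
    have l2: "(\<lambda>n. \<beta> (Complex 0 (V (r n)))) \<longlonglongrightarrow> \<beta> (Complex 0 v)"
      by (rule isCont_tendsto_compose[OF cont\<beta>[OF VB[OF v]]]) (intro tendsto_Complex tendsto_const r)
    have "u t = \<beta> (Complex 0 v)" by (rule LIMSEQ_unique[OF l1 l2])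
    \<comment> \<open>The limit is a corner, where both curves can be read in the box. With
      \<open>\<epsilon> = f (r n)\<close>, equality at the lower corner forces \<open>T = X\<close>
      and \<open>V = y + s1 * \<epsilon>\<close>; \<open>V \<ge> y\<close> gives
      \<open>s1 = 1\<close>, and then \<open>T\<close> is below its lower limit
      \<open>X + s1 * \<epsilon>\<close>. The upper corner is symmetric.\<close>
    from ends[OF t v this] show False
    proof
      assume "t = X \<and> v = y"
      then have "\<forall>\<^sub>F n in sequentially. dist (Complex (T (r n)) (f (r n))) (of_real X) < \<epsilon>1"
        using tendstoD[OF W \<epsilon>1(1)] by simp
      then obtain n where n: "norm (Complex (T (r n)) (f (r n)) - of_real X) < \<epsilon>1"
        unfolding eventually_sequentially dist_norm by blast
      have "Complex (s1 * (T (r n) - X)) (s1 * f (r n) + y) = Complex 0 (V (r n))"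
        by (rule inj\<beta>[OF _ c1(2)[OF n] VB[OF T(4) T(5)]]) (use c1(1)[OF n] T(6)[of "r n"] in simp)
      then show False using s1(1) f(2)[of "r n"] T(2)[of "r n"] T(4)[of "r n"] by auto
    next
      assume "t = X' \<and> v = y'"
      then have "\<forall>\<^sub>F n in sequentially. dist (Complex (T (r n)) (f (r n))) (of_real X') < \<epsilon>1"
        using tendstoD[OF W \<epsilon>1(1)] by simp
      then obtain n where n: "norm (Complex (T (r n)) (f (r n)) - of_real X') < \<epsilon>1"
        unfolding eventually_sequentially dist_norm by blast
      have "Complex (s2 * (T (r n) - X')) (s2 * f (r n) + y') = Complex 0 (V (r n))"
        by (rule inj\<beta>[OF _ c2(2)[OF n] VB[OF T(4) T(5)]]) (use c2(1)[OF n] T(6)[of "r n"] in simp)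
      then show False using s2(1) f(2)[of "r n"] T(3)[of "r n"] T(5)[of "r n"] by auto
    qed
  qed
  define Q3 where "Q3 \<epsilon> \<longleftrightarrow> (\<epsilon> < \<epsilon>2 \<and> (\<exists>v t. y + s1 * \<epsilon> \<le> v \<and> v \<le> y' + s2 * \<epsilon> \<and> X \<le> t \<and> t \<le> X' \<and> \<beta> (Complex \<epsilon> v) = u t))" for \<epsilon>
  have BE: "\<exists>d>0. \<forall>\<epsilon>. 0 < \<epsilon> \<and> \<epsilon> < d \<longrightarrow> \<not> Q3 \<epsilon>"
  proof (rule small_parameter)
    fix f :: "nat \<Rightarrow> real"
    assume f: "f \<longlonglongrightarrow> 0" "\<And>n. 0 < f n"
      "\<And>n. Q3 (f n)"
    then obtain V T where T: "\<And>n. f n < \<epsilon>2" "\<And>n. y + s1 * f n \<le> V n" "\<And>n. V n \<le> y' + s2 * f n" "\<And>n. X \<le> T n" "\<And>n. T n \<le> X'"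
      "\<And>n. \<beta> (Complex (f n) (V n)) = u (T n)" unfolding Q3_def by metis
    have bd: "y - \<epsilon>2 \<le> V n \<and> V n \<le> y' + \<epsilon>2" for n
      using T(1)[of n] T(2)[of n] T(3)[of n] f(2)[of n] s1(1) s2(1) by auto
    obtain r v t where r: "strict_mono r" "(\<lambda>n. V (r n)) \<longlonglongrightarrow> v" "(\<lambda>n. T (r n)) \<longlonglongrightarrow> t"
      using bounded_pair_subseq[of "y - \<epsilon>2" V "y' + \<epsilon>2" X T X'] bd T(4,5) by metis
    have fr: "(\<lambda>n. f (r n)) \<longlonglongrightarrow> 0" using LIMSEQ_subseq_LIMSEQ[OF f(1) r(1)] by (simp add: o_def)
    have "(\<lambda>n. y + s1 * f (r n)) \<longlonglongrightarrow> y + s1 * 0" "(\<lambda>n. y' + s2 * f (r n)) \<longlonglongrightarrow> y' + s2 * 0" by (intro tendsto_intros fr)+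
    then have v: "y \<le> v" "v \<le> y'" using LIMSEQ_le[OF _ r(2), of _ "y + s1 * 0"] LIMSEQ_le[OF r(2), of _ "y' + s2 * 0"] T(2,3) by auto
    have t: "X \<le> t" "t \<le> X'" using LIMSEQ_le_const[OF r(3)] LIMSEQ_le_const2[OF r(3)] T(4,5) by auto
    have VB: "Complex (f n) (V n) \<in> ball 0 \<rho>" for n
      using S2B[of "f n"] f(2)[of n] T(1)[of n] T(2)[of n] T(3)[of n] by (auto simp: S2_def subset_eq)
    have vB: "Complex 0 v \<in> ball 0 \<rho>" using v y by (intro cyB) auto
    have W0: "(\<lambda>n. Complex (f (r n)) (V (r n))) \<longlonglongrightarrow> Complex 0 v" by (intro tendsto_Complex fr r)
    have l1: "(\<lambda>n. u (T (r n))) \<longlonglongrightarrow> \<beta> (Complex 0 v)"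
      using isCont_tendsto_compose[OF cont\<beta>[OF vB] W0] by (simp only: T(6))
    have l2: "(\<lambda>n. u (T (r n))) \<longlonglongrightarrow> u t" by (rule isCont_tendsto_compose[OF contu[OF t] r(3)])
    have "u t = \<beta> (Complex 0 v)" by (rule LIMSEQ_unique[OF l2 l1])
    have W: "(\<lambda>n. complex_of_real (T (r n))) \<longlonglongrightarrow> of_real t" using r(3) by (intro tendsto_of_real)
    have Ee: "\<beta> (Complex (f n) (V n)) = E (Complex (T n) 0)" for n
      using T(6)[of n] Ereal(1)[OF T(4,5)] by (simp add: complex_of_real_def)
    \<comment> \<open>Now equality at the lower corner gives \<open>V = y\<close> and
      \<open>T = X + s1 * \<epsilon>\<close> with \<open>\<epsilon> = f (r n)\<close>; the lower
      limit \<open>y + s1 * \<epsilon>\<close> of \<open>V\<close> forces \<open>s1 = -1\<close>, so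
      \<open>T < X\<close>, which is out of range.\<close>
    from ends[OF t v \<open>u t = _\<close>] show False
    proof
      assume "t = X \<and> v = y"
      then have "\<forall>\<^sub>F n in sequentially. dist (complex_of_real (T (r n))) (of_real X) < \<epsilon>1"
        using tendstoD[OF W \<epsilon>1(1)] by simp
      then obtain n where n: "norm (Complex (T (r n)) 0 - of_real X) < \<epsilon>1"
        unfolding eventually_sequentially dist_norm complex_of_real_def by blast
      have "Complex (s1 * (T (r n) - X)) (s1 * 0 + y) = Complex (f (r n)) (V (r n))"
        using inj\<beta>[OF _ c1(2)[OF n] VB] c1(1)[OF n] Ee[of "r n"] by simp
      then show False using s1(1) f(2)[of "r n"] T(2)[of "r n"] T(4)[of "r n"] by auto
    next
      assume "t = X' \<and> v = y'"
      then have "\<forall>\<^sub>F n in sequentially. dist (complex_of_real (T (r n))) (of_real X') < \<epsilon>1"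
        using tendstoD[OF W \<epsilon>1(1)] by simp
      then obtain n where n: "norm (Complex (T (r n)) 0 - of_real X') < \<epsilon>1"
        unfolding eventually_sequentially dist_norm complex_of_real_def by blast
      have "Complex (s2 * (T (r n) - X')) (s2 * 0 + y') = Complex (f (r n)) (V (r n))"
        using inj\<beta>[OF _ c2(2)[OF n] VB] c2(1)[OF n] Ee[of "r n"] by simp
      then show False using s2(1) f(2)[of "r n"] T(3)[of "r n"] T(5)[of "r n"] by auto
    qed
  qed
  have "\<exists>d>0. \<forall>\<epsilon>. 0 < \<epsilon> \<and> \<epsilon> < d \<longrightarrow> (E ` S1 \<epsilon> \<union> \<beta> ` S2 \<epsilon>) \<inter> J0 = {}"
  proof -
    obtain d1 where d1: "d1 > 0" "\<forall>\<epsilon>. 0 < \<epsilon> \<and> \<epsilon> < d1 \<longrightarrow> \<not> Q1 \<epsilon>" using EE by blast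
    obtain d2 where d2: "d2 > 0" "\<forall>\<epsilon>. 0 < \<epsilon> \<and> \<epsilon> < d2 \<longrightarrow> \<not> Q2 \<epsilon>" using EB by blast
    obtain d3 where d3: "d3 > 0" "\<forall>\<epsilon>. 0 < \<epsilon> \<and> \<epsilon> < d3 \<longrightarrow> \<not> Q3 \<epsilon>" using BE by blast
    have "(E ` S1 \<epsilon> \<union> \<beta> ` S2 \<epsilon>) \<inter> J0 = {}" if \<epsilon>: "0 < \<epsilon>" "\<epsilon> < min (min d1 d2) (min d3 \<epsilon>2)" for \<epsilon>
    proof -
      have "E w \<noteq> u t" if "w \<in> S1 \<epsilon>" "X \<le> t" "t \<le> X'" for w t
      proof
        assume "E w = u t"
        then have "Q1 \<epsilon>" unfolding Q1_def using that \<epsilon>(2)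
          by (intro conjI exI[of _ "Re w"] exI[of _ t]) (auto simp: S1_def)
        then show False using d1(2) \<epsilon> by simp
      qed
      moreover have "E w \<noteq> \<beta> w'" if "w \<in> S1 \<epsilon>" "w' \<in> S2 0" for w w'
      proof
        assume "E w = \<beta> w'"
        moreover have "w = Complex (Re w) \<epsilon>" "w' = Complex 0 (Im w')" using that by (auto simp: S1_def S2_def complex_eq_iff)
        ultimately have "E (Complex (Re w) \<epsilon>) = \<beta> (Complex 0 (Im w'))" by metis
        then have "Q2 \<epsilon>" unfolding Q2_def using that \<epsilon>(2)
          by (intro conjI exI[of _ "Re w"] exI[of _ "Im w'"]) (auto simp: S1_def S2_def)
        then show False using d2(2) \<epsilon> by simp
      qed
      moreover have "\<beta> w \<noteq> u t" if "w \<in> S2 \<epsilon>" "X \<le> t" "t \<le> X'" for w t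
      proof
        assume "\<beta> w = u t"
        then have "Q3 \<epsilon>" unfolding Q3_def using that \<epsilon>(2)
          by (intro conjI exI[of _ "Im w"] exI[of _ t]) (auto simp: S2_def)
        then show False using d3(2) \<epsilon> by simp
      qed
      moreover have "\<beta> w \<noteq> \<beta> w'" if w: "w \<in> S2 \<epsilon>" "w' \<in> S2 0" for w w'
      proof
        assume eq: "\<beta> w = \<beta> w'"
        have "w \<in> ball 0 \<rho>" "w' \<in> ball 0 \<rho>" using w S2B[of \<epsilon>] S2B[of 0] \<epsilon> \<epsilon>2(1) by auto
        from inj\<beta>[OF eq this] have "w = w'" .
        then show False using w \<epsilon>(1) by (auto simp: S2_def)
      qed
      ultimately show ?thesis unfolding J0_def by auto
    qed
    then show ?thesis using d1(1) d2(1) d3(1) \<epsilon>2(1) by (intro exI[of _ "min (min d1 d2) (min d3 \<epsilon>2)"]) auto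
  qed
  then obtain \<delta>1 where \<delta>1: "\<delta>1 > 0" "\<And>\<epsilon>. 0 < \<epsilon> \<Longrightarrow> \<epsilon> < \<delta>1 \<Longrightarrow> (E ` S1 \<epsilon> \<union> \<beta> ` S2 \<epsilon>) \<inter> J0 = {}" by blast

  \<comment> \<open>The displaced loops and their convergence\<close>
  define A A' C C' where "A \<epsilon> = Complex (X + s1 * \<epsilon>) \<epsilon>" and "A' \<epsilon> = Complex (X' + s2 * \<epsilon>) \<epsilon>"
    and "C \<epsilon> = Complex \<epsilon> (y' + s2 * \<epsilon>)" and "C' \<epsilon> = Complex \<epsilon> (y + s1 * \<epsilon>)" for \<epsilon>
  define J where "J \<epsilon> = (E \<circ> linepath (A \<epsilon>) (A' \<epsilon>)) +++ (\<beta> \<circ> linepath (C \<epsilon>) (C' \<epsilon>))" for \<epsilon>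
  have seg1: "closed_segment (A \<epsilon>) (A' \<epsilon>) = S1 \<epsilon>" if "0 \<le> \<epsilon>" "\<epsilon> < \<epsilon>2" for \<epsilon>
  proof -
    have "X + s1 * \<epsilon> \<le> X' + s2 * \<epsilon>" using that s1(1) s2(1) \<epsilon>2(5) X(1) by auto
    then show ?thesis by (auto simp: A_def A'_def S1_def closed_segment_same_Im closed_segment_eq_real_ivl)
  qed
  have seg2: "closed_segment (C \<epsilon>) (C' \<epsilon>) = S2 \<epsilon>" if "0 \<le> \<epsilon>" "\<epsilon> < \<epsilon>2" for \<epsilon>
  proof -
    have "y + s1 * \<epsilon> \<le> y' + s2 * \<epsilon>" using that s1(1) s2(1) \<epsilon>2(6) y(1) by auto
    then show ?thesis by (auto simp: C_def C'_def S2_def closed_segment_same_Re closed_segment_eq_real_ivl)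
  qed
  \<comment> \<open>Moving up by \<open>\<epsilon>\<close> in the strip changes the height in the
    box by \<open>s1 * \<epsilon>\<close> at \<open>X\<close> and by \<open>s2 * \<epsilon>\<close>
    at \<open>X'\<close>; the shifts of the end points are chosen so that the displaced curves
    meet.\<close>
  have join: "E (A' \<epsilon>) = \<beta> (C \<epsilon>)" "\<beta> (C' \<epsilon>) = E (A \<epsilon>)" if "0 \<le> \<epsilon>" "\<epsilon> < \<epsilon>1 / 2" for \<epsilon>
  proof -
    have "norm (Complex (X' + s2 * \<epsilon>) \<epsilon> - of_real X') \<le> \<epsilon> + \<epsilon>" "norm (Complex (X + s1 * \<epsilon>) \<epsilon> - of_real X) \<le> \<epsilon> + \<epsilon>"
      using cmod_le[of "Complex (X' + s2 * \<epsilon>) \<epsilon> - of_real X'"] cmod_le[of "Complex (X + s1 * \<epsilon>) \<epsilon> - of_real X"] s1(1) s2(1) that(1) by auto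
    then have "norm (Complex (X' + s2 * \<epsilon>) \<epsilon> - of_real X') < \<epsilon>1" "norm (Complex (X + s1 * \<epsilon>) \<epsilon> - of_real X) < \<epsilon>1"
      using that(2) by linarith+
    from c2(1)[OF this(1)] c1(1)[OF this(2)] show "E (A' \<epsilon>) = \<beta> (C \<epsilon>)" "\<beta> (C' \<epsilon>) = E (A \<epsilon>)"
      using s1(1) s2(1) by (auto simp: A_def A'_def C_def C'_def add.commute)
  qed
  have vp1: "valid_path (E \<circ> linepath (A \<epsilon>) (A' \<epsilon>))" "path_image (E \<circ> linepath (A \<epsilon>) (A' \<epsilon>)) = E ` S1 \<epsilon>"
    and vp2: "valid_path (\<beta> \<circ> linepath (C \<epsilon>) (C' \<epsilon>))" "path_image (\<beta> \<circ> linepath (C \<epsilon>) (C' \<epsilon>)) = \<beta> ` S2 \<epsilon>"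
    if "0 \<le> \<epsilon>" "\<epsilon> < \<epsilon>2" for \<epsilon>
    using valid_path_compose_holomorphic[OF valid_path_linepath E(1,2)] S1N[OF that] seg1[OF that]
      valid_path_compose_holomorphic[OF valid_path_linepath fb(2) open_ball] S2B[OF that] seg2[OF that]
    by (auto simp: path_image_compose)
  define \<epsilon>3 where "\<epsilon>3 = min \<epsilon>2 (\<epsilon>1 / 2)"
  have \<epsilon>3: "0 < \<epsilon>3" "\<epsilon>3 \<le> \<epsilon>2" "\<epsilon>3 \<le> \<epsilon>1 / 2" using \<epsilon>2(1) \<epsilon>1(1) by (auto simp: \<epsilon>3_def)
  have Jv: "valid_path (J \<epsilon>)" "path_image (J \<epsilon>) = E ` S1 \<epsilon> \<union> \<beta> ` S2 \<epsilon>" "pathfinish (J \<epsilon>) = pathstart (J \<epsilon>)"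
    if "0 \<le> \<epsilon>" "\<epsilon> < \<epsilon>3" for \<epsilon>
  proof -
    have *: "\<epsilon> < \<epsilon>2" "\<epsilon> < \<epsilon>1 / 2" using that \<epsilon>3 by auto
    have fs: "pathfinish (E \<circ> linepath (A \<epsilon>) (A' \<epsilon>)) = pathstart (\<beta> \<circ> linepath (C \<epsilon>) (C' \<epsilon>))"
      using join(1)[OF that(1) *(2)] by (simp add: pathfinish_compose pathstart_compose)
    show "valid_path (J \<epsilon>)" unfolding J_def by (rule valid_path_join[OF vp1(1) vp2(1) fs]) (use that * in auto)
    show "path_image (J \<epsilon>) = E ` S1 \<epsilon> \<union> \<beta> ` S2 \<epsilon>" unfolding J_def path_image_join[OF fs] 
      using vp1(2)[OF that(1) *(1)] vp2(2)[OF that(1) *(1)] by simp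
    show "pathfinish (J \<epsilon>) = pathstart (J \<epsilon>)"
      using join(2)[OF that(1) *(2)] by (simp add: J_def pathfinish_compose pathstart_compose)
  qed
  have J0im: "path_image (J 0) = J0" using Jv(2)[of 0] \<epsilon>3(1) ES1 by (simp add: J0_def)
  have sp: "simple_path (J 0)"
    unfolding J_def
  proof (rule simple_path_join_loop)
    show "arc (E \<circ> linepath (A 0) (A' 0))"
      unfolding arc_def
    proof
      show "path (E \<circ> linepath (A 0) (A' 0))" using valid_path_imp_path[OF vp1(1)[of 0]] \<epsilon>2(1) by simp
      have "A 0 \<noteq> A' 0" using X(1) by (simp add: A_def A'_def)
      then have "inj_on (linepath (A 0) (A' 0)) {0..1}" using arc_linepath arc_imp_inj_on by (metis arc_def)
      moreover have "inj_on E (linepath (A 0) (A' 0) ` {0..1})"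
      proof (rule inj_onI)
        fix w w' assume "w \<in> linepath (A 0) (A' 0) ` {0..1}" "w' \<in> linepath (A 0) (A' 0) ` {0..1}" and eq: "E w = E w'"
        then have w: "w \<in> S1 0" "w' \<in> S1 0"
          using seg1[of 0] \<epsilon>2(1) path_image_linepath[of "A 0" "A' 0"] by (auto simp: path_image_def)
        then have r: "w = of_real (Re w)" "w' = of_real (Re w')" by (auto simp: S1_def complex_eq_iff)
        have "u (Re w) = u (Re w')" using eq Ereal(1)[of "Re w"] Ereal(1)[of "Re w'"] w r by (simp add: S1_def)
        then have "Re w = Re w'" using inj_onD[OF l(3)] X(2) w by (auto simp: S1_def subset_eq)
        with r show "w = w'" by metis
      qed
      ultimately show "inj_on (E \<circ> linepath (A 0) (A' 0)) {0..1}" by (rule comp_inj_on)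
    qed
    show "arc (\<beta> \<circ> linepath (C 0) (C' 0))"
      unfolding arc_def
    proof
      show "path (\<beta> \<circ> linepath (C 0) (C' 0))" using valid_path_imp_path[OF vp2(1)[of 0]] \<epsilon>2(1) by simp
      have "C 0 \<noteq> C' 0" using y(1) by (simp add: C_def C'_def)
      then have "inj_on (linepath (C 0) (C' 0)) {0..1}" using arc_linepath arc_imp_inj_on by (metis arc_def)
      moreover have "linepath (C 0) (C' 0) ` {0..1} \<subseteq> ball 0 \<rho>"
        using seg2[of 0] S2B[of 0] \<epsilon>2(1) path_image_linepath[of "C 0" "C' 0"] by (auto simp: path_image_def)
      then have "inj_on \<beta> (linepath (C 0) (C' 0) ` {0..1})" using fb(3) inj_on_subset by blast
      ultimately show "inj_on (\<beta> \<circ> linepath (C 0) (C' 0)) {0..1}" by (rule comp_inj_on)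
    qed
    show "pathfinish (E \<circ> linepath (A 0) (A' 0)) = pathstart (\<beta> \<circ> linepath (C 0) (C' 0))"
      "pathfinish (\<beta> \<circ> linepath (C 0) (C' 0)) = pathstart (E \<circ> linepath (A 0) (A' 0))"
      using join[of 0] \<epsilon>1(1) by (simp_all add: pathfinish_compose pathstart_compose)
    show "path_image (E \<circ> linepath (A 0) (A' 0)) \<inter> path_image (\<beta> \<circ> linepath (C 0) (C' 0))
        \<subseteq> {pathstart (E \<circ> linepath (A 0) (A' 0)), pathstart (\<beta> \<circ> linepath (C 0) (C' 0))}"
    proof
      fix z assume "z \<in> path_image (E \<circ> linepath (A 0) (A' 0)) \<inter> path_image (\<beta> \<circ> linepath (C 0) (C' 0))"
      then have "z \<in> u ` {X..X'}" "z \<in> \<beta> ` S2 0" using vp1(2)[of 0] vp2(2)[of 0] \<epsilon>2(1) ES1 by auto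
      then obtain t w where tw: "z = u t" "X \<le> t" "t \<le> X'" "z = \<beta> w" "w \<in> S2 0" by (metis atLeastAtMost_iff imageE)
      have "u t = \<beta> (Complex 0 (Im w))" using tw by (auto simp: S2_def) (metis complex_surj)
      from ends[OF tw(2,3) _ _ this] tw(5) have "t = X \<or> t = X'" by (auto simp: S2_def)
      moreover have "pathstart (E \<circ> linepath (A 0) (A' 0)) = u X"
        using Ereal(1)[of X] X(1) by (simp add: pathstart_compose A_def complex_of_real_def)
      moreover have "pathstart (\<beta> \<circ> linepath (C 0) (C' 0)) = u X'" using uX(2) by (simp add: pathstart_compose C_def)
      ultimately show "z \<in> {pathstart (E \<circ> linepath (A 0) (A' 0)), pathstart (\<beta> \<circ> linepath (C 0) (C' 0))}"
        using tw(1) by auto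
    qed
  qed
  \<comment> \<open>Uniform continuity on the compact rectangle of pairs of displacement and time
    makes the convergence uniform in \<open>t\<close>.\<close>
  have near: "\<exists>d>0. \<forall>\<epsilon> t. 0 \<le> \<epsilon> \<and> \<epsilon> < d \<and> 0 \<le> t \<and> t \<le> 1 \<longrightarrow> norm (F (linepath (P \<epsilon>) (P' \<epsilon>) t) - F (linepath (P 0) (P' 0) t)) < \<kappa>"
    if hyp: "continuous_on S F" "continuous_on UNIV P" "continuous_on UNIV P'" "0 < \<kappa>"
      "\<And>\<epsilon>. 0 \<le> \<epsilon> \<Longrightarrow> \<epsilon> < \<epsilon>2 \<Longrightarrow> closed_segment (P \<epsilon>) (P' \<epsilon>) \<subseteq> S" for S and F :: "complex \<Rightarrow> complex" and P P' :: "real \<Rightarrow> complex" and \<kappa>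
  proof -
    let ?K = "{0..\<epsilon>2/2} \<times> {0..1::real}"
    let ?g = "\<lambda>p. F (linepath (P (fst p)) (P' (fst p)) (snd p))"
    have "continuous_on ?K ?g"
    proof (rule continuous_on_compose2[OF hyp(1)])
      show "continuous_on ?K (\<lambda>p. linepath (P (fst p)) (P' (fst p)) (snd p))"
        unfolding linepath_def
        by (intro continuous_intros continuous_on_compose2[OF hyp(2)] continuous_on_compose2[OF hyp(3)]) auto
      show "(\<lambda>p. linepath (P (fst p)) (P' (fst p)) (snd p)) ` ?K \<subseteq> S"
      proof
        fix z assume "z \<in> (\<lambda>p. linepath (P (fst p)) (P' (fst p)) (snd p)) ` ?K"
        then obtain e t where et: "0 \<le> e" "e \<le> \<epsilon>2/2" "0 \<le> t" "t \<le> 1" "z = linepath (P e) (P' e) t" by auto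
        then have "z \<in> closed_segment (P e) (P' e)" using linepath_in_path[of t "P e" "P' e"] et by simp
        then show "z \<in> S" using hyp(5)[of e] et \<epsilon>2(1) by auto
      qed
    qed
    then have "uniformly_continuous_on ?K ?g" by (intro compact_uniformly_continuous compact_Times compact_Icc)
    then obtain d where d: "d > 0" "\<And>p q. p \<in> ?K \<Longrightarrow> q \<in> ?K \<Longrightarrow> dist q p < d \<Longrightarrow> dist (?g q) (?g p) < \<kappa>"
      unfolding uniformly_continuous_on_def using hyp(4) by metis
    show ?thesis
    proof (intro exI[of _ "min d (\<epsilon>2/2)"] conjI allI impI)
      fix \<epsilon> t :: real assume *: "0 \<le> \<epsilon> \<and> \<epsilon> < min d (\<epsilon>2/2) \<and> 0 \<le> t \<and> t \<le> 1"
      have "dist (\<epsilon>, t) (0, t) < d" using * by (simp add: dist_Pair_Pair)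
      then show "norm (F (linepath (P \<epsilon>) (P' \<epsilon>) t) - F (linepath (P 0) (P' 0) t)) < \<kappa>"
        using d(2)[of "(0, t)" "(\<epsilon>, t)"] * \<epsilon>2(1) by (simp add: dist_norm)
    qed (use d(1) \<epsilon>2(1) in auto)
  qed
  have contEN: "continuous_on NN E" and cont\<beta>B: "continuous_on (ball 0 \<rho>) \<beta>"
    using E(1) fb(2) holomorphic_on_imp_continuous_on by auto
  have contA: "continuous_on UNIV A" "continuous_on UNIV A'" "continuous_on UNIV C" "continuous_on UNIV C'"
    unfolding A_def[abs_def] A'_def[abs_def] C_def[abs_def] C'_def[abs_def] Complex_eq by (intro continuous_intros)+
  have nearJ: "\<exists>d>0. \<forall>\<epsilon> t. 0 \<le> \<epsilon> \<and> \<epsilon> < d \<and> 0 \<le> t \<and> t \<le> 1 \<longrightarrow> norm (J \<epsilon> t - J 0 t) < \<kappa>" if kp: "0 < \<kappa>" for \<kappa>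
  proof -
    obtain d1 where d1: "d1 > 0" "\<And>\<epsilon> t. 0 \<le> \<epsilon> \<and> \<epsilon> < d1 \<and> 0 \<le> t \<and> t \<le> 1 \<Longrightarrow> norm (E (linepath (A \<epsilon>) (A' \<epsilon>) t) - E (linepath (A 0) (A' 0) t)) < \<kappa>"
      using near[OF contEN contA(1,2) kp] S1N seg1 by metis
    obtain d2 where d2: "d2 > 0" "\<And>\<epsilon> t. 0 \<le> \<epsilon> \<and> \<epsilon> < d2 \<and> 0 \<le> t \<and> t \<le> 1 \<Longrightarrow> norm (\<beta> (linepath (C \<epsilon>) (C' \<epsilon>) t) - \<beta> (linepath (C 0) (C' 0) t)) < \<kappa>"
      using near[OF cont\<beta>B contA(3,4) kp] S2B seg2 by metis
    show ?thesis
      by (intro exI[of _ "min d1 d2"]) (use d1 d2 in \<open>auto simp: J_def joinpaths_def\<close>)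
  qed
  have Jclosed: "compact J0" using J0im sp compact_simple_path_image by metis
  have D: "open D" "simply_connected D" "D \<noteq> UNIV"
  proof -
    show "open D" unfolding D_def using Jclosed compact_imp_closed open_inside by blast
    show "simply_connected D" unfolding D_def using simply_connected_inside_simple_path[OF sp] J0im by simp
    show "D \<noteq> UNIV" using bounded_inside[OF compact_imp_bounded[OF Jclosed]] unfolding D_def
      by (metis not_bounded_UNIV)
  qed
  have DJ: "D \<inter> J0 = {}" unfolding D_def by (rule inside_no_overlap)

  \<comment> \<open>The residue and the choice of constants\<close>
  define w0 where "w0 = Complex ((y' - y) / 2) ((y + y') / 2)"
  define R0 where "R0 = (y' - y) / 2"
  define z0 where "z0 = \<beta> w0"
  have R0: "0 < R0" using y(1) by (simp add: R0_def)
  have box: "{w. 0 < Re w \<and> Re w < y' - y \<and> y < Im w \<and> Im w < y'} \<subseteq> ball 0 \<rho>"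
  proof
    fix w assume "w \<in> {w. 0 < Re w \<and> Re w < y' - y \<and> y < Im w \<and> Im w < y'}"
    then have w: "0 < Re w" "Re w < y' - y" "y < Im w" "Im w < y'" by auto
    then have "\<bar>Re w\<bar> < \<rho> / 2" "\<bar>Im w\<bar> < \<rho> / 2" using y fb(1) by (auto simp: abs_if split: if_splits)
    then show "w \<in> ball 0 \<rho>" using cmod_le[of w] by simp
  qed
  have bR: "ball w0 R0 \<subseteq> {w. 0 < Re w \<and> Re w < y' - y \<and> y < Im w \<and> Im w < y'}"
  proof
    fix w assume "w \<in> ball w0 R0"
    then have "\<bar>Re w - (y' - y) / 2\<bar> < R0" "\<bar>Im w - (y + y') / 2\<bar> < R0"
      using abs_Re_le_cmod[of "w - w0"] abs_Im_le_cmod[of "w - w0"] by (auto simp: w0_def dist_norm norm_minus_commute)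
    then show "w \<in> {w. 0 < Re w \<and> Re w < y' - y \<and> y < Im w \<and> Im w < y'}"
      unfolding R0_def by (auto simp: abs_if field_simps split: if_splits)
  qed
  have w0B: "w0 \<in> ball 0 \<rho>" using bR box R0 centre_in_ball by blast
  have "\<beta> ` ball w0 R0 \<subseteq> D" using bR RD by blast
  then have z0D: "z0 \<in> D" unfolding z0_def using R0 by auto
  obtain f1 f2 a0 where f: "f1 holomorphic_on D - {z0}" "f2 holomorphic_on D"
    "\<And>z. z \<in> D - {z0} \<Longrightarrow> f1 z * f2 z = root_poly rs z"
    "\<And>c. c < 1 \<Longrightarrow> \<exists>K. compact K \<and> K \<subseteq> D \<and> z0 \<in> K \<and> (\<forall>z\<in>D - K. c * norm (f1 z) \<le> norm (f2 z) \<and> norm (f2 z) \<le> norm (f1 z))"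
    "\<And>\<gamma>. valid_path \<gamma> \<Longrightarrow> pathfinish \<gamma> = pathstart \<gamma> \<Longrightarrow> path_image \<gamma> \<subseteq> D - {z0} \<Longrightarrow>
       norm (contour_integral \<gamma> f1) = 2 * pi * norm (winding_number \<gamma> z0) * a0 \<and> contour_integral \<gamma> f2 = 0"
    "\<And>h w0 R. h holomorphic_on ball w0 R \<Longrightarrow> h ` ball w0 R \<subseteq> D \<Longrightarrow> h w0 = z0 \<Longrightarrow> 0 < R \<Longrightarrow>
       sqrt (norm (root_poly rs z0)) * norm (deriv h w0) * R \<le> a0"
    by (rule boundary_conjugate_pair[OF D z0D, of rs]) (rule that; assumption)
  have "sqrt (norm (root_poly rs z0)) * norm (deriv \<beta> w0) * R0 \<le> a0"
    by (rule f(6)) (use bR box fb(2) holomorphic_on_subset \<open>\<beta> ` ball w0 R0 \<subseteq> D\<close> R0 in \<open>auto simp: z0_def\<close>)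
  \<comment> \<open>\<open>\<beta>\<close> is isometric for the metric of the differential, so the
    lower bound for \<open>a0\<close> is the radius \<open>R0\<close> itself.\<close>
  moreover have "sqrt (norm (root_poly rs z0)) * norm (deriv \<beta> w0) = 1"
  proof -
    have "norm (- root_poly rs (\<beta> w0) * (deriv \<beta> w0)\<^sup>2) = 1" using fb(4)[OF w0B] by simp
    then have "norm (root_poly rs z0) * (norm (deriv \<beta> w0))\<^sup>2 = 1" by (simp add: z0_def norm_mult norm_power)
    then have "sqrt (norm (root_poly rs z0) * (norm (deriv \<beta> w0))\<^sup>2) = 1" by simp
    then show ?thesis by (simp add: real_sqrt_mult)
  qed
  ultimately have a0: "R0 \<le> a0" by simp
  define \<Lambda> where "\<Lambda> = X' - X + 2"
  have \<Lambda>: "\<Lambda> > 2" using X(1) by (simp add: \<Lambda>_def)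
  \<comment> \<open>The value \<open>9/25\<close> makes \<open>sqrt c \<ge> 4/5\<close>, so that
    \<open>f1\<close> has natural modulus at most \<open>5/4\<close> on the transversal. The other
    term keeps the share \<open>2 * (1 - c) * \<Lambda>\<close> of the leaf at most
    \<open>R0 / 2\<close>, where \<open>\<Lambda>\<close> bounds the length of the displaced
    leaf.\<close>
  define c where "c = 1 - min (9/25) (R0 / (4 * \<Lambda>))"
  have c: "16/25 \<le> c" "c < 1" "(1 - c) * (4 * \<Lambda>) \<le> R0"
  proof -
    show "16/25 \<le> c" "c < 1" using R0 \<Lambda> by (auto simp: c_def min_def field_simps)
    have "(1 - c) * (4 * \<Lambda>) \<le> R0 / (4 * \<Lambda>) * (4 * \<Lambda>)" unfolding c_def using \<Lambda> by (intro mult_right_mono) auto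
    then show "(1 - c) * (4 * \<Lambda>) \<le> R0" using \<Lambda> by simp
  qed
  have "4/5 \<le> sqrt c" using c by (intro real_le_rsqrt) (simp add: power2_eq_square)
  then have sc: "inverse (sqrt c) \<le> 5/4" using le_imp_inverse_le[of "4/5" "sqrt c"] by simp
  obtain K where K: "compact K" "K \<subseteq> D" "z0 \<in> K" "\<And>z. z \<in> D - K \<Longrightarrow> c * norm (f1 z) \<le> norm (f2 z) \<and> norm (f2 z) \<le> norm (f1 z)"
    using f(4)[OF c(2)] by blast
  have "K \<inter> J0 = {}" using K(2) DJ by blast
  \<comment> \<open>A loop uniformly closer than \<open>\<kappa>\<close> to the original one stays
    outside \<open>K\<close>, where the moduli are comparable, and has the same winding number about
    \<open>z0\<close>.\<close>
  then obtain \<kappa> where \<kappa>: "\<kappa> > 0" "\<And>p q. p \<in> K \<Longrightarrow> q \<in> J0 \<Longrightarrow> \<kappa> \<le> dist p q"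
    using separate_compact_closed[OF K(1) compact_imp_closed[OF Jclosed]] by metis
  obtain \<delta>2 where \<delta>2: "\<delta>2 > 0" "\<And>\<epsilon> t. 0 \<le> \<epsilon> \<and> \<epsilon> < \<delta>2 \<and> 0 \<le> t \<and> t \<le> 1 \<Longrightarrow> norm (J \<epsilon> t - J 0 t) < \<kappa>"
    using nearJ[OF \<kappa>(1)] by metis
  define \<epsilon> where "\<epsilon> = min (min \<delta>1 \<delta>2) \<epsilon>3 / 2"
  have \<epsilon>: "0 < \<epsilon>" "\<epsilon> < \<delta>1" "\<epsilon> < \<delta>2" "\<epsilon> < \<epsilon>3" "\<epsilon> < \<epsilon>2"
    using \<delta>1(1) \<delta>2(1) \<epsilon>3 by (auto simp: \<epsilon>_def)
  note Je = Jv[OF less_imp_le[OF \<epsilon>(1)] \<epsilon>(4)]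
  \<comment> \<open>It is not necessary to tell which side of the leaf is inside: the displaced loop
    is connected, misses \<open>J0\<close> and has the point \<open>\<beta> w1\<close> in
    \<open>D\<close>.\<close>
  have JD: "path_image (J \<epsilon>) \<subseteq> D"
  proof
    fix z assume z: "z \<in> path_image (J \<epsilon>)"
    define w1 where "w1 = Complex \<epsilon> ((y + y') / 2)"
    have "w1 \<in> S2 \<epsilon>" using \<epsilon> \<epsilon>2(6) s1(1) s2(1) y(1) by (auto simp: S2_def w1_def field_simps)
    then have w1: "\<beta> w1 \<in> path_image (J \<epsilon>)" unfolding Je(2) by blast
    have "w1 \<in> {w. 0 < Re w \<and> Re w < y' - y \<and> y < Im w \<and> Im w < y'}"
      using \<epsilon> \<epsilon>2(6) y(1) by (auto simp: w1_def)
    then have "\<beta> w1 \<in> D" using RD by blast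
    moreover have "connected_component (- J0) (\<beta> w1) z"
      unfolding connected_component_def
    proof (intro exI conjI)
      show "connected (path_image (J \<epsilon>))" by (rule connected_path_image[OF valid_path_imp_path[OF Je(1)]])
      show "path_image (J \<epsilon>) \<subseteq> - J0" using \<delta>1(2)[OF \<epsilon>(1,2)] unfolding Je(2) by blast
    qed (fact w1 z)+
    ultimately show "z \<in> D" unfolding D_def using inside_same_component by blast
  qed
  have JK: "path_image (J \<epsilon>) \<inter> K = {}"
  proof -
    have "J \<epsilon> t \<notin> K" if "0 \<le> t" "t \<le> 1" for t
    proof
      assume "J \<epsilon> t \<in> K"
      moreover have "J 0 t \<in> J0" using J0im that by (auto simp: path_image_def)
      ultimately have "\<kappa> \<le> norm (J \<epsilon> t - J 0 t)" using \<kappa>(2) by (simp add: dist_norm)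
      then show False using \<delta>2(2)[of \<epsilon> t] \<epsilon> that by auto
    qed
    then show ?thesis by (auto simp: path_image_def)
  qed
  have Jz: "path_image (J \<epsilon>) \<subseteq> D - {z0}" using JD JK K(3) by blast
  have "winding_number (J \<epsilon>) z0 = winding_number (J 0) z0"
  proof (rule winding_number_nearby_loops_eq)
    fix t :: real assume t: "t \<in> {0..1}"
    then have "J 0 t \<in> J0" using J0im by (auto simp: path_image_def)
    then have "\<kappa> \<le> norm (J 0 t - z0)" using \<kappa>(2)[OF K(3)] by (metis dist_commute dist_norm)
    moreover have "norm (J \<epsilon> t - J 0 t) < \<kappa>" using \<delta>2(2)[of \<epsilon> t] \<epsilon> t by auto
    ultimately show "norm (J \<epsilon> t - J 0 t) < norm (J 0 t - z0)" by linarith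
  qed (use Je Jv[of 0] \<epsilon>3(1) valid_path_imp_path in auto)
  moreover have "norm (winding_number (J 0) z0) = 1"
    using simple_closed_path_winding_number_inside[OF sp] z0D J0im
    unfolding D_def by (metis norm_minus_cancel norm_one)
  ultimately have I1: "norm (contour_integral (J \<epsilon>) f1) = 2 * pi * a0" and I2: "contour_integral (J \<epsilon>) f2 = 0"
    using f(5)[OF Je(1) Je(3) Jz] by auto

  \<comment> \<open>Integrals over the displaced loop\<close>
  have int: "contour_integral (J \<epsilon>) g = contour_integral (linepath (A \<epsilon>) (A' \<epsilon>)) (\<lambda>w. deriv E w * g (E w))
      + contour_integral (linepath (C \<epsilon>) (C' \<epsilon>)) (\<lambda>w. deriv \<beta> w * g (\<beta> w))"
    if g: "g holomorphic_on D - {z0}" for g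
  proof -
    have oD: "open (D - {z0})" using D(1) by (simp add: open_delete)
    note v1 = vp1[OF less_imp_le[OF \<epsilon>(1)] \<epsilon>(5)] and v2 = vp2[OF less_imp_le[OF \<epsilon>(1)] \<epsilon>(5)]
    have "contour_integral (J \<epsilon>) g = contour_integral (E \<circ> linepath (A \<epsilon>) (A' \<epsilon>)) g + contour_integral (\<beta> \<circ> linepath (C \<epsilon>) (C' \<epsilon>)) g"
      unfolding J_def
      by (rule contour_integral_join)
         (use contour_integrable_holomorphic_simple[OF g oD] v1 v2 Jz Je(2) in auto)
    also have "contour_integral (E \<circ> linepath (A \<epsilon>) (A' \<epsilon>)) g = contour_integral (linepath (A \<epsilon>) (A' \<epsilon>)) (\<lambda>w. deriv E w * g (E w))"
      by (rule contour_integral_comp_analyticW[of _ NN])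
         (use E(1,2) S1N[OF less_imp_le[OF \<epsilon>(1)] \<epsilon>(5)] seg1[OF less_imp_le[OF \<epsilon>(1)] \<epsilon>(5)] in \<open>auto simp: analytic_on_open\<close>)
    also have "contour_integral (\<beta> \<circ> linepath (C \<epsilon>) (C' \<epsilon>)) g = contour_integral (linepath (C \<epsilon>) (C' \<epsilon>)) (\<lambda>w. deriv \<beta> w * g (\<beta> w))"
      by (rule contour_integral_comp_analyticW[of _ "ball 0 \<rho>"])
         (use fb(2) S2B[OF less_imp_le[OF \<epsilon>(1)] \<epsilon>(5)] seg2[OF less_imp_le[OF \<epsilon>(1)] \<epsilon>(5)] in \<open>auto simp: analytic_on_open\<close>)
    finally show ?thesis .
  qed
  have f2': "f2 holomorphic_on D - {z0}" using f(2) holomorphic_on_subset by blast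
  have im1: "E ` S1 \<epsilon> \<subseteq> D - {z0}" "E ` S1 \<epsilon> \<subseteq> D - K" and im2: "\<beta> ` S2 \<epsilon> \<subseteq> D - {z0}" "\<beta> ` S2 \<epsilon> \<subseteq> D - K"
    using Jz JK JD Je(2) by auto
  note s1N = S1N[OF less_imp_le[OF \<epsilon>(1)] \<epsilon>(5)] and s2B = S2B[OF less_imp_le[OF \<epsilon>(1)] \<epsilon>(5)]
  note sg1 = seg1[OF less_imp_le[OF \<epsilon>(1)] \<epsilon>(5)] and sg2 = seg2[OF less_imp_le[OF \<epsilon>(1)] \<epsilon>(5)]
  have ct1: "continuous_on (S1 \<epsilon>) (\<lambda>w. deriv E w * g (E w))" if "g holomorphic_on D - {z0}" for g
    by (intro continuous_intros continuous_on_compose2[OF holomorphic_on_imp_continuous_on[OF that]])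
       (use s1N im1 holomorphic_deriv[OF E(1,2)] contEN in \<open>auto intro: continuous_on_subset holomorphic_on_imp_continuous_on\<close>)
  have ct2: "continuous_on (S2 \<epsilon>) (\<lambda>w. deriv \<beta> w * g (\<beta> w))" if "g holomorphic_on D - {z0}" for g
    by (intro continuous_intros continuous_on_compose2[OF holomorphic_on_imp_continuous_on[OF that]])
       (use s2B im2 holomorphic_deriv[OF fb(2) open_ball] cont\<beta>B in \<open>auto intro: continuous_on_subset holomorphic_on_imp_continuous_on\<close>)
  have pr1: "deriv E w * f1 (E w) * (deriv E w * f2 (E w)) = -1" if "w \<in> S1 \<epsilon>" for w
  proof -
    have "f1 (E w) * f2 (E w) = root_poly rs (E w)" using f(3) im1(1) that by blast
    moreover have "- root_poly rs (E w) * (deriv E w)\<^sup>2 = 1" using E(4) s1N that by blast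
    moreover have "deriv E w * f1 (E w) * (deriv E w * f2 (E w)) = - (- (f1 (E w) * f2 (E w)) * (deriv E w)\<^sup>2)"
      by (simp add: power2_eq_square)
    ultimately show ?thesis by simp
  qed
  have pr2: "deriv \<beta> w * f1 (\<beta> w) * (deriv \<beta> w * f2 (\<beta> w)) = -1" if "w \<in> S2 \<epsilon>" for w
  proof -
    have "f1 (\<beta> w) * f2 (\<beta> w) = root_poly rs (\<beta> w)" using f(3) im2(1) that by blast
    moreover have "- root_poly rs (\<beta> w) * (deriv \<beta> w)\<^sup>2 = 1" using fb(4) s2B that by blast
    moreover have "deriv \<beta> w * f1 (\<beta> w) * (deriv \<beta> w * f2 (\<beta> w)) = - (- (f1 (\<beta> w) * f2 (\<beta> w)) * (deriv \<beta> w)\<^sup>2)"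
      by (simp add: power2_eq_square)
    ultimately show ?thesis by simp
  qed
  have rt1: "c * norm (deriv E w * f1 (E w)) \<le> norm (deriv E w * f2 (E w))" "norm (deriv E w * f2 (E w)) \<le> norm (deriv E w * f1 (E w))"
    if "w \<in> S1 \<epsilon>" for w
  proof -
    have "c * norm (f1 (E w)) \<le> norm (f2 (E w))" "norm (f2 (E w)) \<le> norm (f1 (E w))" using K(4)[of "E w"] im1(2) that by auto
    from this[THEN mult_left_mono[OF _ norm_ge_zero[of "deriv E w"]]]
    show "c * norm (deriv E w * f1 (E w)) \<le> norm (deriv E w * f2 (E w))" "norm (deriv E w * f2 (E w)) \<le> norm (deriv E w * f1 (E w))"
      by (simp_all add: norm_mult mult.left_commute)
  qed
  have rt2: "c * norm (deriv \<beta> w * f1 (\<beta> w)) \<le> norm (deriv \<beta> w * f2 (\<beta> w))" "norm (deriv \<beta> w * f2 (\<beta> w)) \<le> norm (deriv \<beta> w * f1 (\<beta> w))"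
    if "w \<in> S2 \<epsilon>" for w
  proof -
    have "c * norm (f1 (\<beta> w)) \<le> norm (f2 (\<beta> w))" "norm (f2 (\<beta> w)) \<le> norm (f1 (\<beta> w))" using K(4)[of "\<beta> w"] im2(2) that by auto
    from this[THEN mult_left_mono[OF _ norm_ge_zero[of "deriv \<beta> w"]]]
    show "c * norm (deriv \<beta> w * f1 (\<beta> w)) \<le> norm (deriv \<beta> w * f2 (\<beta> w))" "norm (deriv \<beta> w * f2 (\<beta> w)) \<le> norm (deriv \<beta> w * f1 (\<beta> w))"
      by (simp_all add: norm_mult mult.left_commute)
  qed
  have c4: "1/4 \<le> c" "c \<le> 1" using c by auto
  define F1 F2 where "F1 = contour_integral (linepath (A \<epsilon>) (A' \<epsilon>)) (\<lambda>w. deriv E w * f1 (E w))"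
    and "F2 = contour_integral (linepath (A \<epsilon>) (A' \<epsilon>)) (\<lambda>w. deriv E w * f2 (E w))"
  define G1 G2 where "G1 = contour_integral (linepath (C \<epsilon>) (C' \<epsilon>)) (\<lambda>w. deriv \<beta> w * f1 (\<beta> w))"
    and "G2 = contour_integral (linepath (C \<epsilon>) (C' \<epsilon>)) (\<lambda>w. deriv \<beta> w * f2 (\<beta> w))"
  have "norm (F1 + cnj F2) \<le> 2 * (1 - c) * norm (A' \<epsilon> - A \<epsilon>)"
    unfolding F1_def F2_def
  proof (rule contour_integral_linepath_cnj)
    show "norm (deriv E w * f1 (E w) + cnj (deriv E w * f2 (E w))) \<le> 2 * (1 - c)" if "w \<in> closed_segment (A \<epsilon>) (A' \<epsilon>)" for w
      using norm_add_cnj_pair(1)[OF pr1 rt1 c4] that sg1 by simp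
    show "A' \<epsilon> - A \<epsilon> \<in> \<real>" by (simp add: A_def A'_def complex_is_Real_iff)
  qed (use ct1 f(1) f2' sg1 c in auto)
  moreover have "norm (A' \<epsilon> - A \<epsilon>) \<le> \<Lambda>"
    using cmod_le[of "A' \<epsilon> - A \<epsilon>"] \<epsilon> \<epsilon>2(2,5) s1(1) s2(1) X(1) by (auto simp: A_def A'_def \<Lambda>_def)
  ultimately have b1: "norm (F1 + cnj F2) \<le> 2 * (1 - c) * \<Lambda>"
    using c(2) by (smt (verit, best) mult_left_mono)
  have g1: "norm G1 \<le> inverse (sqrt c) * norm (C' \<epsilon> - C \<epsilon>)"
    unfolding G1_def
    by (rule contour_integral_bound_linepath)
       (use ct2[OF f(1)] sg2 c norm_add_cnj_pair(2)[OF pr2 rt2 c4] in \<open>auto intro: contour_integrable_continuous_linepath\<close>)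
  have g2: "norm G2 \<le> 1 * norm (C' \<epsilon> - C \<epsilon>)"
    unfolding G2_def
    by (rule contour_integral_bound_linepath)
       (use ct2[OF f2'] sg2 c norm_add_cnj_pair(3)[OF pr2 rt2 c4] in \<open>auto intro: contour_integrable_continuous_linepath\<close>)
  have nC: "norm (C' \<epsilon> - C \<epsilon>) \<le> 2 * R0 + R0 / 4"
    using cmod_le[of "C' \<epsilon> - C \<epsilon>"] \<epsilon> \<epsilon>2(6) s1(1) s2(1) y(1) by (auto simp: C_def C'_def R0_def field_simps)
  have "inverse (sqrt c) * norm (C' \<epsilon> - C \<epsilon>) \<le> 5/4 * (2 * R0 + R0 / 4)"
    using sc nC R0 by (intro mult_mono) auto
  from order_trans[OF g1 this] g2 nC have b2: "norm G1 + norm G2 \<le> 9/4 * (2 * R0 + R0 / 4)" by simp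
  \<comment> \<open>The integral of \<open>f2\<close> vanishes, so its conjugate may be added; on
    the leaf this produces the small sum \<open>F1 + cnj F2\<close>. In total at most
    \<open>(1/2 + 81/16) * R0 < 6 * R0\<close> is available, against
    \<open>2 * pi * a0 \<ge> 2 * pi * R0\<close>.\<close>
  have "contour_integral (J \<epsilon>) f1 + cnj (contour_integral (J \<epsilon>) f2) = (F1 + cnj F2) + G1 + cnj G2"
    unfolding int[OF f(1)] int[OF f2'] F1_def F2_def G1_def G2_def by simp
  then have "2 * pi * a0 = norm ((F1 + cnj F2) + G1 + cnj G2)" using I1 I2 by simp
  also have "\<dots> \<le> norm (F1 + cnj F2) + norm G1 + norm G2"
    by (metis add_mono complex_mod_cnj norm_triangle_ineq norm_triangle_mono order_refl)
  also have "\<dots> \<le> R0 / 2 + 9/4 * (2 * R0 + R0 / 4)"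
  proof -
    have "2 * (1 - c) * \<Lambda> = (1 - c) * (4 * \<Lambda>) / 2" by simp
    with b1 b2 c(3) show ?thesis by linarith
  qed
  also have "\<dots> < 6 * R0" using R0 by simp
  also have "\<dots> \<le> 2 * pi * a0" using pi_gt3 a0 R0 by (intro mult_mono) auto
  finally show False by simp
qed

text \<open>The transversal lies on the frontier of the inside of the loop, so inside points occur
  arbitrarily near its midpoint, on one of its two sides. The square on that side misses the loop
  and is therefore inside altogether. If it is the left one, the half turn of the box together with
  reversal of the leaf brings it to the right.\<close>

lemma no_return_ordered:
  assumes L: "leaf rs I u" and B: "flow_box rs \<rho> \<beta>"
    and X: "X < X'" "{X..X'} \<subseteq> I" and y: "y < y'" "\<bar>y\<bar> \<le> \<rho> / 4" "\<bar>y'\<bar> \<le> \<rho> / 4"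
    and uX: "u X = \<beta> (Complex 0 y)" "u X' = \<beta> (Complex 0 y')"
    and nc: "\<And>x v. X < x \<Longrightarrow> x < X' \<Longrightarrow> y \<le> v \<Longrightarrow> v \<le> y' \<Longrightarrow> u x \<noteq> \<beta> (Complex 0 v)"
  shows False
proof -
  note l = leafD[OF L] and fb = flow_boxD[OF B]
  define S where "S = {w. Re w = 0 \<and> y \<le> Im w \<and> Im w \<le> y'}"
  define J0 where "J0 = u ` {X..X'} \<union> \<beta> ` S"
  have inj\<beta>: "w = w'" if "\<beta> w = \<beta> w'" "w \<in> ball 0 \<rho>" "w' \<in> ball 0 \<rho>" for w w'
    using inj_onD[OF fb(3)] that by blast
  have cyB: "Complex 0 v \<in> ball 0 \<rho>" if "\<bar>v\<bar> \<le> \<rho> / 4" for v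
    using that fb(1) by (simp add: cmod_def)
  have SB: "S \<subseteq> ball 0 \<rho>"
  proof
    fix w assume "w \<in> S"
    then have "w = Complex 0 (Im w)" "\<bar>Im w\<bar> \<le> \<rho> / 4" using y by (auto simp: S_def complex_eq_iff)
    then show "w \<in> ball 0 \<rho>" using cyB by metis
  qed
  have seg: "closed_segment (Complex 0 y') (Complex 0 y) = S"
    using y(1) by (auto simp: S_def closed_segment_same_Re closed_segment_eq_real_ivl)
  define p where "p = (u \<circ> linepath X X') +++ (\<beta> \<circ> linepath (Complex 0 y') (Complex 0 y))"
  have lp: "linepath X X' ` {0..1} = {X..X'}"
    using path_image_linepath[of X X'] X(1) by (simp add: path_image_def closed_segment_eq_real_ivl)
  have lq: "linepath (Complex 0 y') (Complex 0 y) ` {0..1} = S"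
    using path_image_linepath[of "Complex 0 y'" "Complex 0 y"] seg by (simp add: path_image_def)
  have im: "path_image (u \<circ> linepath X X') = u ` {X..X'}" "path_image (\<beta> \<circ> linepath (Complex 0 y') (Complex 0 y)) = \<beta> ` S"
    unfolding path_image_def image_comp[symmetric] lp lq by auto
  have sp: "simple_path p" "path_image p = J0" "pathfinish p = pathstart p"
  proof -
    have contu: "continuous_on I u" using l(7) continuous_at_imp_continuous_on by blast
    have cont\<beta>: "continuous_on (ball 0 \<rho>) \<beta>" using fb(2) holomorphic_on_imp_continuous_on by blast
    have a1: "arc (u \<circ> linepath X X')"
      unfolding arc_def path_def
    proof
      show "continuous_on {0..1} (u \<circ> linepath X X')"
        by (rule continuous_on_compose) (unfold lp, auto intro: continuous_on_subset[OF contu X(2)])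
      have i1: "inj_on (linepath X X') {0..1}" using arc_linepath[of X X'] X(1) by (simp add: arc_def)
      have i2: "inj_on u (linepath X X' ` {0..1})" unfolding lp by (rule inj_on_subset[OF l(3) X(2)])
      show "inj_on (u \<circ> linepath X X') {0..1}" by (rule comp_inj_on[OF i1 i2])
    qed
    have a2: "arc (\<beta> \<circ> linepath (Complex 0 y') (Complex 0 y))"
      unfolding arc_def path_def
    proof
      show "continuous_on {0..1} (\<beta> \<circ> linepath (Complex 0 y') (Complex 0 y))"
        by (rule continuous_on_compose) (unfold lq, auto intro: continuous_on_subset[OF cont\<beta> SB])
      have i1: "inj_on (linepath (Complex 0 y') (Complex 0 y)) {0..1}"
        using arc_linepath[of "Complex 0 y'" "Complex 0 y"] y(1) by (simp add: arc_def)
      have i2: "inj_on \<beta> (linepath (Complex 0 y') (Complex 0 y) ` {0..1})" unfolding lq by (rule inj_on_subset[OF fb(3) SB])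
      show "inj_on (\<beta> \<circ> linepath (Complex 0 y') (Complex 0 y)) {0..1}" by (rule comp_inj_on[OF i1 i2])
    qed
    have e: "pathfinish (u \<circ> linepath X X') = pathstart (\<beta> \<circ> linepath (Complex 0 y') (Complex 0 y))"
        "pathfinish (\<beta> \<circ> linepath (Complex 0 y') (Complex 0 y)) = pathstart (u \<circ> linepath X X')"
      using uX by (simp_all add: pathfinish_compose pathstart_compose)
    show "simple_path p" unfolding p_def
    proof (rule simple_path_join_loop[OF a1 a2 e])
      show "path_image (u \<circ> linepath X X') \<inter> path_image (\<beta> \<circ> linepath (Complex 0 y') (Complex 0 y))
          \<subseteq> {pathstart (u \<circ> linepath X X'), pathstart (\<beta> \<circ> linepath (Complex 0 y') (Complex 0 y))}"
      proof
        fix z assume "z \<in> path_image (u \<circ> linepath X X') \<inter> path_image (\<beta> \<circ> linepath (Complex 0 y') (Complex 0 y))"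
        then obtain t w where tw: "t \<in> {X..X'}" "z = u t" "w \<in> S" "z = \<beta> w" unfolding im by blast
        have "w = Complex 0 (Im w)" using tw(3) by (simp add: S_def complex_eq_iff)
        then have "u t = \<beta> (Complex 0 (Im w))" using tw by metis
        then have "\<not> (X < t \<and> t < X')" using nc[of t "Im w"] tw(3) by (auto simp: S_def)
        then have "t = X \<or> t = X'" using tw(1) by auto
        then show "z \<in> {pathstart (u \<circ> linepath X X'), pathstart (\<beta> \<circ> linepath (Complex 0 y') (Complex 0 y))}"
          using tw(2) uX by (auto simp: pathstart_compose)
      qed
    qed
    show "path_image p = J0" unfolding p_def path_image_join[OF e(1)] im J0_def ..
    show "pathfinish p = pathstart p" unfolding p_def using e(2) by simp
  qed
  \<comment> \<open>A leaf point in one of these squares can be followed along its chord to the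
    transversal, which it meets at time \<open>x0\<close> at a height strictly between
    \<open>y\<close> and \<open>y'\<close>. If \<open>x0\<close> lies between \<open>X\<close> and
    \<open>X'\<close>, this is a forbidden crossing; otherwise \<open>X\<close> or \<open>X'\<close>
    is passed on the same chord, which their heights exclude.\<close>
  have disj: "\<beta> w \<notin> J0" if w: "Re w \<noteq> 0" "\<bar>Re w\<bar> < y' - y" "y < Im w" "Im w < y'" for w
  proof
    have "\<bar>Re w\<bar> < \<rho> / 2" "\<bar>Im w\<bar> < \<rho> / 2" using w y by linarith+
    then have wB: "w \<in> ball 0 \<rho>" using cmod_le[of w] by simp
    assume "\<beta> w \<in> J0"
    then consider x where "x \<in> {X..X'}" "\<beta> w = u x" | w' where "w' \<in> S" "\<beta> w = \<beta> w'" unfolding J0_def by blast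
    then show False
    proof cases
      case 2
      have "w = w'" by (rule inj\<beta>[OF 2(2) wB]) (use 2(1) SB in blast)
      then show False using 2(1) w(1) by (simp add: S_def)
    next
      case 1
      then have xI: "x \<in> I" using X(2) by blast
      obtain s :: real where s: "s \<in> {1, -1}"
        "\<And>\<tau>. w + of_real \<tau> \<in> ball 0 \<rho> \<Longrightarrow> x + s * \<tau> \<in> I \<and> u (x + s * \<tau>) = \<beta> (w + of_real \<tau>)"
        by (rule leaf_flow[OF L B xI 1(2)[symmetric] wB]) (rule that; assumption)
      have flow: "u (x + s * \<tau>) = \<beta> (w + of_real \<tau>)" "w + of_real \<tau> \<in> ball 0 \<rho>" if "\<bar>Re w + \<tau>\<bar> \<le> \<bar>Re w\<bar>" for \<tau>
      proof -
        have "norm (w + of_real \<tau>) \<le> norm w"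
          using that by (auto simp: cmod_def intro!: real_sqrt_le_mono abs_le_square_iff[THEN iffD1])
        then show *: "w + of_real \<tau> \<in> ball 0 \<rho>" using wB by simp
        show "u (x + s * \<tau>) = \<beta> (w + of_real \<tau>)" using s(2)[OF *] by blast
      qed
      define x0 where "x0 = x + s * (- Re w)"
      have e0: "w + of_real (- Re w) = Complex 0 (Im w)" by (simp add: complex_eq_iff)
      have x0: "u x0 = \<beta> (Complex 0 (Im w))" using flow(1)[of "- Re w"] unfolding x0_def e0 by simp
      have n0: "Complex 0 (Im w) \<in> ball 0 \<rho>" using flow(2)[of "- Re w"] unfolding e0 by simp
      have notX: "x0 \<noteq> X" "x0 \<noteq> X'"
        using inj\<beta>[OF _ n0 cyB[OF y(2)]] inj\<beta>[OF _ n0 cyB[OF y(3)]] x0 uX w by (metis complex.sel(2) less_irrefl)+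
      have hit: False if Z: "Z \<in> {X, X'}" "\<bar>Z - x\<bar> \<le> \<bar>x0 - x\<bar>" "(Z - x) * (x0 - x) \<ge> 0" for Z
      proof -
        define \<tau> where "\<tau> = s * (Z - x)"
        have xx: "x0 - x = - s * Re w" "Z = x + s * \<tau>" using s(1) by (auto simp: x0_def \<tau>_def)
        have "\<bar>\<tau>\<bar> = \<bar>Z - x\<bar>" "\<bar>x0 - x\<bar> = \<bar>Re w\<bar>" using s(1) xx(1) by (auto simp: \<tau>_def)
        then have "\<bar>\<tau>\<bar> \<le> \<bar>Re w\<bar>" using Z(2) by simp
        moreover have "(Z - x) * (x0 - x) = - (\<tau> * Re w)" by (simp add: xx(1) \<tau>_def)
        then have "\<tau> * Re w \<le> 0" using Z(3) by simp
        ultimately have le: "\<bar>Re w + \<tau>\<bar> \<le> \<bar>Re w\<bar>" by (auto simp: mult_le_0_iff abs_if split: if_splits)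
        have "u Z = \<beta> (w + of_real \<tau>)" using flow(1)[OF le] xx(2) by simp
        moreover obtain v where v: "u Z = \<beta> (Complex 0 v)" "\<bar>v\<bar> \<le> \<rho> / 4" using Z(1) uX y by auto
        ultimately have "w + of_real \<tau> = Complex 0 v" using inj\<beta>[OF _ flow(2)[OF le] cyB[OF v(2)]] by metis
        then have "\<tau> = - Re w" by (auto simp: complex_eq_iff)
        then have "Z = x0" using xx(2) by (simp add: x0_def)
        then show False using Z(1) notX by auto
      qed
      consider "x0 < X" | "X' < x0" | "X < x0" "x0 < X'" using notX by linarith
      then show False
      proof cases
        case a: 1
        show False by (rule hit[of X]) (use a 1(1) in \<open>auto simp: mult_nonpos_nonpos\<close>)
      next
        case a: 2
        show False by (rule hit[of X']) (use a 1(1) in auto)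
      next
        case 3
        then show False using nc[of x0 "Im w"] w x0 by auto
      qed
    qed
  qed
  define m where "m = Complex 0 ((y + y') / 2)"
  define V where "V = ball m ((y' - y) / 2)"
  have V: "\<bar>Re w\<bar> < y' - y" "y < Im w" "Im w < y'" if "w \<in> V" for w
  proof -
    have "\<bar>Re w\<bar> < (y' - y) / 2" "\<bar>Im w - (y + y') / 2\<bar> < (y' - y) / 2"
      using that abs_Re_le_cmod[of "w - m"] abs_Im_le_cmod[of "w - m"]
      by (auto simp: V_def m_def dist_norm norm_minus_commute)
    moreover from this have "Im w - (y + y') / 2 < (y' - y) / 2" "- ((y' - y) / 2) < Im w - (y + y') / 2" by linarith+
    ultimately show "\<bar>Re w\<bar> < y' - y" "y < Im w" "Im w < y'" using y(1) by (auto simp: field_simps)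
  qed
  have VB: "V \<subseteq> ball 0 \<rho>"
  proof
    fix w assume "w \<in> V"
    have "\<bar>Re w\<bar> < \<rho> / 2" "\<bar>Im w\<bar> < \<rho> / 2" using V[OF \<open>w \<in> V\<close>] y by linarith+
    then show "w \<in> ball 0 \<rho>" using cmod_le[of w] by simp
  qed
  have mV: "m \<in> V" using y(1) by (simp add: V_def)
  have "m \<in> S" using y(1) by (simp add: S_def m_def)
  then have "\<beta> m \<in> frontier (inside J0)"
    using Jordan_inside_outside[OF sp(1,3)] sp(2) by (auto simp: J0_def)
  then have cl: "\<beta> m \<in> closure (inside J0)" by (simp add: frontier_def)
  have "open (\<beta> ` V)"
    using open_mapping_thm3[of \<beta> V] fb(2,3) VB unfolding V_def
    by (metis holomorphic_on_subset inj_on_subset open_ball)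
  then obtain w where w: "w \<in> V" "\<beta> w \<in> inside J0"
    using cl mV open_Int_closure_eq_empty[of "\<beta> ` V" "inside J0"] by blast
  have "Re w \<noteq> 0"
  proof
    assume "Re w = 0"
    then have "\<beta> w \<in> J0" using V[OF w(1)] by (auto simp: J0_def S_def)
    then show False using w(2) inside_no_overlap[of J0] by blast
  qed
  have spread: "\<beta> ` R \<subseteq> inside J0" if R: "convex R" "w \<in> R" "\<And>z. z \<in> R \<Longrightarrow> Re z \<noteq> 0 \<and> \<bar>Re z\<bar> < y' - y \<and> y < Im z \<and> Im z < y'" for R
  proof
    fix z assume "z \<in> \<beta> ` R"
    have "R \<subseteq> ball 0 \<rho>"
    proof
      fix z assume "z \<in> R"
      then have "\<bar>Re z\<bar> < \<rho> / 2" "\<bar>Im z\<bar> < \<rho> / 2" using R(3)[of z] y by linarith+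
      then show "z \<in> ball 0 \<rho>" using cmod_le[of z] by simp
    qed
    then have "connected (\<beta> ` R)"
      using fb(2) holomorphic_on_imp_continuous_on R(1)
      by (intro connected_continuous_image convex_connected) (auto intro: continuous_on_subset)
    moreover have "\<beta> ` R \<subseteq> - J0" using disj R(3) by blast
    ultimately have "connected_component (- J0) (\<beta> w) z"
      unfolding connected_component_def using R(2) \<open>z \<in> \<beta> ` R\<close> by blast
    then show "z \<in> inside J0" using w(2) inside_same_component by blast
  qed
  from \<open>Re w \<noteq> 0\<close> consider "0 < Re w" | "Re w < 0" by linarith
  then show False
  proof cases
    case 1
    have "\<beta> ` {w. 0 < Re w \<and> Re w < y' - y \<and> y < Im w \<and> Im w < y'} \<subseteq> inside J0"
    proof (rule spread)
      have "{w. 0 < Re w \<and> Re w < y' - y \<and> y < Im w \<and> Im w < y'} = {w. 0 < Re w} \<inter> {w. Re w < y' - y} \<inter> {w. y < Im w} \<inter> {w. Im w < y'}" by auto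
      then show "convex {w. 0 < Re w \<and> Re w < y' - y \<and> y < Im w \<and> Im w < y'}"
        by (simp add: convex_Int convex_halfspace_Re_gt convex_halfspace_Re_lt convex_halfspace_Im_gt convex_halfspace_Im_lt)
    qed (use V[OF w(1)] 1 in auto)
    then show False using no_return_core[OF L B X y uX nc] unfolding J0_def S_def by blast
  next
    case 2
    have R: "\<beta> ` {w. - (y' - y) < Re w \<and> Re w < 0 \<and> y < Im w \<and> Im w < y'} \<subseteq> inside J0"
    proof (rule spread)
      have "{w. - (y' - y) < Re w \<and> Re w < 0 \<and> y < Im w \<and> Im w < y'} = {w. - (y' - y) < Re w} \<inter> {w. Re w < 0} \<inter> {w. y < Im w} \<inter> {w. Im w < y'}" by auto
      then show "convex {w. - (y' - y) < Re w \<and> Re w < 0 \<and> y < Im w \<and> Im w < y'}"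
        by (simp add: convex_Int convex_halfspace_Re_gt convex_halfspace_Re_lt convex_halfspace_Im_gt convex_halfspace_Im_lt)
    qed (use V[OF w(1)] 2 in auto)
    have mC: "- Complex 0 v = Complex 0 (- v)" for v by (simp add: complex_eq_iff)
    show False
    proof (rule no_return_core[OF leaf_reverse[OF L] flow_box_rotate[OF B], of "- X'" "- X" "- y'" "- y"])
      show "{- X'..- X} \<subseteq> uminus ` I"
      proof
        fix x assume "x \<in> {- X'..- X}"
        then have "- x \<in> I" using X(2) by auto
        then show "x \<in> uminus ` I" by (rule rev_image_eqI) simp
      qed
      show "u (- x) \<noteq> \<beta> (- Complex 0 v)" if "- X' < x" "x < - X" "- y' \<le> v" "v \<le> - y" for x v
        using nc[of "- x" "- v"] that unfolding mC by simp
      have i1: "(\<lambda>x. u (- x)) ` {- X'..- X} = u ` {X..X'}"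
        by (metis (no_types, lifting) image_comp image_cong image_uminus_atLeastAtMost minus_minus o_def)
      have i2: "(\<lambda>w. \<beta> (- w)) ` {w. Re w = 0 \<and> - y' \<le> Im w \<and> Im w \<le> - y} = \<beta> ` S"
      proof
        show "\<beta> ` S \<subseteq> (\<lambda>w. \<beta> (- w)) ` {w. Re w = 0 \<and> - y' \<le> Im w \<and> Im w \<le> - y}"
        proof
          fix z assume "z \<in> \<beta> ` S"
          then obtain w where "w \<in> S" "z = \<beta> w" by blast
          then show "z \<in> (\<lambda>w. \<beta> (- w)) ` {w. Re w = 0 \<and> - y' \<le> Im w \<and> Im w \<le> - y}"
            by (intro image_eqI[of _ _ "- w"]) (auto simp: S_def)
        qed
      qed (auto simp: S_def)
      have i3: "(\<lambda>w. \<beta> (- w)) ` {w. 0 < Re w \<and> Re w < - y - - y' \<and> - y' < Im w \<and> Im w < - y}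
         \<subseteq> \<beta> ` {w. - (y' - y) < Re w \<and> Re w < 0 \<and> y < Im w \<and> Im w < y'}" by auto
      show "(\<lambda>w. \<beta> (- w)) ` {w. 0 < Re w \<and> Re w < - y - - y' \<and> - y' < Im w \<and> Im w < - y}
         \<subseteq> inside ((\<lambda>x. u (- x)) ` {- X'..- X} \<union> (\<lambda>w. \<beta> (- w)) ` {w. Re w = 0 \<and> - y' \<le> Im w \<and> Im w \<le> - y})"
        unfolding i1 i2 J0_def[symmetric] using i3 R by blast
    qed (use X y uX mC in auto)
  qed
qed

text \<open>The heights of the two crossings differ because \<open>u\<close> is injective; if the
  later one is lower, reversing the leaf restores the order.\<close>

lemma no_return:
  assumes L: "leaf rs I u" and B: "flow_box rs \<rho> \<beta>"
    and X: "X < X'" "{X..X'} \<subseteq> I" and y: "\<bar>y\<bar> \<le> \<rho> / 4" "\<bar>y'\<bar> \<le> \<rho> / 4"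
    and uX: "u X = \<beta> (Complex 0 y)" "u X' = \<beta> (Complex 0 y')"
    and nc: "\<And>x v. X < x \<Longrightarrow> x < X' \<Longrightarrow> \<bar>v\<bar> \<le> \<rho> / 4 \<Longrightarrow> u x \<noteq> \<beta> (Complex 0 v)"
  shows False
proof -
  have XI: "X \<in> I" "X' \<in> I" using X by auto
  have "y \<noteq> y'"
  proof
    assume "y = y'"
    then have "u X = u X'" using uX by simp
    then have "X = X'" using inj_onD[OF leafD(3)[OF L] _ XI] by blast
    then show False using X(1) by simp
  qed
  then consider "y < y'" | "y' < y" by linarith
  then show False
  proof cases
    case 1
    show False by (rule no_return_ordered[OF L B X 1 y uX]) (use nc y in auto)
  next
    case 2
    show False
    proof (rule no_return_ordered[OF leaf_reverse[OF L] B, of "- X'" "- X" y' y])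
      show "{- X'..- X} \<subseteq> uminus ` I"
      proof
        fix x assume "x \<in> {- X'..- X}"
        then have "- x \<in> I" using X(2) by auto
        then show "x \<in> uminus ` I" by (rule rev_image_eqI) simp
      qed
      show "u (- x) \<noteq> \<beta> (Complex 0 v)" if "- X' < x" "x < - X" "y' \<le> v" "v \<le> y" for x v
        using nc[of "- x" v] that y by auto
    qed (use X y uX 2 in auto)
  qed
qed

text \<open>If there were two crossings, there would be a first return \<open>Z\<close> to the
  transversal after \<open>X\<close>, contrary to \<open>no_return\<close>. The first return exists
  because crossing times form a closed set and every crossing after \<open>X\<close> comes at least
  \<open>\<rho> / 2\<close> later, the leaf having to follow its chord first.\<close>

lemma leaf_crosses_once:
  assumes L: "leaf rs I u" and B: "flow_box rs \<rho> \<beta>" and X: "X \<in> I" "X' \<in> I"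
    and y: "\<bar>y\<bar> \<le> \<rho> / 4" "\<bar>y'\<bar> \<le> \<rho> / 4" and uX: "u X = \<beta> (Complex 0 y)" "u X' = \<beta> (Complex 0 y')"
  shows "X = X'"
proof -
  have less: False if X: "X \<in> I" "X' \<in> I" "X < X'" and y: "\<bar>y\<bar> \<le> \<rho> / 4" "\<bar>y'\<bar> \<le> \<rho> / 4" 
    and uX: "u X = \<beta> (Complex 0 y)" "u X' = \<beta> (Complex 0 y')" for X X' y y'
  proof -
    note l = leafD[OF L] and fb = flow_boxD[OF B]
    have XX: "{X..X'} \<subseteq> I" using l(2) X unfolding connected_iff_interval by (meson atLeastAtMost_iff subsetI)
    have cyB: "Complex 0 v \<in> ball 0 \<rho>" if "\<bar>v\<bar> \<le> \<rho> / 4" for v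
      using that fb(1) by (simp add: cmod_def)
    obtain s :: real where s: "s \<in> {1, -1}"
      "\<And>\<tau>. Complex 0 y + of_real \<tau> \<in> ball 0 \<rho> \<Longrightarrow> X + s * \<tau> \<in> I \<and> u (X + s * \<tau>) = \<beta> (Complex 0 y + of_real \<tau>)"
      by (rule leaf_flow[OF L B X(1) uX(1) cyB[OF y(1)]]) (rule that; assumption)
    have gap: "X + \<rho> / 2 \<le> x" if x: "X < x" "u x = \<beta> (Complex 0 v)" "\<bar>v\<bar> \<le> \<rho> / 4" for x v
    proof (rule ccontr)
      assume "\<not> ?thesis"
      then have t: "\<bar>s * (x - X)\<bar> < \<rho> / 2" using x(1) s(1) by auto
      have "norm (Complex 0 y + of_real (s * (x - X))) \<le> norm (Complex 0 y) + norm (complex_of_real (s * (x - X)))"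
        by (rule norm_triangle_ineq)
      also have "\<dots> = \<bar>y\<bar> + \<bar>s * (x - X)\<bar>" by (simp only: norm_of_real) (simp add: cmod_def)
      also have "\<dots> < \<rho>" using t y(1) fb(1) by linarith
      finally have in1: "Complex 0 y + of_real (s * (x - X)) \<in> ball 0 \<rho>" by simp
      have "X + s * (s * (x - X)) = x" using s(1) by auto
      then have "\<beta> (Complex 0 v) = \<beta> (Complex 0 y + of_real (s * (x - X)))" using s(2)[OF in1] x(2) by simp
      from inj_onD[OF fb(3) this cyB[OF x(3)] in1] have "s * (x - X) = 0" by (simp add: complex_eq_iff)
      then show False using s(1) x(1) by auto
    qed
    define K where "K = \<beta> ` {w. Re w = 0 \<and> \<bar>Im w\<bar> \<le> \<rho> / 4}"
    have Kv: "z \<in> K \<longleftrightarrow> (\<exists>v. \<bar>v\<bar> \<le> \<rho> / 4 \<and> z = \<beta> (Complex 0 v))" for z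
    proof
      assume "z \<in> K"
      then obtain w where w: "Re w = 0" "\<bar>Im w\<bar> \<le> \<rho> / 4" "z = \<beta> w" unfolding K_def by blast
      then have "w = Complex 0 (Im w)" by (simp add: complex_eq_iff)
      with w show "\<exists>v. \<bar>v\<bar> \<le> \<rho> / 4 \<and> z = \<beta> (Complex 0 v)" by metis
    qed (auto simp: K_def)
    have "compact {w. Re w = 0 \<and> \<bar>Im w\<bar> \<le> \<rho> / 4}"
    proof -
      have "{w. Re w = 0 \<and> \<bar>Im w\<bar> \<le> \<rho> / 4} = Complex 0 ` {-\<rho>/4..\<rho>/4}"
        by (auto simp: image_iff complex_eq_iff abs_le_iff intro!: bexI[of _ "Im _"])
      moreover have "continuous_on {-\<rho>/4..\<rho>/4} (Complex 0)" unfolding Complex_eq by (intro continuous_intros)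
      ultimately show ?thesis by (simp add: compact_continuous_image)
    qed
    moreover have "{w. Re w = 0 \<and> \<bar>Im w\<bar> \<le> \<rho> / 4} \<subseteq> ball 0 \<rho>"
    proof
      fix w assume "w \<in> {w. Re w = 0 \<and> \<bar>Im w\<bar> \<le> \<rho> / 4}"
      then show "w \<in> ball 0 \<rho>" using cmod_le[of w] fb(1) by simp
    qed
    ultimately have "compact K" unfolding K_def
      using fb(2) holomorphic_on_imp_continuous_on by (blast intro: compact_continuous_image continuous_on_subset)
    have contu: "continuous_on {X + \<rho> / 2..X'} u"
    proof (intro continuous_at_imp_continuous_on ballI)
      fix x assume "x \<in> {X + \<rho> / 2..X'}"
      then have "x \<in> I" using XX fb(1) by auto
      then show "isCont u x" by (rule l(7))
    qed
    define C where "C = {X + \<rho> / 2..X'} \<inter> u -` K"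
    have "closed C" unfolding C_def
      by (rule continuous_closed_preimage[OF contu closed_atLeastAtMost compact_imp_closed[OF \<open>compact K\<close>]])
    moreover have "bounded C" unfolding C_def using bounded_closed_interval bounded_subset by blast
    ultimately have "compact C" by (simp add: compact_eq_bounded_closed)
    moreover have "X' \<in> C" unfolding C_def using gap[OF X(3) uX(2) y(2)] uX(2) y(2) Kv by auto
    ultimately obtain Z where Z: "Z \<in> C" "\<And>z. z \<in> C \<Longrightarrow> Z \<le> z" using compact_attains_inf[of C] by blast
    obtain v where v: "\<bar>v\<bar> \<le> \<rho> / 4" "u Z = \<beta> (Complex 0 v)" using Z(1) Kv unfolding C_def by auto
    have XZ: "X < Z" "Z \<le> X'" using Z(1) fb(1) unfolding C_def by auto
    show False
    proof (rule no_return[OF L B XZ(1) _ y(1) v(1) uX(1) v(2)])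
      show "{X..Z} \<subseteq> I" using XX XZ by auto
      fix x t assume x: "X < x" "x < Z" "\<bar>t\<bar> \<le> \<rho> / 4"
      show "u x \<noteq> \<beta> (Complex 0 t)"
      proof
        assume e: "u x = \<beta> (Complex 0 t)"
        then have "x \<in> C" unfolding C_def using gap[OF x(1) e x(3)] x XZ(2) Kv by auto
        from Z(2)[OF this] x(2) show False by simp
      qed
    qed
  qed
  show ?thesis
    using less[OF X(1,2) _ y uX] less[OF X(2,1) _ y(2,1) uX(2,1)] by (meson linorder_neqE_linordered_idom)
qed

text \<open>A point within \<open>r\<close> of \<open>z0\<close> has a box coordinate of size at
  most \<open>3/2 * M * r\<close>, so sliding along its chord for at most that time reaches the
  transversal. Both slides end at the only crossing. The 72 makes \<open>3/2 * M * r\<close> at most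
  a quarter of the box radius \<open>k * d * M / 12\<close>.\<close>

lemma leaf_meets_disc_once:
  assumes L: "leaf rs I u" and d: "0 < d" "\<And>r. r \<in> set rs \<Longrightarrow> d \<le> norm (z0 - r)"
    and r: "r \<le> box_const (length rs) * d / 72"
    and x: "x1 \<in> I" "x2 \<in> I" "norm (u x1 - z0) \<le> r" "norm (u x2 - z0) \<le> r"
  shows "\<bar>x1 - x2\<bar> \<le> 3 * sqrt (norm (root_poly rs z0)) * r"
proof -
  define k M where "k = box_const (length rs)" and "M = sqrt (norm (root_poly rs z0))"
  have k: "0 < k" by (simp add: k_def box_const_pos)
  have M0: "0 \<le> M" by (simp add: M_def)
  obtain \<beta> where \<beta>: "flow_box rs (k * d * M / 12) \<beta>" "\<beta> 0 = z0"
    "\<And>z. norm (z - z0) \<le> k * d / 36 \<Longrightarrow>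
       \<exists>w. norm w \<le> 3 / 2 * M * norm (z - z0) \<and> w \<in> ball 0 (k * d * M / 12) \<and> \<beta> w = z"
    unfolding k_def M_def using flow_box_exists[OF d, of rs] by metis
  define \<rho> where "\<rho> = k * d * M / 12"
  note \<beta> = \<beta>[folded \<rho>_def]
  have r': "r \<le> k * d / 72" using r by (simp add: k_def)
  have q: "3 / 2 * M * r \<le> \<rho> / 4"
  proof -
    have "3 / 2 * M * r \<le> 3 / 2 * M * (k * d / 72)" using r' M0 by (intro mult_left_mono) auto
    also have "\<dots> = \<rho> / 4" by (simp add: \<rho>_def)
    finally show ?thesis .
  qed
  have hit: "\<exists>X y. X \<in> I \<and> \<bar>y\<bar> \<le> \<rho> / 4 \<and> u X = \<beta> (Complex 0 y) \<and> \<bar>X - x\<bar> \<le> 3 / 2 * M * r"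
    if x: "x \<in> I" "norm (u x - z0) \<le> r" for x
  proof -
    have "norm (u x - z0) \<le> k * d / 36" using x(2) r' mult_pos_pos[OF k d(1)] by linarith
    from \<beta>(3)[OF this] obtain w where w: "norm w \<le> 3 / 2 * M * norm (u x - z0)" "w \<in> ball 0 \<rho>" "\<beta> w = u x" by blast
    have "3 / 2 * M * norm (u x - z0) \<le> 3 / 2 * M * r" using x(2) M0 by (intro mult_left_mono) auto
    with w(1) have nw: "norm w \<le> 3 / 2 * M * r" by linarith
    obtain s :: real where s: "s \<in> {1, -1}"
      "\<And>\<tau>. w + of_real \<tau> \<in> ball 0 \<rho> \<Longrightarrow> x + s * \<tau> \<in> I \<and> u (x + s * \<tau>) = \<beta> (w + of_real \<tau>)"
      by (rule leaf_flow[OF L \<beta>(1) x(1) w(3)[symmetric] w(2)]) (rule that; assumption)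
    have e: "w + of_real (- Re w) = Complex 0 (Im w)" by (simp add: complex_eq_iff)
    have iw: "\<bar>Im w\<bar> \<le> 3 / 2 * M * r" "\<bar>Re w\<bar> \<le> 3 / 2 * M * r"
      using nw abs_Im_le_cmod[of w] abs_Re_le_cmod[of w] by linarith+
    have "norm (Complex 0 (Im w)) < \<rho>" using iw(1) q flow_boxD(1)[OF \<beta>(1)] by (simp add: cmod_def)
    then have "x + s * (- Re w) \<in> I \<and> u (x + s * (- Re w)) = \<beta> (Complex 0 (Im w))"
      using s(2)[of "- Re w"] unfolding e by simp
    moreover have "\<bar>x + s * (- Re w) - x\<bar> \<le> 3 / 2 * M * r" using iw(2) s(1) by auto
    ultimately show ?thesis using iw(1) q by (intro exI[of _ "x + s * (- Re w)"] exI[of _ "Im w"]) auto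
  qed
  obtain X1 y1 where 1: "X1 \<in> I" "\<bar>y1\<bar> \<le> \<rho> / 4" "u X1 = \<beta> (Complex 0 y1)" "\<bar>X1 - x1\<bar> \<le> 3 / 2 * M * r"
    using hit[OF x(1,3)] by blast
  obtain X2 y2 where 2: "X2 \<in> I" "\<bar>y2\<bar> \<le> \<rho> / 4" "u X2 = \<beta> (Complex 0 y2)" "\<bar>X2 - x2\<bar> \<le> 3 / 2 * M * r"
    using hit[OF x(2,4)] by blast
  have "X1 = X2" by (rule leaf_crosses_once[OF L \<beta>(1) 1(1) 2(1) 1(2) 2(2) 1(3) 2(3)])
  then have "\<bar>x1 - x2\<bar> \<le> 3 / 2 * M * r + 3 / 2 * M * r" using 1(4) 2(4) by linarith
  also have "\<dots> = 3 * M * r" by simp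
  finally show ?thesis unfolding M_def .
qed

section \<open>Lengths of leaves and edges\<close>

lemma root_poly_has_field_derivative:
  assumes "root_poly rs z \<noteq> 0"
  shows "(root_poly rs has_field_derivative root_poly rs z * (\<Sum>r\<leftarrow>rs. inverse (z - r))) (at z)"
  using assms
proof (induction rs)
  case Nil
  have "root_poly [] = (\<lambda>z. 1)" by auto
  then show ?case by simp
next
  case (Cons r rs)
  have f: "root_poly (r # rs) = (\<lambda>z. (z - r) * root_poly rs z)" by auto
  have nz: "z - r \<noteq> 0" "root_poly rs z \<noteq> 0" using Cons.prems by auto
  have "((\<lambda>z. (z - r) * root_poly rs z) has_field_derivative
      1 * root_poly rs z + root_poly rs z * (\<Sum>r\<leftarrow>rs. inverse (z - r)) * (z - r)) (at z)"
    by (intro DERIV_mult Cons.IH nz) (auto intro!: derivative_eq_intros)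
  moreover have "1 * root_poly rs z + root_poly rs z * (\<Sum>r\<leftarrow>rs. inverse (z - r)) * (z - r)
     = (z - r) * root_poly rs z * (inverse (z - r) + (\<Sum>r\<leftarrow>rs. inverse (z - r)))"
    using nz by (simp add: field_simps)
  ultimately show ?case unfolding f by simp
qed

text \<open>As in the Gauss-Lucas theorem: \<open>v / (z - r)\<close> is a positive multiple of the
  inverse of \<open>cnj v * (z - r)\<close>, and inversion preserves the right half-plane.\<close>

lemma Re_logderiv_pos:
  assumes "rs \<noteq> []" and pos: "\<And>r. r \<in> set rs \<Longrightarrow> 0 < Re (cnj v * (z - r))"
  shows "0 < Re (v * (\<Sum>r\<leftarrow>rs. inverse (z - r)))"
  using assms
proof (induction rs)
  case (Cons r rs)
  have p: "0 < Re (cnj v * (z - r))" using Cons.prems by auto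
  then have nz: "v \<noteq> 0" "z \<noteq> r" by auto
  have inv: "0 < Re (inverse w)" if "0 < Re w" for w :: complex
    using that by (simp add: add_pos_nonneg)
  have sc: "0 < Re (of_real c * w)" if "0 < Re w" "0 < c" for w :: complex and c
    using that by simp
  have "v * inverse (z - r) = of_real ((norm v)\<^sup>2) * inverse (cnj v * (z - r))"
    unfolding complex_norm_square using nz by (simp add: field_simps)
  moreover have "0 < Re (of_real ((norm v)\<^sup>2) * inverse (cnj v * (z - r)))"
    by (rule sc[OF inv[OF p]]) (use nz in simp)
  ultimately have a: "0 < Re (v * inverse (z - r))" by (simp only:)
  have "0 \<le> Re (v * (\<Sum>r\<leftarrow>rs. inverse (z - r)))"
    using Cons by (cases "rs = []") (auto simp: less_imp_le)
  with a show ?case by (simp add: distrib_left)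
qed simp

lemma no_local_max:
  fixes h h' :: "real \<Rightarrow> real"
  assumes e: "0 < e" and der: "\<And>t. \<bar>t\<bar> < e \<Longrightarrow> (h has_real_derivative h' t) (at t)"
    and "h' 0 = 0" and der2: "(h' has_real_derivative D) (at 0)" "0 < D" and mx: "\<And>t. \<bar>t\<bar> < e \<Longrightarrow> h t \<le> h 0"
  shows False
proof -
  obtain d where d: "d > 0" "\<forall>t>0. t < d \<longrightarrow> h' 0 < h' (0 + t)"
    using DERIV_pos_inc_right[OF der2] by blast
  define t where "t = min d e / 2"
  have t: "0 < t" "t < d" "t < e" using d e by (auto simp: t_def min_def)
  obtain z where z: "0 < z" "z < t" "h t - h 0 = (t - 0) * h' z"
    using MVT2[of 0 t h h'] der t by auto
  have "0 < h' z" using d(2) z t assms(3) by simp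
  then have "0 < h t - h 0" using z(3) t by simp
  with mx[of t] t show False by simp
qed

text \<open>Hull property: \<open>Re (cnj v * u)\<close> has no local maximum to the far side of all roots, because
  there its second derivative along a leaf is positive wherever the first one vanishes.\<close>

lemma leaf_in_disc:
  assumes L: "leaf rs I u" and rs: "rs \<noteq> []" "set rs \<subseteq> cball 0 R" and bd: "bounded (u ` I)" and x0: "x0 \<in> I"
  shows "norm (u x0) \<le> R"
proof (rule ccontr)
  assume "\<not> norm (u x0) \<le> R"
  then have big: "R < norm (u x0)" by simp
  note l = leafD[OF L]
  obtain B where B: "\<And>x. x \<in> I \<Longrightarrow> norm (u x) \<le> B" using bd unfolding bounded_iff by auto
  \<comment> \<open>\<open>K\<close> contains no root, since the roots have modulus at most
    \<open>R < |u x0|\<close>. By properness \<open>|u|\<close> therefore attains its maximum over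
    the leaf.\<close>
  define K where "K = cball (0::complex) B - ball 0 (norm (u x0))"
  have "compact K" unfolding K_def by (intro compact_diff compact_cball open_ball)
  moreover have "root_poly rs z \<noteq> 0" if "z \<in> K" for z
    using that big rs(2) by (auto simp: K_def root_poly_eq_0_iff)
  ultimately have "compact {x\<in>I. u x \<in> K}" by (rule l(5))
  moreover have "x0 \<in> {x\<in>I. u x \<in> K}" using x0 B by (auto simp: K_def)
  moreover have "continuous_on {x\<in>I. u x \<in> K} (\<lambda>x. norm (u x))"
    using l(7) by (intro continuous_at_imp_continuous_on ballI continuous_intros) auto
  ultimately obtain x1 where x1: "x1 \<in> I" "u x1 \<in> K" "\<And>x. x \<in> I \<Longrightarrow> u x \<in> K \<Longrightarrow> norm (u x) \<le> norm (u x1)"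
    using continuous_attains_sup[of "{x\<in>I. u x \<in> K}" "\<lambda>x. norm (u x)"] by blast
  have mx: "norm (u x) \<le> norm (u x1)" if "x \<in> I" for x
  proof (cases "u x \<in> K")
    case False
    then have "norm (u x) < norm (u x0)" using B[OF that] by (auto simp: K_def)
    also have "\<dots> \<le> norm (u x1)" using x1(2) by (simp add: K_def)
    finally show ?thesis by simp
  qed (use x1 that in auto)
  define z1 where "z1 = u x1"
  have z1: "R < norm z1" using big x1(2) by (simp add: K_def z1_def)
  have d: "norm z1 - R \<le> norm (z1 - r)" if "r \<in> set rs" for r
    using norm_triangle_ineq2[of z1 r] rs(2) that by auto
  obtain \<beta> \<rho> where \<beta>: "flow_box rs \<rho> \<beta>" "\<beta> 0 = z1"
    using flow_box_exists[of "norm z1 - R" rs z1] d z1 by (metis diff_gt_0_iff_gt)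
  note fb = flow_boxD[OF \<beta>(1)]
  have 0: "0 \<in> ball (0::complex) \<rho>" using fb(1) by simp
  have ux1: "u x1 = \<beta> 0" by (simp add: \<beta>(2) z1_def)
  obtain s :: real where s: "s \<in> {1, -1}"
    "\<And>\<tau>. 0 + of_real \<tau> \<in> ball (0::complex) \<rho> \<Longrightarrow> x1 + s * \<tau> \<in> I \<and> u (x1 + s * \<tau>) = \<beta> (0 + of_real \<tau>)"
    by (rule leaf_flow[OF L \<beta>(1) x1(1) ux1 0]) (rule that; assumption)
  have \<beta>mx: "norm (\<beta> (of_real t)) \<le> norm z1" if "\<bar>t\<bar> < \<rho>" for t
    using s(2)[of t] that mx[of "x1 + s * t"] by (simp add: z1_def)
  have z1nz: "z1 \<noteq> 0" using z1 rs by (metis norm_zero not_less_iff_gr_or_eq order_less_le_trans mem_cball_0 norm_ge_zero subsetD list.set_intros(1) list.exhaust less_le_not_le order.trans)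
  define v where "v = z1 / of_real (norm z1)"
  have v: "norm v = 1" "cnj v * z1 = of_real (norm z1)"
    using z1nz by (simp_all add: v_def norm_divide complex_norm_square[symmetric] power2_eq_square field_simps)
  define h h' where "h t = Re (cnj v * \<beta> (of_real t))" and "h' t = Re (cnj v * deriv \<beta> (of_real t))" for t
  define g where "g = deriv \<beta> 0"
  define S where "S = (\<Sum>r\<leftarrow>rs. inverse (z1 - r))"
  have realder: "((\<lambda>t. Re (cnj v * F (of_real t))) has_real_derivative Re (cnj v * F')) (at t)"
    if "(F has_field_derivative F') (at (of_real t))" for F F' t
  proof -
    have "((\<lambda>t. F (of_real t)) has_vector_derivative F') (at t)"
      using field_vector_diff_chain_at[OF has_vector_derivative_of_real[OF DERIV_ident] that]
      by (simp add: o_def)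
    from has_vector_derivative_mult_right[OF this, of "cnj v"]
    have "((\<lambda>t. cnj v * F (of_real t)) has_vector_derivative cnj v * F') (at t)" .
    from bounded_linear.has_vector_derivative[OF bounded_linear_Re this]
    show ?thesis by (simp add: has_real_derivative_iff_has_vector_derivative)
  qed
  have hd: "(h has_real_derivative h' t) (at t)" if "\<bar>t\<bar> < \<rho>" for t
    unfolding h_def[abs_def] h'_def by (rule realder) (use that fb(6) in auto)
  have hmx: "h t \<le> h 0" if "\<bar>t\<bar> < \<rho>" for t
  proof -
    have "h t \<le> norm (cnj v * \<beta> (of_real t))" unfolding h_def by (rule complex_Re_le_cmod)
    also have "\<dots> \<le> norm z1" using \<beta>mx[OF that] v(1) by (simp add: norm_mult)
    also have "\<dots> = h 0" using v(2) by (simp add: h_def \<beta>(2))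
    finally show ?thesis .
  qed
  have h'0: "h' 0 = 0"
    by (rule DERIV_local_max[OF hd[of 0], of \<rho>]) (use hmx fb(1) in auto)
  have nzP: "root_poly rs z1 \<noteq> 0" using fb(5)[OF 0] \<beta>(2) by simp
  have gP: "- root_poly rs z1 * g\<^sup>2 = 1" using fb(4)[OF 0] \<beta>(2) by (simp add: g_def)
  have dd: "(deriv \<beta> has_field_derivative deriv (deriv \<beta>) 0) (at 0)"
    by (rule holomorphic_derivI[OF holomorphic_deriv[OF fb(2) open_ball] open_ball 0])
  \<comment> \<open>Obtained by differentiating the constant
    \<open>P (\<beta> w) * (deriv \<beta> w)^2\<close> at 0; \<open>S\<close> is the logarithmic
    derivative of \<open>P\<close> at \<open>z1\<close>.\<close>
  have g2: "deriv (deriv \<beta>) 0 = - (g\<^sup>2 * S / 2)"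
  proof -
    have "((\<lambda>w. root_poly rs (\<beta> w)) has_field_derivative root_poly rs z1 * S * g) (at 0)"
      using DERIV_chain2[of "root_poly rs" "root_poly rs z1 * S" \<beta> 0 g] root_poly_has_field_derivative[OF nzP] fb(6)[OF 0] \<beta>(2)
      by (simp add: S_def g_def)
    from DERIV_mult[OF this DERIV_power[OF dd, of 2]]
    have "((\<lambda>w. root_poly rs (\<beta> w) * (deriv \<beta> w)\<^sup>2) has_field_derivative
        root_poly rs z1 * S * g * g\<^sup>2 + 2 * g * deriv (deriv \<beta>) 0 * root_poly rs z1) (at 0)"
      by (simp add: \<beta>(2) g_def mult.commute mult.left_commute)
    moreover have "((\<lambda>w. root_poly rs (\<beta> w) * (deriv \<beta> w)\<^sup>2) has_field_derivative 0) (at 0)"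
      by (rule has_field_derivative_transform_within_open[OF DERIV_const open_ball 0, of "-1"])
         (use fb(4) in \<open>metis minus_mult_left minus_equation_iff\<close>)
    ultimately have "root_poly rs z1 * S * g * g\<^sup>2 + 2 * g * deriv (deriv \<beta>) 0 * root_poly rs z1 = 0"
      by (rule DERIV_unique)
    then have "(root_poly rs z1 * g) * (S * g\<^sup>2 + 2 * deriv (deriv \<beta>) 0) = 0" by (simp add: algebra_simps)
    moreover have "root_poly rs z1 * g \<noteq> 0" using gP by auto
    ultimately have "S * g\<^sup>2 + 2 * deriv (deriv \<beta>) 0 = 0" by simp
    then have "2 * deriv (deriv \<beta>) 0 = - (g\<^sup>2 * S)" by (simp add: eq_neg_iff_add_eq_0 algebra_simps)
    then have "deriv (deriv \<beta>) 0 = - (g\<^sup>2 * S) / 2"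
      by (metis nonzero_mult_div_cancel_left zero_neq_numeral)
    then show ?thesis by simp
  qed
  have "(h' has_real_derivative Re (cnj v * deriv (deriv \<beta>) 0)) (at 0)"
    unfolding h'_def[abs_def] by (rule realder) (use dd in simp)
  moreover have "0 < Re (cnj v * deriv (deriv \<beta>) 0)"
  proof -
    define q where "q = Im (cnj v * g)"
    \<comment> \<open>At the maximum the velocity \<open>g\<close> is perpendicular to
      \<open>v\<close>, so \<open>g^2\<close> is a negative multiple of \<open>v^2\<close>, and the
      second derivative in direction \<open>v\<close> has the sign of
      \<open>Re (v * S)\<close>.\<close>
    have "cnj v * g = \<i> * of_real q" using h'0 by (simp add: q_def h'_def g_def complex_eq_iff)
    then have "v * (cnj v * g) = \<i> * of_real q * v" by simp
    then have gq: "g = \<i> * of_real q * v"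
      using v(1) by (metis complex_norm_square mult.assoc mult_1 of_real_1 one_power2)
    have "g \<noteq> 0" using gP by auto
    then have "q \<noteq> 0" using gq by auto
    have "cnj v * deriv (deriv \<beta>) 0 = of_real (q\<^sup>2 / 2) * (v * cnj v) * (v * S)"
      unfolding g2 gq by (simp add: power_mult_distrib power2_eq_square[of v] field_simps)
    also have "v * cnj v = 1" using v(1) by (metis complex_norm_square of_real_1 one_power2)
    finally have "cnj v * deriv (deriv \<beta>) 0 = of_real (q\<^sup>2 / 2) * (v * S)" by (simp only: mult_1_right)
    moreover have "Re (of_real a * w) = a * Re w" for a w by simp
    ultimately have "Re (cnj v * deriv (deriv \<beta>) 0) = q\<^sup>2 / 2 * Re (v * S)" by (simp only:)
    moreover have "0 < q\<^sup>2 / 2" using \<open>q \<noteq> 0\<close> by simp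
    moreover have "0 < Re (v * S)"
      unfolding S_def
    proof (rule Re_logderiv_pos[OF rs(1)])
      fix r assume r: "r \<in> set rs"
      have "Re (cnj v * r) \<le> norm (cnj v * r)" by (rule complex_Re_le_cmod)
      also have "\<dots> \<le> R" using rs(2) r v(1) by (auto simp: norm_mult)
      finally show "0 < Re (cnj v * (z1 - r))" using z1 v(2) by (simp add: right_diff_distrib)
    qed
    ultimately show ?thesis by (simp only: mult_pos_pos)
  qed
  ultimately show False using no_local_max[OF fb(1) hd h'0 _ _ hmx] by blast
qed

lemma interval_cover_length:
  fixes a b :: "'i \<Rightarrow> real"
  assumes "finite T" "{x..x'} \<subseteq> (\<Union>i\<in>T. {a i..b i})" "\<And>i. i \<in> T \<Longrightarrow> a i \<le> b i" "x \<le> x'"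
  shows "x' - x \<le> (\<Sum>i\<in>T. b i - a i)"
proof -
  have "measure lborel {x..x'} \<le> measure lborel (\<Union>i\<in>T. {a i..b i})"
  proof (rule measure_mono_fmeasurable)
    show "(\<Union>i\<in>T. {a i..b i}) \<in> fmeasurable lborel"
      using assms(1) by (intro fmeasurable_compact compact_UN) auto
  qed (use assms in auto)
  also have "\<dots> \<le> (\<Sum>i\<in>T. measure lborel {a i..b i})"
    by (rule measure_UNION_le[OF assms(1)]) auto
  also have "\<dots> = (\<Sum>i\<in>T. b i - a i)" using assms(3) by (intro sum.cong) auto
  finally show ?thesis using assms(4) by simp
qed

text \<open>The scales \<open>2R/2\<^sup>j\<close> of the distance to the roots contribute geometrically decreasing lengths, each
  scale being covered by boundedly many discs that a leaf meets only once.\<close>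

lemma leaf_length_bound:
  assumes "0 < R" "0 < n"
  obtains C where "\<And>rs I u x x'. length rs = n \<Longrightarrow> set rs \<subseteq> cball 0 R \<Longrightarrow> leaf rs I u \<Longrightarrow> u ` I \<subseteq> cball 0 R \<Longrightarrow>
    x \<in> I \<Longrightarrow> x' \<in> I \<Longrightarrow> x' - x \<le> C"
proof -
  \<comment> \<open>Two points of one covering disc at scale \<open>j\<close> are at most
    \<open>2 * \<rho> j * k\<close> apart, and this must not exceed \<open>box_const n * \<rho> (Suc
    j) / 72 = box_const n * \<rho> j / 144\<close>; so any divisor from 288 on serves.\<close>
  define k where "k = box_const n / 300"
  have k: "0 < k" "k \<le> 1" using box_const_pos[of n] box_const_le[of n] by (auto simp: k_def)
  obtain Q where Q: "finite Q" "cball (0::complex) 1 \<subseteq> (\<Union>q\<in>Q. ball q k)"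
    using compact_cball[of "0::complex" 1] k(1) unfolding compact_eq_totally_bounded by blast
  define M where "M = sqrt ((2 * R) ^ n)"
  define \<rho> where "\<rho> j = 2 * R / 2 ^ j" for j :: nat
  have \<rho>: "0 < \<rho> j" "\<rho> (Suc j) = \<rho> j / 2" for j using assms(1) by (auto simp: \<rho>_def)
  have \<rho>anti: "\<rho> j \<le> \<rho> i" if "i \<le> j" for i j
    unfolding \<rho>_def using that assms(1) by (intro divide_left_mono power_increasing) auto
  define C where "C = (real n * real (card Q)) * (12 * M * (4 * R))"
  have "x' - x \<le> C" if rs: "length rs = n" "set rs \<subseteq> cball 0 R" and L: "leaf rs I u" and uR: "u ` I \<subseteq> cball 0 R"
    and x: "x \<in> I" "x' \<in> I" for rs I u x x'
  proof (cases "x \<le> x'")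
    case False
    have "0 \<le> C" using assms by (simp add: C_def M_def)
    with False show ?thesis by simp
  next
    case True
    note l = leafD[OF L]
    have XX: "{x..x'} \<subseteq> I" using l(2) x unfolding connected_iff_interval by (meson atLeastAtMost_iff subsetI)
    have rsne: "set rs \<noteq> {}" using rs(1) assms(2) by auto
    have far: "norm (u t - r) \<le> 2 * R" if "t \<in> I" "r \<in> set rs" for t r
    proof -
      have "norm (u t) \<le> R" "norm r \<le> R" using uR rs(2) that by auto
      then show ?thesis using norm_triangle_ineq4[of "u t" r] by linarith
    qed
    have "continuous_on {x..x'} u" using l(7) XX by (intro continuous_at_imp_continuous_on) auto
    then have "compact (u ` {x..x'})" by (rule compact_continuous_image) simp
    moreover have "u ` {x..x'} \<inter> set rs = {}" using l(6) XX by (auto simp: root_poly_eq_0_iff)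
    ultimately obtain d where d: "d > 0" "\<And>z r. z \<in> u ` {x..x'} \<Longrightarrow> r \<in> set rs \<Longrightarrow> d \<le> dist z r"
      using separate_compact_closed[of "u ` {x..x'}" "set rs"] by (metis finite_imp_closed finite_set)
    \<comment> \<open>Only finitely many scales occur on a compact piece. Their number depends on
      the leaf, but the geometric sum is at most \<open>4 * R\<close> for every
      \<open>J\<close>.\<close>
    obtain J where J: "\<rho> J < d"
    proof -
      obtain m where "(1/2) ^ m < d / (2 * R)" using real_arch_pow_inv[of "d / (2 * R)" "1/2"] d(1) assms(1) by auto
      then have "\<rho> m < d" using assms(1) by (simp add: \<rho>_def power_one_over field_simps)
      then show ?thesis by (rule that)
    qed
    \<comment> \<open>The index consists of a scale, a root and a point of the net. The distance at
      least \<open>\<rho> (Suc j)\<close> from all roots is what makes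
      \<open>leaf_meets_disc_once\<close> applicable at this scale.\<close>
    define A where "A = (\<lambda>(j, r, q). {t\<in>I. (\<forall>r'\<in>set rs. \<rho> (Suc j) \<le> norm (u t - r')) \<and> norm (u t - (r + of_real (\<rho> j) * q)) \<le> \<rho> j * k})"
    have small: "\<bar>t - t'\<bar> \<le> 6 * M * \<rho> j" if t: "t \<in> A (j, r, q)" "t' \<in> A (j, r, q)" for t t' j r q
    proof -
      let ?p = "r + of_real (\<rho> j) * q"
      have tI: "t \<in> I" "t' \<in> I" using t by (auto simp: A_def)
      have "norm (u t' - u t) \<le> norm (u t' - ?p) + norm (u t - ?p)"
        using norm_triangle_ineq4[of "u t' - ?p" "u t - ?p"] by simp
      also have "\<dots> \<le> \<rho> j * k + \<rho> j * k" using t by (intro add_mono) (auto simp: A_def)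
      finally have n: "norm (u t' - u t) \<le> 2 * \<rho> j * k" by (simp add: algebra_simps)
      have "\<bar>t - t'\<bar> \<le> 3 * sqrt (norm (root_poly rs (u t))) * (2 * \<rho> j * k)"
      proof (rule leaf_meets_disc_once[OF L, of "\<rho> (Suc j)"])
        show "2 * \<rho> j * k \<le> box_const (length rs) * \<rho> (Suc j) / 72"
          using \<rho>(1)[of j] box_const_pos[of n] by (simp add: k_def rs(1) \<rho>(2))
      qed (use n tI t \<rho>(1)[of j] \<rho>(1)[of "Suc j"] k in \<open>auto simp: A_def\<close>)
      also have "\<dots> \<le> 3 * M * (2 * \<rho> j * 1)"
      proof (intro mult_mono)
        show "sqrt (norm (root_poly rs (u t))) \<le> M"
          unfolding M_def using norm_root_poly_le[of rs "u t" "2 * R"] far[OF tI(1)] rs(1) by (auto intro!: real_sqrt_le_mono)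
      qed (use \<rho>(1)[of j] k assms(1) in \<open>auto simp: M_def\<close>)
      finally show ?thesis by simp
    qed
    have "\<exists>c. A i \<subseteq> {c - 6 * M * \<rho> (fst i)..c + 6 * M * \<rho> (fst i)}" for i
    proof (cases "A i = {}")
      case False
      then obtain c where "c \<in> A i" by blast
      then have "A i \<subseteq> {c - 6 * M * \<rho> (fst i)..c + 6 * M * \<rho> (fst i)}"
        using small[of _ "fst i" "fst (snd i)" "snd (snd i)" c] by (force simp: abs_le_iff)
      then show ?thesis by blast
    qed simp
    then obtain c where c: "\<And>i. A i \<subseteq> {c i - 6 * M * \<rho> (fst i)..c i + 6 * M * \<rho> (fst i)}" by metis
    define T where "T = {..<J} \<times> (set rs \<times> Q)"
    have cover: "{x..x'} \<subseteq> (\<Union>i\<in>T. {c i - 6 * M * \<rho> (fst i)..c i + 6 * M * \<rho> (fst i)})"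
    proof
      fix t assume t: "t \<in> {x..x'}"
      then have tI: "t \<in> I" using XX by blast
      obtain r where r: "r \<in> set rs" "\<And>r'. r' \<in> set rs \<Longrightarrow> norm (u t - r) \<le> norm (u t - r')"
        using arg_min_if_finite[of "set rs" "\<lambda>r. norm (u t - r)"] rsne by (metis finite_set not_le)
      define \<delta> where "\<delta> = norm (u t - r)"
      have \<delta>: "d \<le> \<delta>" "\<delta> \<le> \<rho> 0" using d(2)[of "u t" r] t r(1) far[OF tI r(1)] by (auto simp: \<delta>_def dist_norm \<rho>_def)
      \<comment> \<open>Picks the scale with
        \<open>\<rho> (Suc j) < \<delta> \<le> \<rho> j\<close>, where
        \<open>m = Suc j\<close>.\<close>
      define m where "m = (LEAST m. \<rho> m < \<delta>)"
      have m: "\<rho> m < \<delta>" unfolding m_def by (rule LeastI[of _ J]) (use J \<delta> in simp)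
      then obtain j where j: "m = Suc j" using \<delta>(2) by (cases m) auto
      have "\<not> \<rho> j < \<delta>" using not_less_Least[of j "\<lambda>m. \<rho> m < \<delta>"] j by (simp add: m_def)
      then have jd: "\<rho> (Suc j) < \<delta>" "\<delta> \<le> \<rho> j" using m j by auto
      have jJ: "j < J"
      proof (rule ccontr)
        assume "\<not> j < J"
        then have "\<rho> j \<le> \<rho> J" using \<rho>anti by simp
        then show False using J \<delta>(1) jd(2) by linarith
      qed
      have "(u t - r) / of_real (\<rho> j) \<in> cball 0 1" using jd(2) \<rho>(1)[of j] by (simp add: \<delta>_def norm_divide)
      then obtain q where q: "q \<in> Q" "(u t - r) / of_real (\<rho> j) \<in> ball q k" using Q(2) by blast
      then have q': "norm ((u t - r) / of_real (\<rho> j) - q) < k" by (simp add: dist_norm norm_minus_commute)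
      have "u t - (r + of_real (\<rho> j) * q) = of_real (\<rho> j) * ((u t - r) / of_real (\<rho> j) - q)"
        using \<rho>(1)[of j] by (simp add: field_simps)
      then have "norm (u t - (r + of_real (\<rho> j) * q)) = \<rho> j * norm ((u t - r) / of_real (\<rho> j) - q)"
        using \<rho>(1)[of j] by (simp only: norm_mult norm_of_real abs_of_pos)
      also have "\<dots> \<le> \<rho> j * k" using q' \<rho>(1)[of j] by (intro mult_left_mono) auto
      finally have "t \<in> A (j, r, q)" using tI jd(1) r(2) by (force simp: A_def \<delta>_def)
      moreover have "(j, r, q) \<in> T" using jJ r(1) q(1) by (simp add: T_def)
      ultimately show "t \<in> (\<Union>i\<in>T. {c i - 6 * M * \<rho> (fst i)..c i + 6 * M * \<rho> (fst i)})" using c by blast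
    qed
    have M0: "0 \<le> M" using assms(1) by (simp add: M_def)
    have "x' - x \<le> (\<Sum>i\<in>T. (c i + 6 * M * \<rho> (fst i)) - (c i - 6 * M * \<rho> (fst i)))"
      by (rule interval_cover_length[OF _ cover _ True]) (use Q(1) M0 \<rho>(1) in \<open>auto simp: T_def less_imp_le\<close>)
    also have "\<dots> = (\<Sum>i\<in>T. 12 * M * \<rho> (fst i))" by (intro sum.cong) auto
    also have "\<dots> = (\<Sum>j<J. \<Sum>p\<in>set rs \<times> Q. 12 * M * \<rho> j)" unfolding T_def by (subst sum.cartesian_product) (simp add: split_def)
    also have "\<dots> = (\<Sum>j<J. \<rho> j) * (real (card (set rs) * card Q) * (12 * M))"
      unfolding sum_distrib_right by (intro sum.cong refl) (simp add: card_cartesian_product)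
    also have "(\<Sum>j<J. \<rho> j) = 4 * R - 2 * \<rho> J"
      by (induction J) (auto simp: \<rho>(2), simp add: \<rho>_def)
    also have "(4 * R - 2 * \<rho> J) * (real (card (set rs) * card Q) * (12 * M)) \<le> (4 * R) * (real (n * card Q) * (12 * M))"
    proof (intro mult_mono of_nat_mono)
      show "card (set rs) \<le> n" using card_length[of rs] rs(1) by simp
    qed (use \<rho>(1)[of J] M0 assms(1) in auto)
    also have "\<dots> = C" by (simp add: C_def)
    finally show ?thesis .
  qed
  then show ?thesis by (rule that)
qed

text \<open>Injectivity on the closed interval makes the two end zeros distinct. No derivative is
  demanded at the ends, where unit natural speed means infinite Euclidean speed.\<close>

definition edge :: "complex list \<Rightarrow> real \<Rightarrow> (real \<Rightarrow> complex) \<Rightarrow> bool" where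
  "edge rs l u \<longleftrightarrow> 0 < l \<and> continuous_on {0..l} u \<and> inj_on u {0..l} \<and> root_poly rs (u 0) = 0 \<and> root_poly rs (u l) = 0
     \<and> (\<forall>x\<in>{0<..<l}. \<exists>v. (u has_vector_derivative v) (at x) \<and> - root_poly rs (u x) * v\<^sup>2 = 1)"

lemma edgeD:
  assumes "edge rs l u"
  shows "0 < l" "continuous_on {0..l} u" "inj_on u {0..l}" "root_poly rs (u 0) = 0" "root_poly rs (u l) = 0"
    "0 < x \<Longrightarrow> x < l \<Longrightarrow> \<exists>v. (u has_vector_derivative v) (at x) \<and> - root_poly rs (u x) * v\<^sup>2 = 1"
  using assms unfolding edge_def by auto

text \<open>Properness holds because the ends are zeros: the preimage of a compact set of regular
  points is closed in \<open>{0..l}\<close> and misses both ends.\<close>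

lemma edge_leaf:
  assumes "edge rs l u" shows "leaf rs {0<..<l} u"
  unfolding leaf_def
proof (intro conjI allI impI)
  note e = edgeD[OF assms]
  show "inj_on u {0<..<l}" using e(3) by (rule inj_on_subset) auto
  show "\<forall>x\<in>{0<..<l}. \<exists>v. (u has_vector_derivative v) (at x) \<and> - root_poly rs (u x) * v\<^sup>2 = 1" using e(6) by auto
  fix K assume K: "compact K \<and> (\<forall>z\<in>K. root_poly rs z \<noteq> 0)"
  have "{x \<in> {0<..<l}. u x \<in> K} = {0..l} \<inter> u -` K"
  proof
    show "{0..l} \<inter> u -` K \<subseteq> {x \<in> {0<..<l}. u x \<in> K}"
    proof
      fix x assume x: "x \<in> {0..l} \<inter> u -` K"
      then have "root_poly rs (u x) \<noteq> 0" using K by auto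
      then have "x \<noteq> 0" "x \<noteq> l" using e(4,5) by auto
      then show "x \<in> {x \<in> {0<..<l}. u x \<in> K}" using x by auto
    qed
  qed auto
  moreover have "closed ({0..l} \<inter> u -` K)"
    using continuous_closed_preimage[OF e(2) closed_atLeastAtMost] K compact_imp_closed by blast
  ultimately show "compact {x \<in> {0<..<l}. u x \<in> K}"
    using compact_Int_closed[of "{0..l}" "{0..l} \<inter> u -` K"] by (simp add: Int_absorb1)
qed (use assms in \<open>auto simp: edge_def\<close>)

lemma edge_in_disc:
  assumes e: "edge rs l u" and rs: "set rs \<subseteq> cball 0 R" shows "u ` {0..l} \<subseteq> cball 0 R"
proof -
  note e' = edgeD[OF e]
  have "compact (u ` {0..l})" using e'(2) by (rule compact_continuous_image) simp
  then have "bounded (u ` {0<..<l})" by (rule bounded_subset[OF compact_imp_bounded]) auto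
  moreover have "rs \<noteq> []" using e'(4) by auto
  ultimately have i: "norm (u x) \<le> R" if "0 < x" "x < l" for x
    using leaf_in_disc[OF edge_leaf[OF e] _ rs] that by auto
  have "u 0 \<in> cball 0 R" "u l \<in> cball 0 R" using e'(4,5) rs by (auto simp: root_poly_eq_0_iff)
  moreover have "u x \<in> cball 0 R" if "x \<noteq> 0" "x \<noteq> l" "x \<in> {0..l}" for x using i[of x] that by auto
  ultimately have "u x \<in> cball 0 R" if "x \<in> {0..l}" for x using that by (cases "x = 0"; cases "x = l") auto
  then show ?thesis by blast
qed

text \<open>The bound for leaves concerns differences of interior parameters; these come arbitrarily
  close to the full length \<open>l\<close>.\<close>

lemma edge_length_bound:
  assumes "0 < R" "0 < n"
  obtains C where "\<And>rs l u. length rs = n \<Longrightarrow> set rs \<subseteq> cball 0 R \<Longrightarrow> edge rs l u \<Longrightarrow> l \<le> C"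
proof -
  obtain C where C: "\<And>rs I u x x'. length rs = n \<Longrightarrow> set rs \<subseteq> cball 0 R \<Longrightarrow> leaf rs I u \<Longrightarrow> u ` I \<subseteq> cball 0 R \<Longrightarrow>
    x \<in> I \<Longrightarrow> x' \<in> I \<Longrightarrow> x' - x \<le> C"
    by (rule leaf_length_bound[OF assms]) (rule that; assumption)
  have "l \<le> C" if rs: "length rs = n" "set rs \<subseteq> cball 0 R" and e: "edge rs l u" for rs l u
  proof (rule ccontr)
    assume "\<not> l \<le> C"
    have l0: "0 < l" using edgeD(1)[OF e] .
    have im: "u ` {0<..<l} \<subseteq> cball 0 R" using edge_in_disc[OF e rs(2)] by (meson greaterThanLessThan_subseteq_atLeastAtMost_iff image_mono order_refl order_trans)
    have d: "x' - x \<le> C" if "0 < x" "x < l" "0 < x'" "x' < l" for x x'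
      by (rule C[OF rs edge_leaf[OF e] im]) (use that in auto)
    have "0 \<le> C" using d[of "l/2" "l/2"] l0 by simp
    define t where "t = (l - C) / 4"
    have t: "0 < t" "t < l" "0 < l - t" "l - t < l" using \<open>\<not> l \<le> C\<close> \<open>0 \<le> C\<close> l0 by (auto simp: t_def field_simps)
    have "(l - t) - t \<le> C" using d[OF t] .
    then show False using \<open>\<not> l \<le> C\<close> by (simp add: t_def field_simps)
  qed
  then show ?thesis by (rule that)
qed

text \<open>\<open>t2\<close> is the first time at level \<open>b\<close>, and \<open>t1\<close> is
  the last time at level \<open>a\<close> before it; this traps \<open>f\<close> between the two
  levels in the meantime.\<close>

lemma continuous_crossing:
  fixes f :: "real \<Rightarrow> real"
  assumes "x \<le> x'" "continuous_on {x..x'} f" "f x \<le> a" "a < b" "b \<le> f x'"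
  obtains t1 t2 where "x \<le> t1" "t1 < t2" "t2 \<le> x'" "f t1 = a" "f t2 = b" "\<And>t. t1 \<le> t \<Longrightarrow> t \<le> t2 \<Longrightarrow> a \<le> f t \<and> f t \<le> b"
proof -
  have "\<exists>t\<ge>x. t \<le> x' \<and> f t = b" by (rule IVT') (use assms in auto)
  moreover have "closed ({x..x'} \<inter> f -` {b})" by (rule continuous_closed_preimage[OF assms(2)]) auto
  then have cpt: "compact ({x..x'} \<inter> f -` {b})" using compact_Int_closed[of "{x..x'}" "{x..x'} \<inter> f -` {b}"] by (simp add: Int_absorb1)
  ultimately have "{x..x'} \<inter> f -` {b} \<noteq> {}" by auto
  define S where "S = {x..x'} \<inter> f -` {b}"
  have "\<exists>t\<in>S. \<forall>s\<in>S. t \<le> s"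
    unfolding S_def by (rule compact_attains_inf[OF cpt \<open>{x..x'} \<inter> f -` {b} \<noteq> {}\<close>])
  then obtain t2 where "t2 \<in> S" "\<forall>t\<in>S. t2 \<le> t" by blast
  note t2 = this[unfolded S_def]
  have c2: "continuous_on {x..t2} f" using assms(2) by (rule continuous_on_subset) (use t2 in auto)
  have ub: "f t \<le> b" if "x \<le> t" "t \<le> t2" for t
  proof (rule ccontr)
    assume n: "\<not> f t \<le> b"
    have "\<exists>s\<ge>x. s \<le> t \<and> f s = b"
      by (rule IVT') (use n assms that c2 in \<open>auto intro: continuous_on_subset\<close>)
    then obtain s where s: "x \<le> s" "s \<le> t" "f s = b" by blast
    then have "t2 \<le> s" using t2 that by auto
    then have "t = t2" using s that by simp
    then show False using n t2(1) by auto
  qed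
  have "\<exists>t\<ge>x. t \<le> t2 \<and> f t = a" by (rule IVT') (use assms t2 c2 in auto)
  moreover have "closed ({x..t2} \<inter> f -` {a})" by (rule continuous_closed_preimage[OF c2]) auto
  then have cpt: "compact ({x..t2} \<inter> f -` {a})" using compact_Int_closed[of "{x..t2}" "{x..t2} \<inter> f -` {a}"] by (simp add: Int_absorb1)
  ultimately have "{x..t2} \<inter> f -` {a} \<noteq> {}" by auto
  define S' where "S' = {x..t2} \<inter> f -` {a}"
  have "\<exists>t\<in>S'. \<forall>s\<in>S'. s \<le> t"
    unfolding S'_def by (rule compact_attains_sup[OF cpt \<open>{x..t2} \<inter> f -` {a} \<noteq> {}\<close>])
  then obtain t1 where "t1 \<in> S'" "\<forall>t\<in>S'. t \<le> t1" by blast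
  note t1 = this[unfolded S'_def]
  have lb: "a \<le> f t" if "t1 \<le> t" "t \<le> t2" for t
  proof (rule ccontr)
    assume n: "\<not> a \<le> f t"
    have "\<exists>s\<ge>t. s \<le> t2 \<and> f s = a"
      by (rule IVT') (use n assms that t1 t2 c2 in \<open>auto intro: continuous_on_subset\<close>)
    then obtain s where s: "t \<le> s" "s \<le> t2" "f s = a" by blast
    then have "s \<le> t1" using t1 that by auto
    then have "t = t1" using s that by simp
    then show False using n t1 by auto
  qed
  show ?thesis
  proof (rule that[of t1 t2])
    have "t1 \<noteq> t2" using t1(1) t2(1) assms(4) by auto
    then show "t1 < t2" using t1 by auto
  qed (use t1(1) t2(1) ub lb in auto)
qed

text \<open>Pigeonhole: there are \<open>n + 1\<close> disjoint open slots of width \<open>e\<close>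
  and at most \<open>n\<close> points.\<close>

lemma slot_avoiding:
  fixes D :: "real set"
  assumes "finite D" "card D \<le> n" "0 < e"
  obtains j where "j \<le> n" "\<And>d. d \<in> D \<Longrightarrow> d \<le> real j * e \<or> real (Suc j) * e \<le> d"
proof (rule ccontr)
  assume "\<not> thesis"
  then have "\<forall>j\<in>{..n}. \<exists>d\<in>D. real j * e < d \<and> d < real (Suc j) * e"
    using that by (meson atMost_iff not_le)
  then obtain g where g: "\<And>j. j \<le> n \<Longrightarrow> g j \<in> D \<and> real j * e < g j \<and> g j < real (Suc j) * e" by (metis atMost_iff)
  have "inj_on g {..n}"
  proof (rule linorder_inj_onI)
    fix i j assume ij: "i < j" "i \<in> {..n}" "j \<in> {..n}"
    have "g i < real (Suc i) * e" using g ij by auto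
    also have "\<dots> \<le> real j * e" using ij assms(3) by (intro mult_right_mono) auto
    also have "\<dots> < g j" using g ij by auto
    finally show "g i \<noteq> g j" by simp
  qed auto
  moreover have "g ` {..n} \<subseteq> D" using g by auto
  ultimately have "card {..n} \<le> card D" using card_inj_on_le assms(1) by blast
  then show False using assms(2) by simp
qed

text \<open>An edge that moves by \<open>\<epsilon>\<close> crosses an annulus around its starting point free of roots.\<close>

lemma edge_modulus:
  assumes "0 < \<epsilon>"
  obtains c where "0 < c" "\<And>rs l u x x'. length rs = n \<Longrightarrow> edge rs l u \<Longrightarrow> x \<in> {0..l} \<Longrightarrow> x' \<in> {0..l} \<Longrightarrow>
    \<epsilon> \<le> norm (u x - u x') \<Longrightarrow> c \<le> \<bar>x - x'\<bar>"
proof -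
  \<comment> \<open>\<open>n + 1\<close> slots of width \<open>3 * \<eta>\<close> fill the distances
    from 0 to \<open>\<epsilon>\<close>. In a slot free of root distances, the middle third keeps
    \<open>\<eta>\<close> away from every root.\<close>
  define \<eta> where "\<eta> = \<epsilon> / (3 * (real n + 1))"
  have \<eta>: "0 < \<eta>" "3 * \<eta> * (real n + 1) = \<epsilon>" using assms by (auto simp: \<eta>_def field_simps)
  \<comment> \<open>A lower bound for the square root of \<open>|P|\<close> at distance
    \<open>\<eta>\<close> from the roots; the Euclidean speed there is at most \<open>1 / q\<close>,
    so crossing a width \<open>\<eta>\<close> takes time at least \<open>\<eta> * q\<close>.\<close>
  define q where "q = sqrt (\<eta> ^ n)"
  have q: "0 < q" using \<eta> by (simp add: q_def)
  have main: "\<eta> * q \<le> x' - x" if rs: "length rs = n" and e: "edge rs l u" and x: "x \<in> {0..l}" "x' \<in> {0..l}" "x \<le> x'"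
    and far: "\<epsilon> \<le> norm (u x' - u x)" for rs l u x x'
  proof -
    note e' = edgeD[OF e]
    define f where "f t = norm (u t - u x)" for t
    have cu: "continuous_on {x..x'} u" using e'(2) by (rule continuous_on_subset) (use x in auto)
    have cf: "continuous_on {x..x'} f" unfolding f_def by (intro continuous_intros cu)
    have "card ((\<lambda>r. norm (r - u x)) ` set rs) \<le> n"
      using card_image_le[of "set rs" "\<lambda>r. norm (r - u x)"] card_length[of rs] rs by simp
    then obtain j where j: "j \<le> n" "\<And>r. r \<in> set rs \<Longrightarrow> norm (r - u x) \<le> real j * (3 * \<eta>) \<or> real (Suc j) * (3 * \<eta>) \<le> norm (r - u x)"
      using slot_avoiding[of "(\<lambda>r. norm (r - u x)) ` set rs" n "3 * \<eta>"] \<eta>(1) by (metis finite_imageI finite_set image_eqI mult_pos_pos zero_less_numeral)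
    define a where "a = real j * (3 * \<eta>) + \<eta>"
    have aj: "a + 2 * \<eta> = real (Suc j) * (3 * \<eta>)" by (simp add: a_def algebra_simps)
    have "real (Suc j) * (3 * \<eta>) \<le> (real n + 1) * (3 * \<eta>)" using j(1) \<eta>(1) by (intro mult_right_mono) auto
    then have "a + 2 * \<eta> \<le> \<epsilon>" unfolding aj using \<eta>(2) by (simp add: algebra_simps)
    then have ab: "f x \<le> a" "a < a + \<eta>" "a + \<eta> \<le> f x'" using far \<eta>(1) by (auto simp: f_def a_def)
    obtain t1 t2 where t: "x \<le> t1" "t1 < t2" "t2 \<le> x'" "f t1 = a" "f t2 = a + \<eta>" "\<And>t. t1 \<le> t \<Longrightarrow> t \<le> t2 \<Longrightarrow> a \<le> f t \<and> f t \<le> a + \<eta>"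
      by (rule continuous_crossing[OF x(3) cf ab]) (rule that; assumption)
    have rt: "\<eta> \<le> norm (u t - r)" if "t1 \<le> t" "t \<le> t2" "r \<in> set rs" for t r
    proof -
      have "\<eta> \<le> \<bar>f t - norm (r - u x)\<bar>" using j(2)[OF that(3)] t(6)[OF that(1,2)] aj by (auto simp: a_def)
      also have "\<dots> \<le> norm ((u t - u x) - (r - u x))" unfolding f_def by (rule norm_triangle_ineq3)
      finally show ?thesis by simp
    qed
    have ex: "\<exists>v. (u has_vector_derivative v) (at t) \<and> norm v \<le> inverse q" if "t1 < t" "t < t2" for t
    proof -
      obtain v where v: "(u has_vector_derivative v) (at t)" "- root_poly rs (u t) * v\<^sup>2 = 1"
        using e'(6)[of t] \<open>t1 < t\<close> \<open>t < t2\<close> t x by auto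
      have "\<eta> ^ n \<le> norm (root_poly rs (u t))" using norm_root_poly_ge[of \<eta> rs "u t"] rt[of t] that \<eta>(1) rs by auto
      then have "q \<le> sqrt (norm (root_poly rs (u t)))" by (simp add: q_def)
      moreover have "norm (root_poly rs (u t)) * (norm v)\<^sup>2 = 1" using arg_cong[OF v(2), of norm] by (simp add: norm_mult norm_power)
      then have "sqrt (norm (root_poly rs (u t))) * norm v = 1" by (metis norm_ge_zero real_sqrt_abs2 real_sqrt_mult real_sqrt_one abs_of_nonneg power2_eq_square)
      ultimately have "q * norm v \<le> 1" by (metis mult_right_mono norm_ge_zero)
      then have "norm v \<le> inverse q" using q by (simp add: field_simps)
      with v(1) show ?thesis by blast
    qed
    then obtain V where V: "\<And>t. t1 < t \<Longrightarrow> t < t2 \<Longrightarrow> (u has_vector_derivative V t) (at t) \<and> norm (V t) \<le> inverse q" by metis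
    have cu2: "continuous_on {t1..t2} u" using cu by (rule continuous_on_subset) (use t in auto)
    obtain s where s: "s \<in> {t1<..<t2}" "norm (u t2 - u t1) \<le> norm ((t2 - t1) *\<^sub>R V s)"
      using mvt_general[OF t(2) cu2, of "\<lambda>t h. h *\<^sub>R V t"] V unfolding has_vector_derivative_def by blast
    have "\<eta> = f t2 - f t1" using t by simp
    also have "\<dots> \<le> norm (u t2 - u t1)" unfolding f_def using norm_triangle_ineq2[of "u t2 - u x" "u t1 - u x"] by simp
    also have "\<dots> \<le> (t2 - t1) * inverse q"
      using s V[of s] t(2) by (auto intro: order_trans mult_left_mono)
    finally have "\<eta> * q \<le> t2 - t1" using q by (simp add: field_simps)
    then show ?thesis using t by simp
  qed
  show ?thesis
  proof (rule that[of "\<eta> * q"])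
    show "0 < \<eta> * q" using \<eta> q by simp
    fix rs l u x x' assume *: "length rs = n" "edge rs l u" "x \<in> {0..l}" "x' \<in> {0..l}" "\<epsilon> \<le> norm (u x - u x')"
    show "\<eta> * q \<le> \<bar>x - x'\<bar>"
      using main[OF *(1-4)] main[OF *(1,2,4,3)] *(5) by (cases "x \<le> x'") (auto simp: norm_minus_commute)
  qed
qed

section \<open>Decomposing a short trajectory into edges\<close>

text \<open>\<open>d\<close> will be the natural speed of a trajectory, which is not known to be
  continuous but is locally a derivative. Derivatives are Henstock-Kurzweil integrable, bisection
  extends this to compact subintervals, and the indefinite integral is a global primitive.\<close>

lemma antiderivative_glue:
  fixes d :: "real \<Rightarrow> real"
  assumes "a < b" and loc: "\<And>s. a < s \<Longrightarrow> s < b \<Longrightarrow> \<exists>e>0. \<exists>H. \<forall>t. \<bar>t - s\<bar> < e \<longrightarrow> (H has_real_derivative d t) (at t)"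
  obtains h where "\<And>s. a < s \<Longrightarrow> s < b \<Longrightarrow> (h has_real_derivative d s) (at s)"
proof -
  have ftc: "(d has_integral H q - H p) {p..q}" if "p \<le> q" "\<And>t. p \<le> t \<Longrightarrow> t \<le> q \<Longrightarrow> (H has_real_derivative d t) (at t)" for H p q
    by (rule fundamental_theorem_of_calculus[OF that(1)])
       (use that(2) in \<open>auto simp: has_real_derivative_iff_has_vector_derivative intro: has_vector_derivative_at_within\<close>)
  have intg: "d integrable_on {p..q}" if pq: "a < p" "p \<le> q" "q < b" for p q
    using pq(2)
  proof (induction rule: Bolzano)
    case (trans x y z)
    show ?case by (rule Henstock_Kurzweil_Integration.integrable_combine[OF trans(3,4,1,2)])
  next
    case (local x)
    then obtain e H where e: "e > 0" "\<And>t. \<bar>t - x\<bar> < e \<Longrightarrow> (H has_real_derivative d t) (at t)"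
      using loc[of x] pq by force
    show ?case
    proof (intro exI[of _ e] conjI allI impI e(1))
      fix y z assume yz: "y \<le> x \<and> x \<le> z \<and> z - y < e"
      have "(d has_integral H z - H y) {y..z}" by (rule ftc) (use yz e(2) in auto)
      then show "d integrable_on {y..z}" by blast
    qed
  qed
  define D where "D p q = integral {p..q} d" for p q
  define m where "m = (a + b) / 2"
  have m: "a < m" "m < b" using assms(1) by (auto simp: m_def)
  define h where "h t = (if m \<le> t then D m t else - D t m)" for t
  have comb: "D p q + D q r = D p r" if "a < p" "p \<le> q" "q \<le> r" "r < b" for p q r
    unfolding D_def using Henstock_Kurzweil_Integration.integral_combine[of p q r d] intg[of p r] that by auto
  have h: "h t - h s = D s t" if "a < s" "s \<le> t" "t < b" for s t
  proof (cases "m \<le> s")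
    case True
    then show ?thesis using comb[of m s t] m that by (simp add: h_def)
  next
    case False
    show ?thesis
    proof (cases "m \<le> t")
      case True
      then show ?thesis using comb[of s m t] m that False by (simp add: h_def)
    next
      case f: False
      then show ?thesis using comb[of s t m] m that False by (simp add: h_def)
    qed
  qed
  show ?thesis
  proof (rule that)
    fix s assume s: "a < s" "s < b"
    obtain e H where e: "e > 0" "\<And>t. \<bar>t - s\<bar> < e \<Longrightarrow> (H has_real_derivative d t) (at t)"
      using loc[OF s] by blast
    define e' where "e' = min e (min (s - a) (b - s))"
    have e': "0 < e'" "e' \<le> e" "e' \<le> s - a" "e' \<le> b - s" using e(1) s by (auto simp: e'_def)
    have eq: "H t + (h s - H s) = h t" if t: "t \<in> ball s e'" for t
    proof -
      have ab: "a < t" "t < b" "\<bar>t - s\<bar> < e" using t e' by (auto simp: dist_real_def)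
      show ?thesis
      proof (cases "s \<le> t")
        case True
        have "(d has_integral H t - H s) {s..t}" by (rule ftc[OF True]) (use ab e(2) in auto)
        then have "D s t = H t - H s" unfolding D_def by (rule integral_unique)
        then show ?thesis using h[OF s(1) True ab(2)] by simp
      next
        case False
        then have le: "t \<le> s" by simp
        have "(d has_integral H s - H t) {t..s}" by (rule ftc[OF le]) (use ab e(2) in auto)
        then have "D t s = H s - H t" unfolding D_def by (rule integral_unique)
        then show ?thesis using h[OF ab(1) le s(2)] by simp
      qed
    qed
    have "((\<lambda>t. H t + (h s - H s)) has_real_derivative d s) (at s)"
      using e by (auto intro!: derivative_eq_intros)
    then show "(h has_real_derivative d s) (at s)"
      by (rule has_field_derivative_transform_within_open[OF _ open_ball _ eq]) (use e'(1) in auto)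
  qed
qed

lemma open_real_interval:
  fixes I :: "real set"
  assumes "open I" "connected I" "I \<noteq> {}" "\<And>x y. x \<in> I \<Longrightarrow> y \<in> I \<Longrightarrow> y - x \<le> C"
  obtains \<alpha> \<beta> where "\<alpha> < \<beta>" "I = {\<alpha><..<\<beta>}"
proof -
  obtain x0 where x0: "x0 \<in> I" using assms(3) by blast
  have bb: "bdd_below I" "bdd_above I"
    by (rule bdd_belowI[of _ "x0 - C"], use assms(4)[OF _ x0] in force, rule bdd_aboveI[of _ "x0 + C"], use assms(4)[OF x0] in force)
  have "x \<in> I" if x: "Inf I < x" "x < Sup I" for x
  proof -
    obtain y z where "y \<in> I" "y < x" "z \<in> I" "x < z"
      using cInf_lessD[OF assms(3) x(1)] less_cSupD[OF assms(3) x(2)] by blast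
    then show ?thesis using assms(2) unfolding connected_iff_interval by (meson less_imp_le)
  qed
  moreover have "Inf I < x \<and> x < Sup I" if x: "x \<in> I" for x
  proof -
    obtain e where e: "e > 0" "ball x e \<subseteq> I" using assms(1) x openE by blast
    then have "x - e/2 \<in> I" "x + e/2 \<in> I" by (auto simp: subset_eq dist_real_def)
    then have "Inf I \<le> x - e/2" "x + e/2 \<le> Sup I" using bb cInf_lower cSup_upper by auto
    then show ?thesis using e(1) by simp
  qed
  ultimately have "I = {Inf I<..<Sup I}" by auto
  moreover have "Inf I < Sup I" using \<open>\<And>x. x \<in> I \<Longrightarrow> Inf I < x \<and> x < Sup I\<close>[OF x0] by linarith
  ultimately show ?thesis using that by blast
qed

text \<open>The natural length \<open>h\<close>, with derivative \<open>sqrt X\<close>, becomes the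
  parameter. In it the open piece is a leaf with bounded image, so the uniform length bound makes
  the parameter interval finite, and the end zeros can be attached.\<close>

lemma unbroken_piece_edge:
  assumes s12: "s1 < s2" and cont: "continuous_on {s1..s2} \<gamma>" and inj: "inj_on \<gamma> {s1..s2}"
    and ends: "root_poly rs (\<gamma> s1) = 0" "root_poly rs (\<gamma> s2) = 0"
    and hor: "\<And>s. s1 < s \<Longrightarrow> s < s2 \<Longrightarrow> \<exists>v x. (\<gamma> has_vector_derivative v) (at s) \<and> 0 < x \<and> - root_poly rs (\<gamma> s) * v\<^sup>2 = complex_of_real x"
  obtains l u where "edge rs l u" "u 0 = \<gamma> s1" "u l = \<gamma> s2"
proof -
  obtain V X where V: "\<And>s. s1 < s \<Longrightarrow> s < s2 \<Longrightarrow> (\<gamma> has_vector_derivative V s) (at s) \<and> 0 < X s \<and> - root_poly rs (\<gamma> s) * (V s)\<^sup>2 = complex_of_real (X s)"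
    using hor by metis
  have reg: "root_poly rs (\<gamma> s) \<noteq> 0" if "s1 < s" "s < s2" for s using V[OF that] by auto
  define d where "d s = sqrt (X s)" for s
  have d0: "0 < d s" if "s1 < s" "s < s2" for s using V[OF that] by (simp add: d_def)
  have cg: "isCont \<gamma> s" if "s1 < s" "s < s2" for s using V[OF that] has_vector_derivative_continuous by blast
  have loc: "\<exists>e>0. \<exists>H. \<forall>t. \<bar>t - s\<bar> < e \<longrightarrow> (H has_real_derivative d t) (at t)" if s: "s1 < s" "s < s2" for s
  proof -
    have "\<gamma> s \<notin> set rs" using reg[OF s] by (simp add: root_poly_eq_0_iff)
    then obtain \<delta> where \<delta>: "\<delta> > 0" "\<And>r. r \<in> set rs \<Longrightarrow> \<delta> \<le> norm (\<gamma> s - r)"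
      using separate_point_closed[of "set rs" "\<gamma> s"] by (metis dist_norm finite_imp_closed finite_set)
    obtain \<beta> \<rho> where \<beta>: "flow_box rs \<rho> \<beta>" "\<beta> 0 = \<gamma> s" using flow_box_exists[OF \<delta>] by metis
    note fb = flow_boxD[OF \<beta>(1)]
    obtain \<Phi> where \<Phi>: "\<And>z. z \<in> \<beta> ` ball 0 \<rho> \<Longrightarrow> (\<Phi> has_field_derivative deriv \<Phi> z) (at z)"
      "\<And>z. z \<in> \<beta> ` ball 0 \<rho> \<Longrightarrow> (deriv \<Phi> z)\<^sup>2 = - root_poly rs z"
      using flow_box_coordinate[OF \<beta>(1)] by metis
    have "\<gamma> s \<in> \<beta> ` ball 0 \<rho>" using \<beta>(2) fb(1) by (metis centre_in_ball image_eqI)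
    moreover have "continuous_on {s1<..<s2} \<gamma>" using cg by (intro continuous_at_imp_continuous_on) auto
    then have "open ({s1<..<s2} \<inter> \<gamma> -` (\<beta> ` ball 0 \<rho>))" by (rule continuous_open_preimage[OF _ open_greaterThanLessThan fb(7)])
    ultimately obtain e where e: "e > 0" "ball s e \<subseteq> {s1<..<s2} \<inter> \<gamma> -` (\<beta> ` ball 0 \<rho>)"
      using s openE[of "{s1<..<s2} \<inter> \<gamma> -` (\<beta> ` ball 0 \<rho>)" s] by auto
    have ee: "s1 < t" "t < s2" "\<gamma> t \<in> \<beta> ` ball 0 \<rho>" if "s - e < t" "t < s + e" for t
    proof -
      have "t \<in> ball s e" using that by (auto simp: dist_real_def)
      with e(2) have "t \<in> {s1<..<s2} \<inter> \<gamma> -` (\<beta> ` ball 0 \<rho>)" by blast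
      then have "t \<in> {s1<..<s2}" "t \<in> \<gamma> -` (\<beta> ` ball 0 \<rho>)" by (rule IntD1, rule IntD2)
      then show "s1 < t" "t < s2" "\<gamma> t \<in> \<beta> ` ball 0 \<rho>" by (simp_all only: greaterThanLessThan_iff vimage_eq)
    qed
    \<comment> \<open>In the natural parameter the velocity is \<open>d t\<close> or
      \<open>- d t\<close>. Darboux's theorem keeps one sign near \<open>s\<close>, so the real part
      of the parameter, or its negative, is a local primitive of \<open>d\<close>.\<close>
    define g where "g t = V t * deriv \<Phi> (\<gamma> t)" for t
    have g: "((\<Phi> \<circ> \<gamma>) has_vector_derivative g t) (at t)" "g t = of_real (d t) \<or> g t = - of_real (d t)" if t: "s - e < t" "t < s + e" for t
    proof -
      note st = ee[OF t]
      have Vt: "(\<gamma> has_vector_derivative V t) (at t)" using V[OF st(1,2)] by blast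
      show "((\<Phi> \<circ> \<gamma>) has_vector_derivative g t) (at t)" unfolding g_def
        by (rule field_vector_diff_chain_at[OF Vt \<Phi>(1)[OF st(3)]])
      have "(g t)\<^sup>2 = (of_real (d t))\<^sup>2"
        using V[OF st(1,2)] \<Phi>(2)[OF st(3)] by (simp add: g_def power_mult_distrib d_def mult.commute flip: of_real_power)
      then show "g t = of_real (d t) \<or> g t = - of_real (d t)" by (simp add: power2_eq_iff)
    qed
    have R: "((\<lambda>t. Re (\<Phi> (\<gamma> t))) has_real_derivative Re (g t)) (at t)" if "s - e < t" "t < s + e" for t
      using bounded_linear.has_vector_derivative[OF bounded_linear_Re g(1)[OF that]]
      by (simp add: has_real_derivative_iff_has_vector_derivative o_def)
    have Rn: "Re (g t) \<noteq> 0" if "s - e < t" "t < s + e" for t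
      using g(2)[OF that] d0[OF ee(1,2)[OF that]] by auto
    have "(\<forall>t. s - e < t \<and> t < s + e \<longrightarrow> 0 < Re (g t)) \<or> (\<forall>t. s - e < t \<and> t < s + e \<longrightarrow> Re (g t) < 0)"
      by (rule nonzero_derivative_sign[where f = "\<lambda>t. Re (\<Phi> (\<gamma> t))"]) (use R Rn in blast)
    then show ?thesis
    proof
      assume pos: "\<forall>t. s - e < t \<and> t < s + e \<longrightarrow> 0 < Re (g t)"
      have "Re (g t) = d t" if "s - e < t" "t < s + e" for t
        using g(2)[OF that] pos[rule_format, of t] d0[OF ee(1,2)[OF that]] that by auto
      then show ?thesis using R e(1) by (intro exI[of _ e] conjI exI[of _ "\<lambda>t. Re (\<Phi> (\<gamma> t))"]) (auto simp: abs_less_iff)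
    next
      assume neg: "\<forall>t. s - e < t \<and> t < s + e \<longrightarrow> Re (g t) < 0"
      have "- Re (g t) = d t" if "s - e < t" "t < s + e" for t
        using g(2)[OF that] neg[rule_format, of t] d0[OF ee(1,2)[OF that]] that by auto
      then have "((\<lambda>t. - Re (\<Phi> (\<gamma> t))) has_real_derivative d t) (at t)" if "s - e < t" "t < s + e" for t
        using DERIV_minus[OF R[OF that]] that by simp
      then show ?thesis using e(1) by (intro exI[of _ e] conjI exI[of _ "\<lambda>t. - Re (\<Phi> (\<gamma> t))"]) (auto simp: abs_less_iff)
    qed
  qed
  obtain h where h: "\<And>s. s1 < s \<Longrightarrow> s < s2 \<Longrightarrow> (h has_real_derivative d s) (at s)"
    by (rule antiderivative_glue[OF s12 loc]) (assumption, assumption, rule that, assumption)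
  have hmono: "h s < h t" if "s1 < s" "s < t" "t < s2" for s t
    by (rule DERIV_pos_imp_increasing[OF that(2)]) (use h d0 that in \<open>meson le_less_trans less_le_trans\<close>)
  have hinj: "inj_on h {s1<..<s2}" by (rule linorder_inj_onI) (use hmono in force)+
  have hcont: "continuous_on {s1<..<s2} h"
    using h by (intro continuous_at_imp_continuous_on ballI) (auto intro: DERIV_isCont)
  \<comment> \<open>Invariance of domain supplies at once that \<open>I\<close> is open and that the
    inverse of \<open>h\<close> is continuous.\<close>
  define I where "I = h ` {s1<..<s2}"
  have Iopen: "open I" unfolding I_def by (rule invariance_of_domain[OF hcont open_greaterThanLessThan hinj])
  obtain g where g: "homeomorphism {s1<..<s2} I h g"
    unfolding I_def by (rule invariance_of_domain_homeomorphism[OF open_greaterThanLessThan hcont _ hinj]) auto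
  have gh: "g (h s) = s" if "s1 < s" "s < s2" for s using g that by (auto simp: homeomorphism_def)
  have hg: "h (g x) = x" "s1 < g x" "g x < s2" if "x \<in> I" for x using g that by (auto simp: homeomorphism_def)
  have gcont: "isCont g x" if "x \<in> I" for x
    using g Iopen that by (simp add: homeomorphism_def continuous_on_eq_continuous_at)
  have gder: "(g has_real_derivative inverse (d (g x))) (at x)" if x: "x \<in> I" for x
  proof -
    obtain e where e: "e > 0" "ball x e \<subseteq> I" using Iopen x openE by blast
    show ?thesis
      by (rule DERIV_inverse_function[where f = h and g = g and x = x and a = "x - e" and b = "x + e", OF h[OF hg(2,3)[OF x]]])
         (use d0[OF hg(2,3)[OF x]] e hg(1) gcont[OF x] in \<open>auto simp: subset_eq dist_real_def abs_less_iff\<close>)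
  qed
  define u where "u x = \<gamma> (g x)" for x
  have uder: "\<exists>v. (u has_vector_derivative v) (at x) \<and> - root_poly rs (u x) * v\<^sup>2 = 1" if x: "x \<in> I" for x
  proof (intro exI conjI)
    note gx = hg(2,3)[OF x]
    have "(g has_vector_derivative inverse (d (g x))) (at x)"
      using gder[OF x] by (simp add: has_real_derivative_iff_has_vector_derivative)
    from vector_diff_chain_at[OF this, of \<gamma> "V (g x)"] V[OF gx]
    show "(u has_vector_derivative inverse (d (g x)) *\<^sub>R V (g x)) (at x)" unfolding u_def[abs_def] by (simp add: o_def)
    have "- root_poly rs (u x) * (inverse (d (g x)) *\<^sub>R V (g x))\<^sup>2 = of_real ((inverse (d (g x)))\<^sup>2) * (- root_poly rs (\<gamma> (g x)) * (V (g x))\<^sup>2)"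
      by (simp add: u_def scaleR_conv_of_real power_mult_distrib)
    also have "\<dots> = of_real ((inverse (d (g x)))\<^sup>2 * X (g x))" using V[OF gx] by (simp only: of_real_mult)
    also have "(inverse (d (g x)))\<^sup>2 * X (g x) = 1" using V[OF gx] by (simp add: d_def power_inverse)
    finally show "- root_poly rs (u x) * (inverse (d (g x)) *\<^sub>R V (g x))\<^sup>2 = 1" by simp
  qed
  have L: "leaf rs I u"
    unfolding leaf_def
  proof (intro conjI ballI allI impI Iopen uder)
    show "connected I" unfolding I_def by (rule connected_continuous_image[OF hcont]) simp
    show "I \<noteq> {}" unfolding I_def using s12 by simp
    show "inj_on u I"
    proof (rule inj_onI)
      fix x y assume xy: "x \<in> I" "y \<in> I" "u x = u y"
      then have "g x = g y" using inj_onD[OF inj, of "g x" "g y"] hg(2,3)[OF xy(1)] hg(2,3)[OF xy(2)] by (simp add: u_def)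
      then show "x = y" using hg(1) xy by metis
    qed
    fix K assume K: "compact K \<and> (\<forall>z\<in>K. root_poly rs z \<noteq> 0)"
    define S where "S = {s1..s2} \<inter> \<gamma> -` K"
    have "closed S" unfolding S_def using continuous_closed_preimage[OF cont closed_atLeastAtMost] K compact_imp_closed by blast
    then have "compact S" using compact_Int_closed[of "{s1..s2}" S] unfolding S_def by (simp add: Int_absorb1)
    moreover have Ssub: "S \<subseteq> {s1<..<s2}"
    proof
      fix s assume s: "s \<in> S"
      then have "root_poly rs (\<gamma> s) \<noteq> 0" using K by (auto simp: S_def)
      then have "s \<noteq> s1" "s \<noteq> s2" using ends by auto
      then show "s \<in> {s1<..<s2}" using s by (auto simp: S_def)
    qed
    ultimately have "compact (h ` S)" using hcont by (blast intro: compact_continuous_image continuous_on_subset)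
    moreover have "{x \<in> I. u x \<in> K} = h ` S"
    proof
      show "{x \<in> I. u x \<in> K} \<subseteq> h ` S"
      proof
        fix x assume x: "x \<in> {x \<in> I. u x \<in> K}"
        then have "g x \<in> S" using hg(2,3)[of x] by (auto simp: S_def u_def)
        then show "x \<in> h ` S" using hg(1)[of x] x by (metis (mono_tags, lifting) image_eqI mem_Collect_eq)
      qed
      show "h ` S \<subseteq> {x \<in> I. u x \<in> K}" using Ssub gh by (auto simp: I_def u_def S_def)
    qed
    ultimately show "compact {x \<in> I. u x \<in> K}" by simp
  qed
  have rsne: "rs \<noteq> []" using ends by auto
  obtain R0 where R0: "\<And>r. r \<in> set rs \<Longrightarrow> norm r \<le> R0" using finite_imp_bounded[of "set rs"] unfolding bounded_iff by auto
  define R where "R = max R0 1"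
  have R: "0 < R" "set rs \<subseteq> cball 0 R" using R0 by (auto simp: R_def le_max_iff_disj)
  have "u ` I \<subseteq> \<gamma> ` {s1..s2}" unfolding u_def using hg(2,3) by force
  moreover have "compact (\<gamma> ` {s1..s2})" using cont by (rule compact_continuous_image) simp
  ultimately have "bounded (u ` I)" using compact_imp_bounded bounded_subset by blast
  then have uR: "u ` I \<subseteq> cball 0 R" using leaf_in_disc[OF L rsne R(2)] by auto
  obtain C where C: "\<And>x x'. x \<in> I \<Longrightarrow> x' \<in> I \<Longrightarrow> x' - x \<le> C"
    using leaf_length_bound[OF R(1), of "length rs"] rsne R(2) L uR by (metis length_greater_0_conv)
  have conI: "connected I" "I \<noteq> {}" using L by (auto simp: leaf_def)
  obtain \<alpha> \<beta> where ab: "\<alpha> < \<beta>" "I = {\<alpha><..<\<beta>}"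
    using open_real_interval[OF Iopen conI, of C] C by metis
  define l where "l = \<beta> - \<alpha>"
  \<comment> \<open>\<open>g\<close>, continued by lines of slope one on both sides, is an
    increasing bijection of the real line; increasing surjections are continuous, which settles
    continuity at the two ends without computing limits.\<close>
  define k where "k x = (if x \<le> 0 then s1 + x else if x < l then g (\<alpha> + x) else s2 + (x - l))" for x
  have l0: "0 < l" using ab by (simp add: l_def)
  have gmono: "g x < g y" if "x \<in> I" "y \<in> I" "x < y" for x y
  proof (rule ccontr)
    assume "\<not> g x < g y"
    then have "h (g y) \<le> h (g x)" using hmono[of "g y" "g x"] hg(2,3)[OF that(1)] hg(2,3)[OF that(2)] by (cases "g y = g x") auto
    then show False using hg(1) that by simp
  qed
  have kin: "s1 < k x \<and> k x < s2" "k x = g (\<alpha> + x)" "\<alpha> + x \<in> I" if "0 < x" "x < l" for x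
    using that hg(2,3)[of "\<alpha> + x"] ab by (auto simp: k_def l_def)
  have kmono: "k x < k y" if "x < y" for x y
  proof -
    consider "y \<le> 0" | "x \<le> 0" "0 < y" "y < l" | "x \<le> 0" "l \<le> y" | "0 < x" "y < l" | "0 < x" "x < l" "l \<le> y" | "l \<le> x" using l0 by linarith
    then show ?thesis
    proof cases
      case 2 then show ?thesis using kin(1)[of y] by (simp add: k_def)
    next
      case 4 then show ?thesis using kin(2)[of x] kin(2)[of y] gmono[OF kin(3)[of x] kin(3)[of y]] that by simp
    next
      case 5 then show ?thesis using kin(1)[of x] l0 by (simp add: k_def)
    qed (use that l0 s12 in \<open>auto simp: k_def\<close>)
  qed
  have "surj k"
    unfolding surj_def
  proof
    fix y
    consider "y \<le> s1" | "s2 \<le> y" | "s1 < y" "y < s2" by linarith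
    then show "\<exists>x. y = k x"
    proof cases
      case 1 then show ?thesis by (intro exI[of _ "y - s1"]) (simp add: k_def)
    next
      case 2 then show ?thesis using l0 by (intro exI[of _ "l + (y - s2)"]) (simp add: k_def)
    next
      case 3
      then have "h y \<in> I" by (auto simp: I_def)
      then have "0 < h y - \<alpha>" "h y - \<alpha> < l" using ab by (auto simp: l_def)
      from kin(2)[OF this] gh[OF 3] show ?thesis by (intro exI[of _ "h y - \<alpha>"]) simp
    qed
  qed
  then have kc: "continuous_on UNIV k"
    by (intro continuous_onI_mono) (use kmono in \<open>auto simp: order.order_iff_strict\<close>)
  have kran: "k ` {0..l} \<subseteq> {s1..s2}"
  proof
    fix y assume "y \<in> k ` {0..l}"
    then obtain x where x: "0 \<le> x" "x \<le> l" "y = k x" by auto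
    consider "x = 0" | "x = l" | "0 < x" "x < l" using x by linarith
    then show "y \<in> {s1..s2}" using kin(1)[of x] x(3) s12 l0 by cases (auto simp: k_def)
  qed
  have "edge rs l (\<lambda>x. \<gamma> (k x))"
    unfolding edge_def
  proof (intro conjI ballI)
    show "continuous_on {0..l} (\<lambda>x. \<gamma> (k x))"
      by (rule continuous_on_compose2[OF cont continuous_on_subset[OF kc] kran]) auto
    have kinj: "inj_on k {0..l}" by (rule linorder_inj_onI) (use kmono in force)+
    have "inj_on (\<gamma> \<circ> k) {0..l}" by (rule comp_inj_on[OF kinj inj_on_subset[OF inj kran]])
    then show "inj_on (\<lambda>x. \<gamma> (k x)) {0..l}" by (simp add: o_def)
    show "root_poly rs (\<gamma> (k 0)) = 0" "root_poly rs (\<gamma> (k l)) = 0" using ends l0 by (simp_all add: k_def)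
    fix x assume "x \<in> {0<..<l}"
    then have x: "0 < x" "x < l" by auto
    obtain v where v: "(u has_vector_derivative v) (at (\<alpha> + x))" "- root_poly rs (u (\<alpha> + x)) * v\<^sup>2 = 1"
      using uder[OF kin(3)[OF x]] by blast
    have "((\<lambda>x. \<alpha> + x) has_vector_derivative 1) (at x)" by (auto intro!: derivative_eq_intros)
    from vector_diff_chain_at[OF this v(1)] have "((\<lambda>x. u (\<alpha> + x)) has_vector_derivative v) (at x)" by (simp add: o_def)
    then have "((\<lambda>x. \<gamma> (k x)) has_vector_derivative v) (at x)"
      by (rule has_vector_derivative_transform_within_open[of _ _ _ "{0<..<l}"]) (use x kin(2) in \<open>auto simp: u_def\<close>)
    moreover have "u (\<alpha> + x) = \<gamma> (k x)" using kin(2)[OF x] by (simp add: u_def)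
    ultimately show "\<exists>v. ((\<lambda>x. \<gamma> (k x)) has_vector_derivative v) (at x) \<and> - root_poly rs (\<gamma> (k x)) * v\<^sup>2 = 1"
      using v(2) by auto
  qed (rule l0)
  moreover have "\<gamma> (k 0) = \<gamma> s1" "\<gamma> (k l) = \<gamma> s2" using l0 by (simp_all add: k_def)
  ultimately show ?thesis by (rule that)
qed

definition edge_rel :: "complex list \<Rightarrow> (complex \<times> complex) set" where
  "edge_rel rs = {(p, q). \<exists>l u. edge rs l u \<and> u 0 = p \<and> u l = q}"

text \<open>Zeros are met at finitely many times, because \<open>\<gamma>\<close> is injective and
  \<open>set rs\<close> is finite. The induction on the number of such times before \<open>s\<close>
  appends the piece that starts at the preceding one.\<close>

lemma horizontal_arc_edges:
  assumes g: "arc \<gamma>" and ends: "root_poly rs (\<gamma> 0) = 0" "root_poly rs (\<gamma> 1) = 0"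
    and hor: "\<And>s. 0 < s \<Longrightarrow> s < 1 \<Longrightarrow> root_poly rs (\<gamma> s) \<noteq> 0 \<Longrightarrow>
      \<exists>v x. (\<gamma> has_vector_derivative v) (at s) \<and> 0 < x \<and> - root_poly rs (\<gamma> s) * v\<^sup>2 = complex_of_real x"
  shows "(\<gamma> 0, \<gamma> 1) \<in> (edge_rel rs)\<^sup>*"
proof -
  have cont: "continuous_on {0..1} \<gamma>" and inj: "inj_on \<gamma> {0..1}" using g by (auto simp: arc_def path_def)
  define T where "T = {0..1} \<inter> \<gamma> -` set rs"
  have fin: "finite T" unfolding T_def Int_commute[of "{0..1}"] using inj by (intro finite_vimage_IntI) auto
  have T: "s \<in> T \<longleftrightarrow> 0 \<le> s \<and> s \<le> 1 \<and> root_poly rs (\<gamma> s) = 0" for s by (auto simp: T_def root_poly_eq_0_iff)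
  have "(\<gamma> 0, \<gamma> s) \<in> (edge_rel rs)\<^sup>*" if "s \<in> T" for s
    using that
  proof (induction "card {t\<in>T. t < s}" arbitrary: s rule: less_induct)
    case less
    show ?case
    proof (cases "s = 0")
      case False
      define P where "P = {t\<in>T. t < s}"
      have "0 \<in> P" using False less.prems ends T by (auto simp: P_def)
      have finP: "finite P" using fin by (simp add: P_def)
      define s' where "s' = Max P"
      have s': "s' \<in> P" "\<And>t. t \<in> P \<Longrightarrow> t \<le> s'" using Max_in[OF finP] \<open>0 \<in> P\<close> Max_ge[OF finP] by (auto simp: s'_def)
      have s'T: "s' \<in> T" "s' < s" using s'(1) by (auto simp: P_def)
      have "{t\<in>T. t < s'} \<subset> {t\<in>T. t < s}" using s'T by auto
      then have "card {t\<in>T. t < s'} < card {t\<in>T. t < s}" using fin by (intro psubset_card_mono) auto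
      from less.hyps[OF this s'T(1)] have 1: "(\<gamma> 0, \<gamma> s') \<in> (edge_rel rs)\<^sup>*" .
      have b: "0 \<le> s'" "s \<le> 1" using s'T less.prems T by auto
      obtain l u where "edge rs l u" "u 0 = \<gamma> s'" "u l = \<gamma> s"
      proof (rule unbroken_piece_edge[OF s'T(2)])
        show "continuous_on {s'..s} \<gamma>" using cont by (rule continuous_on_subset) (use b in auto)
        show "inj_on \<gamma> {s'..s}" using inj by (rule inj_on_subset) (use b in auto)
        fix t assume t: "s' < t" "t < s"
        have "t \<notin> T" using s'(2)[of t] t by (auto simp: P_def)
        then show "\<exists>v x. (\<gamma> has_vector_derivative v) (at t) \<and> 0 < x \<and> - root_poly rs (\<gamma> t) * v\<^sup>2 = complex_of_real x"
          using t b T by (intro hor) auto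
      qed (use s'T less.prems T in auto)
      then have "(\<gamma> s', \<gamma> s) \<in> edge_rel rs" by (auto simp: edge_rel_def)
      with 1 show ?thesis by (rule rtrancl_into_rtrancl)
    qed simp
  qed
  then show ?thesis using ends T[of 1] by simp
qed

section \<open>Limits of edges\<close>

text \<open>The estimate of \<open>root_poly_ratio\<close> with the roots moving instead of the
  point: each factor is \<open>1 + (r - q) / (z - r)\<close>.\<close>

lemma root_poly_quotient:
  assumes "length qs = length rs" "0 < d" "0 \<le> k"
    and "\<And>i. i < length rs \<Longrightarrow> d \<le> norm (z - rs ! i)"
    and "\<And>i. i < length rs \<Longrightarrow> norm (rs ! i - qs ! i) \<le> k * d"
  shows "norm (root_poly qs z / root_poly rs z - 1) \<le> (1 + k) ^ length rs - 1"
  using assms(1,4,5)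
proof (induction qs rs rule: list_induct2)
  case (Cons q qs r rs)
  define t where "t = (r - q) / (z - r)"
  define A where "A = root_poly qs z / root_poly rs z - 1"
  have d: "d \<le> norm (z - r)" using Cons.prems(1)[of 0] by simp
  then have nz: "z \<noteq> r" using assms(2) by auto
  have "norm t \<le> k * d / d"
    unfolding t_def norm_divide using d assms(2,3) Cons.prems(2)[of 0] by (intro frac_le) auto
  then have t: "norm t \<le> k" using assms(2) by simp
  have A: "norm A \<le> (1 + k) ^ length rs - 1"
    unfolding A_def using Cons.prems(1)[of "Suc _"] Cons.prems(2)[of "Suc _"] by (intro Cons.IH) auto
  have "root_poly (q # qs) z / root_poly (r # rs) z = (1 + t) * (1 + A)"
    using nz by (simp add: t_def A_def field_simps)
  then have "root_poly (q # qs) z / root_poly (r # rs) z - 1 = t + A + t * A" by (simp add: algebra_simps)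
  also have "norm \<dots> \<le> norm t + norm A + norm t * norm A"
    by (metis norm_triangle_mono norm_mult norm_triangle_ineq order_refl)
  also have "\<dots> \<le> k + ((1 + k) ^ length rs - 1) + k * ((1 + k) ^ length rs - 1)"
    using t A assms(3) by (intro add_mono mult_mono) auto
  also have "\<dots> = (1 + k) ^ length (r # rs) - 1" by (simp add: algebra_simps)
  finally show ?case .
qed simp

text \<open>Rescaled to \<open>{0..1}\<close>, the edges are bounded and, by
  \<open>edge_modulus\<close>, equicontinuous, so a subsequence converges uniformly to some
  \<open>w\<close>, with lengths tending to \<open>\<Lambda>\<close>. The displacement bound
  \<open>\<epsilon>\<close> keeps \<open>\<Lambda>\<close> positive. \<open>w\<close> may run
  through further zeros of the limit, hence a chain of edges in the conclusion.\<close>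

lemma edge_limit_aux:
  assumes len: "\<And>m. length (rs m) = n" "length qs = n"
    and conv: "\<And>i. i < n \<Longrightarrow> (\<lambda>m. rs m ! i) \<longlonglongrightarrow> qs ! i"
    and e: "\<And>m. edge (rs m) (l m) (u m)"
    and ends: "(\<lambda>m. u m 0) \<longlonglongrightarrow> p" "(\<lambda>m. u m (l m)) \<longlonglongrightarrow> q"
    and \<epsilon>: "0 < \<epsilon>" "\<And>m. \<epsilon> \<le> norm (u m 0 - u m (l m))"
  shows "(p, q) \<in> (edge_rel qs)\<^sup>*"
proof -

  \<comment> \<open>Uniform bounds on roots and lengths\<close>
  have n0: "0 < n" using edgeD(4)[OF e[of 0]] len(1)[of 0] by (cases "rs 0") auto
  have "\<exists>b. \<forall>m. norm (rs m ! i) \<le> b" if "i < n" for i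
    using convergent_imp_Bseq[OF convergentI[OF conv[OF that]]] unfolding Bseq_def by blast
  then obtain b where b: "\<And>i m. i < n \<Longrightarrow> norm (rs m ! i) \<le> b i" by metis
  define R where "R = 1 + (\<Sum>i<n. \<bar>b i\<bar>)"
  have R0: "0 < R" unfolding R_def by (simp add: add_pos_nonneg sum_nonneg)
  have bR: "b i \<le> R" if "i < n" for i
    using member_le_sum[of i "{..<n}" "\<lambda>i. \<bar>b i\<bar>"] that unfolding R_def by auto
  have R: "set (rs m) \<subseteq> cball 0 R" for m
    using b bR len(1)[of m] by (force simp: in_set_conv_nth intro: order_trans)
  obtain C where C: "\<And>m. l m \<le> C"
    using edge_length_bound[OF R0 n0] len(1) R e by metis
  have C0: "0 < C" using edgeD(1)[OF e[of 0]] C[of 0] by linarith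
  obtain c where c: "0 < c" "\<And>m. c \<le> l m"
  proof -
    obtain c where c: "0 < c" "\<And>rs l u x x'. length rs = n \<Longrightarrow> edge rs l u \<Longrightarrow> x \<in> {0..l} \<Longrightarrow> x' \<in> {0..l} \<Longrightarrow>
      \<epsilon> \<le> norm (u x - u x') \<Longrightarrow> c \<le> \<bar>x - x'\<bar>" by (rule edge_modulus[OF \<epsilon>(1)]) (rule that; assumption)
    have "c \<le> l m" for m using c(2)[OF len(1) e[of m], of 0 "l m"] edgeD(1)[OF e[of m]] \<epsilon>(2)[of m] by simp
    with c(1) show ?thesis by (rule that)
  qed
  define v where "v m t = u m (l m * t)" for m t
  have lt: "l m * t \<in> {0..l m}" if "t \<in> {0..1}" for m t
    using that edgeD(1)[OF e[of m]] by (simp add: mult_left_le)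
  have vR: "norm (v m t) \<le> R" if "t \<in> {0..1}" for m t
    using edge_in_disc[OF e R] lt[OF that] unfolding v_def by force
  have equi: "\<exists>d>0. \<forall>m y. y \<in> {0..1} \<and> norm (x - y) < d \<longrightarrow> norm (v m x - v m y) < \<eta>" if xh: "x \<in> {0..1}" "0 < \<eta>" for x \<eta>
  proof -
    obtain a where a: "0 < a" "\<And>rs l u x x'. length rs = n \<Longrightarrow> edge rs l u \<Longrightarrow> x \<in> {0..l} \<Longrightarrow> x' \<in> {0..l} \<Longrightarrow>
      \<eta> \<le> norm (u x - u x') \<Longrightarrow> a \<le> \<bar>x - x'\<bar>" by (rule edge_modulus[OF xh(2)]) (rule that; assumption)
    show ?thesis
    proof (intro exI[of _ "a / C"] conjI allI impI)
      show "0 < a / C" using a C0 by simp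
      fix m y assume y: "y \<in> {0..1} \<and> norm (x - y) < a / C"
      show "norm (v m x - v m y) < \<eta>"
      proof (rule ccontr)
        assume "\<not> ?thesis"
        then have "a \<le> \<bar>l m * x - l m * y\<bar>"
          using a(2)[OF len(1) e lt[OF \<open>x \<in> {0..1}\<close>] lt, of y m] y by (simp add: v_def)
        also have "\<dots> = l m * \<bar>x - y\<bar>" using edgeD(1)[OF e[of m]] by (simp add: abs_mult flip: right_diff_distrib)
        also have "\<dots> \<le> C * \<bar>x - y\<bar>" using C by (intro mult_right_mono) auto
        also have "\<dots> < a" using y C0 by (simp add: field_simps)
        finally show False by simp
      qed
    qed
  qed

  \<comment> \<open>The limit curve and its ends\<close>
  obtain w k where w: "continuous_on {0..1} w" "strict_mono (k :: nat \<Rightarrow> nat)"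
      "\<And>e. 0 < e \<Longrightarrow> \<exists>N. \<forall>m x. m \<ge> N \<and> x \<in> {0..1} \<longrightarrow> norm (v (k m) x - w x) < e"
    using Arzela_Ascoli[of "{0..1::real}" v R] vR equi by (metis compact_Icc)
  have lb: "c \<le> l (k m) \<and> l (k m) \<le> C" for m using c(2) C by simp
  obtain r \<Lambda> where r: "strict_mono (r :: nat \<Rightarrow> nat)" "(\<lambda>m. l (k (r m))) \<longlonglongrightarrow> \<Lambda>"
    by (rule bounded_pair_subseq[of c "\<lambda>m. l (k m)" C, OF lb lb]) (rule that; assumption)
  define K where "K m = k (r m)" for m
  have K: "strict_mono K" unfolding K_def using w(2) r(1) by (simp add: strict_mono_def)
  have lK: "(\<lambda>m. l (K m)) \<longlonglongrightarrow> \<Lambda>" using r(2) by (simp add: K_def)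
  have lam: "0 < \<Lambda>" using LIMSEQ_le_const[OF lK, of c] c by force
  have unif: "\<exists>N. \<forall>m\<ge>N. \<forall>x\<in>{0..1}. norm (v (K m) x - w x) < \<eta>" if "0 < \<eta>" for \<eta>
  proof -
    obtain N where N: "\<And>m x. m \<ge> N \<Longrightarrow> x \<in> {0..1} \<Longrightarrow> norm (v (k m) x - w x) < \<eta>" using w(3)[OF \<open>0 < \<eta>\<close>] by blast
    have rm: "m \<le> r m" for m using r(1) by (rule seq_suble)
    show ?thesis unfolding K_def
    proof (intro exI[of _ N] allI impI ballI)
      fix m and x :: real assume "N \<le> m" and x: "x \<in> {0..1}"
      then have "N \<le> r m" using rm[of m] by linarith
      then show "norm (v (k (r m)) x - w x) < \<eta>" using x by (rule N)
    qed
  qed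
  have pw: "(\<lambda>m. v (K m) x) \<longlonglongrightarrow> w x" if "x \<in> {0..1}" for x
    unfolding LIMSEQ_iff using unif that by blast
  have convK: "(\<lambda>m. rs (K m) ! i) \<longlonglongrightarrow> qs ! i" if "i < n" for i
    using LIMSEQ_subseq_LIMSEQ[OF conv[OF that] K] by (simp add: o_def)
  have rclose: "\<forall>\<^sub>F m in sequentially. \<forall>i<n. norm (rs (K m) ! i - qs ! i) < \<eta>" if "0 < \<eta>" for \<eta>
  proof -
    have "\<forall>\<^sub>F m in sequentially. \<forall>i\<in>{..<n}. dist (rs (K m) ! i) (qs ! i) < \<eta>"
      by (rule eventually_ball_finite) (use convK that in \<open>auto simp: tendsto_iff\<close>)
    then show ?thesis by eventually_elim (auto simp: dist_norm)
  qed
  have w01: "w 0 = p" "w 1 = q"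
  proof -
    have "(\<lambda>m. v (K m) 0) \<longlonglongrightarrow> p" "(\<lambda>m. v (K m) 1) \<longlonglongrightarrow> q"
      using LIMSEQ_subseq_LIMSEQ[OF ends(1) K] LIMSEQ_subseq_LIMSEQ[OF ends(2) K] by (simp_all add: v_def o_def)
    then show "w 0 = p" "w 1 = q" using pw[of 0] pw[of 1] LIMSEQ_unique by auto
  qed
  have limroot: "x \<in> set qs" if z: "\<And>m. z m \<in> set (rs (K m))" "z \<longlonglongrightarrow> x" for z x
  proof (rule ccontr)
    assume "x \<notin> set qs"
    then obtain d where d: "d > 0" "\<And>r. r \<in> set qs \<Longrightarrow> d \<le> dist x r"
      using separate_point_closed[of "set qs" x] by (metis finite_imp_closed finite_set)
    have "\<forall>\<^sub>F m in sequentially. dist (z m) x < d/2" using tendstoD[OF z(2), of "d/2"] d(1) by simp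
    moreover have "\<forall>\<^sub>F m in sequentially. \<forall>i<n. norm (rs (K m) ! i - qs ! i) < d/2" using rclose[of "d/2"] d(1) by simp
    ultimately have "\<forall>\<^sub>F m in sequentially. False"
    proof eventually_elim
      case (elim m)
      obtain i where i: "i < n" "rs (K m) ! i = z m" using z(1)[of m] len(1) by (auto simp: in_set_conv_nth)
      have "d \<le> dist x (qs ! i)" using d(2) i(1) len(2) by simp
      also have "\<dots> \<le> dist (z m) x + dist (z m) (qs ! i)" by (metis dist_commute dist_triangle)
      also have "\<dots> < d/2 + d/2" using elim i by (intro add_strict_mono) (auto simp: dist_norm)
      finally show False by simp
    qed
    then show False by simp
  qed
  have pq: "p \<in> set qs" "q \<in> set qs"
  proof -
    show "p \<in> set qs" by (rule limroot[OF _ LIMSEQ_subseq_LIMSEQ[OF ends(1) K]])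
       (use edgeD(4)[OF e] in \<open>simp add: root_poly_eq_0_iff\<close>)
    show "q \<in> set qs" by (rule limroot[OF _ LIMSEQ_subseq_LIMSEQ[OF ends(2) K]])
       (use edgeD(5)[OF e] in \<open>simp add: root_poly_eq_0_iff\<close>)
  qed
  have sep: "\<exists>d>0. \<forall>i<n. 2 * d \<le> norm (z - qs ! i)" if "z \<notin> set qs" for z
  proof -
    obtain d where d: "d > 0" "\<And>r. r \<in> set qs \<Longrightarrow> d \<le> dist z r"
      using separate_point_closed[OF _ \<open>z \<notin> set qs\<close>] by (metis finite_imp_closed finite_set)
    then show ?thesis using len(2) by (intro exI[of _ "d/2"]) (auto simp: dist_norm)
  qed

  \<comment> \<open>Injectivity away from the zeros\<close>
  have inj: "x = y" if xy: "0 < x" "x < 1" "0 < y" "y < 1" "w x = w y" "w x \<notin> set qs" for x y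
  proof (rule ccontr)
    assume "x \<noteq> y"
    obtain d where d: "d > 0" "\<And>i. i < n \<Longrightarrow> 2 * d \<le> norm (w x - qs ! i)" using sep[OF xy(6)] by blast
    define M where "M = sqrt ((2 * R) ^ n)"
    have M0: "0 < M" using R0 by (simp add: M_def)
    \<comment> \<open>If \<open>w x = w y\<close>, late edges visit the disc of radius
      \<open>s\<close> about this point at both rescaled times. The choice of \<open>s\<close> makes
      the admissible delay \<open>3 * M * s\<close> smaller than \<open>c * |x - y|\<close>, which
      is at most the time elapsed.\<close>
    define s where "s = min (box_const n * d / 72) (c * \<bar>x - y\<bar> / (6 * M))"
    have s: "0 < s" "s \<le> box_const n * d / 72" "3 * M * s < c * \<bar>x - y\<bar>"
    proof -
      show "0 < s" using box_const_pos[of n] d(1) c(1) M0 \<open>x \<noteq> y\<close> by (simp add: s_def)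
      show "s \<le> box_const n * d / 72" by (simp add: s_def)
      have "3 * M * s \<le> 3 * M * (c * \<bar>x - y\<bar> / (6 * M))" using M0 by (intro mult_left_mono) (auto simp: s_def)
      also have "\<dots> = c * \<bar>x - y\<bar> / 2" using M0 by simp
      also have "\<dots> < c * \<bar>x - y\<bar>" using c(1) \<open>x \<noteq> y\<close> by simp
      finally show "3 * M * s < c * \<bar>x - y\<bar>" .
    qed
    have zR: "norm (w x) \<le> R"
      using LIMSEQ_le_const2[OF tendsto_norm[OF pw[of x]], of R] vR[of x] xy by auto
    have "\<forall>\<^sub>F m in sequentially. norm (v (K m) x - w x) < s" "\<forall>\<^sub>F m in sequentially. norm (v (K m) y - w x) < s"
      using pw[of x] pw[of y] xy s(1) by (auto simp: tendsto_iff dist_norm)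
    moreover have "\<forall>\<^sub>F m in sequentially. \<forall>i<n. norm (rs (K m) ! i - qs ! i) < d" using rclose d(1) by simp
    ultimately have "\<forall>\<^sub>F m in sequentially. False"
    proof eventually_elim
      case (elim m)
      have far: "d \<le> norm (w x - r)" if r: "r \<in> set (rs (K m))" for r
      proof -
        obtain i where i: "i < n" "rs (K m) ! i = r" using r len(1) by (auto simp: in_set_conv_nth)
        have "2 * d \<le> norm (w x - qs ! i)" using d(2) i by simp
        also have "\<dots> \<le> norm (w x - r) + norm (r - qs ! i)" using norm_triangle_ineq[of "w x - r" "r - qs ! i"] by simp
        finally show ?thesis using elim(3) i by force
      qed
      have l0: "0 < l (K m)" using edgeD(1)[OF e] .
      have "\<bar>l (K m) * x - l (K m) * y\<bar> \<le> 3 * sqrt (norm (root_poly (rs (K m)) (w x))) * s"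
        by (rule leaf_meets_disc_once[OF edge_leaf[OF e] d(1) far])
           (use s(2) elim l0 xy len(1) in \<open>auto simp: v_def less_imp_le\<close>)
      also have "\<dots> \<le> 3 * M * s"
      proof -
        have "norm (w x - r) \<le> 2 * R" if "r \<in> set (rs (K m))" for r
          using norm_triangle_ineq4[of "w x" r] zR R[of "K m"] that by force
        then have "norm (root_poly (rs (K m)) (w x)) \<le> (2 * R) ^ n"
          using norm_root_poly_le[of "rs (K m)" "w x" "2 * R"] len(1) by simp
        then show ?thesis using s(1) by (auto simp: M_def intro!: mult_right_mono)
      qed
      also have "\<dots> < c * \<bar>x - y\<bar>" by (rule s(3))
      also have "\<dots> \<le> l (K m) * \<bar>x - y\<bar>" using c(2) by (intro mult_right_mono) auto
      also have "\<dots> = \<bar>l (K m) * x - l (K m) * y\<bar>" using l0 by (simp add: abs_mult flip: right_diff_distrib)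
      finally show False by simp
    qed
    then show False by simp
  qed

  \<comment> \<open>Horizontality away from the zeros\<close>
  have hor: "\<exists>V. (w has_vector_derivative V) (at t) \<and> - root_poly qs (w t) * V\<^sup>2 = of_real (\<Lambda>\<^sup>2)"
    if t: "0 < t" "t < 1" and reg: "w t \<notin> set qs" for t
  proof -
    define z where "z = w t"
    obtain d where d: "d > 0" "\<And>i. i < n \<Longrightarrow> 2 * d \<le> norm (z - qs ! i)" using sep[OF reg] z_def by blast
    have "\<And>r. r \<in> set qs \<Longrightarrow> d \<le> norm (z - r)" using d len(2) by (force simp: in_set_conv_nth)
    then obtain \<beta> \<rho> where \<beta>: "flow_box qs \<rho> \<beta>" "\<beta> 0 = z" using flow_box_exists[OF d(1)] by metis
    note fb = flow_boxD[OF \<beta>(1)]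
    obtain \<Phi> where \<Phi>: "\<And>w. w \<in> ball 0 \<rho> \<Longrightarrow> \<Phi> (\<beta> w) = w" "\<And>z. z \<in> \<beta> ` ball 0 \<rho> \<Longrightarrow> \<beta> (\<Phi> z) = z"
      "\<And>z. z \<in> \<beta> ` ball 0 \<rho> \<Longrightarrow> (\<Phi> has_field_derivative deriv \<Phi> z) (at z)"
      "\<And>z. z \<in> \<beta> ` ball 0 \<rho> \<Longrightarrow> (deriv \<Phi> z)\<^sup>2 = - root_poly qs z"
      using flow_box_coordinate[OF \<beta>(1)] by metis
    have z0: "0 \<in> ball (0::complex) \<rho>" using fb(1) by simp
    have "z \<in> \<beta> ` ball 0 \<rho>" using \<beta>(2) z0 by blast
    then obtain \<eta>0 where \<eta>0: "\<eta>0 > 0" "ball z \<eta>0 \<subseteq> \<beta> ` ball 0 \<rho>" using fb(7) openE by blast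
    define \<eta> where "\<eta> = min \<eta>0 d / 2"
    have \<eta>: "0 < \<eta>" "2 * \<eta> \<le> \<eta>0" "2 * \<eta> \<le> d" using \<eta>0(1) d(1) by (auto simp: \<eta>_def)
    obtain a0 where a0: "a0 > 0" "\<And>x. x \<in> {0..1} \<Longrightarrow> dist x t < a0 \<Longrightarrow> dist (w x) z < \<eta>"
      using w(1) \<eta>(1) t unfolding continuous_on_iff z_def by (metis atLeastAtMost_iff less_imp_le)
    define a where "a = min a0 (min t (1 - t))"
    have a: "0 < a" "a \<le> a0" "a \<le> t" "a \<le> 1 - t" using a0(1) t by (auto simp: a_def)
    have near: "x \<in> {0..1}" "0 < x" "x < 1" "norm (w x - z) < \<eta>" if "t - a < x" "x < t + a" for x
    proof -
      show x: "x \<in> {0..1}" "0 < x" "x < 1" using that a by auto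
      show "norm (w x - z) < \<eta>" using a0(2)[OF x(1)] that a(2) by (auto simp: dist_norm abs_less_iff)
    qed
    obtain N1 where N1: "\<And>m x. m \<ge> N1 \<Longrightarrow> x \<in> {0..1} \<Longrightarrow> norm (v (K m) x - w x) < \<eta>" using unif[OF \<eta>(1)] by blast
    \<comment> \<open>Bounds the relative difference between the limit polynomial and the
      approximating one at distance less than \<open>d\<close> from \<open>z\<close>, where the
      approximating roots are eventually at least \<open>d / 2\<close> away. In the natural
      parameter of the limit the velocity \<open>W\<close> then satisfies
      \<open>|W^2 - L^2| \<le> L^2 * \<delta> m\<close>.\<close>
    define \<delta> where "\<delta> m = (1 + (\<Sum>i<n. norm (rs (K m) ! i - qs ! i)) / (d/2)) ^ n - 1" for m
    have "(\<lambda>m. \<Sum>i<n. norm (rs (K m) ! i - qs ! i)) \<longlonglongrightarrow> (\<Sum>i<n. 0)"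
      by (intro tendsto_sum tendsto_norm_zero) (use convK LIM_zero in auto)
    from tendsto_diff[OF tendsto_power[OF tendsto_add[OF tendsto_const tendsto_divide[OF this tendsto_const, of "d/2"]]] tendsto_const, of 1 n 1]
    have "\<delta> \<longlonglongrightarrow> (1 + (\<Sum>i<n. 0) / (d/2)) ^ n - 1" unfolding \<delta>_def using d(1) by simp
    then have \<delta>0: "\<delta> \<longlonglongrightarrow> 0" by simp
    have ev: "\<forall>\<^sub>F m in sequentially. \<delta> m < 1" "\<forall>\<^sub>F m in sequentially. \<forall>i<n. norm (rs (K m) ! i - qs ! i) < d/2" "\<forall>\<^sub>F m in sequentially. N1 \<le> m"
      using order_tendstoD(2)[OF \<delta>0, of 1] rclose[of "d/2"] d(1) eventually_ge_at_top by auto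
    have "\<forall>\<^sub>F m in sequentially. \<exists>s\<in>{1,-1::real}. \<forall>x y. t - a < x \<and> x < t + a \<and> t - a < y \<and> y < t + a \<longrightarrow>
        norm (\<Phi> (v (K m) x) - \<Phi> (v (K m) y) - of_real (s * l (K m) * (x - y))) \<le> l (K m) * \<delta> m * \<bar>x - y\<bar>"
      using ev
    proof eventually_elim
      case (elim m)
      define L where "L = l (K m)"
      have L0: "0 < L" unfolding L_def using edgeD(1)[OF e] .
      have inB: "v (K m) x \<in> \<beta> ` ball 0 \<rho>" "norm (v (K m) x - z) < d" if x: "t - a < x" "x < t + a" for x
      proof -
        have "norm (v (K m) x - z) \<le> norm (v (K m) x - w x) + norm (w x - z)"
          using norm_triangle_ineq[of "v (K m) x - w x" "w x - z"] by simp
        also have "\<dots> < \<eta> + \<eta>" using N1[OF elim(3) near(1)[OF x]] near(4)[OF x] by (intro add_strict_mono)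
        finally have *: "norm (v (K m) x - z) < 2 * \<eta>" by simp
        then show "norm (v (K m) x - z) < d" using \<eta>(3) by simp
        have "v (K m) x \<in> ball z \<eta>0" using * \<eta>(2) by (simp add: dist_norm norm_minus_commute)
        then show "v (K m) x \<in> \<beta> ` ball 0 \<rho>" using \<eta>0(2) by blast
      qed
      have ratio: "norm (root_poly qs y / root_poly (rs (K m)) y - 1) \<le> \<delta> m" if y: "norm (y - z) < d" for y
      proof -
        have "norm (root_poly qs y / root_poly (rs (K m)) y - 1) \<le> (1 + (\<Sum>i<n. norm (rs (K m) ! i - qs ! i)) / (d/2)) ^ length (rs (K m)) - 1"
        proof (rule root_poly_quotient)
          fix i assume "i < length (rs (K m))"
          then have i: "i < n" using len(1) by simp
          have "2 * d \<le> norm (z - qs ! i)" by (rule d(2)[OF i])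
          also have "\<dots> \<le> norm (y - z) + norm (y - rs (K m) ! i) + norm (rs (K m) ! i - qs ! i)"
            by (smt (verit) norm_diff_triangle_ineq norm_minus_commute norm_triangle_ineq diff_add_cancel add_diff_eq diff_diff_eq2 norm_triangle_sub dist_norm dist_triangle dist_commute)
          finally show "d/2 \<le> norm (y - rs (K m) ! i)" using y elim(2) i by fastforce
          show "norm (rs (K m) ! i - qs ! i) \<le> (\<Sum>i<n. norm (rs (K m) ! i - qs ! i)) / (d/2) * (d/2)"
            using member_le_sum[of i "{..<n}" "\<lambda>i. norm (rs (K m) ! i - qs ! i)"] i d(1) by simp
        qed (use len d(1) in \<open>auto intro!: divide_nonneg_pos sum_nonneg\<close>)
        then show ?thesis by (simp add: \<delta>_def len(1))
      qed
      have "\<exists>W. ((\<lambda>x. \<Phi> (v (K m) x)) has_vector_derivative W) (at x) \<and> norm (W\<^sup>2 - (of_real L)\<^sup>2) \<le> L\<^sup>2 * \<delta> m"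
        if x: "t - a < x" "x < t + a" for x
      proof -
        have lx: "0 < L * x" "L * x < L" using near(2,3)[OF x] L0 by auto
        obtain V where V: "(u (K m) has_vector_derivative V) (at (L * x))" "- root_poly (rs (K m)) (u (K m) (L * x)) * V\<^sup>2 = 1"
          using edgeD(6)[OF e lx[unfolded L_def]] unfolding L_def by blast
        have "((\<lambda>x. L * x) has_vector_derivative L) (at x)" by (auto intro!: derivative_eq_intros)
        from vector_diff_chain_at[OF this V(1)]
        have 1: "(v (K m) has_vector_derivative L *\<^sub>R V) (at x)" unfolding v_def[abs_def] L_def by (simp add: o_def)
        define W where "W = (L *\<^sub>R V) * deriv \<Phi> (v (K m) x)"
        have 2: "((\<lambda>x. \<Phi> (v (K m) x)) has_vector_derivative W) (at x)"
          using field_vector_diff_chain_at[OF 1 \<Phi>(3)[OF inB(1)[OF x]]] unfolding W_def by (simp add: o_def)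
        have vx: "v (K m) x = u (K m) (L * x)" by (simp add: v_def L_def)
        define Pm where "Pm = root_poly (rs (K m)) (v (K m) x)"
        have Pm: "- Pm * V\<^sup>2 = 1" using V(2) by (simp add: Pm_def vx)
        then have "Pm \<noteq> 0" by auto
        then have "V\<^sup>2 = - inverse Pm" using Pm by (simp add: field_simps eq_neg_iff_add_eq_0 neg_eq_iff_add_eq_0)
        have "W\<^sup>2 = of_real L ^ 2 * (root_poly qs (v (K m) x) / Pm)"
          unfolding W_def power_mult_distrib \<Phi>(4)[OF inB(1)[OF x]] scaleR_conv_of_real \<open>V\<^sup>2 = - inverse Pm\<close>
          by (simp add: field_simps)
        then have "W\<^sup>2 - (of_real L)\<^sup>2 = of_real L ^ 2 * (root_poly qs (v (K m) x) / Pm - 1)" by (simp add: algebra_simps)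
        then have "norm (W\<^sup>2 - (of_real L)\<^sup>2) = L\<^sup>2 * norm (root_poly qs (v (K m) x) / Pm - 1)"
          by (simp add: norm_mult norm_power)
        also have "\<dots> \<le> L\<^sup>2 * \<delta> m" unfolding Pm_def by (intro mult_left_mono ratio inB(2)[OF x]) auto
        finally show ?thesis using 2 by blast
      qed
      then obtain W where W: "\<And>x. t - a < x \<Longrightarrow> x < t + a \<Longrightarrow> ((\<lambda>x. \<Phi> (v (K m) x)) has_vector_derivative W x) (at x) \<and> norm ((W x)\<^sup>2 - (of_real L)\<^sup>2) \<le> L\<^sup>2 * \<delta> m"
        by metis
      have RW: "Re (W x) \<noteq> 0" if x: "t - a < x" "x < t + a" for x
      proof
        assume "Re (W x) = 0"
        then have "Re ((W x)\<^sup>2 - (of_real L)\<^sup>2) \<le> - (L\<^sup>2)" by (simp add: power2_eq_square)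
        then have "L\<^sup>2 \<le> norm ((W x)\<^sup>2 - (of_real L)\<^sup>2)" using abs_Re_le_cmod[of "(W x)\<^sup>2 - (of_real L)\<^sup>2"] by linarith
        also have "\<dots> \<le> L\<^sup>2 * \<delta> m" using W[OF x] by blast
        also have "\<dots> < L\<^sup>2 * 1" using elim(1) L0 by (intro mult_strict_left_mono) auto
        finally show False by simp
      qed
      have RD: "((\<lambda>x. Re (\<Phi> (v (K m) x))) has_real_derivative Re (W x)) (at x)" if "t - a < x" "x < t + a" for x
        using bounded_linear.has_vector_derivative[OF bounded_linear_Re conjunct1[OF W[OF that]]]
        by (simp add: has_real_derivative_iff_has_vector_derivative)
      have "(\<forall>x. t - a < x \<and> x < t + a \<longrightarrow> 0 < Re (W x)) \<or> (\<forall>x. t - a < x \<and> x < t + a \<longrightarrow> Re (W x) < 0)"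
        by (rule nonzero_derivative_sign[where f = "\<lambda>x. Re (\<Phi> (v (K m) x))"]) (use RD RW in blast)
      then obtain s :: real where s: "s \<in> {1,-1}" "\<And>x. t - a < x \<Longrightarrow> x < t + a \<Longrightarrow> 0 < s * Re (W x)"
        by (metis insertI1 insertI2 mult_1 mult_minus1 neg_0_less_iff_less)
      \<comment> \<open>From \<open>W^2 - L^2 = (W - s * L) * (W + s * L)\<close>: as
        \<open>s\<close> is the constant sign of \<open>Re W\<close>, the second factor has modulus
        at least \<open>L\<close>.\<close>
      have Wc: "norm (W x - of_real (s * L)) \<le> L * \<delta> m" if x: "t - a < x" "x < t + a" for x
      proof -
        have "(W x - of_real (s * L)) * (W x + of_real (s * L)) = (W x)\<^sup>2 - (of_real L)\<^sup>2"
          using s(1) by (auto simp: power2_eq_square algebra_simps)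
        then have "norm (W x - of_real (s * L)) * norm (W x + of_real (s * L)) \<le> L\<^sup>2 * \<delta> m"
          using W[OF x] by (metis norm_mult)
        moreover have "L \<le> norm (W x + of_real (s * L))"
          using abs_Re_le_cmod[of "W x + of_real (s * L)"] s(1) s(2)[OF x] L0 by auto
        then have "norm (W x - of_real (s * L)) * L \<le> norm (W x - of_real (s * L)) * norm (W x + of_real (s * L))"
          by (rule mult_left_mono) simp
        ultimately have "norm (W x - of_real (s * L)) * L \<le> (L * \<delta> m) * L" by (simp add: power2_eq_square mult_ac)
        then show ?thesis using mult_le_cancel_right_pos[OF L0, of "norm (W x - of_real (s * L))" "L * \<delta> m"] by blast
      qed
      show ?case
      proof (intro bexI[OF _ s(1)] allI impI)
        fix x y assume xy: "t - a < x \<and> x < t + a \<and> t - a < y \<and> y < t + a"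
        have "norm ((\<Phi> (v (K m) x) - of_real (s * L * x)) - (\<Phi> (v (K m) y) - of_real (s * L * y))) \<le> L * \<delta> m * norm (x - y)"
        proof (rule differentiable_bound[of "{t - a<..<t + a}" _ "\<lambda>x h. h *\<^sub>R (W x - of_real (s * L))"])
          fix x assume x: "x \<in> {t - a<..<t + a}"
          have "((\<lambda>x. of_real (s * L * x)) has_vector_derivative complex_of_real (s * L)) (at x)"
            by (intro has_vector_derivative_of_real) (auto intro!: derivative_eq_intros)
          from has_vector_derivative_diff[OF conjunct1[OF W] this] x
          show "((\<lambda>x. \<Phi> (v (K m) x) - of_real (s * L * x)) has_derivative (\<lambda>h. h *\<^sub>R (W x - of_real (s * L)))) (at x within {t - a<..<t + a})"
            unfolding has_vector_derivative_def by (auto intro: has_derivative_at_withinI)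
          show "onorm (\<lambda>h. h *\<^sub>R (W x - of_real (s * L))) \<le> L * \<delta> m"
            by (rule onorm_le) (use Wc[of x] x in \<open>auto simp: mult.commute intro!: mult_left_mono\<close>)
        qed (use xy in auto)
        then show "norm (\<Phi> (v (K m) x) - \<Phi> (v (K m) y) - of_real (s * l (K m) * (x - y))) \<le> l (K m) * \<delta> m * \<bar>x - y\<bar>"
          by (simp add: L_def algebra_simps)
      qed
    qed
    then obtain N where N: "\<And>m. m \<ge> N \<Longrightarrow> \<exists>s\<in>{1,-1::real}. \<forall>x y. t - a < x \<and> x < t + a \<and> t - a < y \<and> y < t + a \<longrightarrow>
        norm (\<Phi> (v (K m) x) - \<Phi> (v (K m) y) - of_real (s * l (K m) * (x - y))) \<le> l (K m) * \<delta> m * \<bar>x - y\<bar>"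
      unfolding eventually_sequentially by blast
    define K' where "K' m = K (m + N)" for m
    obtain s where s: "\<And>m. s m \<in> {1,-1::real}" "\<And>m x y. t - a < x \<Longrightarrow> x < t + a \<Longrightarrow> t - a < y \<Longrightarrow> y < t + a \<Longrightarrow>
        norm (\<Phi> (v (K' m) x) - \<Phi> (v (K' m) y) - of_real (s m * l (K' m) * (x - y))) \<le> l (K' m) * \<delta> (m + N) * \<bar>x - y\<bar>"
      using N[OF le_add2] unfolding K'_def by metis
    \<comment> \<open>The direction \<open>s m\<close> may vary with \<open>m\<close>; a further
      subsequence makes it converge, necessarily to a sign.\<close>
    obtain f S where f: "strict_mono (f :: nat \<Rightarrow> nat)" "(\<lambda>m. s (f m)) \<longlonglongrightarrow> S"
    proof -
      have sb: "-1 \<le> s m \<and> s m \<le> 1" for m using s(1)[of m] by auto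
      show thesis by (rule bounded_pair_subseq[OF sb sb]) (rule that; assumption)
    qed
    have "(\<lambda>m. s (f m) * s (f m)) \<longlonglongrightarrow> S * S" by (intro tendsto_mult f)
    moreover have "s (f m) * s (f m) = 1" for m using s(1)[of "f m"] by auto
    ultimately have SS: "S * S = 1" using LIMSEQ_unique[OF _ tendsto_const] by force
    have fN: "strict_mono (\<lambda>m. f m + N)" using f(1) by (simp add: strict_mono_def)
    have lim1: "(\<lambda>m. l (K' (f m))) \<longlonglongrightarrow> \<Lambda>" using LIMSEQ_subseq_LIMSEQ[OF lK fN] by (simp add: K'_def o_def)
    have lim2: "(\<lambda>m. \<delta> (f m + N)) \<longlonglongrightarrow> 0" using LIMSEQ_subseq_LIMSEQ[OF \<delta>0 fN] by (simp add: o_def)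
    have wB: "w x \<in> \<beta> ` ball 0 \<rho>" if x: "t - a < x" "x < t + a" for x
    proof -
      have "w x \<in> ball z \<eta>0" using near(4)[OF x] \<eta> by (simp add: dist_norm norm_minus_commute)
      then show ?thesis using \<eta>0(2) by blast
    qed
    have lim3: "(\<lambda>m. \<Phi> (v (K' (f m)) x)) \<longlonglongrightarrow> \<Phi> (w x)" if x: "t - a < x" "x < t + a" for x
    proof -
      have "(\<lambda>m. v (K' (f m)) x) \<longlonglongrightarrow> w x" using LIMSEQ_subseq_LIMSEQ[OF pw[OF near(1)[OF x]] fN] by (simp add: K'_def o_def)
      then show ?thesis using isCont_tendsto_compose[OF DERIV_isCont[OF \<Phi>(3)[OF wB[OF x]]]] by blast
    qed
    have aff: "\<Phi> (w x) - \<Phi> (w y) = of_real (S * \<Lambda> * (x - y))" if xy: "t - a < x" "x < t + a" "t - a < y" "y < t + a" for x y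
    proof -
      have "(\<lambda>m. norm (\<Phi> (v (K' (f m)) x) - \<Phi> (v (K' (f m)) y) - of_real (s (f m) * l (K' (f m)) * (x - y)))) \<longlonglongrightarrow> norm (\<Phi> (w x) - \<Phi> (w y) - of_real (S * \<Lambda> * (x - y)))"
        by (intro tendsto_intros lim1 lim3 f xy)
      moreover have "(\<lambda>m. l (K' (f m)) * \<delta> (f m + N) * \<bar>x - y\<bar>) \<longlonglongrightarrow> \<Lambda> * 0 * \<bar>x - y\<bar>"
        by (intro tendsto_intros lim1 lim2)
      ultimately have "norm (\<Phi> (w x) - \<Phi> (w y) - of_real (S * \<Lambda> * (x - y))) \<le> \<Lambda> * 0 * \<bar>x - y\<bar>"
        by (rule LIMSEQ_le) (use s(2)[OF xy] in blast)
      then show ?thesis by simp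
    qed
    have wt: "\<Phi> (w t) = 0" using \<Phi>(1)[OF z0] \<beta>(2) by (simp add: z_def)
    have weq: "\<beta> (of_real (S * \<Lambda> * (x - t))) = w x" if x: "x \<in> ball t a" for x
    proof -
      have xx: "t - a < x" "x < t + a" using x by (auto simp: dist_real_def abs_less_iff)
      have "\<Phi> (w x) = of_real (S * \<Lambda> * (x - t))" using aff[OF xx, of t] a(1) wt by simp
      then show ?thesis using \<Phi>(2)[OF wB[OF xx]] by simp
    qed
    have "((\<lambda>x. complex_of_real (S * \<Lambda> * (x - t))) has_vector_derivative of_real (S * \<Lambda>)) (at t)"
      by (intro has_vector_derivative_of_real) (auto intro!: derivative_eq_intros)
    moreover have "(\<beta> has_field_derivative deriv \<beta> 0) (at (complex_of_real (S * \<Lambda> * (t - t))))" using fb(6)[OF z0] by simp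
    ultimately have "(\<beta> \<circ> (\<lambda>x. complex_of_real (S * \<Lambda> * (x - t))) has_vector_derivative of_real (S * \<Lambda>) * deriv \<beta> 0) (at t)"
      by (rule field_vector_diff_chain_at)
    then have "(w has_vector_derivative of_real (S * \<Lambda>) * deriv \<beta> 0) (at t)"
      by (rule has_vector_derivative_transform_within_open[OF _ open_ball]) (use a(1) weq in auto)
    moreover have "- root_poly qs (w t) * (of_real (S * \<Lambda>) * deriv \<beta> 0)\<^sup>2 = of_real ((S * \<Lambda>)\<^sup>2) * (- root_poly qs (\<beta> 0) * (deriv \<beta> 0)\<^sup>2)"
      by (simp add: \<beta>(2) z_def power_mult_distrib)
    then have "- root_poly qs (w t) * (of_real (S * \<Lambda>) * deriv \<beta> 0)\<^sup>2 = of_real ((S * \<Lambda>)\<^sup>2)" unfolding fb(4)[OF z0] by (simp only: mult_1_right)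
    moreover have "(S * \<Lambda>)\<^sup>2 = \<Lambda>\<^sup>2" using SS by (simp add: power_mult_distrib power2_eq_square)
    ultimately show ?thesis by metis
  qed

  \<comment> \<open>Cutting the limit curve at the zeros\<close>
  have closed_fin: "closed ({0..1} \<inter> w -` F)" if "finite F" for F
    by (rule continuous_closed_preimage[OF w(1) closed_atLeastAtMost finite_imp_closed[OF that]])
  have compact_fin: "compact ({0..1} \<inter> w -` F)" if "finite F" for F
    using closed_fin[OF that] compact_Int_closed[of "{0..1}" "{0..1} \<inter> w -` F"] by (simp add: Int_absorb1)
  define E where "E = {z \<in> set qs. (p, z) \<in> (edge_rel qs)\<^sup>*}"
  have "q \<in> E"
  proof (rule ccontr)
    assume "q \<notin> E"
    \<comment> \<open>The times at which \<open>w\<close> is at a zero are not known to be finite in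
      number, so extremal times replace an induction: \<open>\<tau>B\<close> is the first time at a
      zero outside \<open>E\<close> and \<open>\<tau>A\<close> the last time before it at a zero in
      \<open>E\<close>. The piece in between is an edge leaving \<open>E\<close>, which is
      absurd.\<close>
    define B where "B = {0..1} \<inter> w -` (set qs - E)"
    have "1 \<in> B" using \<open>q \<notin> E\<close> pq w01 by (simp add: B_def)
    have "compact B" unfolding B_def by (rule compact_fin) simp
    then obtain \<tau>B where B: "\<tau>B \<in> B" "\<And>x. x \<in> B \<Longrightarrow> \<tau>B \<le> x" using compact_attains_inf[of B] \<open>1 \<in> B\<close> by blast
    define A where "A = ({0..1} \<inter> w -` E) \<inter> {..\<tau>B}"
    have "0 \<in> A" using pq(1) w01 B(1) by (simp add: A_def E_def B_def)
    have "compact A" unfolding A_def by (intro compact_Int_closed compact_fin) (auto simp: E_def)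
    then obtain \<tau>A where A: "\<tau>A \<in> A" "\<And>x. x \<in> A \<Longrightarrow> x \<le> \<tau>A" using compact_attains_sup[of A] \<open>0 \<in> A\<close> by blast
    have AB: "w \<tau>A \<in> E" "w \<tau>B \<in> set qs - E" "0 \<le> \<tau>A" "\<tau>A \<le> \<tau>B" "\<tau>B \<le> 1" using A(1) B(1) by (auto simp: A_def B_def)
    then have "\<tau>A < \<tau>B" by (cases "\<tau>A = \<tau>B") auto
    have reg: "w x \<notin> set qs" if "\<tau>A < x" "x < \<tau>B" for x
    proof
      assume "w x \<in> set qs"
      then have "x \<in> A \<or> x \<in> B" using that AB by (auto simp: A_def B_def)
      then show False using A(2)[of x] B(2)[of x] that by auto
    qed
    define L where "L = \<Lambda> * (\<tau>B - \<tau>A)"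
    define g where "g x = w (\<tau>A + x / \<Lambda>)" for x
    have L0: "0 < L" using \<open>\<tau>A < \<tau>B\<close> lam by (simp add: L_def)
    have par: "\<tau>A + x / \<Lambda> \<in> {\<tau>A..\<tau>B}" if "x \<in> {0..L}" for x
      using that lam by (auto simp: L_def field_simps)
    have parL: "\<tau>A + L / \<Lambda> = \<tau>B" using lam by (simp add: L_def)
    have winj: "inj_on w {\<tau>A..\<tau>B}"
    proof (rule linorder_inj_onI)
      fix x y assume xy: "x < y" "x \<in> {\<tau>A..\<tau>B}" "y \<in> {\<tau>A..\<tau>B}"
      consider "x = \<tau>A" "y = \<tau>B" | "\<tau>A < x" "x < \<tau>B" | "\<tau>A < y" "y < \<tau>B" using xy by force
      then show "w x \<noteq> w y"
      proof cases
        case 1 then show ?thesis using AB by auto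
      next
        case 2
        show ?thesis
        proof
          assume eq: "w x = w y"
          have "y < \<tau>B" using reg[OF 2] eq AB(2) xy by (cases "y = \<tau>B") auto
          then show False using inj[of x y] eq reg[OF 2] AB xy 2 by auto
        qed
      next
        case 3
        show ?thesis
        proof
          assume eq: "w x = w y"
          have "\<tau>A < x" using reg[OF 3] eq AB(1) xy by (cases "x = \<tau>A") (auto simp: E_def)
          then show False using inj[of x y] eq reg[OF 3] AB xy 3 by auto
        qed
      qed
    qed auto
    have "edge qs L g"
      unfolding edge_def
    proof (intro conjI ballI)
      show "continuous_on {0..L} g" unfolding g_def
        by (rule continuous_on_compose2[OF w(1)]) (use par AB lam in \<open>fastforce intro!: continuous_intros\<close>)+
      show "inj_on g {0..L}"
      proof (rule inj_onI)
        fix x y assume xy: "x \<in> {0..L}" "y \<in> {0..L}" "g x = g y"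
        then have "\<tau>A + x / \<Lambda> = \<tau>A + y / \<Lambda>" using inj_onD[OF winj _ par par] by (simp add: g_def)
        then show "x = y" using lam by simp
      qed
      show "root_poly qs (g 0) = 0" "root_poly qs (g L) = 0"
        using AB parL by (simp_all add: g_def root_poly_eq_0_iff E_def)
      fix x assume "x \<in> {0<..<L}"
      then have x: "\<tau>A < \<tau>A + x / \<Lambda>" "\<tau>A + x / \<Lambda> < \<tau>B" using lam by (auto simp: L_def field_simps)
      obtain V where V: "(w has_vector_derivative V) (at (\<tau>A + x / \<Lambda>))" "- root_poly qs (w (\<tau>A + x / \<Lambda>)) * V\<^sup>2 = of_real (\<Lambda>\<^sup>2)"
        using hor[OF _ _ reg[OF x]] x AB by auto
      have "((\<lambda>x. \<tau>A + x / \<Lambda>) has_vector_derivative inverse \<Lambda>) (at x)"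
        using lam by (auto intro!: derivative_eq_intros simp: field_simps)
      from vector_diff_chain_at[OF this V(1)]
      have "(g has_vector_derivative inverse \<Lambda> *\<^sub>R V) (at x)" unfolding g_def[abs_def] by (simp only: o_def)
      moreover have "- root_poly qs (g x) * (inverse \<Lambda> *\<^sub>R V)\<^sup>2 = of_real ((inverse \<Lambda>)\<^sup>2) * (- root_poly qs (w (\<tau>A + x / \<Lambda>)) * V\<^sup>2)"
        by (simp add: g_def scaleR_conv_of_real power_mult_distrib)
      then have "- root_poly qs (g x) * (inverse \<Lambda> *\<^sub>R V)\<^sup>2 = of_real ((inverse \<Lambda>)\<^sup>2 * \<Lambda>\<^sup>2)" unfolding V(2) by (simp only: of_real_mult)
      moreover have "(inverse \<Lambda>)\<^sup>2 * \<Lambda>\<^sup>2 = 1" using lam by (simp add: power_inverse)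
      ultimately show "\<exists>v. (g has_vector_derivative v) (at x) \<and> - root_poly qs (g x) * v\<^sup>2 = 1" by (metis of_real_1)
    qed (rule L0)
    then have "(w \<tau>A, w \<tau>B) \<in> edge_rel qs" unfolding edge_rel_def using parL by (auto simp: g_def intro!: exI[of _ L] exI[of _ g])
    then have "(p, w \<tau>B) \<in> (edge_rel qs)\<^sup>*" using AB(1) by (auto simp: E_def intro: rtrancl_into_rtrancl)
    then show False using AB(2) by (simp add: E_def)
  qed
  then show ?thesis by (simp add: E_def)
qed

text \<open>Distinct limits keep the ends of all but finitely many edges a fixed distance
  apart.\<close>

lemma edge_limit:
  assumes len: "\<And>m. length (rs m) = n" "length qs = n"
    and conv: "\<And>i. i < n \<Longrightarrow> (\<lambda>m. rs m ! i) \<longlonglongrightarrow> qs ! i"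
    and e: "\<And>m. edge (rs m) (l m) (u m)"
    and ends: "(\<lambda>m. u m 0) \<longlonglongrightarrow> p" "(\<lambda>m. u m (l m)) \<longlonglongrightarrow> q" and "p \<noteq> q"
  shows "(p, q) \<in> (edge_rel qs)\<^sup>*"
proof -
  have "(\<lambda>m. norm (u m 0 - u m (l m))) \<longlonglongrightarrow> norm (p - q)" by (intro tendsto_intros ends)
  moreover have "norm (p - q) / 2 < norm (p - q)" using \<open>p \<noteq> q\<close> by simp
  ultimately have "\<forall>\<^sub>F m in sequentially. norm (p - q) / 2 < norm (u m 0 - u m (l m))" by (rule order_tendstoD(1))
  then obtain N where N: "\<And>m. m \<ge> N \<Longrightarrow> norm (p - q) / 2 < norm (u m 0 - u m (l m))"
    unfolding eventually_sequentially by blast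
  show ?thesis
  proof (rule edge_limit_aux[where rs = "\<lambda>m. rs (m + N)" and u = "\<lambda>m. u (m + N)" and l = "\<lambda>m. l (m + N)" and \<epsilon> = "norm (p - q) / 2"])
    show "(\<lambda>m. rs (m + N) ! i) \<longlonglongrightarrow> qs ! i" if "i < n" for i
      using LIMSEQ_ignore_initial_segment[OF conv[OF that]] .
    show "(\<lambda>m. u (m + N) 0) \<longlonglongrightarrow> p" "(\<lambda>m. u (m + N) (l (m + N))) \<longlonglongrightarrow> q"
      using LIMSEQ_ignore_initial_segment[OF ends(1)] LIMSEQ_ignore_initial_segment[OF ends(2)] by auto
    show "norm (p - q) / 2 \<le> norm (u (m + N) 0 - u (m + N) (l (m + N)))" for m
      using N[of "m + N"] by simp
  qed (use len e \<open>p \<noteq> q\<close> in auto)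
qed

section \<open>Assembling edges into an arc\<close>

text \<open>The parameters at which the first leaf lies on the second form an open and closed subset
  of \<open>I1\<close>: by \<open>leaf_flow\<close> each leaf contains the whole chord of a flow box
  through any of its points.\<close>

lemma leaf_subset:
  assumes L1: "leaf rs I1 u1" and L2: "leaf rs I2 u2" and x: "x1 \<in> I1" "x2 \<in> I2" "u1 x1 = u2 x2"
  shows "u1 ` I1 \<subseteq> u2 ` I2"
proof
  fix z assume "z \<in> u1 ` I1"
  then obtain x where z: "z = u1 x" "x \<in> I1" by blast
  have "u1 x \<in> u2 ` I2"
  proof (rule connected_induction_simple[of I1 x1 x "\<lambda>x. u1 x \<in> u2 ` I2"])
    show "u1 x1 \<in> u2 ` I2" using x by auto
    fix y assume y: "y \<in> I1"
    have "finite (set rs)" "u1 y \<notin> set rs" using leafD(6)[OF L1 y] by (auto simp: root_poly_eq_0_iff)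
    then obtain d where d: "0 < d" "\<And>r. r \<in> set rs \<Longrightarrow> d \<le> dist (u1 y) r"
      using separate_point_closed[OF finite_imp_closed] by metis
    obtain \<beta> \<rho> where \<beta>: "flow_box rs \<rho> \<beta>" "\<beta> 0 = u1 y"
      using flow_box_exists[OF d(1), of rs "u1 y"] d(2) by (metis dist_norm)
    have \<rho>: "0 < \<rho>" by (rule flow_boxD[OF \<beta>(1)])
    obtain s :: real where s: "s \<in> {1, -1}"
      "\<And>\<tau>. 0 + complex_of_real \<tau> \<in> ball 0 \<rho> \<Longrightarrow> y + s * \<tau> \<in> I1 \<and> u1 (y + s * \<tau>) = \<beta> (0 + of_real \<tau>)"
      by (rule leaf_flow[OF L1 \<beta>(1) y, of 0]) (use \<beta>(2) \<rho> in auto)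
    have b: "complex_of_real (s * (t - y)) \<in> ball 0 \<rho>" if "t \<in> ball y \<rho>" for t
      using that s(1) by (auto simp: dist_real_def norm_mult abs_minus_commute simp flip: of_real_diff)
    have ss: "s * (s * x) = x" for x using s(1) by auto
    have near: "x' \<in> I1 \<and> u1 x' = \<beta> (of_real (s * (x' - y)))" if "x' \<in> ball y \<rho>" for x'
      using s(2)[of "s * (x' - y)"] b[OF that] unfolding ss by (simp del: of_real_mult of_real_diff)
    show "\<exists>T. openin (top_of_set I1) T \<and> y \<in> T \<and> (\<forall>x\<in>T. \<forall>x'\<in>T. u1 x \<in> u2 ` I2 \<longrightarrow> u1 x' \<in> u2 ` I2)"
    proof (intro exI[of _ "ball y \<rho>"] conjI ballI impI)
      show "openin (top_of_set I1) (ball y \<rho>)" using near by (intro open_subset) auto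
      show "y \<in> ball y \<rho>" using \<rho> by simp
      fix p q assume p: "p \<in> ball y \<rho>" and q: "q \<in> ball y \<rho>" and "u1 p \<in> u2 ` I2"
      then obtain x' where x': "x' \<in> I2" "u2 x' = \<beta> (of_real (s * (p - y)))" using near by auto
      obtain s' :: real where s': "\<And>\<tau>. of_real (s * (p - y)) + complex_of_real \<tau> \<in> ball 0 \<rho> \<Longrightarrow>
          x' + s' * \<tau> \<in> I2 \<and> u2 (x' + s' * \<tau>) = \<beta> (of_real (s * (p - y)) + of_real \<tau>)"
        by (rule leaf_flow[OF L2 \<beta>(1) x' b[OF p]]) (rule that; assumption)
      have e: "of_real (s * (p - y)) + complex_of_real (s * (q - p)) = of_real (s * (q - y))"
        by (simp add: algebra_simps)
      have "x' + s' * (s * (q - p)) \<in> I2" "u2 (x' + s' * (s * (q - p))) = u1 q"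
        using s'[of "s * (q - p)"] b[OF q] near[OF q] unfolding e by auto
      then show "u1 q \<in> u2 ` I2" by (metis imageI)
    qed
  qed (use leafD(2)[OF L1] x z in auto)
  then show "z \<in> u2 ` I2" using z by simp
qed

lemma edge_image_subset:
  assumes "edge rs l u" "closed S" "u ` {0<..<l} \<subseteq> S" shows "u ` {0..l} \<subseteq> S"
proof -
  have "closure {0<..<l} = {0..l}" using edgeD(1)[OF assms(1)] by (simp add: closure_greaterThanLessThan)
  then show ?thesis using image_closure_subset[of "{0<..<l}" u S] edgeD(2)[OF assms(1)] assms(2,3) by simp
qed

definition horizontal_at :: "complex list \<Rightarrow> (real \<Rightarrow> complex) \<Rightarrow> real \<Rightarrow> bool" where
  "horizontal_at rs \<gamma> s \<longleftrightarrow> (root_poly rs (\<gamma> s) \<noteq> 0 \<longrightarrow>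
     (\<exists>v x. (\<gamma> has_vector_derivative v) (at s) \<and> 0 < x \<and> - root_poly rs (\<gamma> s) * v\<^sup>2 = complex_of_real x))"

text \<open>The velocity is multiplied by \<open>c\<close> and the positive value of the
  differential by \<open>c^2\<close>, so its sign survives a change of orientation as well.\<close>

lemma horizontal_at_affine:
  assumes "horizontal_at rs \<gamma> (c * s + d)" "c \<noteq> 0" "0 < e" and eq: "\<And>t. \<bar>t - s\<bar> < e \<Longrightarrow> \<eta> t = \<gamma> (c * t + d)"
  shows "horizontal_at rs \<eta> s"
  unfolding horizontal_at_def
proof
  assume "root_poly rs (\<eta> s) \<noteq> 0"
  then obtain v x where v: "(\<gamma> has_vector_derivative v) (at (c * s + d))" "0 < x" "- root_poly rs (\<gamma> (c * s + d)) * v\<^sup>2 = complex_of_real x"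
    using assms(1) eq[of s] assms(3) unfolding horizontal_at_def by auto
  have "((\<lambda>t. c * t + d) has_vector_derivative c) (at s)" by (auto intro!: derivative_eq_intros)
  from vector_diff_chain_at[OF this v(1)]
  have "(\<gamma> \<circ> (\<lambda>t. c * t + d) has_vector_derivative c *\<^sub>R v) (at s)" .
  then have "(\<eta> has_vector_derivative c *\<^sub>R v) (at s)"
    by (rule has_vector_derivative_transform_within_open[of _ _ _ "ball s e"])
       (use assms(3) eq in \<open>auto simp: dist_real_def abs_minus_commute\<close>)
  moreover have "- root_poly rs (\<eta> s) * (c *\<^sub>R v)\<^sup>2 = of_real (c\<^sup>2) * (- root_poly rs (\<gamma> (c * s + d)) * v\<^sup>2)"
    using eq[of s] assms(3) by (simp add: scaleR_conv_of_real power_mult_distrib)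
  then have "- root_poly rs (\<eta> s) * (c *\<^sub>R v)\<^sup>2 = of_real (c\<^sup>2 * x)" unfolding v(3) by simp
  moreover have "0 < c\<^sup>2 * x" using assms(2) v(2) by simp
  ultimately show "\<exists>v x. (\<eta> has_vector_derivative v) (at s) \<and> 0 < x \<and> - root_poly rs (\<eta> s) * v\<^sup>2 = complex_of_real x"
    by blast
qed

text \<open>An edge can meet a saturated set in which it is not contained only at its end points, so appending it
  to an arc with saturated image creates no self-intersection.\<close>

definition saturated :: "complex list \<Rightarrow> complex set \<Rightarrow> bool" where
  "saturated rs S \<longleftrightarrow> (\<forall>l u x. edge rs l u \<and> 0 < x \<and> x < l \<and> u x \<in> S \<longrightarrow> u ` {0..l} \<subseteq> S)"

lemma saturatedD: "saturated rs S \<Longrightarrow> edge rs l u \<Longrightarrow> 0 < x \<Longrightarrow> x < l \<Longrightarrow> u x \<in> S \<Longrightarrow> u ` {0..l} \<subseteq> S"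
  unfolding saturated_def by blast

lemma saturated_Un: "saturated rs S \<Longrightarrow> saturated rs T \<Longrightarrow> saturated rs (S \<union> T)"
  unfolding saturated_def by blast

lemma edge_regular:
  assumes "edge rs l u" "0 < x" "x < l" shows "root_poly rs (u x) \<noteq> 0"
  using leafD(6)[OF edge_leaf[OF assms(1)], of x] assms by simp

text \<open>An interior point of one edge is regular, so on the other edge it is interior too;
  \<open>leaf_subset\<close> then gives the open edge, and closure gives its ends.\<close>

lemma saturated_edge:
  assumes e: "edge rs l u" shows "saturated rs (u ` {0..l})"
  unfolding saturated_def
proof (intro allI impI, elim conjE)
  fix l' u' x assume e': "edge rs l' u'" and x: "0 < x" "x < l'" and "u' x \<in> u ` {0..l}"
  then obtain y where y: "u' x = u y" "0 \<le> y" "y \<le> l" by auto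
  have "y \<noteq> 0" "y \<noteq> l" using edge_regular[OF e' x] edgeD(4,5)[OF e] y(1) by auto
  then have "u' ` {0<..<l'} \<subseteq> u ` {0<..<l}"
    using leaf_subset[OF edge_leaf[OF e'] edge_leaf[OF e], of x y] x y by auto
  also have "\<dots> \<subseteq> u ` {0..l}" by (intro image_mono) auto
  finally have *: "u' ` {0<..<l'} \<subseteq> u ` {0..l}" .
  have "compact (u ` {0..l})" using edgeD(2)[OF e] by (rule compact_continuous_image) simp
  from edge_image_subset[OF e' compact_imp_closed[OF this] *] show "u' ` {0..l'} \<subseteq> u ` {0..l}" .
qed

definition saturated_arc :: "complex list \<Rightarrow> (real \<Rightarrow> complex) \<Rightarrow> bool" where
  "saturated_arc rs p \<longleftrightarrow> arc p \<and> (\<forall>s\<in>{0<..<1}. horizontal_at rs p s) \<and> saturated rs (path_image p)"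

lemma saturated_arc_edge:
  assumes e: "edge rs l u" shows "saturated_arc rs (\<lambda>t. u (l * t))" "path_image (\<lambda>t. u (l * t)) = u ` {0..l}"
proof -
  note e' = edgeD[OF e]
  have im: "(\<lambda>t. l * t) ` {0..1} = {0..l}" using e'(1) by (auto simp: image_mult_atLeastAtMost)
  have "path_image (\<lambda>t. u (l * t)) = u ` ((\<lambda>t. l * t) ` {0..1})" unfolding path_image_def by (simp only: image_image)
  then show pi: "path_image (\<lambda>t. u (l * t)) = u ` {0..l}" by (simp only: im)
  have "continuous_on {0..1} (\<lambda>t. u (l * t))"
    by (rule continuous_on_compose2[OF e'(2)]) (use im in \<open>auto intro!: continuous_intros\<close>)
  moreover have "inj_on (\<lambda>t. u (l * t)) {0..1}"
  proof (rule inj_onI)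
    fix x y :: real assume xy: "x \<in> {0..1}" "y \<in> {0..1}" "u (l * x) = u (l * y)"
    have "l * x \<in> {0..l}" "l * y \<in> {0..l}" using xy im by blast+
    then have "l * x = l * y" using inj_onD[OF e'(3) xy(3)] by blast
    then show "x = y" using e'(1) by simp
  qed
  moreover have "horizontal_at rs (\<lambda>t. u (l * t)) s" if s: "s \<in> {0<..<1}" for s
  proof (rule horizontal_at_affine[of rs u l s 0 1])
    obtain v where "(u has_vector_derivative v) (at (l * s))" "- root_poly rs (u (l * s)) * v\<^sup>2 = complex_of_real 1"
      using e'(6)[of "l * s"] e'(1) s by auto
    then show "horizontal_at rs u (l * s + 0)" unfolding horizontal_at_def by (auto intro!: exI[of _ "1::real"])
  qed (use e'(1) in auto)
  ultimately show "saturated_arc rs (\<lambda>t. u (l * t))"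
    unfolding saturated_arc_def arc_def path_def pi using saturated_edge[OF e] by blast
qed

text \<open>Cutting at a zero preserves saturation: the interior of an edge on the arc is connected
  and does not contain \<open>p s\<close>, so it lies entirely before or entirely after the
  cut.\<close>

lemma saturated_arc_subpath:
  assumes p: "saturated_arc rs p" and s: "0 < s" "s \<le> 1" and root: "root_poly rs (p s) = 0"
  shows "saturated_arc rs (subpath 0 s p)"
proof -
  have a: "arc p" and h: "\<And>t. 0 < t \<Longrightarrow> t < 1 \<Longrightarrow> horizontal_at rs p t" and sat: "saturated rs (path_image p)"
    using p unfolding saturated_arc_def by auto
  have cont: "continuous_on {0..1} p" and inj: "inj_on p {0..1}" using a by (auto simp: arc_def path_def)
  have "arc (subpath 0 s p)" using a s by (intro arc_subpath_arc) auto
  moreover have "horizontal_at rs (subpath 0 s p) t" if t: "t \<in> {0<..<1}" for t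
  proof (rule horizontal_at_affine[of rs p s t 0 1])
    have "s * t < 1 * 1" using s t by (intro mult_le_less_imp_less) auto
    then show "horizontal_at rs p (s * t + 0)" using h[of "s * t"] s t by simp
  qed (use s in \<open>auto simp: subpath_def\<close>)
  moreover have "saturated rs (path_image (subpath 0 s p))"
    unfolding saturated_def
  proof (intro allI impI, elim conjE)
    fix l u x assume e: "edge rs l u" and x: "0 < x" "x < l" "u x \<in> path_image (subpath 0 s p)"
    have pi: "path_image (subpath 0 s p) = p ` {0..s}" using s by (simp add: path_image_subpath)
    define A B J where "A = p ` {0..s}" and "B = p ` {s..1}" and "J = u ` {0<..<l}"
    have AB: "closed A" "closed B" "A \<union> B = path_image p"
    proof -
      have "compact A" "compact B" unfolding A_def B_def
        by (intro compact_continuous_image continuous_on_subset[OF cont]; use s in auto)+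
      then show "closed A" "closed B" by (auto intro: compact_imp_closed)
      have "{0..s} \<union> {s..1} = {0..1}" using s by auto
      then show "A \<union> B = path_image p" unfolding A_def B_def path_image_def by (simp only: flip: image_Un)
    qed
    have xA: "u x \<in> A" using x(3) by (simp add: A_def pi)
    have "u ` {0..l} \<subseteq> path_image p" using saturatedD[OF sat e x(1,2)] xA AB(3) by blast
    then have J: "J \<subseteq> A \<union> B" unfolding AB(3) J_def by (meson atLeastAtMost_iff greaterThanLessThan_subseteq_atLeastAtMost_iff image_mono order.trans order_refl)
    have "A \<inter> B \<subseteq> {p s}"
    proof
      fix z assume "z \<in> A \<inter> B"
      then obtain t t' where t: "z = p t" "t \<in> {0..s}" "z = p t'" "t' \<in> {s..1}" unfolding A_def B_def by blast
      then have "t = t'" using inj_onD[OF inj, of t t'] s by auto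
      then show "z \<in> {p s}" using t by auto
    qed
    moreover have "p s \<notin> J" using root edge_regular[OF e] unfolding J_def by auto
    ultimately have "A \<inter> B \<inter> J = {}" by blast
    moreover have "connected J" unfolding J_def
      by (rule connected_continuous_image[OF continuous_on_subset[OF edgeD(2)[OF e]]]) auto
    ultimately have "A \<inter> J = {} \<or> B \<inter> J = {}" using AB(1,2) J unfolding connected_closed by blast
    moreover have "u x \<in> A \<inter> J" using xA x unfolding J_def by auto
    ultimately have "J \<subseteq> A" using J by blast
    then show "u ` {0..l} \<subseteq> path_image (subpath 0 s p)"
      using edge_image_subset[OF e AB(1)] unfolding J_def pi A_def by blast
  qed
  ultimately show ?thesis unfolding saturated_arc_def by blast
qed

lemma saturated_arc_join:
  assumes p: "saturated_arc rs p" and q: "saturated_arc rs q" and pq: "pathfinish p = pathstart q"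
    and root: "root_poly rs (pathstart q) = 0" and int: "path_image p \<inter> path_image q \<subseteq> {pathstart q}"
  shows "saturated_arc rs (p +++ q)"
proof -
  have a: "arc p" "arc q" and h: "\<And>t. 0 < t \<Longrightarrow> t < 1 \<Longrightarrow> horizontal_at rs p t \<and> horizontal_at rs q t"
    and sat: "saturated rs (path_image p)" "saturated rs (path_image q)"
    using p q unfolding saturated_arc_def by auto
  have "horizontal_at rs (p +++ q) t" if t: "0 < t" "t < 1" for t
  proof -
    consider "t < 1/2" | "t = 1/2" | "1/2 < t" by linarith
    then show ?thesis
    proof cases
      case 1
      show ?thesis
        by (rule horizontal_at_affine[of rs p 2 t 0 "1/2 - t"]) (use h[of "2 * t"] t 1 in \<open>auto simp: joinpaths_def abs_less_iff\<close>)
    next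
      \<comment> \<open>The junction is a zero, where \<open>horizontal_at\<close> is vacuous; the
        two pieces may meet there at an angle.\<close>
      case 2
      then have "2 * t = 1" by simp
      with 2 have "(p +++ q) t = pathfinish p" by (simp add: joinpaths_def pathfinish_def)
      then show ?thesis using root pq by (simp add: horizontal_at_def)
    next
      case 3
      show ?thesis
        by (rule horizontal_at_affine[of rs q 2 t "-1" "t - 1/2"]) (use h[of "2 * t - 1"] t 3 in \<open>auto simp: joinpaths_def abs_less_iff\<close>)
    qed
  qed
  then show ?thesis unfolding saturated_arc_def
    using arc_join[OF a pq int] saturated_Un[OF sat] path_image_join[OF pq] by auto
qed

text \<open>Loop erasure, edge by edge. If the new end \<open>e'\<close> already lies on the arc,
  the arc is cut there. Otherwise the new edge meets the arc only at \<open>e\<close>: a common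
  interior point would by saturation put the whole edge, and with it \<open>e'\<close>, on the
  arc.\<close>

lemma edges_arc:
  assumes "(a, b) \<in> (edge_rel rs)\<^sup>*"
  shows "b = a \<or> (\<exists>p. saturated_arc rs p \<and> pathstart p = a \<and> pathfinish p = b)"
  using assms
proof (induction rule: rtrancl_induct)
  case (step e e')
  then obtain l u where lu: "edge rs l u" "u 0 = e" "u l = e'" unfolding edge_rel_def by auto
  note e = edgeD[OF lu(1)]
  define q where "q t = u (l * t)" for t
  have q: "saturated_arc rs q" "path_image q = u ` {0..l}" "pathstart q = e" "pathfinish q = e'"
    using saturated_arc_edge[OF lu(1)] lu by (auto simp: q_def[abs_def] pathstart_def pathfinish_def)
  show ?case
  proof (cases "e = a \<or> e' = a")
    case True
    then show ?thesis using q by auto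
  next
    case False
    then obtain p where p: "saturated_arc rs p" "pathstart p = a" "pathfinish p = e" using step.IH by blast
    show ?thesis
    proof (cases "e' \<in> path_image p")
      case True
      then obtain s where s: "s \<in> {0..1}" "p s = e'" unfolding path_image_def by blast
      have s0: "s \<noteq> 0" using p(2) s False by (auto simp: pathstart_def)
      have "saturated_arc rs (subpath 0 s p)" using s s0 e(5) lu by (intro saturated_arc_subpath[OF p(1)]) auto
      moreover have "pathstart (subpath 0 s p) = a" "pathfinish (subpath 0 s p) = e'"
        using p(2) s by (auto simp: pathstart_def pathfinish_def subpath_def)
      ultimately show ?thesis by blast
    next
      case out: False
      have "path_image p \<inter> path_image q \<subseteq> {e}"
      proof
        fix z assume "z \<in> path_image p \<inter> path_image q"
        then obtain x where x: "z = u x" "0 \<le> x" "x \<le> l" "u x \<in> path_image p" unfolding q(2) by auto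
        have "x \<noteq> l" using x out lu by auto
        moreover have "\<not> (0 < x \<and> x < l)"
        proof
          assume "0 < x \<and> x < l"
          then have "u ` {0..l} \<subseteq> path_image p"
            using p(1) lu(1) x(4) unfolding saturated_arc_def by (blast intro: saturatedD[THEN subsetD])
          moreover have "u l \<in> u ` {0..l}" using e(1) by (intro imageI) simp
          ultimately show False using out lu(3) by blast
        qed
        ultimately show "z \<in> {e}" using x lu(2) by force
      qed
      then have "saturated_arc rs (p +++ q)"
        using p q e(4) lu(2) by (intro saturated_arc_join) auto
      then show ?thesis using p(2) q(4) by (metis pathfinish_join pathstart_join)
    qed
  qed
qed simp

section \<open>Closedness\<close>

lemma critical_point_root_poly:
  shows "finite_critical_point (\<lambda>z. - root_poly rs z) z \<longleftrightarrow> root_poly rs z = 0"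
    and "\<not> infinite_critical_point (\<lambda>z. - root_poly rs z) z"
proof -
  have "(\<lambda>z. - root_poly rs z) holomorphic_on UNIV" by (intro holomorphic_intros)
  then have a: "(\<lambda>z. - root_poly rs z) analytic_on {z}" using analytic_on_holomorphic by blast
  then have "\<not> is_pole (\<lambda>z. - root_poly rs z) z" by (rule analytic_at_imp_no_pole)
  with a show "finite_critical_point (\<lambda>z. - root_poly rs z) z \<longleftrightarrow> root_poly rs z = 0"
    "\<not> infinite_critical_point (\<lambda>z. - root_poly rs z) z"
    unfolding finite_critical_point_def infinite_critical_point_def qd_zero_def neg_equal_0_iff_equal by blast+
qed

lemma horizontal_curve_root_poly:
  "horizontal_curve (\<lambda>z. - root_poly rs z) \<gamma> \<longleftrightarrow> simple_path \<gamma> \<and> (\<forall>s\<in>{0<..<1}. horizontal_at rs \<gamma> s)"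
  unfolding horizontal_curve_def horizontal_at_def regular_point_def
  using critical_point_root_poly by blast

text \<open>Short trajectories, broken or not, become reachability in the edge graph, a form that
  passes to limits. One direction cuts an arc at its zeros, the other assembles a chain into an arc;
  \<open>p \<noteq> q\<close> makes a simple path an arc and rules out the empty chain.\<close>

lemma has_short_trajectory_root_poly:
  assumes "p \<noteq> q" "root_poly rs p = 0" "root_poly rs q = 0"
  shows "has_short_trajectory (\<lambda>z. - root_poly rs z) p q \<longleftrightarrow> (p, q) \<in> (edge_rel rs)\<^sup>*"
proof
  assume "has_short_trajectory (\<lambda>z. - root_poly rs z) p q"
  then obtain \<gamma> where \<gamma>: "simple_path \<gamma>" "\<And>s. s \<in> {0<..<1} \<Longrightarrow> horizontal_at rs \<gamma> s" "\<gamma> 0 = p" "\<gamma> 1 = q"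
    unfolding has_short_trajectory_def short_trajectory_def horizontal_curve_root_poly pathstart_def pathfinish_def by blast
  have "arc \<gamma>" using \<gamma> assms(1) by (intro simple_path_imp_arc) (auto simp: pathstart_def pathfinish_def)
  then have "(\<gamma> 0, \<gamma> 1) \<in> (edge_rel rs)\<^sup>*"
    by (rule horizontal_arc_edges) (use \<gamma> assms in \<open>auto simp: horizontal_at_def\<close>)
  then show "(p, q) \<in> (edge_rel rs)\<^sup>*" using \<gamma> by simp
next
  assume "(p, q) \<in> (edge_rel rs)\<^sup>*"
  then obtain \<gamma> where "saturated_arc rs \<gamma>" "pathstart \<gamma> = p" "pathfinish \<gamma> = q"
    using edges_arc[of p q rs] assms(1) by auto
  then show "has_short_trajectory (\<lambda>z. - root_poly rs z) p q"
    unfolding has_short_trajectory_def short_trajectory_def horizontal_curve_root_poly critical_point_root_poly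
    using assms by (auto simp: saturated_arc_def arc_imp_simple_path intro!: exI[of _ \<gamma>])
qed

lemma constant_subseq:
  fixes f :: "nat \<Rightarrow> 'a"
  assumes "finite (range f)"
  obtains k c where "strict_mono (k :: nat \<Rightarrow> nat)" "\<And>m. f (k m) = c"
proof -
  obtain m0 where "infinite {m. f m = f m0}"
    using pigeonhole_infinite[OF infinite_UNIV_nat assms] by auto
  then obtain r :: "nat \<Rightarrow> nat" where "strict_mono r" "\<forall>m. r m \<in> {m. f m = f m0}"
    using infinite_enumerate by blast
  then show ?thesis by (intro that[of r "f m0"]) auto
qed

text \<open>The walk is followed for the single differential \<open>rs (k 0)\<close>. Each of its
  edges is, at the same pair of indices, an edge for the whole subsequence, so every step of the
  walk passes to the limit separately.\<close>

lemma edge_rel_limit: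
  assumes len: "\<And>m. length (rs m) = n" "length qs = n"
    and conv: "\<And>i. i < n \<Longrightarrow> (\<lambda>m. rs m ! i) \<longlonglongrightarrow> qs ! i"
    and ij: "i < n" "j < n" and r: "\<And>m :: nat. (rs m ! i, rs m ! j) \<in> (edge_rel (rs m))\<^sup>*"
  shows "(qs ! i, qs ! j) \<in> (edge_rel qs)\<^sup>*"
proof -
  define G where "G m = {(i, j). i < n \<and> j < n \<and> (rs m ! i, rs m ! j) \<in> edge_rel (rs m)}" for m
  \<comment> \<open>The walk ends at some index \<open>j'\<close> carrying the same root as
    \<open>j\<close>, since multiple roots are repeated entries. Recording coincidences in
    \<open>F\<close> keeps them constant along the subsequence, so that they persist in the
    limit.\<close>
  define F where "F m = {(i, j). i < n \<and> j < n \<and> rs m ! i = rs m ! j}" for m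
  have "range (\<lambda>m. (G m, F m)) \<subseteq> Pow ({..<n} \<times> {..<n}) \<times> Pow ({..<n} \<times> {..<n})"
    by (auto simp: G_def F_def)
  then have "finite (range (\<lambda>m. (G m, F m)))" by (rule finite_subset) simp
  then obtain k HK where k: "strict_mono (k :: nat \<Rightarrow> nat)" "\<And>m. (G (k m), F (k m)) = HK" by (rule constant_subseq) blast
  have G: "G (k m) = G (k 0)" and F: "F (k m) = F (k 0)" for m using k(2)[of m] k(2)[of 0] by auto
  have convk: "(\<lambda>m. rs (k m) ! i) \<longlonglongrightarrow> qs ! i" if "i < n" for i
    using LIMSEQ_subseq_LIMSEQ[OF conv[OF that] k(1)] by (simp add: o_def)
  have H: "(qs ! i, qs ! j) \<in> (edge_rel qs)\<^sup>*" if h: "(i, j) \<in> G (k 0)" for i j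
  \<comment> \<open>If the two roots merge, the edges may shrink to a point or tend to a loop; the
    empty chain covers both.\<close>
  proof (cases "qs ! i = qs ! j")
    case False
    have ij: "i < n" "j < n" "\<And>m. (rs (k m) ! i, rs (k m) ! j) \<in> edge_rel (rs (k m))"
      using h G unfolding G_def by blast+
    then obtain l u where u: "\<And>m. edge (rs (k m)) (l m) (u m) \<and> u m 0 = rs (k m) ! i \<and> u m (l m) = rs (k m) ! j"
      unfolding edge_rel_def by (simp only: mem_Collect_eq case_prod_conv) metis
    show ?thesis
      by (rule edge_limit[where rs = "\<lambda>m. rs (k m)" and u = u and l = l, OF len(1) len(2) convk _ _ _ False])
         (use u convk ij in auto)
  qed simp
  have reach: "\<exists>j<n. y = rs (k 0) ! j \<and> (qs ! i, qs ! j) \<in> (edge_rel qs)\<^sup>*" if "(rs (k 0) ! i, y) \<in> (edge_rel (rs (k 0)))\<^sup>*" for y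
    using that
  proof (induction rule: rtrancl_induct)
    case base
    then show ?case using ij by auto
  next
    case (step y z)
    then obtain j where j: "j < n" "y = rs (k 0) ! j" "(qs ! i, qs ! j) \<in> (edge_rel qs)\<^sup>*" by blast
    have "root_poly (rs (k 0)) z = 0" using step.hyps(2) edgeD(5) unfolding edge_rel_def by auto
    then obtain j' where j': "j' < n" "z = rs (k 0) ! j'" using len(1) by (auto simp: root_poly_eq_0_iff in_set_conv_nth)
    have "(j, j') \<in> G (k 0)" using j j' step.hyps(2) by (auto simp: G_def)
    from rtrancl_trans[OF j(3) H[OF this]] show ?case using j' by blast
  qed
  obtain j' where j': "j' < n" "rs (k 0) ! j = rs (k 0) ! j'" "(qs ! i, qs ! j') \<in> (edge_rel qs)\<^sup>*"
    using reach r by blast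
  have "(j', j) \<in> F (k 0)" using j' ij by (simp add: F_def)
  then have "(j', j) \<in> F (k m)" for m unfolding F[of m] .
  then have "(\<lambda>m. rs (k m) ! j') = (\<lambda>m. rs (k m) ! j)" by (simp add: F_def)
  then have "qs ! j' = qs ! j" using convk[OF j'(1)] LIMSEQ_unique[OF convk[OF ij(2)]] by simp
  then show ?thesis using j'(3) by simp
qed

theorem proposition2:
  fixes \<Omega> :: "complex set"
    and c :: "nat \<Rightarrow> complex" and m :: "nat \<Rightarrow> nat"
    and a b :: "complex \<Rightarrow> complex"
    and \<phi> :: "complex \<Rightarrow> real \<Rightarrow> complex"
    and Q :: "complex \<Rightarrow> complex" and P :: "complex \<Rightarrow> complex \<Rightarrow> complex"
  assumes "\<Omega> \<noteq> {}" and "connected \<Omega>"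
    and "inj_on c {1..3}"
    and "\<And>k. k \<in> {1..3} \<Longrightarrow> m k \<in> {1, 2}"
    and Q: "\<And>z. Q z = (\<Prod>k=1..3. (z - c k) ^ m k)"
    and "continuous_on \<Omega> a" and "continuous_on \<Omega> b"
    and "\<And>t. t \<in> \<Omega> \<Longrightarrow> a t \<notin> c ` {1..3}"
    and "\<And>t. t \<in> \<Omega> \<Longrightarrow> b t \<notin> c ` {1..3}"
    and "\<And>t. t \<in> \<Omega> \<Longrightarrow> a t \<noteq> b t"
    and P: "\<And>t z. P t z = (z - a t) * (z - b t) * Q z"
    and "\<And>t. t \<in> \<Omega> \<Longrightarrow> \<phi> t \<in> jordan_arcs_avoiding (c ` {1..3}) (a t) (b t)"
    and "hausdorff_continuous_on \<Omega> (\<lambda>t. path_image (\<phi> t))"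
    and "\<And>t. t \<in> \<Omega> \<Longrightarrow>
           \<exists>r I. sqrt_branch_on (path_image (\<phi> t)) (P t) r \<and> (r has_arc_integral I) (\<phi> t) \<and> Re I = 0"
  shows "closedin (top_of_set \<Omega>) {t \<in> \<Omega>. has_short_trajectory (\<lambda>z. - P t z) (a t) (b t)}"
proof -
  note cont = assms(6,7) and ab = assms(10)
  define cs where "cs = concat (map (\<lambda>k. replicate (m k) (c k)) [1, 2, 3])"
  \<comment> \<open>\<open>a t\<close> and \<open>b t\<close> occupy the positions 0 and 1 and the
    remaining entries are constant, so convergence of the roots is continuity of \<open>a\<close>
    and \<open>b\<close>.\<close>
  define rs where "rs t = a t # b t # cs" for t
  have Qcs: "Q z = root_poly cs z" for z
  proof -
    have "{1..3::nat} = {1, 2, 3}" by auto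
    then show ?thesis by (simp add: Q cs_def root_poly_def)
  qed
  have "(\<lambda>z. - P t z) = (\<lambda>z. - root_poly (rs t) z)" for t by (simp add: P Qcs rs_def fun_eq_iff mult.assoc)
  then have S: "has_short_trajectory (\<lambda>z. - P t z) (a t) (b t) \<longleftrightarrow> (a t, b t) \<in> (edge_rel (rs t))\<^sup>*" if "t \<in> \<Omega>" for t
    using has_short_trajectory_root_poly[OF ab[OF that], of "rs t"] by (simp add: rs_def)
  define S where "S = {t \<in> \<Omega>. (a t, b t) \<in> (edge_rel (rs t))\<^sup>*}"
  have "t \<in> S" if t: "t islimpt S" "t \<in> \<Omega>" for t
  proof -
    obtain f where f: "\<And>m. f m \<in> S" "f \<longlonglongrightarrow> t" using t(1) unfolding islimpt_sequential by auto
    have f\<Omega>: "\<forall>\<^sub>F m in sequentially. f m \<in> \<Omega>" using f(1) by (auto simp: S_def)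
    have lim: "(\<lambda>m. a (f m)) \<longlonglongrightarrow> a t" "(\<lambda>m. b (f m)) \<longlonglongrightarrow> b t"
      using continuous_on_tendsto_compose[OF cont(1) f(2) t(2) f\<Omega>] continuous_on_tendsto_compose[OF cont(2) f(2) t(2) f\<Omega>] by auto
    have conv: "(\<lambda>m. rs (f m) ! i) \<longlonglongrightarrow> rs t ! i" for i
      using lim by (auto simp: rs_def nth_Cons split: nat.split)
    have r: "(rs (f m) ! 0, rs (f m) ! 1) \<in> (edge_rel (rs (f m)))\<^sup>*" for m
      using f(1)[of m] by (simp add: S_def rs_def)
    have "(rs t ! 0, rs t ! 1) \<in> (edge_rel (rs t))\<^sup>*"
      by (rule edge_rel_limit[where n = "length cs + 2" and rs = "\<lambda>m. rs (f m)", OF _ _ conv _ _ r]) (auto simp: rs_def)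
    then show ?thesis using t(2) by (simp add: S_def rs_def)
  qed
  then have "closedin (top_of_set \<Omega>) S" unfolding closedin_limpt by (auto simp: S_def)
  also have "S = {t \<in> \<Omega>. has_short_trajectory (\<lambda>z. - P t z) (a t) (b t)}" using S by (auto simp: S_def)
  finally show ?thesis .
qed

end
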